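(* Let $A=\mathcal{B}(V)\#K[\Gamma]$ be the Radford biproduct of a quantum plane $V=Kx_1\oplus Kx_2$ described in the context, let $H=K[\Gamma]$, let $a_1,a_2,a\in K$, and let $\alpha=\gamma_a*\gamma_1*\gamma_2$ (convolution product in $\mathrm{Hom}(A\otimes A,K)$), which lies in $Z_H^2(A,K)$. Then the cocycle twist $A^\alpha$ is isomorphic as a Hopf algebra to the lifting $A(a_1,a_2,a)$ of $A$, i.e. the Hopf algebra generated by the elements $h\in\Gamma$ (grouplike, with the relations of $\Gamma$) and by $x_1,x_2$ with $\Delta(x_i)=g_i\otimes x_i+x_i\otimes 1$, subject to $$hx_i=\chi_i(h)x_ih\ (h\in\Gamma),\qquad x_i^r=a_i(1-g_i^r)\ (i=1,2),\qquad x_2x_1=q\,x_1x_2+a(1-g_1g_2).$$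
   Context: Setting. $K$ is a field of characteristic $0$, $\Gamma$ a finite abelian group, $H=K[\Gamma]$, $g_1,g_2\in\Gamma$, $\chi_1,\chi_2\in\widehat\Gamma$ characters $\Gamma\to K^\times$ with $\chi_1\chi_2=\varepsilon$ (trivial character), $\chi:=\chi_1=\chi_2^{-1}$, $\chi_1(g_2)\chi_2(g_1)=1$, and $q:=\chi(g_1)$ a primitive $r$-th root of unity, $r>1$; thus $\chi_1(g_1)=\chi_1(g_2)=q$ and $\chi_2(g_1)=\chi_2(g_2)=q^{-1}$. Assume $g_1g_2\ne1$, $g_i^r\neq 1$ and $\chi_i^r=\varepsilon$ for $i=1,2$. $V=Kx_1\oplus Kx_2$ is the Yetter-Drinfeld module over $\Gamma$ with $\rho(x_i)=g_i\otimes x_i$, $h\cdot x_i=\chi_i(h)x_i$ (a quantum plane), and $A=\mathcal{B}(V)\#H$ is the Radford biproduct of its Nichols algebra: the Hopf algebra generated by $\Gamma$ (grouplikes) and $x_1,x_2$ with relations $hx_i=\chi_i(h)x_ih$, $x_i^r=0$, $x_2x_1=qx_1x_2$ and $\Delta(x_i)=g_i\otimes x_i+x_i\otimes1$, $\varepsilon(x_i)=0$; it has basis $\{gx_1^ix_2^j: g\in\Gamma,0\le i,j\le r-1\}$. Cocycles. A linear map $\gamma:A\otimes A\to K$ is $H$-bilinear if $\gamma(hx\otimes yh')=\varepsilon(h)\gamma(x\otimes y)\varepsilon(h')$ for $h,h'\in H$. $Z_H^2(A,K)$ is the set of convolution invertible $H$-bilinear maps $\gamma$ with $\gamma(y_{(1)}\otimes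 z_{(1)})\gamma(x\otimes y_{(2)}z_{(2)})=\gamma(x_{(1)}\otimes y_{(1)})\gamma(x_{(2)}y_{(2)}\otimes z)$ and $\gamma(x\otimes1)=\gamma(1\otimes x)=\varepsilon(x)$. The twist $A^\gamma$ is $A$ as a coalgebra, with product $x\cdot_\gamma y=\gamma(x_{(1)}\otimes y_{(1)})x_{(2)}y_{(2)}\gamma^{-1}(x_{(3)}\otimes y_{(3)})$. The maps $\gamma_1,\gamma_2,\gamma_a:A\otimes A\to K$ are the $H$-bilinear maps given on $x_1^lx_2^m\otimes x_1^nx_2^t$ ($0\le l,m,n,t\le r-1$) as follows: $\gamma_i$ ($i=1,2$) equals $\varepsilon\otimes\varepsilon$ except that $\gamma_i(x_i^m\otimes x_i^{r-m})=a_i$ for $0<m<r$; $\gamma_a$ equals $\varepsilon\otimes\varepsilon$ except that $\gamma_a(x_2^m\otimes x_1^m)=(m)!_q\,a^m$ for $0\le m\le r-1$, where $(m)!_q=\prod_{j=1}^m(1+q+\dots+q^{j-1})$. *)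

theory Defs
  imports
    "HOL-Algebra.QuotRing"
    "HOL-Algebra.Multiplicative_Group"
    "HOL-Library.Poly_Mapping"
    "HOL-Library.Product_Plus"
begin

section \<open>Vector spaces, quotients and tensor products\<close>

text \<open>The ground field is a type of class \<open>field\<close>; it is also needed as a HOL-Algebra structure.\<close>

definition scalars :: "('k::field, 'k) module" where
  "scalars = \<lparr>carrier = UNIV, mult = (*), one = 1, zero = 0, add = (+), smult = (*)\<rparr>"

definition linear_map ::
  "('k, 'a, 'm) module_scheme \<Rightarrow> ('k, 'b, 'n) module_scheme \<Rightarrow> ('a \<Rightarrow> 'b) \<Rightarrow> bool" where
  "linear_map V W f \<longleftrightarrow>
     f \<in> carrier V \<rightarrow> carrier W \<and>
     (\<forall>x\<in>carrier V. \<forall>y\<in>carrier V. f (x \<oplus>\<^bsub>V\<^esub> y) = f x \<oplus>\<^bsub>W\<^esub> f y) \<and>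
     (\<forall>c. \<forall>x\<in>carrier V. f (c \<odot>\<^bsub>V\<^esub> x) = c \<odot>\<^bsub>W\<^esub> f x)"

definition bilinear_map ::
  "('k, 'a, 'm) module_scheme \<Rightarrow> ('k, 'b, 'n) module_scheme \<Rightarrow> ('k, 'c, 'l) module_scheme \<Rightarrow>
   ('a \<Rightarrow> 'b \<Rightarrow> 'c) \<Rightarrow> bool" where
  "bilinear_map V W U f \<longleftrightarrow>
     (\<forall>v\<in>carrier V. linear_map W U (f v)) \<and>
     (\<forall>w\<in>carrier W. linear_map V U (\<lambda>v. f v w))"

definition scale :: "'k::field \<Rightarrow> ('x \<Rightarrow>\<^sub>0 'k) \<Rightarrow> ('x \<Rightarrow>\<^sub>0 'k)" where
  "scale c f = Poly_Mapping.map ((*) c) f"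

definition quotient :: "('k, 'a, 'm) module_scheme \<Rightarrow> 'a set \<Rightarrow> ('k, 'a set) module" where
  "quotient M N =
     ring.extend (M Quot N) (module.fields (\<lambda>c X. \<Union>x\<in>X. N +>\<^bsub>M\<^esub> (c \<odot>\<^bsub>M\<^esub> x)))"

text \<open>
  The space of formal linear combinations of pairs \<open>(v, w)\<close> with \<open>v \<in> V\<close>, \<open>w \<in> W\<close>. The
  multiplication \<open>(v, w) (v', w') = (v v', w w')\<close> makes the tensor product below an algebra
  when \<open>V\<close> and \<open>W\<close> are algebras.
\<close>

definition formal_pairs ::
  "('k::field, 'a, 'm) module_scheme \<Rightarrow> ('k, 'b, 'n) module_scheme \<Rightarrow>
   ('k, ('a \<times> 'b) \<Rightarrow>\<^sub>0 'k) module" where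
  "formal_pairs V W =
     \<lparr>carrier = {u. Poly_Mapping.keys u \<subseteq> carrier V \<times> carrier W},
      mult = (\<lambda>u u'. \<Sum>p\<in>Poly_Mapping.keys u. \<Sum>p'\<in>Poly_Mapping.keys u'.
                Poly_Mapping.single (fst p \<otimes>\<^bsub>V\<^esub> fst p', snd p \<otimes>\<^bsub>W\<^esub> snd p')
                  (Poly_Mapping.lookup u p * Poly_Mapping.lookup u' p')),
      one = Poly_Mapping.single (\<one>\<^bsub>V\<^esub>, \<one>\<^bsub>W\<^esub>) 1,
      zero = 0,
      add = (+),
      smult = scale\<rparr>"

definition tensor_relators ::
  "('k::field, 'a, 'm) module_scheme \<Rightarrow> ('k, 'b, 'n) module_scheme \<Rightarrow> (('a \<times> 'b) \<Rightarrow>\<^sub>0 'k) set" where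
  "tensor_relators V W =
     {Poly_Mapping.single (v \<oplus>\<^bsub>V\<^esub> v', w) 1 - Poly_Mapping.single (v, w) 1
        - Poly_Mapping.single (v', w) 1 | v v' w.
        v \<in> carrier V \<and> v' \<in> carrier V \<and> w \<in> carrier W} \<union>
     {Poly_Mapping.single (v, w \<oplus>\<^bsub>W\<^esub> w') 1 - Poly_Mapping.single (v, w) 1
        - Poly_Mapping.single (v, w') 1 | v w w'.
        v \<in> carrier V \<and> w \<in> carrier W \<and> w' \<in> carrier W} \<union>
     {Poly_Mapping.single (c \<odot>\<^bsub>V\<^esub> v, w) 1 - Poly_Mapping.single (v, w) c | c v w.
        v \<in> carrier V \<and> w \<in> carrier W} \<union>
     {Poly_Mapping.single (v, c \<odot>\<^bsub>W\<^esub> w) 1 - Poly_Mapping.single (v, w) c | c v w.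
        v \<in> carrier V \<and> w \<in> carrier W}"

definition tensor_null ::
  "('k::field, 'a, 'm) module_scheme \<Rightarrow> ('k, 'b, 'n) module_scheme \<Rightarrow> (('a \<times> 'b) \<Rightarrow>\<^sub>0 'k) set" where
  "tensor_null V W =
     \<Inter>{N. submodule N scalars (formal_pairs V W) \<and> tensor_relators V W \<subseteq> N}"

definition tensor ::
  "('k::field, 'a, 'm) module_scheme \<Rightarrow> ('k, 'b, 'n) module_scheme \<Rightarrow>
   ('k, (('a \<times> 'b) \<Rightarrow>\<^sub>0 'k) set) module" where
  "tensor V W = quotient (formal_pairs V W) (tensor_null V W)"

definition pure ::
  "('k::field, 'a, 'm) module_scheme \<Rightarrow> ('k, 'b, 'n) module_scheme \<Rightarrow>
   'a \<Rightarrow> 'b \<Rightarrow> (('a \<times> 'b) \<Rightarrow>\<^sub>0 'k) set" where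
  "pure V W v w = tensor_null V W +>\<^bsub>formal_pairs V W\<^esub> Poly_Mapping.single (v, w) 1"

text \<open>
  The linear map \<open>V \<otimes> W \<rightarrow> U\<close> induced by a bilinear map \<open>f\<close>, computed on a representative.
\<close>

definition tensor_lift ::
  "('k::field, 'c, 'l) module_scheme \<Rightarrow> ('a \<Rightarrow> 'b \<Rightarrow> 'c) \<Rightarrow> (('a \<times> 'b) \<Rightarrow>\<^sub>0 'k) set \<Rightarrow> 'c" where
  "tensor_lift U f t =
     (let u = (SOME u. u \<in> t)
      in \<Oplus>\<^bsub>U\<^esub>p\<in>Poly_Mapping.keys u. Poly_Mapping.lookup u p \<odot>\<^bsub>U\<^esub> f (fst p) (snd p))"


section \<open>Hopf algebras\<close>

record (overloaded) ('k::zero, 'a) hopf = "('k, 'a) module" +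
  comult :: "'a \<Rightarrow> (('a \<times> 'a) \<Rightarrow>\<^sub>0 'k) set"
  counit :: "'a \<Rightarrow> 'k"

text \<open>
  Sweedler notation: for \<open>f\<close> bilinear into \<open>U\<close> (trilinear in the second case), these are
  \<open>f(x\<^sub>1, x\<^sub>2)\<close> and \<open>f(x\<^sub>1, x\<^sub>2, x\<^sub>3)\<close>.
\<close>

definition sweedler ::
  "('k::field, 'a, 'm) hopf_scheme \<Rightarrow> ('k, 'c, 'l) module_scheme \<Rightarrow> ('a \<Rightarrow> 'a \<Rightarrow> 'c) \<Rightarrow> 'a \<Rightarrow> 'c" where
  "sweedler A U f x = tensor_lift U f (comult A x)"

definition sweedler3 ::
  "('k::field, 'a, 'm) hopf_scheme \<Rightarrow> ('k, 'c, 'l) module_scheme \<Rightarrow>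
   ('a \<Rightarrow> 'a \<Rightarrow> 'a \<Rightarrow> 'c) \<Rightarrow> 'a \<Rightarrow> 'c" where
  "sweedler3 A U f x =
     sweedler A U (\<lambda>x' x3. sweedler A U (\<lambda>x1 x2. f x1 x2 x3) x') x"

locale hopf_algebra = ring A for A :: "('k::field, 'a, 'm) hopf_scheme" (structure) +
  assumes vector_space: "Module.module scalars A"
    and smult_mult_left:
      "\<lbrakk>x \<in> carrier A; y \<in> carrier A\<rbrakk> \<Longrightarrow> (c \<odot> x) \<otimes> y = c \<odot> (x \<otimes> y)"
    and smult_mult_right:
      "\<lbrakk>x \<in> carrier A; y \<in> carrier A\<rbrakk> \<Longrightarrow> x \<otimes> (c \<odot> y) = c \<odot> (x \<otimes> y)"
    and comult_linear: "linear_map A (tensor A A) (comult A)"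
    and comult_hom: "comult A \<in> ring_hom A (tensor A A)"
    and counit_linear: "linear_map A scalars (counit A)"
    and counit_hom: "counit A \<in> ring_hom A scalars"
    and coassoc: "x \<in> carrier A \<Longrightarrow>
      sweedler A (tensor A (tensor A A))
        (\<lambda>x' x3. sweedler A (tensor A (tensor A A))
                   (\<lambda>x1 x2. pure A (tensor A A) x1 (pure A A x2 x3)) x') x =
      sweedler A (tensor A (tensor A A)) (\<lambda>x1 x'. pure A (tensor A A) x1 (comult A x')) x"
    and counit_left: "x \<in> carrier A \<Longrightarrow> sweedler A A (\<lambda>x1 x2. counit A x1 \<odot> x2) x = x"
    and counit_right: "x \<in> carrier A \<Longrightarrow> sweedler A A (\<lambda>x1 x2. counit A x2 \<odot> x1) x = x"
    and antipode: "\<exists>S. linear_map A A S \<and>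
      (\<forall>x\<in>carrier A. sweedler A A (\<lambda>x1 x2. S x1 \<otimes> x2) x = counit A x \<odot> \<one> \<and>
                     sweedler A A (\<lambda>x1 x2. x1 \<otimes> S x2) x = counit A x \<odot> \<one>)"

text \<open>
  Bialgebra maps between Hopf algebras automatically commute with the antipodes.
\<close>

definition hopf_isomorphic ::
  "('k::field, 'a, 'm) hopf_scheme \<Rightarrow> ('k, 'b, 'n) hopf_scheme \<Rightarrow> bool" where
  "hopf_isomorphic A B \<longleftrightarrow>
     hopf_algebra A \<and> hopf_algebra B \<and>
     (\<exists>\<phi>\<in>ring_iso A B. linear_map A B \<phi> \<and>
        (\<forall>x\<in>carrier A.
           comult B (\<phi> x) = sweedler A (tensor B B) (\<lambda>x1 x2. pure B B (\<phi> x1) (\<phi> x2)) x \<and>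
           counit B (\<phi> x) = counit A x))"


section \<open>Cocycles and twists\<close>

text \<open>Linear maps \<open>A \<otimes> A \<rightarrow> K\<close> are given in curried form, as bilinear maps.\<close>

definition convolution ::
  "('k::field, 'a, 'm) hopf_scheme \<Rightarrow> ('a \<Rightarrow> 'a \<Rightarrow> 'k) \<Rightarrow> ('a \<Rightarrow> 'a \<Rightarrow> 'k) \<Rightarrow> 'a \<Rightarrow> 'a \<Rightarrow> 'k" where
  "convolution A \<gamma> \<delta> x y =
     sweedler A scalars (\<lambda>x1 x2. sweedler A scalars (\<lambda>y1 y2. \<gamma> x1 y1 * \<delta> x2 y2) y) x"

definition convolution_inverse ::
  "('k::field, 'a, 'm) hopf_scheme \<Rightarrow> ('a \<Rightarrow> 'a \<Rightarrow> 'k) \<Rightarrow> ('a \<Rightarrow> 'a \<Rightarrow> 'k) \<Rightarrow> bool" where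
  "convolution_inverse A \<gamma> \<delta> \<longleftrightarrow>
     bilinear_map A A scalars \<delta> \<and>
     (\<forall>x\<in>carrier A. \<forall>y\<in>carrier A.
        convolution A \<gamma> \<delta> x y = counit A x * counit A y \<and>
        convolution A \<delta> \<gamma> x y = counit A x * counit A y)"

definition h_bilinear ::
  "('k::field, 'a, 'm) hopf_scheme \<Rightarrow> 'a set \<Rightarrow> ('a \<Rightarrow> 'a \<Rightarrow> 'k) \<Rightarrow> bool" where
  "h_bilinear A H \<gamma> \<longleftrightarrow>
     bilinear_map A A scalars \<gamma> \<and>
     (\<forall>h\<in>H. \<forall>h'\<in>H. \<forall>x\<in>carrier A. \<forall>y\<in>carrier A.
        \<gamma> (h \<otimes>\<^bsub>A\<^esub> x) (y \<otimes>\<^bsub>A\<^esub> h') = counit A h * \<gamma> x y * counit A h')"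

definition cocycles ::
  "('k::field, 'a, 'm) hopf_scheme \<Rightarrow> 'a set \<Rightarrow> ('a \<Rightarrow> 'a \<Rightarrow> 'k) set" where
  "cocycles A H =
     {\<gamma>. h_bilinear A H \<gamma> \<and>
          (\<exists>\<delta>. convolution_inverse A \<gamma> \<delta>) \<and>
          (\<forall>x\<in>carrier A. \<forall>y\<in>carrier A. \<forall>z\<in>carrier A.
             sweedler A scalars (\<lambda>y1 y2. sweedler A scalars (\<lambda>z1 z2.
               \<gamma> y1 z1 * \<gamma> x (y2 \<otimes>\<^bsub>A\<^esub> z2)) z) y =
             sweedler A scalars (\<lambda>x1 x2. sweedler A scalars (\<lambda>y1 y2.
               \<gamma> x1 y1 * \<gamma> (x2 \<otimes>\<^bsub>A\<^esub> y2) z) y) x) \<and>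
          (\<forall>x\<in>carrier A. \<gamma> x \<one>\<^bsub>A\<^esub> = counit A x \<and> \<gamma> \<one>\<^bsub>A\<^esub> x = counit A x)}"

text \<open>
  The convolution inverse is unique on \<open>A\<close>, so the choice below does not affect the twist.
\<close>

definition twist ::
  "('k::field, 'a, 'm) hopf_scheme \<Rightarrow> ('a \<Rightarrow> 'a \<Rightarrow> 'k) \<Rightarrow> ('k, 'a, 'm) hopf_scheme" where
  "twist A \<gamma> =
     (let \<delta> = (SOME \<delta>. convolution_inverse A \<gamma> \<delta>)
      in A\<lparr>mult := (\<lambda>x y.
             sweedler3 A A (\<lambda>x1 x2 x3. sweedler3 A A (\<lambda>y1 y2 y3.
               (\<gamma> x1 y1 * \<delta> x3 y3) \<odot>\<^bsub>A\<^esub> (x2 \<otimes>\<^bsub>A\<^esub> y2)) y) x)\<rparr>)"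


section \<open>Presented Hopf algebras\<close>

text \<open>
  With concatenation as addition on lists, \<open>'x list \<Rightarrow>\<^sub>0 'k\<close> is the free associative algebra on
  \<open>'x\<close>, and \<open>('x list \<times> 'x list) \<Rightarrow>\<^sub>0 'k\<close> is its tensor square.
\<close>

instantiation list :: (type) monoid_add
begin

definition zero_list :: "'a list" where "zero_list = []"
definition plus_list :: "'a list \<Rightarrow> 'a list \<Rightarrow> 'a list" where "plus_list = (@)"

instance by standard (simp_all add: zero_list_def plus_list_def)

end

definition free_algebra :: "'x set \<Rightarrow> ('k::field, 'x list \<Rightarrow>\<^sub>0 'k) module" where
  "free_algebra X =
     \<lparr>carrier = {f. Poly_Mapping.keys f \<subseteq> lists X}, mult = (*), one = 1, zero = 0,
      add = (+), smult = scale\<rparr>"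

definition presented_class ::
  "'x set \<Rightarrow> ('x list \<Rightarrow>\<^sub>0 'k) set \<Rightarrow> ('x list \<Rightarrow>\<^sub>0 'k::field) \<Rightarrow> ('x list \<Rightarrow>\<^sub>0 'k) set" where
  "presented_class X R f =
     (Idl\<^bsub>free_algebra X\<^esub> R) +>\<^bsub>free_algebra X\<^esub> f"

text \<open>
  The algebra with generators \<open>X\<close> and relators \<open>R\<close>, where comultiplication and counit are the
  algebra maps determined by the values \<open>\<delta>\<close> and \<open>e\<close> on the generators.
\<close>

definition presented_hopf ::
  "'x set \<Rightarrow> ('x list \<Rightarrow>\<^sub>0 'k) set \<Rightarrow> ('x \<Rightarrow> ('x list \<times> 'x list) \<Rightarrow>\<^sub>0 'k) \<Rightarrow> ('x \<Rightarrow> 'k::field) \<Rightarrow>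
   ('k, ('x list \<Rightarrow>\<^sub>0 'k) set) hopf" where
  "presented_hopf X R \<delta> e =
     (let Q = quotient (free_algebra X) (Idl\<^bsub>free_algebra X\<^esub> R);
          word = (\<lambda>w. presented_class X R (Poly_Mapping.single w 1));
          free_comult = (\<lambda>f. \<Sum>w\<in>Poly_Mapping.keys f.
             scale (Poly_Mapping.lookup f w) (prod_list (map \<delta> w)));
          free_counit = (\<lambda>f. \<Sum>w\<in>Poly_Mapping.keys f.
             Poly_Mapping.lookup f w * prod_list (map e w))
      in module.extend Q (hopf.fields
           (\<lambda>c. let d = free_comult (SOME f. f \<in> c)
                in \<Oplus>\<^bsub>tensor Q Q\<^esub>p\<in>Poly_Mapping.keys d.
                     Poly_Mapping.lookup d p \<odot>\<^bsub>tensor Q Q\<^esub>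
                       pure Q Q (word (fst p)) (word (snd p)))
           (\<lambda>c. free_counit (SOME f. f \<in> c))))"


section \<open>Quantum planes and their liftings\<close>

datatype 'g gen = Grp 'g | X1 | X2

abbreviation gen :: "'g gen \<Rightarrow> ('g gen list \<Rightarrow>\<^sub>0 'k::field)" where
  "gen x \<equiv> Poly_Mapping.single [x] 1"

definition gens :: "('g, 'm) monoid_scheme \<Rightarrow> 'g gen set" where
  "gens G = Grp ` carrier G \<union> {X1, X2}"

text \<open>
  The parameters \<open>u1\<close>, \<open>u2\<close>, \<open>u\<close> are the right-hand sides of the relations
  \<open>x\<^sub>1\<^sup>r = u1\<close>, \<open>x\<^sub>2\<^sup>r = u2\<close>, \<open>x\<^sub>2 x\<^sub>1 = q x\<^sub>1 x\<^sub>2 + u\<close>.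
\<close>

definition relators ::
  "('g, 'm) monoid_scheme \<Rightarrow> ('g \<Rightarrow> 'k) \<Rightarrow> ('g \<Rightarrow> 'k) \<Rightarrow> 'k \<Rightarrow> nat \<Rightarrow>
   ('g gen list \<Rightarrow>\<^sub>0 'k) \<Rightarrow> ('g gen list \<Rightarrow>\<^sub>0 'k) \<Rightarrow> ('g gen list \<Rightarrow>\<^sub>0 'k) \<Rightarrow>
   ('g gen list \<Rightarrow>\<^sub>0 'k::field) set" where
  "relators G \<chi>1 \<chi>2 q r u1 u2 u =
     {gen (Grp h) * gen (Grp h') - gen (Grp (h \<otimes>\<^bsub>G\<^esub> h')) | h h'. h \<in> carrier G \<and> h' \<in> carrier G} \<union>
     {gen (Grp \<one>\<^bsub>G\<^esub>) - 1} \<union>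
     {gen (Grp h) * gen X1 - scale (\<chi>1 h) (gen X1 * gen (Grp h)) | h. h \<in> carrier G} \<union>
     {gen (Grp h) * gen X2 - scale (\<chi>2 h) (gen X2 * gen (Grp h)) | h. h \<in> carrier G} \<union>
     {gen X1 ^ r - u1, gen X2 ^ r - u2,
      gen X2 * gen X1 - (scale q (gen X1 * gen X2) + u)}"

text \<open>\<open>\<Delta>(h) = h \<otimes> h\<close> and \<open>\<Delta>(x\<^sub>i) = g\<^sub>i \<otimes> x\<^sub>i + x\<^sub>i \<otimes> 1\<close>; the empty list is the unit.\<close>

fun gen_comult :: "'g \<Rightarrow> 'g \<Rightarrow> 'g gen \<Rightarrow> ('g gen list \<times> 'g gen list) \<Rightarrow>\<^sub>0 'k::field" where
  "gen_comult g1 g2 (Grp h) = Poly_Mapping.single ([Grp h], [Grp h]) 1"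
| "gen_comult g1 g2 X1 = Poly_Mapping.single ([Grp g1], [X1]) 1 + Poly_Mapping.single ([X1], []) 1"
| "gen_comult g1 g2 X2 = Poly_Mapping.single ([Grp g2], [X2]) 1 + Poly_Mapping.single ([X2], []) 1"

fun gen_counit :: "'g gen \<Rightarrow> 'k::field" where
  "gen_counit (Grp h) = 1"
| "gen_counit X1 = 0"
| "gen_counit X2 = 0"

definition quantum_plane_biproduct ::
  "('g, 'm) monoid_scheme \<Rightarrow> 'g \<Rightarrow> 'g \<Rightarrow> ('g \<Rightarrow> 'k) \<Rightarrow> ('g \<Rightarrow> 'k) \<Rightarrow> 'k \<Rightarrow> nat \<Rightarrow>
   ('k::field, ('g gen list \<Rightarrow>\<^sub>0 'k) set) hopf" where
  "quantum_plane_biproduct G g1 g2 \<chi>1 \<chi>2 q r =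
     presented_hopf (gens G) (relators G \<chi>1 \<chi>2 q r 0 0 0) (gen_comult g1 g2) gen_counit"

definition lifting ::
  "('g, 'm) monoid_scheme \<Rightarrow> 'g \<Rightarrow> 'g \<Rightarrow> ('g \<Rightarrow> 'k) \<Rightarrow> ('g \<Rightarrow> 'k) \<Rightarrow> 'k \<Rightarrow> nat \<Rightarrow>
   'k \<Rightarrow> 'k \<Rightarrow> 'k \<Rightarrow> ('k::field, ('g gen list \<Rightarrow>\<^sub>0 'k) set) hopf" where
  "lifting G g1 g2 \<chi>1 \<chi>2 q r a1 a2 a =
     presented_hopf (gens G)
       (relators G \<chi>1 \<chi>2 q r
          (scale a1 (1 - gen (Grp g1) ^ r))
          (scale a2 (1 - gen (Grp g2) ^ r))
          (scale a (1 - gen (Grp g1) * gen (Grp g2))))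
       (gen_comult g1 g2) gen_counit"

definition biproduct_gen ::
  "('g, 'm) monoid_scheme \<Rightarrow> ('g \<Rightarrow> 'k) \<Rightarrow> ('g \<Rightarrow> 'k) \<Rightarrow> 'k \<Rightarrow> nat \<Rightarrow>
   'g gen \<Rightarrow> ('g gen list \<Rightarrow>\<^sub>0 'k::field) set" where
  "biproduct_gen G \<chi>1 \<chi>2 q r x = presented_class (gens G) (relators G \<chi>1 \<chi>2 q r 0 0 0) (gen x)"

text \<open>
  The image of \<open>K[\<Gamma>]\<close> in \<open>A\<close>, where \<open>\<iota>\<close> embeds the generators into \<open>A\<close>.
\<close>

definition group_subalgebra ::
  "('g, 'm) monoid_scheme \<Rightarrow> ('k::field, 'a, 'n) hopf_scheme \<Rightarrow> ('g gen \<Rightarrow> 'a) \<Rightarrow> 'a set" where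
  "group_subalgebra G A \<iota> = {\<Oplus>\<^bsub>A\<^esub>h\<in>carrier G. c h \<odot>\<^bsub>A\<^esub> \<iota> (Grp h) | c. True}"

text \<open>
  The \<open>H\<close>-bilinear map with value \<open>v l m n t\<close> on \<open>x\<^sub>1\<^sup>l x\<^sub>2\<^sup>m \<otimes> x\<^sub>1\<^sup>n x\<^sub>2\<^sup>t\<close> for exponents less than \<open>r\<close>.
  In the quantum plane biproduct it exists and is unique on \<open>A\<close>, by the basis \<open>g x\<^sub>1\<^sup>i x\<^sub>2\<^sup>j\<close>.
\<close>

definition h_bilinear_extension ::
  "('k::field, 'a, 'n) hopf_scheme \<Rightarrow> 'a set \<Rightarrow> ('g gen \<Rightarrow> 'a) \<Rightarrow> nat \<Rightarrow>
   (nat \<Rightarrow> nat \<Rightarrow> nat \<Rightarrow> nat \<Rightarrow> 'k) \<Rightarrow> 'a \<Rightarrow> 'a \<Rightarrow> 'k" where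
  "h_bilinear_extension A H \<iota> r v =
     (SOME \<gamma>. h_bilinear A H \<gamma> \<and>
        (\<forall>l<r. \<forall>m<r. \<forall>n<r. \<forall>t<r.
           \<gamma> (\<iota> X1 [^]\<^bsub>A\<^esub> l \<otimes>\<^bsub>A\<^esub> \<iota> X2 [^]\<^bsub>A\<^esub> m) (\<iota> X1 [^]\<^bsub>A\<^esub> n \<otimes>\<^bsub>A\<^esub> \<iota> X2 [^]\<^bsub>A\<^esub> t) = v l m n t))"

definition counit_value :: "nat \<Rightarrow> nat \<Rightarrow> nat \<Rightarrow> nat \<Rightarrow> 'k::field" where
  "counit_value l m n t = (if l = 0 \<and> m = 0 \<and> n = 0 \<and> t = 0 then 1 else 0)"

definition gamma_1 ::
  "('k::field, 'a, 'n) hopf_scheme \<Rightarrow> 'a set \<Rightarrow> ('g gen \<Rightarrow> 'a) \<Rightarrow> nat \<Rightarrow> 'k \<Rightarrow> 'a \<Rightarrow> 'a \<Rightarrow> 'k" where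
  "gamma_1 A H \<iota> r a1 = h_bilinear_extension A H \<iota> r
     (\<lambda>l m n t. if m = 0 \<and> t = 0 \<and> 0 < l \<and> l < r \<and> n = r - l then a1
                else counit_value l m n t)"

definition gamma_2 ::
  "('k::field, 'a, 'n) hopf_scheme \<Rightarrow> 'a set \<Rightarrow> ('g gen \<Rightarrow> 'a) \<Rightarrow> nat \<Rightarrow> 'k \<Rightarrow> 'a \<Rightarrow> 'a \<Rightarrow> 'k" where
  "gamma_2 A H \<iota> r a2 = h_bilinear_extension A H \<iota> r
     (\<lambda>l m n t. if l = 0 \<and> n = 0 \<and> 0 < m \<and> m < r \<and> t = r - m then a2
                else counit_value l m n t)"

definition q_factorial :: "'k::field \<Rightarrow> nat \<Rightarrow> 'k" where
  "q_factorial q m = (\<Prod>j=1..m. \<Sum>i<j. q ^ i)"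

definition gamma_a ::
  "('k::field, 'a, 'n) hopf_scheme \<Rightarrow> 'a set \<Rightarrow> ('g gen \<Rightarrow> 'a) \<Rightarrow> nat \<Rightarrow> 'k \<Rightarrow> 'k \<Rightarrow> 'a \<Rightarrow> 'a \<Rightarrow> 'k" where
  "gamma_a A H \<iota> r q a = h_bilinear_extension A H \<iota> r
     (\<lambda>l m n t. if l = 0 \<and> t = 0 \<and> m = n then q_factorial q m * a ^ m
                else counit_value l m n t)"

end

theory Submission
  imports Defs
begin

text \<open>
  For parameters \<open>p = (p\<^sub>1, p\<^sub>2, p\<^sub>0)\<close> and \<open>p'\<close> let \<open>C(p, p')\<close> be the algebra with basis \<open>x\<^sub>1\<^sup>i x\<^sub>2\<^sup>j g\<close>
  (\<open>i, j < r\<close>) and relations \<open>x\<^sub>1\<^sup>r = p\<^sub>1 - p\<^sub>1' g\<^sub>1\<^sup>r\<close>, \<open>x\<^sub>2\<^sup>r = p\<^sub>2 - p\<^sub>2' g\<^sub>2\<^sup>r\<close>,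
  \<open>x\<^sub>2 x\<^sub>1 = q x\<^sub>1 x\<^sub>2 + p\<^sub>0 - p\<^sub>0' g\<^sub>1 g\<^sub>2\<close>. By the quantum binomial theorem at a root of unity,
  \<open>x\<^sub>i \<mapsto> g\<^sub>i \<otimes> x\<^sub>i + x\<^sub>i \<otimes> 1\<close> defines algebra maps \<open>C(p, p'') \<rightarrow> C(p, p') \<otimes> C(p', p'')\<close>, and on the basis
  they do not depend on the parameters: all the \<open>C(p, p')\<close> share one coalgebra. Let
  \<open>\<gamma>(p, p')\<close> be the counit composed with the product of \<open>C(p, p')\<close>. Then multiplicativity of the
  coproduct gives \<open>\<gamma>(p, p'') = \<gamma>(p, p') * \<gamma>(p', p'')\<close>, and the product of \<open>C(p, p)\<close> is the twist of the
  product of \<open>C(0, 0) = A\<close> by \<open>\<gamma>(p, 0)\<close>, whose inverse is \<open>\<gamma>(0, p)\<close>; the cocycle identity is the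
  associativity of \<open>C(p, 0)\<close>. Comparing values, \<open>\<gamma>\<^sub>a\<close>, \<open>\<gamma>\<^sub>1\<close> and \<open>\<gamma>\<^sub>2\<close> are the forms for
  \<open>(a\<^sub>1, a\<^sub>2, a)\<close>, \<open>(a\<^sub>1, a\<^sub>2, 0)\<close>, \<open>(0, a\<^sub>2, 0)\<close>, \<open>(0, 0, 0)\<close>, taken in pairs of consecutive parameters, so
  that \<open>\<alpha> = \<gamma>(p, 0)\<close> for \<open>p = (a\<^sub>1, a\<^sub>2, a)\<close> and \<open>A\<^sup>\<alpha> = C(p, p)\<close> is the lifting.
\<close>

section \<open>Linear extension\<close>

text \<open>The basis is not extracted from the presentation. Left multiplication by the generators
  is written down on formal sums (\<open>bop\<close>) and the relations are checked for these
  operators. Conversely, operators satisfying the relations modulo a stable subspace act on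
  monomials with the same structure constants (\<open>T_mon\<close>). This is used three times: for
  \<open>op\<close> it gives associativity of \<open>prd\<close>, for the operators
  \<open>top\<close> on tensor squares multiplicativity of the coproduct, for the free algebra
  modulo the ideal that monomials span the presented algebra. Most identities then follow by
  comparing two intertwiners that agree on the unit. The delicate point is the wrap-around of an
  exponent at \<open>r\<close>, where the roots of unity enter. In each factor of \<alpha> only one
  parameter differs between the two sides, and the counit kills a leading generator whose parameters
  agree; this keeps the tables of values short. The factors of \<alpha> and the inverse in the twist
  are chosen by \<open>SOME\<close>, so their values on the carrier must be proved unique before
  they can be identified with \<open>gam\<close>.\<close>

abbreviation "lookup \<equiv> Poly_Mapping.lookup"
abbreviation "keys \<equiv> Poly_Mapping.keys"
abbreviation "single \<equiv> Poly_Mapping.single"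
abbreviation basis :: "'x \<Rightarrow> ('x \<Rightarrow>\<^sub>0 'k::field)" where "basis x \<equiv> single x 1"

lemma lookup_scale [simp]: "lookup (scale c f) x = c * lookup f x"
  unfolding scale_def by (simp add: Poly_Mapping.map.rep_eq when_def)

lemma scale_single [simp]: "scale c (single x d) = single x (c * d)"
  by (rule poly_mapping_eqI) (simp add: lookup_single when_def)

interpretation pm: vector_space scale
  by unfold_locales (auto intro!: poly_mapping_eqI simp: lookup_add algebra_simps)

lemma keys_scale_subset: "keys (scale c f) \<subseteq> keys f"
  by (auto simp: in_keys_iff)

text \<open>The target carries an explicit scalar multiplication \<open>s\<close>, so that the same
  rules serve maps into formal sums (\<open>ext\<close>) and functionals
  (\<open>fext\<close>).\<close>

definition lext :: "('k::field \<Rightarrow> 'm::ab_group_add \<Rightarrow> 'm) \<Rightarrow> ('x \<Rightarrow> 'm) \<Rightarrow> ('x \<Rightarrow>\<^sub>0 'k) \<Rightarrow> 'm" where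
  "lext s f c = (\<Sum>x\<in>keys c. s (lookup c x) (f x))"

abbreviation ext :: "('x \<Rightarrow> ('y \<Rightarrow>\<^sub>0 'k::field)) \<Rightarrow> ('x \<Rightarrow>\<^sub>0 'k) \<Rightarrow> ('y \<Rightarrow>\<^sub>0 'k)" where
  "ext \<equiv> lext scale"

abbreviation fext :: "('x \<Rightarrow> 'k::field) \<Rightarrow> ('x \<Rightarrow>\<^sub>0 'k) \<Rightarrow> 'k" where
  "fext \<equiv> lext (*)"

lemma vector_space_field: "vector_space ((*) :: 'k::field \<Rightarrow> 'k \<Rightarrow> 'k)"
  by unfold_locales (auto simp: algebra_simps)

lemma lext_cong: "(\<And>x. x \<in> keys c \<Longrightarrow> f x = f' x) \<Longrightarrow> lext s f c = lext s f' c"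
  by (simp add: lext_def)

context vector_space
begin

lemma lext_eq_sum:
  assumes "finite S" "keys c \<subseteq> S"
  shows "lext scale f c = (\<Sum>x\<in>S. scale (lookup c x) (f x))"
  unfolding lext_def using assms
  by (intro sum.mono_neutral_left) (auto simp: in_keys_iff)

lemma lext_0 [simp]: "lext scale f 0 = 0"
  by (simp add: lext_def)

lemma lext_single [simp]: "lext scale f (single x a) = scale a (f x)"
  by (subst lext_eq_sum[of "{x}"]) auto

lemma lext_add: "lext scale f (c + d) = lext scale f c + lext scale f d"
proof -
  have "keys (c + d) \<subseteq> keys c \<union> keys d" by (rule Poly_Mapping.keys_add)
  then show ?thesis
    by (simp add: lext_eq_sum[of "keys c \<union> keys d"] lookup_add scale_left_distrib sum.distrib)
qed

lemma lext_scale: "lext scale f (Defs.scale a c) = scale a (lext scale f c)"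
  using keys_scale_subset[of a c]
  by (simp add: lext_eq_sum[of "keys c"] scale_sum_right)

lemma linear_lext: "Vector_Spaces.linear Defs.scale scale (lext scale f)"
  by (simp add: Vector_Spaces.linear_iff lext_add lext_scale pm.vector_space_axioms vector_space_axioms)

lemma lext_uminus: "lext scale f (- c) = - lext scale f c"
  using lext_scale[of f "-1" c] lext_add[of f c "- c"]
  by (simp add: eq_neg_iff_add_eq_0 add.commute)

lemma lext_diff: "lext scale f (c - d) = lext scale f c - lext scale f d"
  by (metis diff_conv_add_uminus lext_add lext_uminus)

lemma lext_sum: "lext scale f (\<Sum>i\<in>I. c i) = (\<Sum>i\<in>I. lext scale f (c i))"
  by (induction I rule: infinite_finite_induct) (auto simp: lext_add)

lemma lext_fun_add: "lext scale (\<lambda>x. f x + g x) c = lext scale f c + lext scale g c"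
  by (simp add: lext_def scale_right_distrib sum.distrib)

lemma lext_fun_diff: "lext scale (\<lambda>x. f x - g x) c = lext scale f c - lext scale g c"
  by (simp add: lext_def scale_right_diff_distrib sum_subtractf)

lemma lext_fun_scale: "lext scale (\<lambda>x. scale a (f x)) c = scale a (lext scale f c)"
  by (simp add: lext_def scale_sum_right mult.commute)

lemma lext_fun_0 [simp]: "lext scale (\<lambda>x. 0) c = 0"
  by (simp add: lext_def)

lemma lext_ext: "lext scale f (ext g c) = lext scale (\<lambda>x. lext scale f (g x)) c"
  by (simp add: lext_def[of _ _ c] lext_sum lext_scale)

lemma lext_swap:
  "lext scale (\<lambda>x. lext scale (f x) d) c = lext scale (\<lambda>y. lext scale (\<lambda>x. f x y) c) d"
  by (simp add: lext_def scale_sum_right mult.commute) (rule sum.swap)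

end

lemma linear_lext_comp:
  assumes "Vector_Spaces.linear s1 s2 F"
  shows "F (lext s1 f c) = lext s2 (\<lambda>x. F (f x)) c"
proof -
  interpret Vector_Spaces.linear s1 s2 F by fact
  show ?thesis by (simp add: lext_def sum scale)
qed

lemma ext_basis [simp]: "ext basis c = c"
proof (rule poly_mapping_eqI)
  fix k
  have "lookup (ext basis c) k = (\<Sum>x\<in>keys c. if x = k then lookup c x else 0)"
    unfolding lext_def by (simp add: lookup_sum lookup_single when_def if_distrib cong: if_cong)
  also have "\<dots> = lookup c k" by (auto simp: in_keys_iff)
  finally show "lookup (ext basis c) k = lookup c k" .
qed

lemma linear_eq_lext:
  assumes "Vector_Spaces.linear scale s F"
  shows "F c = lext s (\<lambda>x. F (basis x)) c"
  using linear_lext_comp[OF assms, of basis c] by simp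

lemma linear_eqI:
  assumes "Vector_Spaces.linear scale s F" "Vector_Spaces.linear scale s F'"
    and "\<And>x. x \<in> keys c \<Longrightarrow> F (basis x) = F' (basis x)"
  shows "F c = F' c"
  unfolding linear_eq_lext[OF assms(1), of c] linear_eq_lext[OF assms(2), of c]
  by (rule lext_cong) (rule assms(3))

lemma linearI':
  assumes "vector_space s1" "vector_space s2" "\<And>x y. f (x + y) = f x + f y" "\<And>c x. f (s1 c x) = s2 c (f x)"
  shows "Vector_Spaces.linear s1 s2 f"
  using assms by (simp add: Vector_Spaces.linear_iff)

lemma keys_ext: "keys (ext f c) \<subseteq> (\<Union>x\<in>keys c. keys (f x))"
proof -
  have "keys (ext f c) \<subseteq> (\<Union>x\<in>keys c. keys (scale (lookup c x) (f x)))"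
    unfolding lext_def by (rule Poly_Mapping.keys_sum)
  also have "\<dots> \<subseteq> (\<Union>x\<in>keys c. keys (f x))"
    by (intro UN_mono order.refl keys_scale_subset)
  finally show ?thesis .
qed

lemma keys_ext_subsetI: "(\<And>x. x \<in> keys c \<Longrightarrow> keys (f x) \<subseteq> S) \<Longrightarrow> keys (ext f c) \<subseteq> S"
  by (rule order.trans[OF keys_ext UN_least])

lemma poly_mapping_ext_induct [case_names zero single add]:
  fixes c :: "'x \<Rightarrow>\<^sub>0 'k::field"
  assumes "P 0" "\<And>x a. P (single x a)" "\<And>c d. P c \<Longrightarrow> P d \<Longrightarrow> P (c + d)"
  shows "P c"
proof -
  have "P (\<Sum>x\<in>S. single x (lookup c x))" if "finite S" for S
    using that by induction (auto intro: assms)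
  moreover have "c = (\<Sum>x\<in>keys c. single x (lookup c x))"
    using ext_basis[of c] by (simp add: lext_def)
  ultimately show ?thesis by (metis finite_keys)
qed

lemma scale_mult_left: "scale c f * g = scale c (f * g :: ('x::monoid_add \<Rightarrow>\<^sub>0 'k::field))"
proof (induction f rule: poly_mapping_ext_induct)
  case (single x a)
  show ?case
    by (induction g rule: poly_mapping_ext_induct)
      (simp_all add: mult_single distrib_left pm.scale_right_distrib mult.assoc)
qed (simp_all add: distrib_right pm.scale_right_distrib)

lemma scale_mult_right: "f * scale c g = scale c (f * g :: ('x::monoid_add \<Rightarrow>\<^sub>0 'k::field))"
proof (induction f rule: poly_mapping_ext_induct)
  case (single x a)
  show ?case
    by (induction g rule: poly_mapping_ext_induct)
      (simp_all add: mult_single distrib_left pm.scale_right_distrib mult.left_commute)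
qed (simp_all add: distrib_right pm.scale_right_distrib)

section \<open>Tensor products of spaces of formal sums\<close>

text \<open>Spaces of formal sums have bases, so their tensor product is taken as formal sums over
  pairs, without a quotient. The passage to the abstract \<open>tensor\<close> is made later through
  \<open>tcls\<close>.\<close>

definition otimes :: "('x \<Rightarrow>\<^sub>0 'k::field) \<Rightarrow> ('y \<Rightarrow>\<^sub>0 'k) \<Rightarrow> ('x \<times> 'y \<Rightarrow>\<^sub>0 'k)" where
  "otimes c d = ext (\<lambda>x. ext (\<lambda>y. basis (x, y)) d) c"

lemma otimes_add_left: "otimes (c + c') d = otimes c d + otimes c' d"
  and otimes_add_right: "otimes c (d + d') = otimes c d + otimes c d'"
  and otimes_diff_left: "otimes (c - c') d = otimes c d - otimes c' d"
  and otimes_diff_right: "otimes c (d - d') = otimes c d - otimes c d'"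
  and otimes_scale_left: "otimes (scale a c) d = scale a (otimes c d)"
  and otimes_scale_right: "otimes c (scale a d) = scale a (otimes c d)"
  by (simp_all add: otimes_def pm.lext_add pm.lext_diff pm.lext_scale pm.lext_fun_add pm.lext_fun_diff pm.lext_fun_scale)

lemma otimes_0_left [simp]: "otimes 0 d = 0" and otimes_0_right [simp]: "otimes c 0 = 0"
  by (simp_all add: otimes_def)

lemmas otimes_simps = otimes_add_left otimes_add_right otimes_diff_left otimes_diff_right
  otimes_scale_left otimes_scale_right

lemma otimes_ext_left: "otimes (ext f c) d = ext (\<lambda>x. otimes (f x) d) c"
  by (simp add: otimes_def pm.lext_ext)

lemma otimes_ext_right: "otimes c (ext f d) = ext (\<lambda>y. otimes c (f y)) d"
  by (simp add: otimes_def pm.lext_ext) (rule pm.lext_swap)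

lemma (in vector_space) lext_otimes:
  "lext scale f (otimes c d) = lext scale (\<lambda>x. lext scale (\<lambda>y. f (x, y)) d) c"
  by (simp add: otimes_def lext_ext)

definition tmap :: "(('x \<Rightarrow>\<^sub>0 'k::field) \<Rightarrow> ('u \<Rightarrow>\<^sub>0 'k)) \<Rightarrow> (('y \<Rightarrow>\<^sub>0 'k) \<Rightarrow> ('v \<Rightarrow>\<^sub>0 'k)) \<Rightarrow>
    ('x \<times> 'y \<Rightarrow>\<^sub>0 'k) \<Rightarrow> ('u \<times> 'v \<Rightarrow>\<^sub>0 'k)" where
  "tmap F H = ext (\<lambda>(x, y). otimes (F (basis x)) (H (basis y)))"

abbreviation "pmlinear \<equiv> Vector_Spaces.linear scale scale"

lemma linear_ext [simp]: "pmlinear (ext f)"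
  by (rule pm.linear_lext)

lemma linear_tmap [simp]: "pmlinear (tmap F H)"
  by (simp add: tmap_def)

lemma tmap_basis [simp]: "tmap F H (basis (x, y)) = otimes (F (basis x)) (H (basis y))"
  by (simp add: tmap_def)

lemma linear_comp: "Vector_Spaces.linear s2 s3 F \<Longrightarrow> Vector_Spaces.linear s1 s2 H \<Longrightarrow> Vector_Spaces.linear s1 s3 (\<lambda>c. F (H c))"
  using Vector_Spaces.linear_compose[of s1 s2 H s3 F] by (simp add: o_def)

lemma tmap_otimes:
  assumes "pmlinear F" "pmlinear H"
  shows "tmap F H (otimes c d) = otimes (F c) (H d)"
proof -
  have "otimes (F c) (H d) = otimes (ext (\<lambda>x. F (basis x)) c) (ext (\<lambda>y. H (basis y)) d)"
    using linear_eq_lext[OF assms(1), of c] linear_eq_lext[OF assms(2), of d] by simp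
  also have "\<dots> = ext (\<lambda>x. ext (\<lambda>y. otimes (F (basis x)) (H (basis y))) d) c"
    by (simp only: otimes_ext_left) (simp only: otimes_ext_right)
  finally show ?thesis by (simp only: tmap_def pm.lext_otimes prod.case)
qed

section \<open>The algebras with given relations\<close>

type_synonym 'g mono = "nat \<times> nat \<times> 'g"
type_synonym ('g, 'k) formal = "(nat \<times> nat \<times> 'g) \<Rightarrow>\<^sub>0 'k"
type_synonym 'k params = "'k \<times> 'k \<times> 'k"

abbreviation par1 :: "'k params \<Rightarrow> 'k" where "par1 p \<equiv> fst p"
abbreviation par2 :: "'k params \<Rightarrow> 'k" where "par2 p \<equiv> fst (snd p)"
abbreviation par0 :: "'k params \<Rightarrow> 'k" where "par0 p \<equiv> snd (snd p)"

locale quantum_plane = comm_group G for G :: "('g, 'm) monoid_scheme" (structure) +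
  fixes g1 g2 :: 'g and \<chi>1 \<chi>2 :: "'g \<Rightarrow> 'k::field" and q :: 'k and r :: nat
  assumes g1 [simp]: "g1 \<in> carrier G" and g2 [simp]: "g2 \<in> carrier G"
    and chi1_mult: "h \<in> carrier G \<Longrightarrow> h' \<in> carrier G \<Longrightarrow> \<chi>1 (h \<otimes> h') = \<chi>1 h * \<chi>1 h'"
    and chi2_mult: "h \<in> carrier G \<Longrightarrow> h' \<in> carrier G \<Longrightarrow> \<chi>2 (h \<otimes> h') = \<chi>2 h * \<chi>2 h'"
    and chi12: "h \<in> carrier G \<Longrightarrow> \<chi>1 h * \<chi>2 h = 1"
    and chi1_g1: "\<chi>1 g1 = q" and chi1_g2: "\<chi>1 g2 = q"
    and r_gt_1: "r > 1" and q_pow_r: "q ^ r = 1"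
    and q_primitive: "0 < k \<Longrightarrow> k < r \<Longrightarrow> q ^ k \<noteq> 1"
    and chi1_pow_r: "h \<in> carrier G \<Longrightarrow> \<chi>1 h ^ r = 1"
begin

lemma chi_nonzero: "h \<in> carrier G \<Longrightarrow> \<chi>1 h \<noteq> 0" "h \<in> carrier G \<Longrightarrow> \<chi>2 h \<noteq> 0"
  using chi12[of h] by auto

lemma chi2_eq: "h \<in> carrier G \<Longrightarrow> \<chi>2 h = inverse (\<chi>1 h)"
  using chi12[of h] by (simp add: inverse_unique)

lemma q_nonzero [simp]: "q \<noteq> 0"
  using chi_nonzero(1)[OF g1] by (simp add: chi1_g1)

lemma r_pos [simp]: "0 < r"
  using r_gt_1 by simp

lemma chi_one [simp]: "\<chi>1 \<one> = 1" "\<chi>2 \<one> = 1"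
proof -
  have "\<chi>1 \<one> * \<chi>1 \<one> = \<chi>1 \<one> * 1" using chi1_mult[of \<one> \<one>] by simp
  then show "\<chi>1 \<one> = 1" using chi_nonzero(1)[OF one_closed] mult_left_cancel by blast
  then show "\<chi>2 \<one> = 1" by (simp add: chi2_eq)
qed

lemma chi_pow: "h \<in> carrier G \<Longrightarrow> \<chi>1 (h [^] (n::nat)) = \<chi>1 h ^ n"
  "h \<in> carrier G \<Longrightarrow> \<chi>2 (h [^] (n::nat)) = \<chi>2 h ^ n"
  by (induction n) (auto simp: chi1_mult chi2_mult)

lemma chi2_pow_r: "h \<in> carrier G \<Longrightarrow> \<chi>2 h ^ r = 1"
  by (simp add: chi2_eq power_inverse chi1_pow_r)

lemma chi_g12 [simp]: "\<chi>1 (g1 \<otimes> g2) = q * q" "\<chi>2 g1 = inverse q" "\<chi>2 g2 = inverse q"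
  "\<chi>2 (g1 \<otimes> g2) = inverse q * inverse q"
  by (simp_all add: chi1_mult chi2_mult chi2_eq chi1_g1 chi1_g2)

lemma chi_gr [simp]: "\<chi>1 (g1 [^] r) = 1" "\<chi>1 (g2 [^] r) = 1" "\<chi>2 (g1 [^] r) = 1" "\<chi>2 (g2 [^] r) = 1"
  by (simp_all add: chi_pow chi1_pow_r chi2_pow_r del: chi_g12)

definition qnum :: "nat \<Rightarrow> 'k" where "qnum n = (\<Sum>i<n. q ^ i)"

lemma qnum_0 [simp]: "qnum 0 = 0" and qnum_1 [simp]: "qnum (Suc 0) = 1"
  by (simp_all add: qnum_def)

lemma qnum_Suc: "qnum (Suc n) = qnum n + q ^ n"
  by (simp add: qnum_def)

lemma qnum_Suc': "qnum (Suc n) = 1 + q * qnum n"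
proof (induction n)
  case (Suc n)
  have "qnum (Suc (Suc n)) = (1 + q * qnum n) + q * q ^ n"
    by (simp add: qnum_Suc[of "Suc n"] Suc)
  then show ?case by (simp add: qnum_Suc[of n] algebra_simps)
qed simp

lemma qnum_eq: "(q - 1) * qnum n = q ^ n - 1"
  by (induction n) (simp_all add: qnum_Suc algebra_simps)

lemma q_neq_1: "q \<noteq> 1"
  using q_primitive[of 1] r_gt_1 by auto

lemma qnum_r [simp]: "qnum r = 0"
  using qnum_eq[of r] q_neq_1 by (simp add: q_pow_r)

definition idx :: "'g mono set" where
  "idx = {..<r} \<times> {..<r} \<times> carrier G"

lemma idx_iff [simp]: "(i, j, g) \<in> idx \<longleftrightarrow> i < r \<and> j < r \<and> g \<in> carrier G"
  by (auto simp: idx_def)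

text \<open>
  Left multiplication by a generator on the basis vector \<open>x\<^sub>1\<^sup>i x\<^sub>2\<^sup>j g\<close> of the algebra with relations
  \<open>x\<^sub>1\<^sup>r = p\<^sub>1 - p\<^sub>1' g\<^sub>1\<^sup>r\<close>, \<open>x\<^sub>2\<^sup>r = p\<^sub>2 - p\<^sub>2' g\<^sub>2\<^sup>r\<close> and \<open>x\<^sub>2 x\<^sub>1 = q x\<^sub>1 x\<^sub>2 + p\<^sub>0 - p\<^sub>0' g\<^sub>1 g\<^sub>2\<close>. The biproduct
  is the case \<open>p = p' = 0\<close>, and the lifting is the case \<open>p = p'\<close>.
\<close>

definition bop :: "'k params \<Rightarrow> 'k params \<Rightarrow> 'g gen \<Rightarrow> 'g mono \<Rightarrow> ('g, 'k) formal" where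
  "bop p p' x = (\<lambda>(i, j, g). if (i, j, g) \<notin> idx then 0 else
     (case x of
        Grp h \<Rightarrow> if h \<in> carrier G then single (i, j, h \<otimes> g) (\<chi>1 h ^ i * \<chi>2 h ^ j) else 0
      | X1 \<Rightarrow> if Suc i < r then basis (Suc i, j, g)
              else single (0, j, g) (par1 p) - single (0, j, (g1 [^] r) \<otimes> g) (par1 p')
      | X2 \<Rightarrow> (if Suc j < r then single (i, Suc j, g) (q ^ i)
               else single (i, 0, g) (q ^ i * par2 p) - single (i, 0, (g2 [^] r) \<otimes> g) (q ^ i * par2 p')) +
              (single (i - 1, j, g) (qnum i * par0 p) -
               single (i - 1, j, (g1 \<otimes> g2) \<otimes> g) (qnum i * q ^ (i - 1) * \<chi>2 (g1 \<otimes> g2) ^ j * par0 p'))))"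

definition op :: "'k params \<Rightarrow> 'k params \<Rightarrow> 'g gen \<Rightarrow>
    ('g, 'k) formal \<Rightarrow> ('g, 'k) formal" where
  "op p p' x = ext (bop p p' x)"

lemma linear_op [simp]: "pmlinear (op p p' x)"
  by (simp add: op_def)

lemma op_simps: "op p p' x (c + d) = op p p' x c + op p p' x d" "op p p' x (c - d) = op p p' x c - op p p' x d"
  "op p p' x (scale a c) = scale a (op p p' x c)" "op p p' x 0 = 0"
  by (simp_all add: op_def pm.lext_add pm.lext_diff pm.lext_scale)

lemma op_single: "op p p' x (single k a) = scale a (bop p p' x k)"
  by (simp add: op_def)

lemma op_basis [simp]: "op p p' x (basis k) = bop p p' x k"
  by (simp add: op_def)

lemma bop_outside [simp]: "k \<notin> idx \<Longrightarrow> bop p p' x k = 0"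
  by (cases k) (simp add: bop_def)

lemma bop_Grp: "(i, j, g) \<in> idx \<Longrightarrow> h \<in> carrier G \<Longrightarrow>
    bop p p' (Grp h) (i, j, g) = single (i, j, h \<otimes> g) (\<chi>1 h ^ i * \<chi>2 h ^ j)"
  by (simp add: bop_def)

lemma bop_Grp_outside: "h \<notin> carrier G \<Longrightarrow> bop p p' (Grp h) k = 0"
  by (simp add: bop_def split: prod.split)

lemma bop_X1: "(i, j, g) \<in> idx \<Longrightarrow> Suc i < r \<Longrightarrow> bop p p' X1 (i, j, g) = basis (Suc i, j, g)"
  by (simp add: bop_def)

lemma bop_X1_top: "(i, j, g) \<in> idx \<Longrightarrow> Suc i = r \<Longrightarrow>
   bop p p' X1 (i, j, g) = single (0, j, g) (par1 p) - single (0, j, (g1 [^] r) \<otimes> g) (par1 p')"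
  by (auto simp: bop_def)

lemma bop_X2: "(i, j, g) \<in> idx \<Longrightarrow> Suc j < r \<Longrightarrow> bop p p' X2 (i, j, g) = single (i, Suc j, g) (q ^ i) +
     (single (i - 1, j, g) (qnum i * par0 p) -
      single (i - 1, j, (g1 \<otimes> g2) \<otimes> g) (qnum i * q ^ (i - 1) * \<chi>2 (g1 \<otimes> g2) ^ j * par0 p'))"
  by (simp add: bop_def)

lemma bop_X2_top: "(i, j, g) \<in> idx \<Longrightarrow> Suc j = r \<Longrightarrow> bop p p' X2 (i, j, g) =
     single (i, 0, g) (q ^ i * par2 p) - single (i, 0, (g2 [^] r) \<otimes> g) (q ^ i * par2 p') +
     (single (i - 1, j, g) (qnum i * par0 p) -
      single (i - 1, j, (g1 \<otimes> g2) \<otimes> g) (qnum i * q ^ (i - 1) * \<chi>2 (g1 \<otimes> g2) ^ j * par0 p'))"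
  by (auto simp: bop_def)

lemma keys_bop: "keys (bop p p' x k) \<subseteq> idx"
proof (cases "k \<in> idx")
  case True
  obtain i j g where k: "k = (i, j, g)" by (cases k)
  have 1: "keys (single l a) \<subseteq> idx" if "l \<in> idx" for l and a :: 'k
    using that by (cases "a = 0") auto
  have 2: "keys (c - d) \<subseteq> idx" if "keys c \<subseteq> idx" "keys d \<subseteq> idx" for c d :: "('g, 'k) formal"
    by (rule order.trans[OF Poly_Mapping.keys_diff Un_least[OF that]])
  have 3: "keys (c + d) \<subseteq> idx" if "keys c \<subseteq> idx" "keys d \<subseteq> idx" for c d :: "('g, 'k) formal"
    by (rule order.trans[OF Poly_Mapping.keys_add Un_least[OF that]])
  show ?thesis using True
    by (cases x) (simp_all add: k bop_def 1 2 3 less_imp_diff_less)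
qed simp

lemma keys_op: "keys (op p p' x c) \<subseteq> idx"
  unfolding op_def by (intro keys_ext_subsetI keys_bop)

lemma op_one: "keys c \<subseteq> idx \<Longrightarrow> op p p' (Grp \<one>) c = c"
proof -
  assume "keys c \<subseteq> idx"
  then have "op p p' (Grp \<one>) c = ext basis c"
    unfolding op_def by (intro lext_cong) (auto simp: bop_Grp)
  then show ?thesis by simp
qed

lemma op_Grp_params: "op p p' (Grp h) = op 0 0 (Grp h)"
proof -
  have "bop p p' (Grp h) = bop 0 0 (Grp h)" by (rule HOL.ext) (simp add: bop_def split: prod.split)
  then show ?thesis by (simp add: op_def)
qed

lemma gens_simps [simp]: "X1 \<in> gens G" "X2 \<in> gens G" "Grp h \<in> gens G \<longleftrightarrow> h \<in> carrier G"
  by (auto simp: gens_def)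

text \<open>The monomial \<open>x_1^i x_2^j g\<close> with arbitrary operators \<open>T\<close> in
  the role of the generators. With \<open>op\<close> it yields the product, with \<open>top\<close>
  the coproduct, with multiplication in the free algebra the section \<open>sec\<close>.\<close>

definition mon :: "('g gen \<Rightarrow> 'v::zero \<Rightarrow> 'v) \<Rightarrow> 'v \<Rightarrow> 'g mono \<Rightarrow> 'v" where
  "mon T u = (\<lambda>(i, j, g). if (i, j, g) \<in> idx then (T X1 ^^ i) ((T X2 ^^ j) (T (Grp g) u)) else 0)"

lemma mon_outside [simp]: "k \<notin> idx \<Longrightarrow> mon T u k = 0"
  by (cases k) (auto simp: mon_def)

lemma mon_eq: "(i, j, g) \<in> idx \<Longrightarrow> mon T u (i, j, g) = (T X1 ^^ i) ((T X2 ^^ j) (T (Grp g) u))"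
  by (simp add: mon_def)

lemma mon_intertwine:
  assumes "\<And>x u. x \<in> gens G \<Longrightarrow> F (T x u) = T' x (F u)" "F 0 = 0"
  shows "F (mon T u k) = mon T' (F u) k"
proof (cases "k \<in> idx")
  case True
  have *: "F ((T x ^^ n) v) = (T' x ^^ n) (F v)" if "x \<in> gens G" for x n v
    using that by (induction n) (simp_all add: assms)
  obtain i j g where k: "k = (i, j, g)" by (cases k)
  show ?thesis using True by (simp add: k mon_eq * assms)
qed (simp add: assms)

end

text \<open>
  Operators satisfying the relations modulo the subspace \<open>N\<close>. The operator of \<open>\<one>\<close> need not be the
  identity: for \<open>op\<close> it is the projection onto the span of the basis vectors indexed by \<open>idx\<close>.
\<close>

locale quantum_plane_rep = quantum_plane G g1 g2 \<chi>1 \<chi>2 q r + V: vector_space s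
  for G :: "('g, 'm) monoid_scheme" (structure) and g1 g2 :: 'g and \<chi>1 \<chi>2 :: "'g \<Rightarrow> 'k::field"
    and q r and s :: "'k \<Rightarrow> 'v::ab_group_add \<Rightarrow> 'v" +
  fixes N :: "'v set" and T :: "'g gen \<Rightarrow> 'v \<Rightarrow> 'v" and p p' :: "'k params"
  assumes T_linear: "Vector_Spaces.linear s s (T x)"
    and N_subspace: "V.subspace N"
    and N_stable: "x \<in> gens G \<Longrightarrow> u \<in> N \<Longrightarrow> T x u \<in> N"
    and rel_Grp: "h \<in> carrier G \<Longrightarrow> h' \<in> carrier G \<Longrightarrow> T (Grp h) (T (Grp h') u) - T (Grp (h \<otimes> h')) u \<in> N"
    and rel_Grp_X1: "h \<in> carrier G \<Longrightarrow> T (Grp h) (T X1 u) - s (\<chi>1 h) (T X1 (T (Grp h) u)) \<in> N"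
    and rel_Grp_X2: "h \<in> carrier G \<Longrightarrow> T (Grp h) (T X2 u) - s (\<chi>2 h) (T X2 (T (Grp h) u)) \<in> N"
    and rel_X1: "(T X1 ^^ r) u - (s (par1 p) (T (Grp \<one>) u) - s (par1 p') (T (Grp (g1 [^] r)) u)) \<in> N"
    and rel_X2: "(T X2 ^^ r) u - (s (par2 p) (T (Grp \<one>) u) - s (par2 p') (T (Grp (g2 [^] r)) u)) \<in> N"
    and rel_X2_X1: "T X2 (T X1 u) - (s q (T X1 (T X2 u)) + s (par0 p) (T (Grp \<one>) u)
          - s (par0 p') (T (Grp (g1 \<otimes> g2)) u)) \<in> N"
begin

definition eqv (infix "\<approx>" 50) where "u \<approx> w \<longleftrightarrow> u - w \<in> N"

lemma eqv_refl [simp]: "u \<approx> u"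
  by (simp add: eqv_def V.subspace_0 N_subspace)

lemma eqv_trans [trans]: "u \<approx> w \<Longrightarrow> w \<approx> z \<Longrightarrow> u \<approx> z"
  unfolding eqv_def using V.subspace_add[OF N_subspace, of "u - w" "w - z"] by simp

lemma eqv_add: "u \<approx> w \<Longrightarrow> u' \<approx> w' \<Longrightarrow> u + u' \<approx> w + w'"
  unfolding eqv_def using V.subspace_add[OF N_subspace, of "u - w" "u' - w'"] by (simp add: algebra_simps)

lemma eqv_diff: "u \<approx> w \<Longrightarrow> u' \<approx> w' \<Longrightarrow> u - u' \<approx> w - w'"
  unfolding eqv_def using V.subspace_diff[OF N_subspace, of "u - w" "u' - w'"] by (simp add: algebra_simps)

lemma eqv_scale: "u \<approx> w \<Longrightarrow> s a u \<approx> s a w"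
  unfolding eqv_def using V.subspace_scale[OF N_subspace, of "u - w" a] by (simp add: V.scale_right_diff_distrib)

lemma T_simps: "T x (u + w) = T x u + T x w" "T x (u - w) = T x u - T x w" "T x (s a u) = s a (T x u)"
  "T x 0 = 0"
  using T_linear[of x] by (auto simp: Vector_Spaces.linear_iff_module_hom module_hom.add module_hom.diff
      module_hom.scale module_hom.zero)

lemma Tn_simps: "(T x ^^ n) (u + w) = (T x ^^ n) u + (T x ^^ n) w"
  "(T x ^^ n) (u - w) = (T x ^^ n) u - (T x ^^ n) w" "(T x ^^ n) (s a u) = s a ((T x ^^ n) u)"
  by (induction n) (auto simp: T_simps)

lemma eqv_T: "x \<in> gens G \<Longrightarrow> u \<approx> w \<Longrightarrow> T x u \<approx> T x w"
  unfolding eqv_def using N_stable[of x "u - w"] by (simp add: T_simps)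

lemma eqv_Tn: "x \<in> gens G \<Longrightarrow> u \<approx> w \<Longrightarrow> (T x ^^ n) u \<approx> (T x ^^ n) w"
  by (induction n) (auto intro: eqv_T)

lemmas eqv_intros = eqv_add eqv_diff eqv_scale eqv_T eqv_Tn

lemma Grp_Xn:
  assumes "h \<in> carrier G" "x = X1 \<and> a = \<chi>1 h \<or> x = X2 \<and> a = \<chi>2 h"
  shows "T (Grp h) ((T x ^^ n) u) \<approx> s (a ^ n) ((T x ^^ n) (T (Grp h) u))"
proof (induction n)
  case (Suc n)
  have "T (Grp h) (T x ((T x ^^ n) u)) \<approx> s a (T x (T (Grp h) ((T x ^^ n) u)))"
    using assms rel_Grp_X1 rel_Grp_X2 by (auto simp: eqv_def)
  also have "\<dots> \<approx> s a (T x (s (a ^ n) ((T x ^^ n) (T (Grp h) u))))"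
    using assms by (intro eqv_intros Suc) auto
  finally show ?case by (simp add: T_simps)
qed simp

text \<open>Let g stand for \<open>g1 \<otimes> g2\<close>. When x_2 passes the factors x_1 one by
  one, the k-th exchange leaves \<open>q ^ k\<close> times \<open>par0 p - par0 p' g\<close> between
  \<open>x_1^k\<close> and \<open>x_1^(n-1-k)\<close>. Since \<open>g x_1 = q^2 x_1 g\<close>,
  moving g to the right gives \<open>q ^ (2 * (n - 1) - k)\<close>, and these powers sum to
  \<open>q ^ (n - 1) * qnum n\<close>.\<close>

lemma X2_X1n:
  "T X2 ((T X1 ^^ n) u) \<approx> s (q ^ n) ((T X1 ^^ n) (T X2 u)) +
     (s (qnum n * par0 p) ((T X1 ^^ (n - 1)) (T (Grp \<one>) u)) -
      s (qnum n * q ^ (n - 1) * par0 p') ((T X1 ^^ (n - 1)) (T (Grp (g1 \<otimes> g2)) u)))"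
proof (induction n)
  case (Suc n)
  let ?X = "(T X1 ^^ n)"
  let ?Z = "s (q ^ n) (?X (T X2 u)) +
     (s (qnum n * par0 p) ((T X1 ^^ (n - 1)) (T (Grp \<one>) u)) -
      s (qnum n * q ^ (n - 1) * par0 p') ((T X1 ^^ (n - 1)) (T (Grp (g1 \<otimes> g2)) u)))"
  have "T X2 (T X1 (?X u)) \<approx> s q (T X1 (T X2 (?X u))) + s (par0 p) (T (Grp \<one>) (?X u))
          - s (par0 p') (T (Grp (g1 \<otimes> g2)) (?X u))"
    using rel_X2_X1 by (simp add: eqv_def)
  also have "\<dots> \<approx> s q (T X1 ?Z) + s (par0 p) (s (\<chi>1 \<one> ^ n) (?X (T (Grp \<one>) u)))
          - s (par0 p') (s (\<chi>1 (g1 \<otimes> g2) ^ n) (?X (T (Grp (g1 \<otimes> g2)) u)))"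
    by (intro eqv_intros Suc Grp_Xn) auto
  also have "\<dots> = s (q ^ Suc n) (T X1 (?X (T X2 u))) +
     (s (qnum (Suc n) * par0 p) (?X (T (Grp \<one>) u)) -
      s (qnum (Suc n) * q ^ n * par0 p') (?X (T (Grp (g1 \<otimes> g2)) u)))"
  proof (cases n)
    case (Suc m)
    have 1: "qnum (Suc n) * par0 p = q * (qnum n * par0 p) + par0 p"
      by (simp add: qnum_Suc' algebra_simps)
    have 2: "qnum (Suc n) * q ^ n * par0 p' = q * (qnum n * q ^ (n - 1) * par0 p') + par0 p' * (q * q) ^ n"
      by (simp add: qnum_Suc[of "Suc m"] Suc algebra_simps power_mult_distrib)
    show ?thesis unfolding 1 2
      by (simp add: T_simps V.scale_right_distrib V.scale_right_diff_distrib V.scale_left_distrib Suc)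
  qed (simp add: T_simps V.scale_right_distrib)
  finally show ?case by simp
qed simp

lemma Grp_X2n_Grp:
  assumes "h \<in> carrier G" "g \<in> carrier G"
  shows "T (Grp h) ((T X2 ^^ j) (T (Grp g) u)) \<approx> s (\<chi>2 h ^ j) ((T X2 ^^ j) (T (Grp (h \<otimes> g)) u))"
proof -
  have "T (Grp h) ((T X2 ^^ j) (T (Grp g) u)) \<approx> s (\<chi>2 h ^ j) ((T X2 ^^ j) (T (Grp h) (T (Grp g) u)))"
    using assms by (intro Grp_Xn) auto
  also have "\<dots> \<approx> s (\<chi>2 h ^ j) ((T X2 ^^ j) (T (Grp (h \<otimes> g)) u))"
    using assms by (intro eqv_intros) (auto simp: eqv_def rel_Grp)
  finally show ?thesis .
qed

text \<open>A generator times a monomial is brought to normal form by the defining relations alone,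
  so the structure constants \<open>bop\<close> are forced for any operators that satisfy them. The
  relations for \<open>r\<close>-th powers enter exactly when an exponent would reach
  \<open>r\<close>.\<close>

lemma T_mon: "x \<in> gens G \<Longrightarrow> T x (mon T u k) \<approx> lext s (mon T u) (bop p p' x k)"
proof (cases "k \<in> idx")
  case False
  then show ?thesis by (simp add: T_simps)
next
  case True
  assume x: "x \<in> gens G"
  obtain i j g where k: "k = (i, j, g)" by (cases k)
  have ijg: "i < r" "j < r" "g \<in> carrier G" using True by (simp_all add: k)
  show ?thesis
  proof (cases x)
    case (Grp h)
    have h: "h \<in> carrier G" using x Grp by simp
    have "T (Grp h) (mon T u k) \<approx> s (\<chi>1 h ^ i) ((T X1 ^^ i) (T (Grp h) ((T X2 ^^ j) (T (Grp g) u))))"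
      using h ijg by (simp add: k mon_eq) (intro Grp_Xn, auto)
    also have "\<dots> \<approx> s (\<chi>1 h ^ i) ((T X1 ^^ i) (s (\<chi>2 h ^ j) ((T X2 ^^ j) (T (Grp (h \<otimes> g)) u))))"
      using h ijg by (intro eqv_intros Grp_X2n_Grp) auto
    finally show ?thesis using h ijg by (simp add: Grp k bop_Grp mon_eq Tn_simps)
  next
    case X1
    let ?w = "(T X2 ^^ j) (T (Grp g) u)"
    show ?thesis
    proof (cases "Suc i < r")
      case True
      then show ?thesis using ijg by (simp add: X1 k bop_X1 mon_eq)
    next
      case False
      then have i: "Suc i = r" using ijg by simp
      have "T X1 (mon T u k) = (T X1 ^^ Suc i) ?w"
        using ijg by (simp add: k mon_eq)
      also have "\<dots> = (T X1 ^^ r) ?w" by (simp only: i)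
      also have "\<dots> \<approx> s (par1 p) (T (Grp \<one>) ?w) - s (par1 p') (T (Grp (g1 [^] r)) ?w)"
        using rel_X1 by (simp add: eqv_def)
      also have "\<dots> \<approx> s (par1 p) (s (\<chi>2 \<one> ^ j) ((T X2 ^^ j) (T (Grp (\<one> \<otimes> g)) u))) -
          s (par1 p') (s (\<chi>2 (g1 [^] r) ^ j) ((T X2 ^^ j) (T (Grp ((g1 [^] r) \<otimes> g)) u)))"
        using ijg by (intro eqv_intros Grp_X2n_Grp) auto
      finally show ?thesis using ijg i
        by (simp add: X1 k bop_X1_top mon_eq V.lext_diff)
    qed
  next
    case X2
    let ?w = "(T X2 ^^ j) (T (Grp g) u)" and ?X = "(T X1 ^^ i)" and ?X' = "(T X1 ^^ (i - 1))"
    let ?Z = "s (qnum i * par0 p) (?X' (s (\<chi>2 \<one> ^ j) ((T X2 ^^ j) (T (Grp (\<one> \<otimes> g)) u)))) -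
        s (qnum i * q ^ (i - 1) * par0 p') (?X' (s (\<chi>2 (g1 \<otimes> g2) ^ j) ((T X2 ^^ j) (T (Grp ((g1 \<otimes> g2) \<otimes> g)) u))))"
    have "T X2 (mon T u k) \<approx> s (q ^ i) (?X (T X2 ?w)) + (s (qnum i * par0 p) (?X' (T (Grp \<one>) ?w)) -
        s (qnum i * q ^ (i - 1) * par0 p') (?X' (T (Grp (g1 \<otimes> g2)) ?w)))"
      using ijg X2_X1n[of i ?w] by (simp add: k mon_eq)
    also have "\<dots> \<approx> s (q ^ i) (?X (T X2 ?w)) + ?Z"
      using ijg by (intro eqv_intros Grp_X2n_Grp) auto
    finally have 1: "T X2 (mon T u k) \<approx> s (q ^ i) (?X (T X2 ?w)) + ?Z" .
    have Z: "?Z = lext s (mon T u) (single (i - 1, j, g) (qnum i * par0 p) -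
      single (i - 1, j, (g1 \<otimes> g2) \<otimes> g) (qnum i * q ^ (i - 1) * \<chi>2 (g1 \<otimes> g2) ^ j * par0 p'))"
      using ijg by (simp add: mon_eq V.lext_diff Tn_simps mult.commute mult.left_commute del: chi_g12)
    show ?thesis
    proof (cases "Suc j < r")
      case True
      then show ?thesis using ijg 1 unfolding Z by (simp add: X2 k bop_X2 V.lext_add mon_eq del: chi_g12)
    next
      case False
      then have j: "Suc j = r" using ijg by simp
      have "?X (T X2 ?w) = ?X ((T X2 ^^ Suc j) (T (Grp g) u))"
        by simp
      also have "\<dots> = ?X ((T X2 ^^ r) (T (Grp g) u))" by (simp only: j)
      also have "\<dots> \<approx> ?X (s (par2 p) (T (Grp \<one>) (T (Grp g) u)) - s (par2 p') (T (Grp (g2 [^] r)) (T (Grp g) u)))"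
        using rel_X2 by (intro eqv_intros) (simp_all add: eqv_def)
      also have "\<dots> \<approx> ?X (s (par2 p) (T (Grp (\<one> \<otimes> g)) u) - s (par2 p') (T (Grp ((g2 [^] r) \<otimes> g)) u))"
        using ijg by (intro eqv_intros) (auto simp only: eqv_def intro!: rel_Grp, auto)
      finally have "s (q ^ i) (?X (T X2 ?w)) + ?Z \<approx>
         s (q ^ i) (?X (s (par2 p) (T (Grp (\<one> \<otimes> g)) u) - s (par2 p') (T (Grp ((g2 [^] r) \<otimes> g)) u))) + ?Z"
        by (intro eqv_add eqv_scale eqv_refl)
      with 1 have "T X2 (mon T u k) \<approx> s (q ^ i) (?X (s (par2 p) (T (Grp (\<one> \<otimes> g)) u) - s (par2 p') (T (Grp ((g2 [^] r) \<otimes> g)) u))) + ?Z"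
        by (rule eqv_trans)
      then show ?thesis using ijg j unfolding Z
        by (simp add: X2 k bop_X2_top V.lext_add V.lext_diff mon_eq Tn_simps V.scale_right_diff_distrib del: chi_g12)
    qed
  qed
qed

text \<open>Linear form of \<open>T_mon\<close>: sending the unit to an arbitrary \<open>u\<close>
  extends to a map that intertwines \<open>op\<close> with \<open>T\<close> modulo \<open>N\<close>,
  as for a free module of rank one.\<close>

lemma T_lext_mon:
  assumes "x \<in> gens G"
  shows "T x (lext s (mon T u) c) \<approx> lext s (mon T u) (op p p' x c)"
proof (induction c rule: poly_mapping_ext_induct)
  case (single k a)
  show ?case using T_mon[OF assms, of u k]
    by (simp add: op_single V.lext_scale T_simps eqv_scale)
next
  case (add c d)
  then show ?case by (simp add: V.lext_add op_simps T_simps eqv_add)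
qed (simp add: T_simps op_simps)

end

lemma linear_id_pm [simp]: "pmlinear (\<lambda>u. u)"
  by (auto intro!: linearI' simp: pm.vector_space_axioms)

lemma linear_scale_pm: "pmlinear F \<Longrightarrow> pmlinear (\<lambda>u. scale a (F u))"
  by (auto simp: Vector_Spaces.linear_iff pm.scale_right_distrib mult.commute)

lemma linear_add_pm: "pmlinear F \<Longrightarrow> pmlinear H \<Longrightarrow> pmlinear (\<lambda>u. F u + H u)"
  by (auto simp: Vector_Spaces.linear_iff pm.scale_right_distrib)

lemma linear_diff_pm: "pmlinear F \<Longrightarrow> pmlinear H \<Longrightarrow> pmlinear (\<lambda>u. F u - H u)"
  by (auto simp: Vector_Spaces.linear_iff pm.scale_right_diff_distrib)

lemma linear_funpow_pm:
  fixes T :: "('x \<Rightarrow>\<^sub>0 'k::field) \<Rightarrow> ('x \<Rightarrow>\<^sub>0 'k)"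
  shows "pmlinear T \<Longrightarrow> pmlinear F \<Longrightarrow> pmlinear (\<lambda>u. (T ^^ n) (F u))"
proof (induction n)
  case (Suc n)
  then show ?case using linear_comp[of scale scale T scale "\<lambda>u. (T ^^ n) (F u)"] by simp
qed simp

lemma linear_pm_simps:
  assumes "pmlinear F"
  shows "F (x + y) = F x + F y" "F (x - y) = F x - F y" "F (scale a x) = scale a (F x)" "F 0 = 0"
    "F (sum f I) = (\<Sum>i\<in>I. F (f i))"
  using assms by (auto simp: Vector_Spaces.linear_iff_module_hom module_hom.add module_hom.diff
      module_hom.scale module_hom.zero module_hom.sum)

section \<open>The quantum binomial theorem at a root of unity\<close>

text \<open>Gaussian binomial coefficients, defined by the Pascal rule because the quotient formula
  has zero denominators at a root of unity.\<close>

fun qbin :: "'k::field \<Rightarrow> nat \<Rightarrow> nat \<Rightarrow> 'k" where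
  "qbin t n 0 = 1"
| "qbin t 0 (Suc k) = 0"
| "qbin t (Suc n) (Suc k) = qbin t n k + t ^ Suc k * qbin t n (Suc k)"

lemma qbin_gt: "n < k \<Longrightarrow> qbin t n k = 0"
  by (induction t n k rule: qbin.induct) auto

lemma qbin_self: "qbin t n n = 1"
  by (induction n) (auto simp: qbin_gt)

text \<open>The factorial formula in a form free of division. At a primitive root of unity of order
  \<open>Suc n\<close> the right side is 0, while \<open>t ^ Suc k - 1\<close> is nonzero for
  \<open>k < n\<close>; this kills the inner coefficients.\<close>

lemma qbin_absorb: "(t ^ Suc k - 1) * qbin t (Suc n) (Suc k) = (t ^ Suc n - 1) * qbin t n k"
proof (induction n arbitrary: k)
  case 0
  show ?case by (cases k) auto
next
  case (Suc n)
  show ?case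
  proof (cases k)
    case 0
    then show ?thesis using Suc[of 0] by (simp add: algebra_simps)
  next
    case k: (Suc k')
    let ?c = "qbin t (Suc n) k"
    \<comment> \<open>\<open>1\<close> and \<open>3\<close> are the induction hypothesis at
      \<open>k'\<close> and at \<open>k\<close>. The Pascal rule \<open>2\<close> turns
      \<open>1\<close> into \<open>4\<close>, after which both summands of the goal are multiples of
      \<open>?c\<close>.\<close>
    have 1: "(t ^ k - 1) * ?c = (t ^ Suc n - 1) * qbin t n k'"
      using Suc[of k'] k by simp
    have 2: "?c = qbin t n k' + t ^ k * qbin t n k" by (simp add: k)
    have 3: "(t ^ Suc k - 1) * qbin t (Suc n) (Suc k) = (t ^ Suc n - 1) * qbin t n k" by (rule Suc)
    have "(t ^ Suc n - 1) * (t ^ k * qbin t n k) = (t ^ Suc n - 1) * ?c - (t ^ Suc n - 1) * qbin t n k'"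
      unfolding 2 by (simp add: algebra_simps)
    also have "\<dots> = (t ^ Suc n - 1) * ?c - (t ^ k - 1) * ?c" by (simp only: 1)
    finally have 4: "(t ^ Suc n - 1) * (t ^ k * qbin t n k) = (t ^ Suc n - t ^ k) * ?c" by (simp add: algebra_simps)
    have "(t ^ Suc k - 1) * qbin t (Suc (Suc n)) (Suc k) =
        (t ^ Suc k - 1) * ?c + t ^ Suc k * ((t ^ Suc k - 1) * qbin t (Suc n) (Suc k))"
      by (simp add: algebra_simps)
    also have "\<dots> = (t ^ Suc k - 1) * ?c + t * ((t ^ Suc n - 1) * (t ^ k * qbin t n k))"
      unfolding 3 by (simp add: algebra_simps)
    also have "\<dots> = (t ^ Suc k - 1) * ?c + t * ((t ^ Suc n - t ^ k) * ?c)"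
      unfolding 4 ..
    also have "\<dots> = (t ^ Suc (Suc n) - 1) * ?c" by (simp add: algebra_simps)
    finally show ?thesis .
  qed
qed

lemma qbin_root_of_unity:
  assumes "t ^ r = 1" "\<And>k. 0 < k \<Longrightarrow> k < r \<Longrightarrow> t ^ k \<noteq> 1" "0 < k" "k < r"
  shows "qbin t r k = 0"
proof -
  obtain n k' where "r = Suc n" "k = Suc k'" using assms(3,4) by (metis gr0_implies_Suc less_trans)
  then have "(t ^ k - 1) * qbin t r k = 0" using qbin_absorb[of t k' n] assms(1) by simp
  then show ?thesis using assms by auto
qed

text \<open>Powers of \<open>u\<close> are collected on the left. A further factor \<open>v\<close>
  passes \<open>u ^^ k\<close> at the cost of \<open>t ^ k\<close>, which is the weight in the
  Pascal rule of \<open>qbin\<close>.\<close>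

lemma quantum_binomial:
  assumes u: "pmlinear u" and v: "pmlinear v" and vu: "\<And>z. v (u z) = scale t (u (v z))"
  shows "((\<lambda>z. u z + v z) ^^ n) z = (\<Sum>k\<le>n. scale (qbin t n k) ((u ^^ k) ((v ^^ (n - k)) z)))"
proof (induction n)
  case (Suc n)
  let ?a = "\<lambda>k. (u ^^ k) ((v ^^ (n - k)) z)" and ?b = "\<lambda>k. (u ^^ k) ((v ^^ (Suc n - k)) z)"
  have vuk: "v ((u ^^ k) w) = scale (t ^ k) ((u ^^ k) (v w))" for k w
    by (induction k) (simp_all add: vu linear_pm_simps[OF u] linear_pm_simps[OF v])
  have 1: "u (\<Sum>k\<le>n. scale (qbin t n k) (?a k)) = (\<Sum>k\<le>n. scale (qbin t n k) (?b (Suc k)))"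
    by (simp add: linear_pm_simps[OF u])
  have "v (\<Sum>k\<le>n. scale (qbin t n k) (?a k)) = (\<Sum>k\<le>n. scale (t ^ k * qbin t n k) (?b k))"
    by (auto simp: linear_pm_simps[OF v] vuk Suc_diff_le mult.commute intro!: sum.cong)
  also have "\<dots> = (\<Sum>k\<le>Suc n. scale (t ^ k * qbin t n k) (?b k))"
    by (simp add: qbin_gt)
  also have "\<dots> = ?b 0 + (\<Sum>k\<le>n. scale (t ^ Suc k * qbin t n (Suc k)) (?b (Suc k)))"
    by (subst sum.atMost_Suc_shift) simp
  finally have 2: "v (\<Sum>k\<le>n. scale (qbin t n k) (?a k)) =
      ?b 0 + (\<Sum>k\<le>n. scale (t ^ Suc k * qbin t n (Suc k)) (?b (Suc k)))" .
  have "((\<lambda>z. u z + v z) ^^ Suc n) z = (\<Sum>k\<le>n. scale (qbin t n k) (?b (Suc k))) +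
     (?b 0 + (\<Sum>k\<le>n. scale (t ^ Suc k * qbin t n (Suc k)) (?b (Suc k))))"
    by (simp add: Suc.IH 1 2)
  also have "\<dots> = ?b 0 + (\<Sum>k\<le>n. scale (qbin t (Suc n) (Suc k)) (?b (Suc k)))"
    by (simp add: pm.scale_left_distrib sum.distrib algebra_simps)
  also have "\<dots> = (\<Sum>k\<le>Suc n. scale (qbin t (Suc n) k) (?b k))"
    by (subst sum.atMost_Suc_shift) simp
  finally show ?case .
qed simp

lemma quantum_binomial_root_of_unity:
  assumes "pmlinear u" "pmlinear v" "\<And>z. v (u z) = scale t (u (v z))"
    and "t ^ r = 1" "\<And>k. 0 < k \<Longrightarrow> k < r \<Longrightarrow> t ^ k \<noteq> 1" "0 < r"
  shows "((\<lambda>z. u z + v z) ^^ r) z = (u ^^ r) z + (v ^^ r) z"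
proof -
  let ?f = "\<lambda>k. scale (qbin t r k) ((u ^^ k) ((v ^^ (r - k)) z))"
  have "(\<Sum>k\<le>r. ?f k) = (\<Sum>k\<in>{0, r}. ?f k)"
    using assms(4,5) by (intro sum.mono_neutral_right) (auto simp: qbin_root_of_unity)
  then show ?thesis
    using assms(6) by (simp add: quantum_binomial[OF assms(1-3)] qbin_self add.commute)
qed

section \<open>The algebras on the monomial basis\<close>

context quantum_plane
begin

lemma linear_op_pm: "pmlinear F \<Longrightarrow> pmlinear (\<lambda>u. op p p' x (F u))"
  by (rule linear_comp[OF linear_op])

lemma linear_opn_pm: "pmlinear F \<Longrightarrow> pmlinear (\<lambda>u. (op p p' x ^^ n) (F u))"
  by (rule linear_funpow_pm[OF linear_op])

lemmas linear_intros = linear_diff_pm linear_add_pm linear_scale_pm linear_op_pm linear_opn_pm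

lemma opn_simps: "(op p p' x ^^ n) (c + d) = (op p p' x ^^ n) c + (op p p' x ^^ n) d"
  "(op p p' x ^^ n) (c - d) = (op p p' x ^^ n) c - (op p p' x ^^ n) d"
  "(op p p' x ^^ n) (scale a c) = scale a ((op p p' x ^^ n) c)" "(op p p' x ^^ n) 0 = 0"
  by (induction n) (simp_all add: op_simps)

text \<open>Formal sums may involve indices outside \<open>idx\<close>, on which all operators
  vanish; these basis vectors are compared separately.\<close>

lemma op_eqI:
  assumes "pmlinear F" "pmlinear F'" "\<And>k. k \<notin> idx \<Longrightarrow> F (basis k) = F' (basis k)"
    and "\<And>i j g. i < r \<Longrightarrow> j < r \<Longrightarrow> g \<in> carrier G \<Longrightarrow> F (basis (i, j, g)) = F' (basis (i, j, g))"
  shows "F u = F' u"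
proof (rule linear_eqI[OF assms(1,2)])
  fix k
  show "F (basis k) = F' (basis k)"
    using assms(3)[of k] assms(4) by (cases k) (auto simp: idx_def)
qed

lemma op_Grp_Grp:
  assumes "h \<in> carrier G" "h' \<in> carrier G"
  shows "op p p' (Grp h) (op p p' (Grp h') u) = op p p' (Grp (h \<otimes> h')) u"
  by (rule op_eqI) (auto simp: op_simps op_single bop_Grp assms chi1_mult chi2_mult m_assoc
      power_mult_distrib mult_ac intro!: linear_intros)

lemma chi12_cancel:
  assumes "h \<in> carrier G"
  shows "\<chi>1 h * (\<chi>2 h * c) = c" "\<chi>2 h * (\<chi>1 h * c) = c"
  using chi12[OF assms] by (simp_all flip: mult.assoc add: mult.commute[of "\<chi>2 h"])

lemma op_Grp_X1:
  assumes "h \<in> carrier G"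
  shows "op p p' (Grp h) (op p p' X1 u) = scale (\<chi>1 h) (op p p' X1 (op p p' (Grp h) u))"
proof (rule op_eqI[of "\<lambda>u. op p p' (Grp h) (op p p' X1 u)"
      "\<lambda>u. scale (\<chi>1 h) (op p p' X1 (op p p' (Grp h) u))"])
  fix i j g assume *: "i < r" "j < r" "g \<in> carrier G"
  show "op p p' (Grp h) (op p p' X1 (basis (i, j, g))) = scale (\<chi>1 h) (op p p' X1 (op p p' (Grp h) (basis (i, j, g))))"
  proof (cases "Suc i < r")
    case True
    then show ?thesis using * assms by (simp add: op_single bop_Grp bop_X1 op_simps mult_ac)
  next
    case False
    then have i: "Suc i = r" using * by simp
    \<comment> \<open>The exponent drops from \<open>r - 1\<close> to 0, so the scalar
      \<open>\<chi>1 h ^ i\<close> has to be absorbed: as \<open>\<chi>1 h ^ r = 1\<close> and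
      \<open>\<chi>1 h * \<chi>2 h = 1\<close>, it equals \<open>\<chi>2 h\<close>.\<close>
    have "\<chi>1 h * \<chi>1 h ^ i = \<chi>1 h * \<chi>2 h"
      using chi1_pow_r[OF assms] chi12[OF assms] by (simp flip: i)
    then have "\<chi>1 h ^ i = \<chi>2 h" using chi_nonzero[OF assms] by simp
    then show ?thesis using * assms i
      by (simp add: op_single bop_Grp bop_X1_top op_simps pm.scale_right_diff_distrib m_lcomm mult_ac chi12_cancel)
  qed
qed (auto simp: op_simps intro!: linear_intros)

lemma op_Grp_X2:
  assumes "h \<in> carrier G"
  shows "op p p' (Grp h) (op p p' X2 u) = scale (\<chi>2 h) (op p p' X2 (op p p' (Grp h) u))"
proof (rule op_eqI[of "\<lambda>u. op p p' (Grp h) (op p p' X2 u)"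
      "\<lambda>u. scale (\<chi>2 h) (op p p' X2 (op p p' (Grp h) u))"])
  fix i j g assume *: "i < r" "j < r" "g \<in> carrier G"
  show "op p p' (Grp h) (op p p' X2 (basis (i, j, g))) = scale (\<chi>2 h) (op p p' X2 (op p p' (Grp h) (basis (i, j, g))))"
  proof (cases "Suc j < r")
    case True
    then show ?thesis using * assms
      by (cases i; simp add: op_single bop_Grp bop_X2 op_simps pm.scale_right_diff_distrib
          pm.scale_right_distrib m_lcomm mult_ac less_imp_diff_less chi12_cancel del: chi_g12)
  next
    case False
    then have j: "Suc j = r" using * by simp
    have "\<chi>2 h * \<chi>2 h ^ j = \<chi>2 h * \<chi>1 h"
      using chi2_pow_r[OF assms] chi12[OF assms] by (simp flip: j add: mult.commute)
    then have "\<chi>2 h ^ j = \<chi>1 h" using chi_nonzero[OF assms] by simp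
    then show ?thesis using * assms j
      by (cases i; simp add: op_single bop_Grp bop_X2_top op_simps pm.scale_right_diff_distrib
          pm.scale_right_distrib m_lcomm mult_ac less_imp_diff_less chi12_cancel del: chi_g12)
  qed
qed (auto simp: op_simps intro!: linear_intros)

lemma op_X1n: "i + n < r \<Longrightarrow> j < r \<Longrightarrow> g \<in> carrier G \<Longrightarrow> (op p p' X1 ^^ n) (basis (i, j, g)) = basis (i + n, j, g)"
  by (induction n) (auto simp: bop_X1)

lemma op_X2n: "j + n < r \<Longrightarrow> g \<in> carrier G \<Longrightarrow> (op p p' X2 ^^ n) (basis (0, j, g)) = basis (0, j + n, g)"
  by (induction n) (auto simp: bop_X2)

lemma op_X1_r:
  "(op p p' X1 ^^ r) u = scale (par1 p) (op p p' (Grp \<one>) u) - scale (par1 p') (op p p' (Grp (g1 [^] r)) u)"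
proof (rule op_eqI[of "\<lambda>u. (op p p' X1 ^^ r) u"
      "\<lambda>u. scale (par1 p) (op p p' (Grp \<one>) u) - scale (par1 p') (op p p' (Grp (g1 [^] r)) u)"])
  fix i j g assume *: "i < r" "j < r" "g \<in> carrier G"
  \<comment> \<open>Climb from exponent \<open>i\<close> to \<open>r - 1\<close>, wrap around once,
    and climb from 0 back to \<open>i\<close>.\<close>
  have r: "r = i + Suc (r - Suc i)" using * by simp
  have "(op p p' X1 ^^ r) (basis (i, j, g)) = (op p p' X1 ^^ i) (op p p' X1 ((op p p' X1 ^^ (r - Suc i)) (basis (i, j, g))))"
    by (subst r) (simp add: funpow_add del: add_Suc_right)
  also have "\<dots> = (op p p' X1 ^^ i) (single (0, j, g) (par1 p) - single (0, j, (g1 [^] r) \<otimes> g) (par1 p'))"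
    using * by (simp add: op_X1n bop_X1_top)
  also have "\<dots> = scale (par1 p) ((op p p' X1 ^^ i) (basis (0, j, g)))
      - scale (par1 p') ((op p p' X1 ^^ i) (basis (0, j, (g1 [^] r) \<otimes> g)))"
    by (simp flip: opn_simps)
  also have "\<dots> = single (i, j, g) (par1 p) - single (i, j, (g1 [^] r) \<otimes> g) (par1 p')"
    using * by (simp add: op_X1n)
  finally show "(op p p' X1 ^^ r) (basis (i, j, g)) = scale (par1 p) (op p p' (Grp \<one>) (basis (i, j, g)))
     - scale (par1 p') (op p p' (Grp (g1 [^] r)) (basis (i, j, g)))"
    using * by (simp add: bop_Grp)
next
  fix k assume "k \<notin> idx"
  moreover have "(op p p' X1 ^^ Suc n) (basis k) = 0" if "k \<notin> idx" for n
    using that by (simp add: funpow_swap1 opn_simps)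
  ultimately show "(op p p' X1 ^^ r) (basis k) = scale (par1 p) (op p p' (Grp \<one>) (basis k))
     - scale (par1 p') (op p p' (Grp (g1 [^] r)) (basis k))"
    using r_pos by (metis Suc_pred bop_outside diff_self op_basis pm.scale_zero_right)
qed (auto intro!: linear_intros)

lemma op_X2_X1: "op p p' X2 (op p p' X1 u) = scale q (op p p' X1 (op p p' X2 u)) +
     scale (par0 p) (op p p' (Grp \<one>) u) - scale (par0 p') (op p p' (Grp (g1 \<otimes> g2)) u)"
proof (rule op_eqI[of "\<lambda>u. op p p' X2 (op p p' X1 u)"
      "\<lambda>u. scale q (op p p' X1 (op p p' X2 u)) +
     scale (par0 p) (op p p' (Grp \<one>) u) - scale (par0 p') (op p p' (Grp (g1 \<otimes> g2)) u)"])
  fix i j g assume *: "i < r" "j < r" "g \<in> carrier G"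
  let ?c = "\<chi>2 (g1 \<otimes> g2) ^ j * par0 p'" and ?m = "\<lambda>i. single (i, j, (g1 \<otimes> g2) \<otimes> g)"
  let ?Y = "\<lambda>i. if Suc j < r then basis (i, Suc j, g)
     else single (i, 0, g) (par2 p) - single (i, 0, (g2 [^] r) \<otimes> g) (par2 p')"
  have X2: "bop p p' X2 (i, j, g) = scale (q ^ i) (?Y i) +
     (single (i - 1, j, g) (qnum i * par0 p) - ?m (i - 1) (qnum i * q ^ (i - 1) * ?c))" if "i < r" for i
    using * that by (auto simp: bop_X2 bop_X2_top pm.scale_right_diff_distrib mult.assoc simp del: chi_g12)
  have Grps: "bop p p' (Grp \<one>) (i, j, g) = basis (i, j, g)"
    "bop p p' (Grp (g1 \<otimes> g2)) (i, j, g) = ?m i ((q * q) ^ i * \<chi>2 (g1 \<otimes> g2) ^ j)"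
    using * by (simp_all add: bop_Grp)
  show "op p p' X2 (op p p' X1 (basis (i, j, g))) = scale q (op p p' X1 (op p p' X2 (basis (i, j, g)))) +
     scale (par0 p) (op p p' (Grp \<one>) (basis (i, j, g))) - scale (par0 p') (op p p' (Grp (g1 \<otimes> g2)) (basis (i, j, g)))"
  proof (cases "Suc i < r")
    case True
    have XY: "op p p' X1 (?Y i) = ?Y (Suc i)"
      using * True by (auto simp: op_simps op_single bop_X1 pm.scale_right_diff_distrib)
    have Xb: "op p p' X1 (single (i - 1, j, g) (qnum i * par0 p)) = single (i, j, g) (qnum i * par0 p)"
      "op p p' X1 (?m (i - 1) (qnum i * q ^ (i - 1) * ?c)) = ?m i (qnum i * q ^ (i - 1) * ?c)"
      using * True by (cases i; simp add: op_single bop_X1 op_simps)+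
    have c1: "qnum (Suc i) * par0 p = q * (qnum i * par0 p) + par0 p"
      by (simp add: qnum_Suc' algebra_simps)
    have c2: "qnum (Suc i) * q ^ i * ?c = q * (qnum i * q ^ (i - 1) * ?c) + par0 p' * ((q * q) ^ i * \<chi>2 (g1 \<otimes> g2) ^ j)"
      by (cases i) (simp_all add: qnum_Suc algebra_simps power_mult_distrib del: chi_g12)
    have "op p p' X2 (op p p' X1 (basis (i, j, g))) = scale (q ^ Suc i) (?Y (Suc i)) +
       (single (i, j, g) (qnum (Suc i) * par0 p) - ?m i (qnum (Suc i) * q ^ i * ?c))"
      using * True by (simp add: bop_X1 X2 del: chi_g12)
    also have "\<dots> = scale q (scale (q ^ i) (?Y (Suc i)) +
      (single (i, j, g) (qnum i * par0 p) - ?m i (qnum i * q ^ (i - 1) * ?c))) + scale (par0 p) (basis (i, j, g))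
      - scale (par0 p') (?m i ((q * q) ^ i * \<chi>2 (g1 \<otimes> g2) ^ j))"
      unfolding c1 c2 single_add by (simp add: pm.scale_right_distrib pm.scale_right_diff_distrib del: chi_g12)
    also have "\<dots> = scale q (op p p' X1 (op p p' X2 (basis (i, j, g)))) +
       scale (par0 p) (op p p' (Grp \<one>) (basis (i, j, g))) - scale (par0 p') (op p p' (Grp (g1 \<otimes> g2)) (basis (i, j, g)))"
      by (simp only: op_basis X2[OF *(1)] Grps op_simps XY Xb)
    finally show ?thesis .
  next
    case False
    then have i: "Suc i = r" using * by simp
    then have i0: "i = Suc (i - 1)" using r_gt_1 by simp
    let ?Z = "\<lambda>g. if Suc j < r then basis (0, Suc j, g)
      else single (0, 0, g) (par2 p) - single (0, 0, (g2 [^] r) \<otimes> g) (par2 p')"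
    have 1: "op p p' X2 (op p p' X1 (basis (i, j, g))) = scale (par1 p) (?Z g) - scale (par1 p') (?Z ((g1 [^] r) \<otimes> g))"
      using * i by (auto simp: bop_X1_top op_simps op_single bop_X2 bop_X2_top)
    have 2: "op p p' X1 (?Y i) = scale (par1 p) (?Z g) - scale (par1 p') (?Z ((g1 [^] r) \<otimes> g))"
      using * i by (auto simp: op_simps op_single bop_X1_top pm.scale_right_diff_distrib m_lcomm mult.commute)
    have Xb: "op p p' X1 (single (i - 1, j, g) (qnum i * par0 p)) = single (i, j, g) (qnum i * par0 p)"
      "op p p' X1 (?m (i - 1) (qnum i * q ^ (i - 1) * ?c)) = ?m i (qnum i * q ^ (i - 1) * ?c)"
      using * i0 by (simp_all add: op_single bop_X1 op_simps)
    \<comment> \<open>Once x_1 has wrapped around, the left side has no \<open>par0\<close> terms.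
      On the right they cancel because \<open>qnum r = 0\<close> gives
      \<open>q * qnum (r - 1) = - 1\<close>; and \<open>q * q ^ (r - 1) = 1\<close> makes the
      remaining terms agree.\<close>
    have qi: "q * qnum i = -1" using qnum_Suc'[of i] by (simp add: i eq_neg_iff_add_eq_0 add.commute)
    have qq: "q * q ^ i = 1" using q_pow_r by (simp flip: i)
    have c1: "q * (qnum i * par0 p) + par0 p = 0"
      using qi by (simp flip: mult.assoc)
    have "q * (qnum i * q ^ (i - 1) * ?c) + par0 p' * ((q * q) ^ i * \<chi>2 (g1 \<otimes> g2) ^ j)
        = ((q * qnum i) * q ^ (i - 1) + (q ^ i) * q ^ i) * ?c"
      by (simp add: algebra_simps power_mult_distrib del: chi_g12)
    also have "(q ^ i) * q ^ i = (q * q ^ i) * q ^ (i - 1)"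
      by (subst i0, simp only: power_Suc, simp)
    finally have c2: "q * (qnum i * q ^ (i - 1) * ?c) + par0 p' * ((q * q) ^ i * \<chi>2 (g1 \<otimes> g2) ^ j) = 0"
      unfolding qi qq by simp
    have "scale q (op p p' X1 (op p p' X2 (basis (i, j, g)))) +
       scale (par0 p) (op p p' (Grp \<one>) (basis (i, j, g))) - scale (par0 p') (op p p' (Grp (g1 \<otimes> g2)) (basis (i, j, g)))
       = scale (q * q ^ i) (op p p' X1 (?Y i)) + (single (i, j, g) (q * (qnum i * par0 p) + par0 p) -
         ?m i (q * (qnum i * q ^ (i - 1) * ?c) + par0 p' * ((q * q) ^ i * \<chi>2 (g1 \<otimes> g2) ^ j)))"
      unfolding op_basis X2[OF *(1)] Grps op_simps Xb single_add
      by (simp add: pm.scale_right_distrib pm.scale_right_diff_distrib del: chi_g12)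
    also have "\<dots> = op p p' X2 (op p p' X1 (basis (i, j, g)))"
      unfolding c1 c2 qq 1 2 by simp
    finally show ?thesis by simp
  qed
qed (auto simp: op_simps intro!: linear_intros)

lemma op_Grp_X2n:
  assumes "h \<in> carrier G"
  shows "op p p' (Grp h) ((op p p' X2 ^^ n) u) = scale (\<chi>2 h ^ n) ((op p p' X2 ^^ n) (op p p' (Grp h) u))"
  by (induction n) (simp_all add: op_Grp_X2[OF assms] op_simps)

text \<open>Here powers of x_2 pass a single x_1. As \<open>\<chi>2 (g1 \<otimes> g2)\<close> is the
  square of \<open>inverse q\<close>, the sum attached to \<open>par0 p'\<close> runs over powers of
  \<open>inverse q\<close>. At \<open>n = r\<close> both sums vanish, so \<open>x_2^r\<close>
  commutes with x_1.\<close>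

lemma op_X2n_X1:
  "(op p p' X2 ^^ n) (op p p' X1 u) = scale (q ^ n) (op p p' X1 ((op p p' X2 ^^ n) u)) +
     (scale (qnum n * par0 p) ((op p p' X2 ^^ (n - 1)) (op p p' (Grp \<one>) u)) -
      scale ((\<Sum>k<n. inverse q ^ k) * par0 p') ((op p p' X2 ^^ (n - 1)) (op p p' (Grp (g1 \<otimes> g2)) u)))"
proof (induction n)
  case (Suc n)
  let ?X = "op p p' X2 ^^ n" and ?u = "op p p' (Grp \<one>) u" and ?w = "op p p' (Grp (g1 \<otimes> g2)) u"
  have 1: "op p p' X2 (scale (qnum n * a) ((op p p' X2 ^^ (n - 1)) w)) = scale (qnum n * a) (?X w)" for a w
    by (cases n) (simp_all add: op_simps)
  have 2: "op p p' X2 (scale ((\<Sum>k<n. inverse q ^ k) * a) ((op p p' X2 ^^ (n - 1)) w)) =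
      scale ((\<Sum>k<n. inverse q ^ k) * a) (?X w)" for a w
    by (cases n) (simp_all add: op_simps)
  have "op p p' X2 (op p p' X1 (?X u)) = scale q (op p p' X1 (op p p' X2 (?X u))) +
     scale (par0 p) (?X ?u) - scale (par0 p' * (inverse q * inverse q) ^ n) (?X ?w)"
    by (simp add: op_X2_X1 op_Grp_X2n)
  moreover have "q ^ n * (par0 p' * (inverse q * inverse q) ^ n) = inverse q ^ n * par0 p'"
    by (simp add: power_mult_distrib field_simps)
  ultimately have 3: "scale (q ^ n) (op p p' X2 (op p p' X1 (?X u))) = scale (q ^ Suc n) (op p p' X1 (op p p' X2 (?X u))) +
     (scale (q ^ n * par0 p) (?X ?u) - scale (inverse q ^ n * par0 p') (?X ?w))"
    by (simp add: pm.scale_right_distrib pm.scale_right_diff_distrib mult.commute)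
  have "(op p p' X2 ^^ Suc n) (op p p' X1 u) = scale (q ^ n) (op p p' X2 (op p p' X1 (?X u))) +
     (scale (qnum n * par0 p) (?X ?u) - scale ((\<Sum>k<n. inverse q ^ k) * par0 p') (?X ?w))"
    by (simp only: funpow.simps o_def Suc op_simps(1,2) 1 2) (simp add: op_simps)
  also have "\<dots> = scale (q ^ Suc n) (op p p' X1 (op p p' X2 (?X u))) +
     (scale (qnum (Suc n) * par0 p) (?X ?u) - scale ((\<Sum>k<Suc n. inverse q ^ k) * par0 p') (?X ?w))"
    unfolding 3 by (simp add: qnum_Suc distrib_right pm.scale_left_distrib)
  finally show ?case by simp
qed (simp add: op_simps)

lemma inverse_q_pow: "inverse q ^ k = 1 \<longleftrightarrow> q ^ k = 1"
  by (simp add: power_inverse)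

text \<open>For \<open>i > 0\<close> the operator of x_2 also produces terms with a lower
  x_1-exponent, so its powers are not computed directly there. At \<open>i = 0\<close> these terms
  are absent; the general case follows because \<open>x_2^r\<close> and the right side both commute
  with x_1.\<close>

lemma op_X2_r:
  "(op p p' X2 ^^ r) u = scale (par2 p) (op p p' (Grp \<one>) u) - scale (par2 p') (op p p' (Grp (g2 [^] r)) u)"
proof (rule op_eqI[of "\<lambda>u. (op p p' X2 ^^ r) u"
      "\<lambda>u. scale (par2 p) (op p p' (Grp \<one>) u) - scale (par2 p') (op p p' (Grp (g2 [^] r)) u)"])
  have "(inverse q - 1) * (\<Sum>k<n. inverse q ^ k) = inverse q ^ n - 1" for n
    by (induction n) (simp_all add: algebra_simps)
  from this[of r] have "(inverse q - 1) * (\<Sum>k<r. inverse q ^ k) = 0"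
    by (simp add: power_inverse q_pow_r)
  then have sum0: "(\<Sum>k<r. inverse q ^ k) = 0"
    using q_neq_1 by simp
  let ?D = "\<lambda>u. scale (par2 p) (op p p' (Grp \<one>) u) - scale (par2 p') (op p p' (Grp (g2 [^] r)) u)"
  have comm: "(op p p' X2 ^^ r) (op p p' X1 u) = op p p' X1 ((op p p' X2 ^^ r) u)" for u
    unfolding op_X2n_X1 sum0 by (simp add: q_pow_r)
  have commn: "(op p p' X2 ^^ r) ((op p p' X1 ^^ n) u) = (op p p' X1 ^^ n) ((op p p' X2 ^^ r) u)" for u n
    by (induction n) (simp_all add: comm)
  have "?D (op p p' X1 u) = op p p' X1 (?D u)" for u
    by (simp add: op_Grp_X1 op_simps)
  then have D: "?D ((op p p' X1 ^^ n) u) = (op p p' X1 ^^ n) (?D u)" for u n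
    by (induction n) simp_all
  fix i j g assume *: "i < r" "j < r" "g \<in> carrier G"
  have r: "r = j + Suc (r - Suc j)" using * by simp
  have "(op p p' X2 ^^ r) (basis (0, j, g)) = (op p p' X2 ^^ j) (op p p' X2 ((op p p' X2 ^^ (r - Suc j)) (basis (0, j, g))))"
    by (subst r) (simp add: funpow_add del: add_Suc_right)
  also have "\<dots> = (op p p' X2 ^^ j) (single (0, 0, g) (par2 p) - single (0, 0, (g2 [^] r) \<otimes> g) (par2 p'))"
    using * by (simp add: op_X2n bop_X2_top)
  also have "\<dots> = scale (par2 p) ((op p p' X2 ^^ j) (basis (0, 0, g)))
      - scale (par2 p') ((op p p' X2 ^^ j) (basis (0, 0, (g2 [^] r) \<otimes> g)))"
    by (simp flip: opn_simps)
  also have "\<dots> = ?D (basis (0, j, g))"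
    using * by (simp add: op_X2n bop_Grp)
  finally have 0: "(op p p' X2 ^^ r) (basis (0, j, g)) = ?D (basis (0, j, g))" .
  have "basis (i, j, g) = (op p p' X1 ^^ i) (basis (0, j, g))" using * by (simp add: op_X1n)
  then show "(op p p' X2 ^^ r) (basis (i, j, g)) = ?D (basis (i, j, g))"
    by (simp only: commn 0 D)
next
  fix k assume "k \<notin> idx"
  moreover have "(op p p' X2 ^^ Suc n) (basis k) = 0" if "k \<notin> idx" for n
    using that by (simp add: funpow_swap1 opn_simps)
  ultimately show "(op p p' X2 ^^ r) (basis k) = scale (par2 p) (op p p' (Grp \<one>) (basis k))
     - scale (par2 p') (op p p' (Grp (g2 [^] r)) (basis k))"
    using r_pos by (metis Suc_pred bop_outside diff_self op_basis pm.scale_zero_right)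
qed (auto intro!: linear_intros)

lemma op_rep: "quantum_plane_rep G g1 g2 \<chi>1 \<chi>2 q r scale {0} (op p p') p p'"
  by unfold_locales (auto simp: op_Grp_Grp op_Grp_X1 op_Grp_X2 op_X1_r op_X2_r op_X2_X1 op_simps)

end

lemma tensor_induct [case_names add otimes]:
  assumes "\<And>z z'. P z \<Longrightarrow> P z' \<Longrightarrow> P (z + z')" "\<And>c d. P (otimes c d)"
  shows "P z"
proof (induction z rule: poly_mapping_ext_induct)
  case zero
  show ?case using assms(2)[of 0 0] by simp
next
  case (single x a)
  have "single x a = otimes (basis (fst x)) (single (snd x) a)"
    by (simp add: otimes_def)
  then show ?case using assms(2) by simp
next
  case (add c d)
  then show ?case by (rule assms(1))
qed

lemma otimes_single [simp]: "otimes (single x a) (single y b) = single (x, y) (a * b)"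
  by (simp add: otimes_def)

lemma tmap_simps: "tmap F H (z + z') = tmap F H z + tmap F H z'" "tmap F H (z - z') = tmap F H z - tmap F H z'"
  "tmap F H (scale a z) = scale a (tmap F H z)" "tmap F H 0 = 0"
  by (simp_all add: linear_pm_simps[OF linear_tmap])

lemma tmap_funpow_otimes:
  fixes F :: "('x \<Rightarrow>\<^sub>0 'k::field) \<Rightarrow> ('x \<Rightarrow>\<^sub>0 'k)" and H :: "('y \<Rightarrow>\<^sub>0 'k) \<Rightarrow> ('y \<Rightarrow>\<^sub>0 'k)"
  assumes "pmlinear F" "pmlinear H"
  shows "(tmap F H ^^ n) (otimes c d) = otimes ((F ^^ n) c) ((H ^^ n) d)"
  by (induction n) (simp_all add: tmap_otimes assms)

context quantum_plane
begin

section \<open>The product of C(p, p') and its associativity\<close>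

abbreviation e0 :: "'g mono" where "e0 \<equiv> (0, 0, \<one>)"

text \<open>The monomials of the left factor act on the right factor through \<open>op\<close>. Thus
  \<open>(x c) d = x (c d)\<close> for a generator x is an instance of
  \<open>T_lext_mon\<close>.\<close>

definition prd :: "'k params \<Rightarrow> 'k params \<Rightarrow> ('g, 'k) formal \<Rightarrow> ('g, 'k) formal \<Rightarrow>
    ('g, 'k) formal" where
  "prd p p' c d = ext (mon (op p p') d) c"

lemma prd_op_left: "x \<in> gens G \<Longrightarrow> prd p p' (op p p' x c) d = op p p' x (prd p p' c d)"
proof -
  assume x: "x \<in> gens G"
  interpret R: quantum_plane_rep G g1 g2 \<chi>1 \<chi>2 q r scale "{0}" "op p p'" p p' by (rule op_rep)
  show ?thesis using R.T_lext_mon[OF x, of d c] by (simp add: prd_def R.eqv_def)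
qed

lemma mon_op_simps: "mon (op p p') (d + d') k = mon (op p p') d k + mon (op p p') d' k"
  "mon (op p p') (d - d') k = mon (op p p') d k - mon (op p p') d' k"
  "mon (op p p') (scale a d) k = scale a (mon (op p p') d k)" "mon (op p p') 0 k = 0"
  by (auto simp: mon_def op_simps opn_simps split: prod.splits)

lemma mon_op_fun: "mon (op p p') (d + d') = (\<lambda>k. mon (op p p') d k + mon (op p p') d' k)"
  "mon (op p p') (d - d') = (\<lambda>k. mon (op p p') d k - mon (op p p') d' k)"
  "mon (op p p') (scale a d) = (\<lambda>k. scale a (mon (op p p') d k))" "mon (op p p') 0 = (\<lambda>k. 0)"
  by (simp_all add: fun_eq_iff mon_op_simps)

lemma prd_simps: "prd p p' (c + c') d = prd p p' c d + prd p p' c' d"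
  "prd p p' (c - c') d = prd p p' c d - prd p p' c' d" "prd p p' (scale a c) d = scale a (prd p p' c d)"
  "prd p p' 0 d = 0" "prd p p' c (d + d') = prd p p' c d + prd p p' c d'"
  "prd p p' c (d - d') = prd p p' c d - prd p p' c d'" "prd p p' c (scale a d) = scale a (prd p p' c d)"
  "prd p p' c 0 = 0"
  by (simp_all add: prd_def pm.lext_add pm.lext_diff pm.lext_scale mon_op_fun pm.lext_fun_add
      pm.lext_fun_diff pm.lext_fun_scale)

lemma linear_prd [simp]: "pmlinear (prd p p' c)" "pmlinear (\<lambda>c. prd p p' c d)"
  by (auto intro!: linearI' simp: prd_simps pm.vector_space_axioms)

lemma prd_basis: "prd p p' (basis k) d = mon (op p p') d k"
  by (simp add: prd_def)

lemma keys_mon: "keys (mon (op p p') d k) \<subseteq> idx"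
proof (cases "k \<in> idx")
  case True
  obtain i j g where k: "k = (i, j, g)" by (cases k)
  have *: "keys ((op p p' x ^^ n) c) \<subseteq> idx" if "keys c \<subseteq> idx" for x n c
    using that by (cases n) (simp_all add: keys_op)
  show ?thesis using True by (simp add: k mon_eq * keys_op)
qed simp

lemma keys_prd: "keys (prd p p' c d) \<subseteq> idx"
  unfolding prd_def by (intro keys_ext_subsetI keys_mon)

lemma mon_op_e0: "k \<in> idx \<Longrightarrow> mon (op p p') (basis e0) k = basis k"
proof -
  assume k: "k \<in> idx"
  obtain i j g where "k = (i, j, g)" by (cases k)
  then show ?thesis using k by (simp add: mon_eq bop_Grp op_X2n[where j = 0, simplified] op_X1n[where i = 0, simplified])
qed

lemma prd_e0_right: "keys c \<subseteq> idx \<Longrightarrow> prd p p' c (basis e0) = c"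
proof -
  assume c: "keys c \<subseteq> idx"
  have "prd p p' c (basis e0) = ext basis c"
    unfolding prd_def using c by (intro lext_cong mon_op_e0) blast
  then show ?thesis by simp
qed

lemma prd_group: "g \<in> carrier G \<Longrightarrow> prd p p' (basis (0, 0, g)) d = op p p' (Grp g) d"
  by (simp add: prd_basis mon_eq)

lemma prd_e0_left: "keys d \<subseteq> idx \<Longrightarrow> prd p p' (basis e0) d = d"
  by (simp add: prd_group op_one)

text \<open>Right multiplication by \<open>e\<close> commutes with the operators of all generators,
  hence carries a monomial of operators applied to \<open>d\<close> to the same monomial applied to
  \<open>prd p p' d e\<close>.\<close>

lemma prd_assoc: "prd p p' (prd p p' c d) e = prd p p' c (prd p p' d e)"
proof (induction c rule: poly_mapping_ext_induct)
  case (single k a)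
  have "prd p p' (mon (op p p') d k) e = mon (op p p') (prd p p' d e) k"
    by (rule mon_intertwine[where F = "\<lambda>d. prd p p' d e"]) (simp_all add: prd_op_left prd_simps)
  then show ?case by (simp add: prd_def pm.lext_scale)
qed (simp_all add: prd_simps)

lemma intertwiner_mon:
  assumes "Vector_Spaces.linear scale s F" "\<And>x c. x \<in> gens G \<Longrightarrow> F (op p p' x c) = T x (F c)" "k \<in> idx"
  shows "F (basis k) = mon T (F (basis e0)) k"
  using mon_intertwine[of F "op p p'" T "basis e0" k] assms
  by (simp add: mon_op_e0 Vector_Spaces.linear_iff_module_hom module_hom.zero)

text \<open>The unit generates: every basis vector in \<open>idx\<close> is a monomial in the
  operators applied to \<open>basis e0\<close>. Many identities between linear maps below are
  reduced to this comparison at the unit.\<close>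

lemma intertwiner_eq:
  assumes "Vector_Spaces.linear scale s F" "\<And>x c. x \<in> gens G \<Longrightarrow> F (op p p' x c) = T x (F c)"
    and "Vector_Spaces.linear scale s F'" "\<And>x c. x \<in> gens G \<Longrightarrow> F' (op p p' x c) = T x (F' c)"
    and "F (basis e0) = F' (basis e0)" "keys c \<subseteq> idx"
  shows "F c = F' c"
proof (rule linear_eqI[OF assms(1,3)])
  fix k assume "k \<in> keys c"
  then have k: "k \<in> idx" using assms(6) by auto
  have "F (basis k) = mon T (F (basis e0)) k" by (rule intertwiner_mon[OF assms(1,2) k])
  also have "\<dots> = mon T (F' (basis e0)) k" by (simp only: assms(5))
  also have "\<dots> = F' (basis k)" by (rule intertwiner_mon[OF assms(3,4) k, symmetric])
  finally show "F (basis k) = F' (basis k)" .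
qed

section \<open>The comultiplication\<close>

text \<open>Left multiplication by \<Delta>(x) on the tensor product of C(p, p') and C(p', p''). The
  factor 1 of \<open>x_i \<otimes> 1\<close> is the operator of \<open>\<one>\<close>, a projection
  onto the span of \<open>idx\<close>, so that the relations hold on all formal sums.\<close>

definition top :: "'k params \<Rightarrow> 'k params \<Rightarrow> 'k params \<Rightarrow> 'g gen \<Rightarrow>
    ('g mono \<times> 'g mono \<Rightarrow>\<^sub>0 'k) \<Rightarrow> ('g mono \<times> 'g mono \<Rightarrow>\<^sub>0 'k)" where
  "top p p' p'' x z = (case x of
      Grp h \<Rightarrow> tmap (op p p' (Grp h)) (op p' p'' (Grp h)) z
    | X1 \<Rightarrow> tmap (op p p' X1) (op p' p'' (Grp \<one>)) z + tmap (op p p' (Grp g1)) (op p' p'' X1) z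
    | X2 \<Rightarrow> tmap (op p p' X2) (op p' p'' (Grp \<one>)) z + tmap (op p p' (Grp g2)) (op p' p'' X2) z)"

lemma top_otimes:
  "top p p' p'' (Grp h) (otimes c d) = otimes (op p p' (Grp h) c) (op p' p'' (Grp h) d)"
  "top p p' p'' X1 (otimes c d) = otimes (op p p' X1 c) (op p' p'' (Grp \<one>) d) + otimes (op p p' (Grp g1) c) (op p' p'' X1 d)"
  "top p p' p'' X2 (otimes c d) = otimes (op p p' X2 c) (op p' p'' (Grp \<one>) d) + otimes (op p p' (Grp g2) c) (op p' p'' X2 d)"
  by (simp_all add: top_def tmap_otimes)

lemma top_basis:
  "top p p' p'' (Grp h) (basis (k, l)) = otimes (bop p p' (Grp h) k) (bop p' p'' (Grp h) l)"
  "top p p' p'' X1 (basis (k, l)) = otimes (bop p p' X1 k) (bop p' p'' (Grp \<one>) l) + otimes (bop p p' (Grp g1) k) (bop p' p'' X1 l)"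
  "top p p' p'' X2 (basis (k, l)) = otimes (bop p p' X2 k) (bop p' p'' (Grp \<one>) l) + otimes (bop p p' (Grp g2) k) (bop p' p'' X2 l)"
  by (simp_all add: top_def)

lemma linear_top [simp]: "pmlinear (top p p' p'' x)"
  unfolding top_def by (cases x) (auto intro: linear_add_pm)

lemma top_simps: "top p p' p'' x (z + z') = top p p' p'' x z + top p p' p'' x z'"
  "top p p' p'' x (z - z') = top p p' p'' x z - top p p' p'' x z'"
  "top p p' p'' x (scale a z) = scale a (top p p' p'' x z)" "top p p' p'' x 0 = 0"
  by (simp_all add: linear_pm_simps[OF linear_top])

lemma op_Grp_pow: "h \<in> carrier G \<Longrightarrow> 0 < n \<Longrightarrow> (op p p' (Grp h) ^^ n) u = op p p' (Grp (h [^] n)) u"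
proof (induction n)
  case (Suc n)
  show ?case
  proof (cases "n = 0")
    case False
    then have "(op p p' (Grp h) ^^ Suc n) u = op p p' (Grp h) (op p p' (Grp (h [^] n)) u)"
      using Suc by simp
    then show ?thesis using Suc.prems m_comm[of h "h [^] n"] by (simp only: op_Grp_Grp nat_pow_closed nat_pow_Suc)
  qed (use Suc.prems in simp)
qed simp

text \<open>With \<open>u = x \<otimes> 1\<close> and \<open>v = h \<otimes> x\<close> one has
  \<open>v u = t u v\<close>, so the binomial theorem leaves \<open>u^r + v^r\<close>. This is
  \<open>(a - a' h^r) \<otimes> 1 + h^r \<otimes> (a' - a'' h^r)\<close>, in which the middle
  parameter cancels.\<close>

lemma top_Xr:
  assumes h: "h \<in> carrier G" and t: "t ^ r = 1" "\<And>k. 0 < k \<Longrightarrow> k < r \<Longrightarrow> t ^ k \<noteq> 1"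
    and comm: "\<And>u. op p p' (Grp h) (op p p' x u) = scale t (op p p' x (op p p' (Grp h) u))"
      "\<And>u. op p' p'' (Grp \<one>) (op p' p'' x u) = op p' p'' x (op p' p'' (Grp \<one>) u)"
    and pow: "\<And>u. (op p p' x ^^ r) u = scale a (op p p' (Grp \<one>) u) - scale a' (op p p' (Grp (h [^] r)) u)"
      "\<And>u. (op p' p'' x ^^ r) u = scale a' (op p' p'' (Grp \<one>) u) - scale a'' (op p' p'' (Grp (h [^] r)) u)"
  shows "((\<lambda>z. tmap (op p p' x) (op p' p'' (Grp \<one>)) z + tmap (op p p' (Grp h)) (op p' p'' x) z) ^^ r) z =
    scale a (tmap (op p p' (Grp \<one>)) (op p' p'' (Grp \<one>)) z) - scale a'' (tmap (op p p' (Grp (h [^] r))) (op p' p'' (Grp (h [^] r))) z)"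
proof -
  let ?u = "tmap (op p p' x) (op p' p'' (Grp \<one>))" and ?v = "tmap (op p p' (Grp h)) (op p' p'' x)"
  have "?v (?u z) = scale t (?u (?v z))" for z
    by (induction z rule: tensor_induct)
      (simp_all add: tmap_simps tmap_otimes comm otimes_simps pm.scale_right_distrib)
  then have "((\<lambda>z. ?u z + ?v z) ^^ r) z = (?u ^^ r) z + (?v ^^ r) z"
    by (intro quantum_binomial_root_of_unity[where t = t]) (use t in auto)
  also have "\<dots> = scale a (tmap (op p p' (Grp \<one>)) (op p' p'' (Grp \<one>)) z) - scale a'' (tmap (op p p' (Grp (h [^] r))) (op p' p'' (Grp (h [^] r))) z)"
  proof (induction z rule: tensor_induct)
    case (add z z')
    have 1: "(tmap F H ^^ r) (z + z') = (tmap F H ^^ r) z + (tmap F H ^^ r) z'"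
      for F H :: "('g, 'k) formal \<Rightarrow> ('g, 'k) formal"
      using linear_funpow_pm[OF linear_tmap[of F H] linear_id_pm, of r] by (simp add: linear_pm_simps)
    have "(?u ^^ r) (z + z') + (?v ^^ r) (z + z') = ((?u ^^ r) z + (?v ^^ r) z) + ((?u ^^ r) z' + (?v ^^ r) z')"
      unfolding 1 by (simp add: algebra_simps)
    then show ?case unfolding add by (simp add: tmap_simps pm.scale_right_distrib algebra_simps)
  next
    case (otimes c d)
    then show ?case using h
      by (simp add: tmap_funpow_otimes tmap_otimes pow op_Grp_pow otimes_simps)
  qed
  finally show ?thesis .
qed

text \<open>The middle parameter cancels in every relation. For \<open>x_2 x_1\<close>, with g
  standing for \<open>g1 \<otimes> g2\<close>, the lower terms are
  \<open>(p_0 - p_0' g) \<otimes> 1 + g \<otimes> (p_0' - p_0'' g)\<close>; the mixed terms agree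
  because \<open>\<chi>1 g2 = q\<close> and \<open>\<chi>2 g1 = inverse q\<close>.\<close>

lemma top_rep: "quantum_plane_rep G g1 g2 \<chi>1 \<chi>2 q r scale {0} (top p p' p'') p p''"
proof unfold_locales
  fix h h' u assume *: "h \<in> carrier G" "h' \<in> carrier G"
  have "top p p' p'' (Grp h) (top p p' p'' (Grp h') u) = top p p' p'' (Grp (h \<otimes> h')) u"
    by (induction u rule: tensor_induct) (simp_all add: top_simps top_otimes op_Grp_Grp *)
  then show "top p p' p'' (Grp h) (top p p' p'' (Grp h') u) - top p p' p'' (Grp (h \<otimes> h')) u \<in> {0}" by simp
next
  fix h u assume *: "h \<in> carrier G"
  have "top p p' p'' (Grp h) (top p p' p'' X1 u) = scale (\<chi>1 h) (top p p' p'' X1 (top p p' p'' (Grp h) u))"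
    by (induction u rule: tensor_induct)
      (simp_all add: top_simps top_otimes op_Grp_Grp * op_Grp_X1 otimes_simps pm.scale_right_distrib m_comm)
  then show "top p p' p'' (Grp h) (top p p' p'' X1 u) - scale (\<chi>1 h) (top p p' p'' X1 (top p p' p'' (Grp h) u)) \<in> {0}" by simp
  have "top p p' p'' (Grp h) (top p p' p'' X2 u) = scale (\<chi>2 h) (top p p' p'' X2 (top p p' p'' (Grp h) u))"
    by (induction u rule: tensor_induct)
      (simp_all add: top_simps top_otimes op_Grp_Grp * op_Grp_X2 otimes_simps pm.scale_right_distrib m_comm)
  then show "top p p' p'' (Grp h) (top p p' p'' X2 u) - scale (\<chi>2 h) (top p p' p'' X2 (top p p' p'' (Grp h) u)) \<in> {0}" by simp
next
  fix u
  have "(top p p' p'' X1 ^^ r) u = scale (par1 p) (top p p' p'' (Grp \<one>) u) - scale (par1 p'') (top p p' p'' (Grp (g1 [^] r)) u)"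
    unfolding top_def gen.case
    by (rule top_Xr[where t = q and a' = "par1 p'"])
      (use q_pow_r q_primitive in \<open>auto simp: op_Grp_X1 op_X1_r chi1_g1\<close>)
  then show "(top p p' p'' X1 ^^ r) u - (scale (par1 p) (top p p' p'' (Grp \<one>) u) - scale (par1 p'') (top p p' p'' (Grp (g1 [^] r)) u)) \<in> {0}"
    by simp
  have "(top p p' p'' X2 ^^ r) u = scale (par2 p) (top p p' p'' (Grp \<one>) u) - scale (par2 p'') (top p p' p'' (Grp (g2 [^] r)) u)"
    unfolding top_def gen.case
    by (rule top_Xr[where t = "inverse q" and a' = "par2 p'"])
      (use q_pow_r q_primitive in \<open>auto simp: op_Grp_X2 op_X2_r inverse_q_pow\<close>)
  then show "(top p p' p'' X2 ^^ r) u - (scale (par2 p) (top p p' p'' (Grp \<one>) u) - scale (par2 p'') (top p p' p'' (Grp (g2 [^] r)) u)) \<in> {0}"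
    by simp
  have "top p p' p'' X2 (top p p' p'' X1 u) = scale q (top p p' p'' X1 (top p p' p'' X2 u)) +
     scale (par0 p) (top p p' p'' (Grp \<one>) u) - scale (par0 p'') (top p p' p'' (Grp (g1 \<otimes> g2)) u)"
    by (induction u rule: tensor_induct)
      (simp_all add: top_simps top_otimes op_Grp_Grp op_Grp_X1 op_Grp_X2 op_X2_X1 otimes_simps chi1_g1 chi1_g2
         pm.scale_right_distrib pm.scale_right_diff_distrib m_comm algebra_simps)
  then show "top p p' p'' X2 (top p p' p'' X1 u) - (scale q (top p p' p'' X1 (top p p' p'' X2 u)) +
     scale (par0 p) (top p p' p'' (Grp \<one>) u) - scale (par0 p'') (top p p' p'' (Grp (g1 \<otimes> g2)) u)) \<in> {0}"
    by simp
qed (auto simp: top_simps)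

text \<open>Zero parameters are only a normalization: \<open>mon_top\<close> gives the same value
  for all parameters.\<close>

definition copb :: "'g mono \<Rightarrow> ('g mono \<times> 'g mono \<Rightarrow>\<^sub>0 'k)" where
  "copb = mon (top 0 0 0) (basis (e0, e0))"

definition cop :: "('g, 'k) formal \<Rightarrow> ('g mono \<times> 'g mono \<Rightarrow>\<^sub>0 'k)" where
  "cop = ext copb"

lemma linear_cop [simp]: "pmlinear cop"
  by (simp add: cop_def)

lemma cop_basis [simp]: "cop (basis k) = copb k"
  by (simp add: cop_def)

lemma cop_simps: "cop (c + d) = cop c + cop d" "cop (c - d) = cop c - cop d"
  "cop (scale a c) = scale a (cop c)" "cop 0 = 0"
  by (simp_all add: linear_pm_simps[OF linear_cop])

text \<open>
  The summands of the coproduct of \<open>x\<^sub>1\<^sup>i x\<^sub>2\<^sup>j g\<close> never reach the exponent \<open>r\<close>, so the parameters do not enter.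
\<close>

definition deg1 :: "nat \<Rightarrow> ('g mono \<times> 'g mono) set" where
  "deg1 n = {(k, l). k \<in> idx \<and> l \<in> idx \<and> fst k + fst l = n}"

text \<open>In a monomial x_2 acts before x_1, so at that stage both x_1-exponents are 0 and the
  terms of \<open>bop\<close> with the factor \<open>qnum i\<close> disappear.\<close>

definition deg2 :: "nat \<Rightarrow> ('g mono \<times> 'g mono) set" where
  "deg2 n = {(k, l). k \<in> idx \<and> l \<in> idx \<and> fst k = 0 \<and> fst l = 0 \<and> fst (snd k) + fst (snd l) = n}"

lemma top_X2_deg2:
  assumes "keys z \<subseteq> deg2 n" "Suc n < r"
  shows "top p p' p'' X2 z = top 0 0 0 X2 z" "keys (top p p' p'' X2 z) \<subseteq> deg2 (Suc n)"
proof -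
  let ?f = "\<lambda>((i::nat, j, g), (i'::nat, j', g')). basis ((0, Suc j, g), (0, j', g'))
    + single ((0, j, g2 \<otimes> g), (0, Suc j', g')) (\<chi>2 g2 ^ j)"
  have top: "top p p' p'' X2 z = ext ?f z" for p p' p''
  proof -
    have "top p p' p'' X2 z = ext (\<lambda>kl. top p p' p'' X2 (basis kl)) z"
      by (rule linear_eq_lext) simp
    also have "\<dots> = ext ?f z"
    proof (rule lext_cong)
      fix kl assume "kl \<in> keys z"
      then have "kl \<in> deg2 n" using assms by auto
      then obtain j g j' g' where kl: "kl = ((0, j, g), (0, j', g'))" and *: "j < r" "g \<in> carrier G" "j' < r" "g' \<in> carrier G" "j + j' = n"
        by (auto simp: deg2_def)
      then show "top p p' p'' X2 (basis kl) = ?f kl"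
        using assms(2) by (simp add: top_basis bop_X2 bop_Grp)
    qed
    finally show ?thesis .
  qed
  show "top p p' p'' X2 z = top 0 0 0 X2 z" by (simp only: top)
  show "keys (top p p' p'' X2 z) \<subseteq> deg2 (Suc n)"
    unfolding top
  proof (rule keys_ext_subsetI)
    fix kl assume "kl \<in> keys z"
    then have "kl \<in> deg2 n" using assms by auto
    then obtain j g j' g' where kl: "kl = ((0, j, g), (0, j', g'))" and *: "j < r" "g \<in> carrier G" "j' < r" "g' \<in> carrier G" "j + j' = n"
      by (auto simp: deg2_def)
    have "keys (?f kl) \<subseteq> {((0, Suc j, g), (0, j', g')), ((0, j, g2 \<otimes> g), (0, Suc j', g'))}"
      unfolding kl prod.case by (rule order.trans[OF Poly_Mapping.keys_add]) auto
    also have "\<dots> \<subseteq> deg2 (Suc n)" using * assms(2) by (auto simp: deg2_def)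
    finally show "keys (?f kl) \<subseteq> deg2 (Suc n)" .
  qed
qed

lemma top_X1_deg1:
  assumes "keys z \<subseteq> deg1 n" "Suc n < r"
  shows "top p p' p'' X1 z = top 0 0 0 X1 z" "keys (top p p' p'' X1 z) \<subseteq> deg1 (Suc n)"
proof -
  let ?f = "\<lambda>((i::nat, j, g), (i'::nat, j', g')). basis ((Suc i, j, g), (i', j', g'))
    + single ((i, j, g1 \<otimes> g), (Suc i', j', g')) (\<chi>1 g1 ^ i * \<chi>2 g1 ^ j)"
  have top: "top p p' p'' X1 z = ext ?f z" for p p' p''
  proof -
    have "top p p' p'' X1 z = ext (\<lambda>kl. top p p' p'' X1 (basis kl)) z"
      by (rule linear_eq_lext) simp
    also have "\<dots> = ext ?f z"
    proof (rule lext_cong)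
      fix kl assume "kl \<in> keys z"
      then have "kl \<in> deg1 n" using assms by auto
      then obtain i j g i' j' g' where kl: "kl = ((i, j, g), (i', j', g'))" and *: "i < r" "i' < r" "j < r" "g \<in> carrier G" "j' < r" "g' \<in> carrier G" "i + i' = n"
        by (auto simp: deg1_def)
      then show "top p p' p'' X1 (basis kl) = ?f kl"
        using assms(2) by (simp add: top_basis bop_X1 bop_Grp)
    qed
    finally show ?thesis .
  qed
  show "top p p' p'' X1 z = top 0 0 0 X1 z" by (simp only: top)
  show "keys (top p p' p'' X1 z) \<subseteq> deg1 (Suc n)"
    unfolding top
  proof (rule keys_ext_subsetI)
    fix kl assume "kl \<in> keys z"
    then have "kl \<in> deg1 n" using assms by auto
    then obtain i j g i' j' g' where kl: "kl = ((i, j, g), (i', j', g'))" and *: "i < r" "i' < r" "j < r" "g \<in> carrier G" "j' < r" "g' \<in> carrier G" "i + i' = n"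
      by (auto simp: deg1_def)
    have "keys (?f kl) \<subseteq> {((Suc i, j, g), (i', j', g')), ((i, j, g1 \<otimes> g), (Suc i', j', g'))}"
      unfolding kl prod.case by (rule order.trans[OF Poly_Mapping.keys_add]) auto
    also have "\<dots> \<subseteq> deg1 (Suc n)" using * assms(2) by (auto simp: deg1_def)
    finally show "keys (?f kl) \<subseteq> deg1 (Suc n)" .
  qed
qed

lemma top_Grp_e0: "g \<in> carrier G \<Longrightarrow> top p p' p'' (Grp g) (basis (e0, e0)) = basis ((0, 0, g), (0, 0, g))"
  by (simp add: top_basis bop_Grp)

lemma top_X2n:
  assumes "g \<in> carrier G" "j < r"
  shows "(top p p' p'' X2 ^^ j) (basis ((0, 0, g), (0, 0, g))) = (top 0 0 0 X2 ^^ j) (basis ((0, 0, g), (0, 0, g))) \<and>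
    keys ((top 0 0 0 X2 ^^ j) (basis ((0, 0, g), (0, 0, g)))) \<subseteq> deg2 j"
  using assms(2)
proof (induction j)
  case 0
  then show ?case using assms(1) by (simp add: deg2_def)
next
  case (Suc j)
  let ?z = "(top 0 0 0 X2 ^^ j) (basis ((0, 0, g), (0, 0, g)))"
  have z: "keys ?z \<subseteq> deg2 j" using Suc by simp
  show ?case using top_X2_deg2[OF z Suc.prems, of p p' p''] top_X2_deg2(2)[OF z Suc.prems, of 0 0 0] Suc by simp
qed

lemma top_X1n:
  assumes "keys z \<subseteq> deg1 0" "i < r"
  shows "(top p p' p'' X1 ^^ i) z = (top 0 0 0 X1 ^^ i) z \<and> keys ((top 0 0 0 X1 ^^ i) z) \<subseteq> deg1 i"
  using assms(2)
proof (induction i)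
  case 0
  then show ?case using assms(1) by simp
next
  case (Suc i)
  let ?z = "(top 0 0 0 X1 ^^ i) z"
  have z: "keys ?z \<subseteq> deg1 i" using Suc by simp
  show ?case using top_X1_deg1[OF z Suc.prems, of p p' p''] top_X1_deg1(2)[OF z Suc.prems, of 0 0 0] Suc by simp
qed

lemma deg2_deg1: "deg2 j \<subseteq> deg1 0"
  by (auto simp: deg2_def deg1_def)

lemma
  assumes "k \<in> idx"
  shows mon_top: "mon (top p p' p'') (basis (e0, e0)) k = copb k"
    and keys_copb_deg1: "keys (copb k) \<subseteq> deg1 (fst k)"
    and keys_copb_deg2: "fst k = 0 \<Longrightarrow> keys (copb k) \<subseteq> deg2 (fst (snd k))"
proof -
  obtain i j g where k: "k = (i, j, g)" by (cases k)
  have *: "i < r" "j < r" "g \<in> carrier G" using assms by (simp_all add: k)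
  let ?z = "(top 0 0 0 X2 ^^ j) (basis ((0, 0, g), (0, 0, g)))"
  have z: "keys ?z \<subseteq> deg1 0" using top_X2n[OF *(3,2)] deg2_deg1 by blast
  have c: "copb k = (top 0 0 0 X1 ^^ i) ?z"
    using assms by (simp add: copb_def k mon_eq top_Grp_e0)
  show "mon (top p p' p'') (basis (e0, e0)) k = copb k"
    using assms top_X2n[OF *(3,2), of p p' p''] top_X1n[OF z *(1), of p p' p''] by (simp add: k mon_eq top_Grp_e0 c[unfolded k])
  show "keys (copb k) \<subseteq> deg1 (fst k)" using top_X1n[OF z *(1)] by (simp add: k c[unfolded k])
  assume "fst k = 0"
  then have "copb k = ?z" using c by (simp add: k)
  then show "keys (copb k) \<subseteq> deg2 (fst (snd k))"
    using top_X2n[OF *(3,2)] by (simp only: k fst_conv snd_conv)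
qed

lemma copb_outside: "k \<notin> idx \<Longrightarrow> copb k = 0"
  by (simp add: copb_def)

lemma keys_copb: "keys (copb k) \<subseteq> idx \<times> idx"
proof (cases "k \<in> idx")
  case True
  have "deg1 n \<subseteq> idx \<times> idx" for n by (auto simp: deg1_def)
  then show ?thesis using keys_copb_deg1[OF True] by blast
qed (simp add: copb_outside)

lemma keys_cop: "keys (cop c) \<subseteq> idx \<times> idx"
  unfolding cop_def by (intro keys_ext_subsetI keys_copb)

text \<open>\<open>T_lext_mon\<close> for \<open>top p p' p''\<close> at the unit tensor. By
  \<open>mon_top\<close> the monomials there do not depend on the parameters, so the single map
  \<open>cop\<close> is an intertwiner for every triple \<open>p\<close>, \<open>p'\<close>,
  \<open>p''\<close>.\<close>

lemma cop_op: "x \<in> gens G \<Longrightarrow> cop (op p p'' x c) = top p p' p'' x (cop c)"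
proof -
  assume x: "x \<in> gens G"
  interpret R: quantum_plane_rep G g1 g2 \<chi>1 \<chi>2 q r scale "{0}" "top p p' p''" p p'' by (rule top_rep)
  have c: "cop c = ext (mon (top p p' p'') (basis (e0, e0))) c" for c
  proof -
    have "copb k = mon (top p p' p'') (basis (e0, e0)) k" for k
      by (cases "k \<in> idx") (simp_all add: mon_top copb_outside)
    then show ?thesis by (simp add: cop_def lext_def)
  qed
  show ?thesis using R.T_lext_mon[OF x, of "basis (e0, e0)" c] by (simp add: R.eqv_def c)
qed

lemma copb_group: "g \<in> carrier G \<Longrightarrow> copb (0, 0, g) = basis ((0, 0, g), (0, 0, g))"
  by (simp add: copb_def mon_eq top_Grp_e0)

end

interpretation fld: vector_space "(*) :: 'k::field \<Rightarrow> 'k \<Rightarrow> 'k"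
  by (rule vector_space_field)

context quantum_plane
begin

section \<open>Multiplicativity of the coproduct\<close>

definition prd2 where
  "prd2 p p' p'' y z = ext (\<lambda>(k, l). tmap (prd p p' (basis k)) (prd p' p'' (basis l)) z) y"

lemma ext_prd_basis: "ext (\<lambda>k. prd p p' (basis k) d) c = prd p p' c d"
  by (rule linear_eq_lext[symmetric]) simp

lemma prd2_otimes: "prd2 p p' p'' (otimes c d) z = tmap (prd p p' c) (prd p' p'' d) z"
proof (induction z rule: tensor_induct)
  case (add z z')
  have "prd2 p p' p'' y (z + z') = prd2 p p' p'' y z + prd2 p p' p'' y z'" for y
    by (simp add: prd2_def tmap_simps split_def pm.lext_fun_add)
  then show ?case using add by (simp add: tmap_simps)
next
  case (otimes e f)
  have "prd2 p p' p'' (otimes c d) (otimes e f) =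
      ext (\<lambda>x. ext (\<lambda>y. otimes (prd p p' (basis x) e) (prd p' p'' (basis y) f)) d) c"
    by (simp add: prd2_def pm.lext_otimes tmap_otimes)
  also have "\<dots> = otimes (ext (\<lambda>k. prd p p' (basis k) e) c) (ext (\<lambda>k. prd p' p'' (basis k) f) d)"
    by (simp only: otimes_ext_left) (simp only: otimes_ext_right)
  finally show ?case by (simp add: ext_prd_basis tmap_otimes)
qed

lemma linear_prd2 [simp]: "pmlinear (\<lambda>y. prd2 p p' p'' y z)"
  by (simp add: prd2_def)

lemma top_prd2: "x \<in> gens G \<Longrightarrow> top p p' p'' x (prd2 p p' p'' y z) = prd2 p p' p'' (top p p' p'' x y) z"
proof (induction y rule: tensor_induct)
  case (add y y')
  then show ?case by (simp add: top_simps linear_pm_simps[OF linear_prd2])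
next
  case (otimes c d)
  show ?case
  proof (induction z rule: tensor_induct)
    case (add z z')
    have "prd2 p p' p'' y (z + z') = prd2 p p' p'' y z + prd2 p p' p'' y z'" for y
      by (simp add: prd2_def tmap_simps split_def pm.lext_fun_add)
    then show ?case using add by (simp add: top_simps)
  next
    case (otimes e f)
    show ?case using \<open>x \<in> gens G\<close>
      by (cases x) (simp_all add: prd2_otimes tmap_otimes top_otimes prd_op_left linear_pm_simps[OF linear_prd2])
  qed
qed

text \<open>As functions of \<open>c\<close>, both sides intertwine \<open>op p p''\<close> with
  \<open>top p p' p''\<close>, and they agree at the unit. The middle parameter \<open>p'\<close> is
  free; applying the counit to one or both tensor factors yields \<open>prd_twist_left\<close>,
  \<open>prd_twist_right\<close> and \<open>gam_comp\<close>.\<close>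

lemma cop_prd:
  assumes "keys c \<subseteq> idx"
  shows "cop (prd p p'' c d) = prd2 p p' p'' (cop c) (cop d)"
proof (rule intertwiner_eq[where F = "\<lambda>c. cop (prd p p'' c d)" and F' = "\<lambda>c. prd2 p p' p'' (cop c) (cop d)"
      and T = "top p p' p''" and p = p and p' = p'', OF _ _ _ _ _ assms])
  show "pmlinear (\<lambda>c. cop (prd p p'' c d))" by (rule linear_comp[OF linear_cop]) simp
  show "pmlinear (\<lambda>c. prd2 p p' p'' (cop c) (cop d))" by (rule linear_comp[OF linear_prd2]) simp
  show "cop (prd p p'' (op p p'' x c) d) = top p p' p'' x (cop (prd p p'' c d))" if "x \<in> gens G" for x c
    using that by (simp add: prd_op_left cop_op)
  show "prd2 p p' p'' (cop (op p p'' x c)) (cop d) = top p p' p'' x (prd2 p p' p'' (cop c) (cop d))"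
    if "x \<in> gens G" for x c
    using that by (simp add: cop_op[where p' = p'] top_prd2)
  have "prd p p' (basis e0) = op p p' (Grp \<one>)" for p p'
    by (simp add: fun_eq_iff prd_group)
  then show "cop (prd p p'' (basis e0) d) = prd2 p p' p'' (cop (basis e0)) (cop d)"
    using prd2_otimes[of p p' p'' "basis e0" "basis e0" "cop d"]
    by (simp add: copb_group cop_op[where p' = p'] top_def)
qed

lemma lext_prd2:
  assumes "vector_space s"
  shows "lext s f (prd2 p p' p'' y z) = lext s (\<lambda>(k, k'). lext s (\<lambda>(l, l').
      lext s f (otimes (prd p p' (basis k) (basis l)) (prd p' p'' (basis k') (basis l')))) z) y"
proof -
  interpret vector_space s by fact
  show ?thesis by (simp add: prd2_def tmap_def lext_ext split_def)
qed

section \<open>Coassociativity\<close>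

definition asc :: "(('a \<times> 'b) \<times> 'c \<Rightarrow>\<^sub>0 'k) \<Rightarrow> ('a \<times> 'b \<times> 'c \<Rightarrow>\<^sub>0 'k)" where
  "asc = ext (\<lambda>((x, y), z). basis (x, y, z))"

lemma linear_asc: "pmlinear asc"
  by (simp add: asc_def)

lemma asc_otimes: "asc (otimes (otimes c d) e) = otimes c (otimes d e)"
  unfolding asc_def pm.lext_otimes by (simp add: otimes_def pm.lext_ext)

text \<open>Left multiplication by the iterated coproduct of a generator. Zero parameters suffice,
  because \<open>cop\<close> does not involve them.\<close>

definition top3 :: "'g gen \<Rightarrow> ('g mono \<times> 'g mono \<times> 'g mono \<Rightarrow>\<^sub>0 'k) \<Rightarrow>
    ('g mono \<times> 'g mono \<times> 'g mono \<Rightarrow>\<^sub>0 'k)" where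
  "top3 x z = (case x of
      Grp h \<Rightarrow> tmap (op 0 0 (Grp h)) (top 0 0 0 (Grp h)) z
    | X1 \<Rightarrow> tmap (op 0 0 X1) (top 0 0 0 (Grp \<one>)) z + tmap (op 0 0 (Grp g1)) (top 0 0 0 X1) z
    | X2 \<Rightarrow> tmap (op 0 0 X2) (top 0 0 0 (Grp \<one>)) z + tmap (op 0 0 (Grp g2)) (top 0 0 0 X2) z)"

lemma top3_add: "top3 x (z + z') = top3 x z + top3 x z'"
  by (cases x) (simp_all add: top3_def tmap_simps)

lemma asc_top3:
  "asc (otimes (top 0 0 0 (Grp h) y) (op 0 0 (Grp h) d)) = top3 (Grp h) (asc (otimes y d))"
  "asc (otimes (top 0 0 0 X1 y) (op 0 0 (Grp \<one>) d)) + asc (otimes (top 0 0 0 (Grp g1) y) (op 0 0 X1 d)) = top3 X1 (asc (otimes y d))"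
  "asc (otimes (top 0 0 0 X2 y) (op 0 0 (Grp \<one>) d)) + asc (otimes (top 0 0 0 (Grp g2) y) (op 0 0 X2 d)) = top3 X2 (asc (otimes y d))"
  by (induction y rule: tensor_induct;
      simp add: top_simps top_otimes otimes_simps linear_pm_simps[OF linear_asc] asc_otimes top3_add;
      simp add: top3_def tmap_otimes top_otimes otimes_simps linear_pm_simps[OF linear_asc] asc_otimes algebra_simps)+

text \<open>Both iterated coproducts intertwine \<open>op 0 0\<close> with \<open>top3\<close> and
  agree at the unit.\<close>

lemma coassoc_pm:
  assumes "keys c \<subseteq> idx"
  shows "asc (tmap cop (\<lambda>d. d) (cop c)) = tmap (\<lambda>d. d) cop (cop c)"
proof (rule intertwiner_eq[where F = "\<lambda>c. asc (tmap cop (\<lambda>d. d) (cop c))" and F' = "\<lambda>c. tmap (\<lambda>d. d) cop (cop c)"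
      and T = "top3" and p = 0 and p' = 0, OF _ _ _ _ _ assms])
  show "pmlinear (\<lambda>c. asc (tmap cop (\<lambda>d. d) (cop c)))"
    by (intro linear_comp[OF linear_asc] linear_comp[OF linear_tmap] linear_cop)
  show "pmlinear (\<lambda>c. tmap (\<lambda>d. d) cop (cop c))"
    by (intro linear_comp[OF linear_tmap] linear_cop)
  have 1: "asc (tmap cop (\<lambda>d. d) (top 0 0 0 x z)) = top3 x (asc (tmap cop (\<lambda>d. d) z))" if x: "x \<in> gens G" for x z
  proof (induction z rule: tensor_induct)
    case (otimes c d)
    then show ?case using x
      by (cases x) (simp_all add: top_otimes tmap_simps tmap_otimes cop_op[where p' = 0] linear_pm_simps[OF linear_asc] asc_top3)
  qed (simp add: top_simps tmap_simps linear_pm_simps[OF linear_asc] top3_add)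
  show "asc (tmap cop (\<lambda>d. d) (cop (op 0 0 x c))) = top3 x (asc (tmap cop (\<lambda>d. d) (cop c)))"
    if "x \<in> gens G" for x c
    using 1 that by (simp add: cop_op[where p' = 0])
  have 2: "tmap (\<lambda>d. d) cop (top 0 0 0 x z) = top3 x (tmap (\<lambda>d. d) cop z)" if x: "x \<in> gens G" for x z
  proof (induction z rule: tensor_induct)
    case (otimes c d)
    then show ?case using x
      by (cases x) (simp_all add: top_otimes tmap_simps tmap_otimes cop_op[where p' = 0] top3_def)
  qed (simp add: top_simps tmap_simps top3_add)
  show "tmap (\<lambda>d. d) cop (cop (op 0 0 x c)) = top3 x (tmap (\<lambda>d. d) cop (cop c))"
    if "x \<in> gens G" for x c
    using 2 that by (simp add: cop_op[where p' = 0])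
  show "asc (tmap cop (\<lambda>d. d) (cop (basis e0))) = tmap (\<lambda>d. d) cop (cop (basis e0))"
    by (simp add: copb_group asc_def)
qed

lemma coassoc_lext:
  assumes "vector_space s" "keys c \<subseteq> idx"
  shows "lext s (\<lambda>(x, k3). lext s (\<lambda>(k1, k2). f k1 k2 k3) (copb x)) (cop c) =
    lext s (\<lambda>(k1, x). lext s (\<lambda>(k2, k3). f k1 k2 k3) (copb x)) (cop c)"
proof -
  interpret vector_space s by fact
  let ?f = "\<lambda>(k1, k2, k3). f k1 k2 k3"
  have 1: "tmap cop (\<lambda>d. d) z = ext (\<lambda>(x, k3). ext (\<lambda>l. basis (l, k3)) (copb x)) z" for z
    by (simp add: tmap_def otimes_def)
  have 2: "tmap (\<lambda>d. d) cop z = ext (\<lambda>(k1, x). ext (\<lambda>l. basis (k1, l)) (copb x)) z" for z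
    by (simp add: tmap_def otimes_def)
  have "lext s ?f (asc (tmap cop (\<lambda>d. d) (cop c))) = lext s ?f (tmap (\<lambda>d. d) cop (cop c))"
    by (simp only: coassoc_pm[OF assms(2)])
  then show ?thesis
    unfolding 1 2 asc_def by (simp add: lext_ext split_def)
qed

section \<open>The counit\<close>

definition epsb :: "'g mono \<Rightarrow> 'k" where
  "epsb k = (if k \<in> idx \<and> fst k = 0 \<and> fst (snd k) = 0 then 1 else 0)"

definition eps :: "('g, 'k) formal \<Rightarrow> 'k" where
  "eps = fext epsb"

lemma eps_simps: "eps (c + d) = eps c + eps d" "eps (c - d) = eps c - eps d" "eps (scale a c) = a * eps c"
  "eps 0 = 0" "eps (single k a) = a * epsb k"
  by (simp_all add: eps_def fld.lext_add fld.lext_diff fld.lext_scale)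

lemma linear_eps: "Vector_Spaces.linear scale (*) eps"
  unfolding eps_def by (rule fld.linear_lext)

lemma eps_e0 [simp]: "eps (basis e0) = 1"
  by (simp add: eps_simps epsb_def)

lemma eps_Grp: "h \<in> carrier G \<Longrightarrow> eps (op p p' (Grp h) c) = eps c"
proof (induction c rule: poly_mapping_ext_induct)
  case (single k a)
  obtain i j g where k: "k = (i, j, g)" by (cases k)
  show ?case
    by (cases "k \<in> idx") (use single in \<open>auto simp: k op_single bop_Grp eps_simps epsb_def\<close>)
qed (simp_all add: op_simps eps_simps)

text \<open>Only the wrap-around can contribute, and there the two terms have counits
  \<open>par1 p\<close> and \<open>- par1 p'\<close>. Where these parameters differ, this is the
  source of the entry a_1 in the cocycle.\<close>

lemma eps_X1: "par1 p = par1 p' \<Longrightarrow> eps (op p p' X1 c) = 0"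
proof (induction c rule: poly_mapping_ext_induct)
  case (single k a)
  obtain i j g where k: "k = (i, j, g)" by (cases k)
  show ?case
  proof (cases "k \<in> idx")
    case True
    then show ?thesis using single
      by (cases "Suc i < r") (auto simp: k op_single bop_X1 bop_X1_top eps_simps epsb_def)
  qed (simp add: op_single eps_simps)
qed (simp_all add: op_simps eps_simps)

lemma eps_X2: "par2 p = par2 p' \<Longrightarrow> par0 p = par0 p' \<Longrightarrow> eps (op p p' X2 c) = 0"
proof (induction c rule: poly_mapping_ext_induct)
  case (single k a)
  obtain i j g where k: "k = (i, j, g)" by (cases k)
  show ?case
  proof (cases "k \<in> idx")
    case True
    \<comment> \<open>The terms that lower \<open>i\<close> have nonzero counit only if
      \<open>i - 1 = 0\<close>. Then \<open>i\<close> is 0, where \<open>qnum i = 0\<close>, or 1,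
      where the factor \<open>q ^ (i - 1)\<close> is 1; so they cancel when \<open>par0\<close>
      agrees.\<close>
    have "qnum i = qnum i * q ^ (i - Suc 0) \<or> 1 < i" by (cases i; cases "i - 1") auto
    then show ?thesis using single True
      by (cases "Suc j < r"; cases "j = 0") (auto simp: k op_single bop_X2 bop_X2_top eps_simps epsb_def)
  qed (simp add: op_single eps_simps)
qed (simp_all add: op_simps eps_simps)

lemma lext_eps_otimes:
  "ext (\<lambda>(k, l). single l (epsb k)) (otimes c d) = scale (eps c) d"
  "ext (\<lambda>(k, l). single k (epsb l)) (otimes c d) = scale (eps d) c"
proof -
 have 1: "ext (\<lambda>y. single y a) d = scale a d" for d :: "'x \<Rightarrow>\<^sub>0 'k" and a
    using pm.lext_fun_scale[of a basis d] by simp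
  have 2: "ext (\<lambda>x. scale (f x) d) c = scale (fext f c) d" for c :: "'x \<Rightarrow>\<^sub>0 'k" and f and d :: "'y \<Rightarrow>\<^sub>0 'k"
    by (simp add: lext_def pm.scale_sum_left)
  show "ext (\<lambda>(k, l). single l (epsb k)) (otimes c d) = scale (eps c) d"
    by (simp add: pm.lext_otimes 1 2 eps_def)
  have 3: "ext (\<lambda>y. single x (f y)) d = single x (fext f d)" for d :: "'x \<Rightarrow>\<^sub>0 'k" and f and x :: 'y
    using 2[of f "basis x" d] by simp
  show "ext (\<lambda>(k, l). single k (epsb l)) (otimes c d) = scale (eps d) c"
    by (simp add: pm.lext_otimes 1 3 eps_def)
qed

text \<open>The counit sends group elements to 1 and kills x_1 and x_2 when both parameters are 0.
  Applied to one tensor factor it therefore turns \<open>top 0 0 0\<close> into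
  \<open>op 0 0\<close>, and the composite is an intertwiner fixing the unit.\<close>

lemma
  assumes "keys c \<subseteq> idx"
  shows counit_left_pm: "ext (\<lambda>(k, l). single l (epsb k)) (cop c) = c" (is "?L (cop c) = c")
    and counit_right_pm: "ext (\<lambda>(k, l). single k (epsb l)) (cop c) = c" (is "?R (cop c) = c")
proof -
  have e0: "copb e0 = basis (e0, e0)" "epsb e0 = 1" by (simp_all add: copb_group epsb_def)
  have 1: "?L (top 0 0 0 x z) = op 0 0 x (?L z)" if "x \<in> gens G" for x z
  proof (induction z rule: tensor_induct)
    case (otimes c d)
    then show ?case using that
      by (cases x) (simp_all add: top_otimes pm.lext_add lext_eps_otimes eps_Grp eps_X1 eps_X2 op_simps)
  qed (simp add: top_simps pm.lext_add op_simps)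
  have 2: "?R (top 0 0 0 x z) = op 0 0 x (?R z)" if "x \<in> gens G" for x z
  proof (induction z rule: tensor_induct)
    case (otimes c d)
    then show ?case using that
      by (cases x) (simp_all add: top_otimes pm.lext_add lext_eps_otimes eps_Grp eps_X1 eps_X2 op_simps)
  qed (simp add: top_simps pm.lext_add op_simps)
  show "?L (cop c) = c"
    by (rule intertwiner_eq[where F = "\<lambda>c. ?L (cop c)" and F' = "\<lambda>c. c" and T = "op 0 0", OF _ _ _ _ _ assms])
      (auto simp: cop_op[where p' = 0] 1 e0 intro!: linear_comp[OF pm.linear_lext])
  show "?R (cop c) = c"
    by (rule intertwiner_eq[where F = "\<lambda>c. ?R (cop c)" and F' = "\<lambda>c. c" and T = "op 0 0", OF _ _ _ _ _ assms])
      (auto simp: cop_op[where p' = 0] 2 e0 intro!: linear_comp[OF pm.linear_lext])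
qed

lemma eps_cop: "keys c \<subseteq> idx \<Longrightarrow> fext (\<lambda>(k, l). epsb k * epsb l) (cop c) = eps c"
proof -
  assume c: "keys c \<subseteq> idx"
  have "eps c = eps (ext (\<lambda>(k, l). single l (epsb k)) (cop c))"
    by (simp only: counit_left_pm[OF c])
  also have "\<dots> = fext (\<lambda>(k, l). epsb k * epsb l) (cop c)"
    by (simp add: eps_def fld.lext_ext split_def mult.commute)
  finally show ?thesis by simp
qed

section \<open>The cocycles\<close>

definition gam :: "'k params \<Rightarrow> 'k params \<Rightarrow> ('g, 'k) formal \<Rightarrow> ('g, 'k) formal \<Rightarrow> 'k" where
  "gam p p' c d = eps (prd p p' c d)"

lemma gam_simps: "gam p p' (c + c') d = gam p p' c d + gam p p' c' d"
  "gam p p' (scale a c) d = a * gam p p' c d" "gam p p' c (d + d') = gam p p' c d + gam p p' c d'"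
  "gam p p' c (scale a d) = a * gam p p' c d"
  by (simp_all add: gam_def prd_simps eps_simps)

lemma fext_eps_otimes: "fext (\<lambda>(k, l). epsb k * epsb l) (otimes c d) = eps c * eps d"
  by (simp add: fld.lext_otimes eps_def fld.lext_fun_scale mult.commute[of _ "fext epsb d"])

text \<open>Apply \<epsilon> \<otimes> \<epsilon> to \<open>cop_prd\<close>; on the left
  \<open>eps_cop\<close> reduces this to the counit.\<close>

lemma gam_comp:
  assumes "keys c \<subseteq> idx"
  shows "gam p p'' c d = fext (\<lambda>(k, k'). fext (\<lambda>(l, l').
      gam p p' (basis k) (basis l) * gam p' p'' (basis k') (basis l')) (cop d)) (cop c)"
  unfolding gam_def eps_cop[OF keys_prd, symmetric, of p p''] cop_prd[OF assms, where p' = p']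
    lext_prd2[OF vector_space_field] fext_eps_otimes ..

text \<open>Apply \<epsilon> \<otimes> id to \<open>cop_prd\<close>. Twisting on the left by
  \<gamma>(p, p') replaces the first parameter \<open>p'\<close> by \<open>p\<close>;
  \<open>prd_twist_right\<close> treats the second parameter in the same way.\<close>

lemma prd_twist_left:
  assumes "keys c \<subseteq> idx"
  shows "prd p p'' c d = ext (\<lambda>(k, k'). ext (\<lambda>(l, l').
      scale (gam p p' (basis k) (basis l)) (prd p' p'' (basis k') (basis l'))) (cop d)) (cop c)"
  unfolding gam_def
  by (subst counit_left_pm[OF keys_prd, symmetric])
    (simp only: cop_prd[OF assms, where p' = p'] lext_prd2[OF pm.vector_space_axioms] lext_eps_otimes)

lemma prd_twist_right:
  assumes "keys c \<subseteq> idx"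
  shows "prd p p'' c d = ext (\<lambda>(k, k'). ext (\<lambda>(l, l').
      scale (gam p' p'' (basis k') (basis l')) (prd p p' (basis k) (basis l))) (cop d)) (cop c)"
  unfolding gam_def
  by (subst counit_right_pm[OF keys_prd, symmetric])
    (simp only: cop_prd[OF assms, where p' = p'] lext_prd2[OF pm.vector_space_axioms] lext_eps_otimes)

text \<open>On C(p, p) the counit is an algebra map, since equal parameters make it kill both x_1
  and x_2. Together with \<open>gam_comp\<close> this makes \<gamma>(p', p) the inverse of
  \<gamma>(p, p').\<close>

lemma gam_self: "keys c \<subseteq> idx \<Longrightarrow> gam p p c d = eps c * eps d"
proof -
  assume c: "keys c \<subseteq> idx"
  show ?thesis unfolding gam_def
  \<comment> \<open>\<open>T\<close> is the trivial one-dimensional representation: group elements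
    act as the identity, x_1 and x_2 as 0.\<close>
  proof (rule intertwiner_eq[where F = "\<lambda>c. eps (prd p p c d)" and F' = "\<lambda>c. eps c * eps d" and
        T = "\<lambda>x v. case x of Grp h \<Rightarrow> v | _ \<Rightarrow> 0" and p = p and p' = p, OF _ _ _ _ _ c])
    show "Vector_Spaces.linear scale (*) (\<lambda>c. eps (prd p p c d))"
      by (rule linear_comp[OF linear_eps]) simp
    show "Vector_Spaces.linear scale (*) (\<lambda>c. eps c * eps d)"
      by (simp add: Vector_Spaces.linear_iff eps_simps distrib_right pm.vector_space_axioms fld.vector_space_axioms)
  qed (auto simp: prd_op_left eps_Grp eps_X1 eps_X2 prd_group split: gen.split)
qed

lemma eps_prd: "keys c \<subseteq> idx \<Longrightarrow> eps (prd p p c d) = eps c * eps d"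
  using gam_self by (simp add: gam_def)

section \<open>H-bilinearity of the forms\<close>

lemma mon_op_group: "i < r \<Longrightarrow> j < r \<Longrightarrow> g \<in> carrier G \<Longrightarrow> h \<in> carrier G \<Longrightarrow>
    mon (op p p') (basis (0, 0, h)) (i, j, g) = basis (i, j, g \<otimes> h)"
  by (simp add: mon_eq bop_Grp op_X2n[where j = 0, simplified] op_X1n[where i = 0, simplified])

text \<open>Right multiplication by a group element only shifts the group component of a monomial,
  so no relation with parameters is used. This matters because H-bilinearity multiplies in A = C(0,
  0), whereas \<open>gam p p'\<close> multiplies in C(p, p').\<close>

lemma prd_group_right_params: "h \<in> carrier G \<Longrightarrow> prd p p' c (basis (0, 0, h)) = prd 0 0 c (basis (0, 0, h))"
proof -
  assume h: "h \<in> carrier G"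
  have "mon (op p p') (basis (0, 0, h)) k = mon (op 0 0) (basis (0, 0, h)) k" for k
  proof (cases "k \<in> idx")
    case True
    then show ?thesis using h by (cases k) (simp add: mon_op_group)
  qed simp
  then show ?thesis by (simp add: prd_def lext_def)
qed

lemma eps_group_right: "h \<in> carrier G \<Longrightarrow> keys c \<subseteq> idx \<Longrightarrow> eps (prd p p' c (basis (0, 0, h))) = eps c"
  using eps_prd[of c 0 "basis (0, 0, h)"]
  by (simp add: prd_group_right_params[of h p p'] eps_simps epsb_def)

lemma gam_group:
  assumes "h \<in> carrier G" "h' \<in> carrier G"
  shows "gam p p' (prd 0 0 (basis (0, 0, h)) c) (prd 0 0 d (basis (0, 0, h'))) = gam p p' c d"
proof -
  have 1: "prd 0 0 (basis (0, 0, h)) c = op p p' (Grp h) c"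
    using op_Grp_params[of p p' h] by (simp add: prd_group assms)
  have "gam p p' (prd 0 0 (basis (0, 0, h)) c) (prd 0 0 d (basis (0, 0, h'))) =
      eps (prd p p' c (prd p p' d (basis (0, 0, h'))))"
    unfolding gam_def 1 by (simp add: prd_op_left assms eps_Grp prd_group_right_params[of h' p p'])
  also have "\<dots> = eps (prd p p' (prd p p' c d) (basis (0, 0, h')))" by (simp only: prd_assoc)
  also have "\<dots> = gam p p' c d" by (simp add: eps_group_right assms keys_prd gam_def)
  finally show ?thesis .
qed

section \<open>Values of the forms on monomials\<close>

lemma gam_mon: "l < r \<Longrightarrow> m < r \<Longrightarrow> n < r \<Longrightarrow> t < r \<Longrightarrow>
    gam p p' (basis (l, m, \<one>)) (basis (n, t, \<one>)) = eps ((op p p' X1 ^^ l) ((op p p' X2 ^^ m) (basis (n, t, \<one>))))"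
  by (simp add: gam_def prd_basis mon_eq bop_Grp)

lemma eps_X1_pow: "par1 p = par1 p' \<Longrightarrow> 0 < l \<Longrightarrow> eps ((op p p' X1 ^^ l) c) = 0"
  by (cases l) (auto simp: eps_X1)

text \<open>Since \<open>par1\<close> agrees on both sides, a leading x_1 is killed by the counit.
  In \<open>x_2^m x_1^n x_2^t\<close> a contribution survives only if each leading x_2 removes one
  x_1; the factors \<open>qnum n * a\<close>, \<open>qnum (n - 1) * a\<close> and so on multiply to
  the q-factorial.\<close>

lemma gam_a_value:
  assumes "l < r" "m < r" "n < r" "t < r"
  shows "gam (a1, a2, a) (a1, a2, 0) (basis (l, m, \<one>)) (basis (n, t, \<one>)) =
    (if l = 0 \<and> t = 0 \<and> m = n then q_factorial q m * a ^ m else counit_value l m n t)"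
proof -
  let ?X = "op (a1, a2, a) (a1, a2, 0) X2"
  have "eps ((?X ^^ m) (basis (n, t, g))) = (if t = 0 \<and> m = n then q_factorial q m * a ^ m else 0)"
    if "n < r" "t < r" "g \<in> carrier G" for n t g
    using that
  proof (induction m arbitrary: n t g)
    case 0
    then show ?case by (auto simp: eps_simps epsb_def q_factorial_def)
  next
    case (Suc m)
    define E where "E k = eps ((?X ^^ m) (basis k))" for k
    have lin: "eps ((?X ^^ m) (single k b)) = b * E k" for k b
      using opn_simps(3)[where a = b and c = "basis k"] by (simp add: E_def eps_simps flip: scale_single[of b k 1, simplified])
    have E: "E (n, t, g) = (if t = 0 \<and> m = n then q_factorial q m * a ^ m else 0)"
      if "n < r" "t < r" "g \<in> carrier G" for n t g
      using Suc.IH[OF that] by (simp add: E_def)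
    \<comment> \<open>The terms that keep \<open>n\<close> vanish: raising \<open>t\<close> gives
      value 0 by induction, and at \<open>t = r - 1\<close> the two wrap-around terms have equal
      values and opposite coefficients.\<close>
    have "eps ((?X ^^ Suc m) (basis (n, t, g))) = qnum n * a * E (n - 1, t, g)"
    proof (cases "Suc t < r")
      case True
      then show ?thesis using Suc.prems
        by (simp add: funpow_swap1 bop_X2 opn_simps eps_simps lin E)
    next
      case False
      then have "Suc t = r" using Suc.prems by simp
      then show ?thesis using Suc.prems
        by (simp add: funpow_swap1 bop_X2_top opn_simps eps_simps lin E)
    qed
    also have "\<dots> = (if t = 0 \<and> Suc m = n then q_factorial q (Suc m) * a ^ Suc m else 0)"
      using Suc.prems by (cases n) (auto simp: E q_factorial_def qnum_def)
    finally show ?case .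
  qed
  then show ?thesis using assms
    by (cases "l = 0") (auto simp: gam_mon eps_X1_pow counit_value_def)
qed

text \<open>With \<open>par0 = 0\<close> and \<open>par2\<close> equal on both sides, the counit
  kills x_2 even behind powers of x_1 (\<open>Y\<close>), which leaves \<open>m = 0\<close>. Then
  \<open>x_1^l x_1^n x_2^t\<close> has nonzero counit only for \<open>t = 0\<close> and
  \<open>l + n\<close> equal to 0 or \<open>r\<close>, and here \<open>x_1^r = a_1\<close>.\<close>

lemma gam_1_value:
  assumes "l < r" "m < r" "n < r" "t < r"
  shows "gam (a1, a2, 0) (0, a2, 0) (basis (l, m, \<one>)) (basis (n, t, \<one>)) =
    (if m = 0 \<and> t = 0 \<and> 0 < l \<and> l < r \<and> n = r - l then a1 else counit_value l m n t)"
proof -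
  let ?X = "op (a1, a2, 0) (0, a2, 0) X1" and ?Y = "op (a1, a2, 0) (0, a2, 0) X2"
  have X: "eps ((?X ^^ l) (basis (i, j, g))) = (if j = 0 then if l = 0 \<and> i = 0 then 1 else if i + l = r then a1 else 0 else 0)"
    if "i < r" "j < r" "g \<in> carrier G" for i j g
  proof (cases "i + l < r")
    case True
    then show ?thesis using that by (auto simp: op_X1n eps_simps epsb_def)
  next
    case False
    \<comment> \<open>Both \<open>i\<close> and \<open>l\<close> are below \<open>r\<close>, so
      exactly one wrap-around occurs, after \<open>r - Suc i\<close> steps.\<close>
    then have l: "l = (i + l - r) + Suc (r - Suc i)" using that by simp
    have "(?X ^^ l) (basis (i, j, g)) = (?X ^^ (i + l - r)) (?X ((?X ^^ (r - Suc i)) (basis (i, j, g))))"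
      by (subst l) (simp only: funpow_add funpow.simps o_apply)
    also have "\<dots> = (?X ^^ (i + l - r)) (scale a1 (basis (0, j, g)))"
      using that by (simp add: op_X1n bop_X1_top)
    also have "\<dots> = scale a1 (basis (i + l - r, j, g))"
      unfolding opn_simps using that assms False by (simp add: op_X1n)
    finally show ?thesis using that assms False by (auto simp: eps_simps epsb_def)
  qed
  \<comment> \<open>With \<open>par0 = 0\<close> the operator of x_2 keeps the x_1-exponent. Raising
    \<open>j\<close> gives value 0 by \<open>X\<close>, and the two wrap-around terms of x_2 cancel
    because \<open>X\<close> does not depend on the group element.\<close>
  have Y: "eps ((?X ^^ l) (?Y c)) = 0" for c
  proof (induction c rule: poly_mapping_ext_induct)
    case (single k b)
    obtain i j g where k: "k = (i, j, g)" by (cases k)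
    define E where "E k = eps ((?X ^^ l) (basis k))" for k
    have lin: "eps ((?X ^^ l) (single k b)) = b * E k" for k b
      using opn_simps(3)[where a = b and c = "basis k"] by (simp add: E_def eps_simps flip: scale_single[of b k 1, simplified])
    note XE = X[folded E_def]
    show ?case
    proof (cases "k \<in> idx")
      case True
      then show ?thesis
        by (cases "Suc j < r") (auto simp: k op_single bop_X2 bop_X2_top opn_simps eps_simps lin XE)
    qed (simp add: op_single opn_simps eps_simps)
  qed (simp_all add: op_simps opn_simps eps_simps)
  show ?thesis
  proof (cases m)
    case 0
    then show ?thesis using assms by (auto simp: gam_mon X counit_value_def)
  next
    case (Suc m')
    then show ?thesis using assms by (simp add: gam_mon Y counit_value_def)
  qed
qed

text \<open>Now \<open>par0 = 0\<close>, so x_2 never lowers the x_1-exponent. An x_1 in the second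
  argument survives until the counit (\<open>0\<close>), a leading one is killed since
  \<open>par1\<close> agrees, and powers of x_2 alone behave like those of x_1 in
  \<open>gam_1_value\<close>.\<close>

lemma gam_2_value:
  assumes "l < r" "m < r" "n < r" "t < r"
  shows "gam (0, a2, 0) (0, 0, 0) (basis (l, m, \<one>)) (basis (n, t, \<one>)) =
    (if l = 0 \<and> n = 0 \<and> 0 < m \<and> m < r \<and> t = r - m then a2 else counit_value l m n t)"
proof -
  let ?X = "op (0, a2, 0) (0, 0, 0) X2"
  have 0: "eps ((?X ^^ m) (basis (n, t, g))) = 0" if "0 < n" "n < r" "t < r" "g \<in> carrier G" for n t g m
    using that
  proof (induction m arbitrary: t g)
    case (Suc m)
    define E where "E k = eps ((?X ^^ m) (basis k))" for k
    have lin: "eps ((?X ^^ m) (single k b)) = b * E k" for k b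
      using opn_simps(3)[where a = b and c = "basis k"] by (simp add: E_def eps_simps flip: scale_single[of b k 1, simplified])
    have E: "E (n, t, g) = 0" if "t < r" "g \<in> carrier G" for t g
      using Suc.IH[of t g] Suc.prems that by (simp add: E_def)
    have "Suc t < r \<or> Suc t = r" using Suc.prems by auto
    then show ?case using Suc.prems
      by (elim disjE) (simp_all add: funpow_swap1 bop_X2 bop_X2_top opn_simps eps_simps lin E)
  qed (simp add: eps_simps epsb_def)
  have X: "eps ((?X ^^ m) (basis (0, t, \<one>))) = (if m = 0 \<and> t = 0 then 1 else if t + m = r then a2 else 0)"
  proof (cases "t + m < r")
    case True
    then show ?thesis using assms by (auto simp: op_X2n eps_simps epsb_def)
  next
    case False
    then have m: "m = (t + m - r) + Suc (r - Suc t)" using assms by simp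
    have "(?X ^^ m) (basis (0, t, \<one>)) = (?X ^^ (t + m - r)) (?X ((?X ^^ (r - Suc t)) (basis (0, t, \<one>))))"
      by (subst m) (simp only: funpow_add funpow.simps o_apply)
    also have "\<dots> = (?X ^^ (t + m - r)) (scale a2 (basis (0, 0, \<one>)))"
      using assms by (simp add: op_X2n bop_X2_top)
    also have "\<dots> = scale a2 (basis (0, t + m - r, \<one>))"
      unfolding opn_simps using assms False by (simp add: op_X2n)
    finally show ?thesis using assms False by (auto simp: eps_simps epsb_def)
  qed
  show ?thesis
  proof (cases "l = 0")
    case True
    then show ?thesis using assms 0[of n t \<one> m] by (cases "n = 0") (auto simp: gam_mon X counit_value_def)
  next
    case False
    then show ?thesis using assms by (simp add: gam_mon eps_X1_pow counit_value_def)
  qed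
qed

section \<open>The antipode\<close>

\<comment> \<open>The antipode sends \<open>x\<close> to \<open>- g\<^sup>-\<^sup>1 x\<close> when \<open>\<Delta> x = g \<otimes> x + x \<otimes> 1\<close>.\<close>
definition sX :: "'k params \<Rightarrow> 'g gen \<Rightarrow> 'g \<Rightarrow> ('g, 'k) formal \<Rightarrow> ('g, 'k) formal" where
  "sX p x g c = - op p p (Grp (inv g)) (op p p x c)"

text \<open>An antipode reverses products, so \<open>x_1^i x_2^j g\<close> must go to
  \<open>g^-1 S(x_2)^j S(x_1)^i\<close>; \<open>sX\<close> is left multiplication by
  \<open>S(x_i)\<close>.\<close>

definition antb :: "'k params \<Rightarrow> 'g mono \<Rightarrow> ('g, 'k) formal" where
  "antb p = (\<lambda>(i, j, g). if (i, j, g) \<in> idx then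
     op p p (Grp (inv g)) ((sX p X2 g2 ^^ j) ((sX p X1 g1 ^^ i) (basis e0))) else 0)"

lemma antb_eq: "(i, j, g) \<in> idx \<Longrightarrow> antb p (i, j, g) =
    op p p (Grp (inv g)) ((sX p X2 g2 ^^ j) ((sX p X1 g1 ^^ i) (basis e0)))"
  by (simp add: antb_def)

lemma antb_outside: "k \<notin> idx \<Longrightarrow> antb p k = 0"
  by (cases k) (auto simp: antb_def)

lemma keys_antb: "keys (antb p k) \<subseteq> idx"
  by (cases k) (simp add: antb_def keys_op)

lemma op_uminus: "op p p' x (- c) = - op p p' x c"
  using op_simps(2)[of p p' x 0 c] by (simp add: op_simps)

lemma prd_uminus: "prd p p' (- c) d = - prd p p' c d" "prd p p' c (- d) = - prd p p' c d"
  using prd_simps(2)[of p p' 0 c d] prd_simps(6)[of p p' c 0 d] by (simp_all add: prd_simps)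

lemma chi_inv: "h \<in> carrier G \<Longrightarrow> \<chi>1 (inv h) = inverse (\<chi>1 h)" "h \<in> carrier G \<Longrightarrow> \<chi>2 (inv h) = inverse (\<chi>2 h)"
  using chi1_mult[of h "inv h"] chi2_mult[of h "inv h"] chi_nonzero[of h]
  by (simp_all add: inverse_eq_divide eq_divide_eq mult.commute)

lemma prd_sXn:
  assumes "x \<in> gens G" "g \<in> carrier G"
  shows "prd p p ((sX p x g ^^ n) c) d = (sX p x g ^^ n) (prd p p c d)"
  by (induction n) (simp_all add: sX_def prd_uminus prd_op_left assms)

lemma sX_simps: "sX p x g (scale a c) = scale a (sX p x g c)"
  "(sX p x g ^^ n) (scale a c) = scale a ((sX p x g ^^ n) c)"
proof -
  show 1: "sX p x g (scale a c) = scale a (sX p x g c)" for c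
    by (simp add: sX_def op_simps pm.scale_minus_right)
  show "(sX p x g ^^ n) (scale a c) = scale a ((sX p x g ^^ n) c)"
    by (induction n) (simp_all add: 1)
qed

lemma sXn_Grp_inv:
  assumes h: "h \<in> carrier G" and g: "g \<in> carrier G" and x: "x = X1 \<and> a = \<chi>1 h \<or> x = X2 \<and> a = \<chi>2 h"
  shows "(sX p x g ^^ n) (op p p (Grp (inv h)) c) = scale (a ^ n) (op p p (Grp (inv h)) ((sX p x g ^^ n) c))"
proof (induction n)
  case (Suc n)
  have a: "a \<noteq> 0" using x chi_nonzero[OF h] by auto
  have "op p p (Grp (inv h)) (op p p x c) = scale (inverse a) (op p p x (op p p (Grp (inv h)) c))" for c
    using x h by (auto simp: op_Grp_X1 op_Grp_X2 chi_inv)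
  then have 1: "op p p x (op p p (Grp (inv h)) c) = scale a (op p p (Grp (inv h)) (op p p x c))" for c
    using a by simp
  have "sX p x g (op p p (Grp (inv h)) c) = scale a (op p p (Grp (inv h)) (sX p x g c))" for c
    using h g by (simp add: sX_def 1 op_simps op_uminus op_Grp_Grp m_comm pm.scale_minus_right)
  then show ?case by (simp add: Suc sX_simps)
qed simp

text \<open>This is \<open>S(h k) = S(k) h^-1\<close>: carrying \<open>h^-1\<close> leftwards
  through the factors \<open>S(x_i)\<close> produces the same scalar as carrying \<open>h\<close>
  past the monomial.\<close>

lemma antb_Grp:
  assumes "h \<in> carrier G"
  shows "ext (antb p) (bop p p (Grp h) k) = prd p p (antb p k) (basis (0, 0, inv h))"
proof (cases "k \<in> idx")
  case True
  obtain i j g where k: "k = (i, j, g)" by (cases k)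
  have ijg: "i < r" "j < r" "g \<in> carrier G" using True by (simp_all add: k)
  let ?W = "(sX p X2 g2 ^^ j) ((sX p X1 g1 ^^ i) (basis e0))"
  have "prd p p ?W (basis (0, 0, inv h)) = (sX p X2 g2 ^^ j) ((sX p X1 g1 ^^ i) (op p p (Grp (inv h)) (basis e0)))"
    using assms by (simp add: prd_sXn prd_group bop_Grp)
  also have "\<dots> = scale (\<chi>1 h ^ i * \<chi>2 h ^ j) (op p p (Grp (inv h)) ?W)"
    using assms by (simp add: sXn_Grp_inv[where a = "\<chi>1 h"] sXn_Grp_inv[where a = "\<chi>2 h"] sX_simps mult.commute del: op_basis)
  finally have "prd p p (antb p k) (basis (0, 0, inv h)) =
      scale (\<chi>1 h ^ i * \<chi>2 h ^ j) (op p p (Grp (inv g)) (op p p (Grp (inv h)) ?W))"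
    using ijg by (simp add: k antb_eq prd_op_left op_simps)
  then show ?thesis using ijg assms by (simp add: k bop_Grp antb_eq op_Grp_Grp inv_mult_group)
qed (simp add: antb_outside prd_simps)

text \<open>\<open>S(x_1 k) = S(k) S(x_1)\<close> is needed only below the wrap-around: the factors
  in the coproduct of a basis vector stay in \<open>deg1\<close>, so their exponents never reach
  \<open>r\<close>. A general proof of anti-multiplicativity is thereby avoided.\<close>

lemma antb_X1:
  assumes "k \<in> idx" "Suc (fst k) < r"
  shows "ext (antb p) (bop p p X1 k) = prd p p (antb p k) (sX p X1 g1 (basis e0))"
proof -
  obtain i j g where k: "k = (i, j, g)" by (cases k)
  have ijg: "Suc i < r" "j < r" "g \<in> carrier G" using assms by (simp_all add: k)
  have "keys (sX p X1 g1 (basis e0)) \<subseteq> idx" by (simp add: sX_def keys_op del: op_basis)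
  then show ?thesis using ijg
    by (simp add: k bop_X1 antb_eq prd_op_left prd_sXn prd_e0_left funpow_swap1)
qed

lemma antb_X2:
  assumes "k \<in> idx" "fst k = 0" "Suc (fst (snd k)) < r"
  shows "ext (antb p) (bop p p X2 k) = prd p p (antb p k) (sX p X2 g2 (basis e0))"
proof -
  obtain j g where k: "k = (0, j, g)" using assms by (cases k) auto
  have ijg: "Suc j < r" "g \<in> carrier G" using assms by (simp_all add: k)
  have "keys (sX p X2 g2 (basis e0)) \<subseteq> idx" by (simp add: sX_def keys_op del: op_basis)
  then show ?thesis using ijg
    by (simp add: k bop_X2 antb_eq prd_op_left prd_sXn prd_e0_left funpow_swap1)
qed

definition antl where "antl p z = ext (\<lambda>(k, l). prd p p (antb p k) (basis l)) z"
definition antr where "antr p z = ext (\<lambda>(k, l). prd p p (basis k) (antb p l)) z"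

lemma linear_antl [simp]: "pmlinear (antl p)" and linear_antr [simp]: "pmlinear (antr p)"
  unfolding antl_def antr_def by simp_all

lemma antl_otimes: "antl p (otimes c d) = prd p p (ext (antb p) c) d"
proof -
  have "ext (\<lambda>y. prd p p e (basis y)) d = prd p p e d" for e
    by (rule linear_eq_lext[symmetric]) simp
  then have "antl p (otimes c d) = ext (\<lambda>x. prd p p (antb p x) d) c"
    by (simp add: antl_def pm.lext_otimes)
  also have "\<dots> = prd p p (ext (antb p) c) d"
    by (rule linear_lext_comp[where F = "\<lambda>c. prd p p c d", symmetric]) simp
  finally show ?thesis .
qed

lemma antr_otimes: "antr p (otimes c d) = prd p p c (ext (antb p) d)"
proof -
  have "ext (\<lambda>y. prd p p e (antb p y)) d = prd p p e (ext (antb p) d)" for e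
    by (rule linear_lext_comp[symmetric]) simp
  then have "antr p (otimes c d) = ext (\<lambda>x. prd p p (basis x) (ext (antb p) d)) c"
    by (simp add: antr_def pm.lext_otimes)
  then show ?thesis by (simp add: ext_prd_basis)
qed

text \<open>\<open>S(x k) l + S(g k) (x l) = S(k) (S(x) l + g^-1 x l)\<close>, and
  \<open>S(x) = - g^-1 x\<close>.\<close>

lemma antl_top:
  assumes l: "l \<in> idx" and x: "x = X1 \<and> g = g1 \<or> x = X2 \<and> g = g2"
    and k: "ext (antb p) (bop p p x k) = prd p p (antb p k) (sX p x g (basis e0))"
  shows "antl p (top p p p x (basis (k, l))) = 0"
proof -
  have xg: "x \<in> gens G" "g \<in> carrier G" using x by auto
  have "antl p (top p p p x (basis (k, l))) = prd p p (ext (antb p) (bop p p x k)) (bop p p (Grp \<one>) l) +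
      prd p p (ext (antb p) (bop p p (Grp g) k)) (bop p p x l)"
    using x by (auto simp: top_basis linear_pm_simps[OF linear_antl] antl_otimes)
  also have "bop p p (Grp \<one>) l = basis l"
    using l op_one[of "basis l"] by simp
  also have "prd p p (ext (antb p) (bop p p x k)) (basis l) + prd p p (ext (antb p) (bop p p (Grp g) k)) (bop p p x l)
     = prd p p (antb p k) (prd p p (sX p x g (basis e0)) (basis l) + prd p p (basis (0, 0, inv g)) (bop p p x l))"
    by (simp add: k antb_Grp xg prd_assoc prd_simps)
  also have "prd p p (sX p x g (basis e0)) (basis l) = - op p p (Grp (inv g)) (op p p x (basis l))"
    unfolding sX_def using xg l by (simp add: prd_uminus prd_op_left prd_e0_left del: op_basis)
  finally show ?thesis using xg by (simp add: prd_group prd_simps)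
qed

text \<open>In contrast to \<open>antl_top\<close>, the two terms cancel only when
  \<open>k S(l)\<close>, summed over the coproduct, is a multiple of the unit, since then
  \<open>x + g S(x) = 0\<close> applies. The formula is therefore kept in a form suited to
  induction.\<close>

lemma antr_top:
  assumes k: "k \<in> idx" and x: "x = X1 \<and> g = g1 \<or> x = X2 \<and> g = g2" and l: "l \<in> idx"
    and l': "ext (antb p) (bop p p x l) = prd p p (antb p l) (sX p x g (basis e0))"
  shows "antr p (top p p p x (basis (k, l))) =
    op p p x (antr p (basis (k, l))) + op p p (Grp g) (prd p p (antr p (basis (k, l))) (sX p x g (basis e0)))"
proof -
  have xg: "x \<in> gens G" "g \<in> carrier G" using x by auto
  have "antr p (top p p p x (basis (k, l))) = prd p p (bop p p x k) (ext (antb p) (bop p p (Grp \<one>) l)) +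
      prd p p (bop p p (Grp g) k) (ext (antb p) (bop p p x l))"
    using x by (auto simp: top_basis linear_pm_simps[OF linear_antr] antr_otimes)
  also have "bop p p (Grp \<one>) l = basis l"
    using l op_one[of "basis l"] by simp
  also have "prd p p (bop p p x k) (ext (antb p) (basis l)) = op p p x (prd p p (basis k) (antb p l))"
    using xg by (simp add: prd_op_left flip: op_basis)
  also have "prd p p (bop p p (Grp g) k) (ext (antb p) (bop p p x l)) =
      op p p (Grp g) (prd p p (prd p p (basis k) (antb p l)) (sX p x g (basis e0)))"
    unfolding l' using xg by (simp add: prd_op_left prd_assoc flip: op_basis)
  finally show ?thesis by (simp add: antr_def)
qed

text \<open>The monomial is built up one generator at a time, x_2 before x_1, while the degrees stay
  below \<open>r\<close>. Each step gives 0, the counit of the new monomial; only the right identity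
  needs the induction hypothesis for this.\<close>

lemma antl_copb: "k \<in> idx \<Longrightarrow> antl p (copb k) = scale (epsb k) (basis e0)"
  and antr_copb: "k \<in> idx \<Longrightarrow> antr p (copb k) = scale (epsb k) (basis e0)"
proof -
  have r1: "antl p (top p p p x z) = 0"
    if "x = X1 \<and> g = g1 \<or> x = X2 \<and> g = g2" and
      "\<And>k l. (k, l) \<in> keys z \<Longrightarrow> l \<in> idx \<and> ext (antb p) (bop p p x k) = prd p p (antb p k) (sX p x g (basis e0))" for x g z
  proof (rule linear_eqI[where F = "\<lambda>z. antl p (top p p p x z)" and F' = "\<lambda>z. 0" and s = scale])
    show "pmlinear (\<lambda>z. antl p (top p p p x z))" by (rule linear_comp[OF linear_antl]) simp
    show "pmlinear (\<lambda>z. 0)" by (rule linearI') (simp_all add: pm.vector_space_axioms)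
    show "antl p (top p p p x (basis k)) = 0" if "k \<in> keys z" for k
      using that \<open>\<And>k l. (k, l) \<in> keys z \<Longrightarrow> _\<close> \<open>x = X1 \<and> g = g1 \<or> x = X2 \<and> g = g2\<close>
      by (cases k) (auto intro!: antl_top)
  qed
  have r2: "antr p (top p p p x z) = op p p x (antr p z) + op p p (Grp g) (prd p p (antr p z) (sX p x g (basis e0)))"
    if "x = X1 \<and> g = g1 \<or> x = X2 \<and> g = g2" and
      "\<And>k l. (k, l) \<in> keys z \<Longrightarrow> k \<in> idx \<and> l \<in> idx \<and> ext (antb p) (bop p p x l) = prd p p (antb p l) (sX p x g (basis e0))" for x g z
  proof (rule linear_eqI[where F = "\<lambda>z. antr p (top p p p x z)" and
        F' = "\<lambda>z. op p p x (antr p z) + op p p (Grp g) (prd p p (antr p z) (sX p x g (basis e0)))" and s = scale])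
    show "pmlinear (\<lambda>z. antr p (top p p p x z))" by (rule linear_comp[OF linear_antr]) simp
    show "pmlinear (\<lambda>z. op p p x (antr p z) + op p p (Grp g) (prd p p (antr p z) (sX p x g (basis e0))))"
      by (intro linear_add_pm linear_op_pm linear_comp[OF linear_prd(2)] linear_antr)
    show "antr p (top p p p x (basis k)) = op p p x (antr p (basis k)) +
        op p p (Grp g) (prd p p (antr p (basis k)) (sX p x g (basis e0)))" if "k \<in> keys z" for k
      using that \<open>\<And>k l. (k, l) \<in> keys z \<Longrightarrow> _\<close> \<open>x = X1 \<and> g = g1 \<or> x = X2 \<and> g = g2\<close>
      by (cases k) (auto intro!: antr_top)
  qed
  have r3: "op p p x (scale a (basis e0)) + op p p (Grp g) (prd p p (scale a (basis e0)) (sX p x g (basis e0))) = 0"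
    if "x = X1 \<and> g = g1 \<or> x = X2 \<and> g = g2" for x g a
  proof -
    have "g \<in> carrier G" using that by auto
    moreover have "keys (sX p x g (basis e0)) \<subseteq> idx" by (simp add: sX_def keys_op del: op_basis)
    ultimately have "op p p (Grp g) (prd p p (basis e0) (sX p x g (basis e0))) = - op p p x (basis e0)"
      by (simp add: prd_e0_left) (simp add: sX_def op_uminus op_Grp_Grp op_one keys_op keys_bop)
    then show ?thesis by (simp add: op_simps prd_simps pm.scale_minus_right flip: scale_single[of a e0 1, simplified] del: scale_single op_basis)
  qed
  have main: "antl p (copb k) = scale (epsb k) (basis e0) \<and> antr p (copb k) = scale (epsb k) (basis e0)" if k: "k \<in> idx"
  proof -
    obtain i j g where k': "k = (i, j, g)" by (cases k)
    have ijg: "i < r" "j < r" "g \<in> carrier G" using k by (simp_all add: k')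
    have step: "antl p (copb (i, j, g)) = scale (epsb (i, j, g)) (basis e0) \<and> antr p (copb (i, j, g)) = scale (epsb (i, j, g)) (basis e0)"
      if x: "y = X1 \<and> h = g1 \<or> y = X2 \<and> h = g2"
        and b: "bop p p y k' = basis (i, j, g)" "k' \<in> idx"
        and IH: "antr p (copb k') = scale (epsb k') (basis e0)" and eps: "epsb (i, j, g) = 0"
        and l: "\<And>k l. (k, l) \<in> keys (copb k') \<Longrightarrow> k \<in> idx \<and> l \<in> idx \<and>
           ext (antb p) (bop p p y k) = prd p p (antb p k) (sX p y h (basis e0)) \<and>
           ext (antb p) (bop p p y l) = prd p p (antb p l) (sX p y h (basis e0))"
      for y h k' i j g
    proof -
      have "copb (i, j, g) = cop (op p p y (basis k'))" using b by simp
      also have "\<dots> = top p p p y (copb k')" using x by (auto simp: cop_op[where p' = p] simp del: op_basis)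
      finally have c: "copb (i, j, g) = top p p p y (copb k')" .
      show ?thesis unfolding c eps using r1[OF x, of "copb k'"] r2[OF x, of "copb k'"] r3[OF x] l IH by auto
    qed
    have 0: "antl p (copb (0, j, g)) = scale (epsb (0, j, g)) (basis e0) \<and> antr p (copb (0, j, g)) = scale (epsb (0, j, g)) (basis e0)"
      using ijg(2)
    proof (induction j)
      case 0
      have "antb p (0, 0, g) = basis (0, 0, inv g)" using ijg by (simp add: antb_eq bop_Grp)
      then show ?case using ijg by (simp add: copb_group antl_def antr_def prd_group bop_Grp epsb_def)
    next
      case (Suc j)
      have sub: "keys (copb (0, j, g)) \<subseteq> deg2 j" using keys_copb_deg2[of "(0, j, g)"] Suc ijg by simp
      show ?case
      proof (rule step[of X2 g2 "(0, j, g)"])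
        fix k l assume "(k, l) \<in> keys (copb (0, j, g))"
        then have "(k, l) \<in> deg2 j" using sub by blast
        then show "k \<in> idx \<and> l \<in> idx \<and> ext (antb p) (bop p p X2 k) = prd p p (antb p k) (sX p X2 g2 (basis e0)) \<and>
           ext (antb p) (bop p p X2 l) = prd p p (antb p l) (sX p X2 g2 (basis e0))"
          using Suc by (auto simp: deg2_def intro!: antb_X2)
      qed (use Suc ijg in \<open>auto simp: bop_X2 epsb_def\<close>)
    qed
    have "antl p (copb (i, j, g)) = scale (epsb (i, j, g)) (basis e0) \<and> antr p (copb (i, j, g)) = scale (epsb (i, j, g)) (basis e0)"
      using ijg(1)
    proof (induction i)
      case 0
      show ?case by (rule \<open>antl p (copb (0, j, g)) = _ \<and> _\<close>)
    next
      case (Suc i)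
      have sub: "keys (copb (i, j, g)) \<subseteq> deg1 i" using keys_copb_deg1[of "(i, j, g)"] Suc ijg by simp
      show ?case
      proof (rule step[of X1 g1 "(i, j, g)"])
        fix k l assume "(k, l) \<in> keys (copb (i, j, g))"
        then have "(k, l) \<in> deg1 i" using sub by blast
        then show "k \<in> idx \<and> l \<in> idx \<and> ext (antb p) (bop p p X1 k) = prd p p (antb p k) (sX p X1 g1 (basis e0)) \<and>
           ext (antb p) (bop p p X1 l) = prd p p (antb p l) (sX p X1 g1 (basis e0))"
          using Suc by (auto simp: deg1_def intro!: antb_X1)
      qed (use Suc ijg in \<open>auto simp: bop_X1 epsb_def\<close>)
    qed
    then show ?thesis by (simp add: k')
  qed
  show "k \<in> idx \<Longrightarrow> antl p (copb k) = scale (epsb k) (basis e0)"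
    "k \<in> idx \<Longrightarrow> antr p (copb k) = scale (epsb k) (basis e0)"
    using main by auto
qed

lemma
  assumes "keys c \<subseteq> idx"
  shows antipode_left_pm: "ext (\<lambda>(k, l). prd p p (antb p k) (basis l)) (cop c) = scale (eps c) (basis e0)"
    and antipode_right_pm: "ext (\<lambda>(k, l). prd p p (basis k) (antb p l)) (cop c) = scale (eps c) (basis e0)"
proof -
  have lin: "pmlinear (\<lambda>c. scale (eps c) (basis e0))"
    by (auto intro!: linearI' simp: eps_simps single_add pm.vector_space_axioms)
  have l: "pmlinear (\<lambda>c. antl p (cop c))" "pmlinear (\<lambda>c. antr p (cop c))"
    by (rule linear_comp[OF linear_antl linear_cop], rule linear_comp[OF linear_antr linear_cop])
  have "antl p (cop c) = scale (eps c) (basis e0)"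
    by (rule linear_eqI[OF l(1) lin]) (use assms in \<open>auto simp: antl_copb eps_simps\<close>)
  then show "ext (\<lambda>(k, l). prd p p (antb p k) (basis l)) (cop c) = scale (eps c) (basis e0)"
    by (simp add: antl_def)
  have "antr p (cop c) = scale (eps c) (basis e0)"
    by (rule linear_eqI[OF l(2) lin]) (use assms in \<open>auto simp: antr_copb eps_simps\<close>)
  then show "ext (\<lambda>(k, l). prd p p (basis k) (antb p l)) (cop c) = scale (eps c) (basis e0)"
    by (simp add: antr_def)
qed

end

\<comment> \<open>For the field itself this rule is \<open>a * (b * c) = (a * b) * c\<close>, which loops with \<open>mult.assoc\<close>.\<close>
declare fld.scale_scale [simp del]

section \<open>Linear combinations in modules over the field of scalars\<close>

lemma scalars_simps [simp]: "carrier scalars = UNIV" "mult scalars = (*)" "one scalars = 1"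
  "zero scalars = 0" "add scalars = (+)" "smult scalars = (*)"
  by (simp_all add: scalars_def)

lemma abelian_group_scalars: "abelian_group (scalars :: ('k::field, 'k) module)"
proof (rule abelian_groupI)
  fix x :: 'k
  show "\<exists>y\<in>carrier scalars. y \<oplus>\<^bsub>scalars\<^esub> x = \<zero>\<^bsub>scalars\<^esub>"
    by (rule bexI[of _ "-x"]) simp_all
qed (simp_all add: add_ac)

lemma cring_scalars: "cring (scalars :: ('k::field, 'k) module)"
proof (rule cringI)
  show "comm_monoid (scalars :: ('k, 'k) module)"
    by (rule comm_monoidI) (simp_all add: mult_ac)
qed (simp_all add: abelian_group_scalars distrib_right)

locale kspace =
  fixes U :: "('k::field, 'u, 'm) module_scheme" (structure)
  assumes module_U: "Module.module scalars U"

sublocale kspace \<subseteq> Module.module scalars U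
  by (rule module_U)

context kspace
begin

lemma smult_closed' [simp, intro]: "x \<in> carrier U \<Longrightarrow> c \<odot> x \<in> carrier U"
  using smult_closed[of c x] by simp

lemma smult_left_distrib: "x \<in> carrier U \<Longrightarrow> (a + b) \<odot> x = a \<odot> x \<oplus> b \<odot> x"
  using smult_l_distr[of a b x] by simp

lemma smult_right_distrib: "x \<in> carrier U \<Longrightarrow> y \<in> carrier U \<Longrightarrow> a \<odot> (x \<oplus> y) = a \<odot> x \<oplus> a \<odot> y"
  using smult_r_distr[of a x y] by simp

lemma smult_smult: "x \<in> carrier U \<Longrightarrow> a \<odot> (b \<odot> x) = (a * b) \<odot> x"
  using smult_assoc1[of a b x] by simp

lemma smult_1 [simp]: "x \<in> carrier U \<Longrightarrow> 1 \<odot> x = x"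
  using smult_one[of x] by simp

lemma smult_0 [simp]: "x \<in> carrier U \<Longrightarrow> 0 \<odot> x = \<zero>"
  using smult_l_null[of x] by simp

lemma smult_zero [simp]: "a \<odot> \<zero> = \<zero>"
  using smult_r_null[of a] by simp

end

lemma kspaceI: "Module.module scalars U \<Longrightarrow> kspace U"
  by (simp add: kspace_def)

lemma kspace_scalars: "kspace (scalars :: ('k::field, 'k) module)"
proof (intro kspaceI moduleI)
  show "cring (scalars :: ('k, 'k) module)" by (rule cring_scalars)
  show "abelian_group (scalars :: ('k, 'k) module)" by (rule abelian_group_scalars)
qed (simp_all add: algebra_simps)

text \<open>Counterpart of \<open>lext\<close> for modules with an explicit carrier, such as the
  tensor products and the presented algebras.\<close>

definition lin :: "('k::field, 'u, 'm) module_scheme \<Rightarrow> ('x \<Rightarrow> 'u) \<Rightarrow> ('x \<Rightarrow>\<^sub>0 'k) \<Rightarrow> 'u" where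
  "lin U f c = (\<Oplus>\<^bsub>U\<^esub>x\<in>keys c. lookup c x \<odot>\<^bsub>U\<^esub> f x)"

lemma lin_scalars: "lin scalars f c = fext f c"
proof -
  interpret kspace "scalars :: ('a, 'a) module" by (rule kspace_scalars)
  have "(\<Oplus>\<^bsub>scalars\<^esub>x\<in>S. h x) = (\<Sum>x\<in>S. h x)" if "finite S" for S and h :: "'b \<Rightarrow> 'a"
    using that by induction auto
  then show ?thesis by (simp add: lin_def lext_def)
qed

context kspace
begin

lemma lin_cong: "(\<And>x. x \<in> keys c \<Longrightarrow> f x = f' x) \<Longrightarrow> (\<And>x. x \<in> keys c \<Longrightarrow> f' x \<in> carrier U) \<Longrightarrow> lin U f c = lin U f' c"
  unfolding lin_def by (rule M.finsum_cong') auto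

lemma lin_closed [intro, simp]: "(\<And>x. x \<in> keys c \<Longrightarrow> f x \<in> carrier U) \<Longrightarrow> lin U f c \<in> carrier U"
  unfolding lin_def by (rule M.finsum_closed) auto

lemma lin_eq_finsum:
  assumes "finite S" "keys c \<subseteq> S" "\<And>x. x \<in> S \<Longrightarrow> f x \<in> carrier U"
  shows "lin U f c = (\<Oplus>x\<in>S. lookup c x \<odot> f x)"
  unfolding lin_def
  by (rule M.add.finprod_mono_neutral_cong_left) (use assms in \<open>auto simp: in_keys_iff\<close>)

lemma lin_0 [simp]: "lin U f 0 = \<zero>"
  by (simp add: lin_def)

lemma lin_single [simp]: "f x \<in> carrier U \<Longrightarrow> lin U f (single x a) = a \<odot> f x"
  by (subst lin_eq_finsum[of "{x}"]) auto

lemma lin_add: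
  assumes "\<And>x. x \<in> keys c \<union> keys d \<Longrightarrow> f x \<in> carrier U"
  shows "lin U f (c + d) = lin U f c \<oplus> lin U f d"
proof -
  have "keys (c + d) \<subseteq> keys c \<union> keys d" by (rule Poly_Mapping.keys_add)
  then have "lin U f (c + d) = (\<Oplus>x\<in>keys c \<union> keys d. lookup (c + d) x \<odot> f x)"
    using assms by (intro lin_eq_finsum) auto
  also have "\<dots> = (\<Oplus>x\<in>keys c \<union> keys d. lookup c x \<odot> f x \<oplus> lookup d x \<odot> f x)"
    using assms by (intro M.finsum_cong') (auto simp: lookup_add smult_left_distrib)
  also have "\<dots> = (\<Oplus>x\<in>keys c \<union> keys d. lookup c x \<odot> f x) \<oplus> (\<Oplus>x\<in>keys c \<union> keys d. lookup d x \<odot> f x)"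
    using assms by (intro M.finsum_addf) auto
  also have "\<dots> = lin U f c \<oplus> lin U f d"
    using assms by (subst (1 2) lin_eq_finsum[of "keys c \<union> keys d"]) auto
  finally show ?thesis .
qed

lemma lin_scale:
  assumes "\<And>x. x \<in> keys c \<Longrightarrow> f x \<in> carrier U"
  shows "lin U f (scale a c) = a \<odot> lin U f c"
proof -
  have "lin U f (scale a c) = (\<Oplus>x\<in>keys c. lookup (scale a c) x \<odot> f x)"
    using assms keys_scale_subset[of a c] by (intro lin_eq_finsum) auto
  also have "\<dots> = (\<Oplus>x\<in>keys c. a \<odot> (lookup c x \<odot> f x))"
    using assms by (intro M.finsum_cong') (auto simp: smult_smult)
  also have "\<dots> = a \<odot> lin U f c"
    unfolding lin_def using assms by (intro finsum_smult_ldistr[symmetric]) auto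
  finally show ?thesis .
qed

end

lemma linear_mapD:
  assumes "linear_map V W f"
  shows "x \<in> carrier V \<Longrightarrow> f x \<in> carrier W"
    "x \<in> carrier V \<Longrightarrow> y \<in> carrier V \<Longrightarrow> f (x \<oplus>\<^bsub>V\<^esub> y) = f x \<oplus>\<^bsub>W\<^esub> f y"
    "x \<in> carrier V \<Longrightarrow> f (c \<odot>\<^bsub>V\<^esub> x) = c \<odot>\<^bsub>W\<^esub> f x"
  using assms by (auto simp: linear_map_def)

lemma linear_mapI:
  assumes "\<And>x. x \<in> carrier V \<Longrightarrow> f x \<in> carrier W"
    "\<And>x y. x \<in> carrier V \<Longrightarrow> y \<in> carrier V \<Longrightarrow> f (x \<oplus>\<^bsub>V\<^esub> y) = f x \<oplus>\<^bsub>W\<^esub> f y"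
    "\<And>c x. x \<in> carrier V \<Longrightarrow> f (c \<odot>\<^bsub>V\<^esub> x) = c \<odot>\<^bsub>W\<^esub> f x"
  shows "linear_map V W f"
  using assms by (auto simp: linear_map_def)

lemma linear_map_zero:
  assumes "linear_map V W f" "kspace V" "kspace W"
  shows "f \<zero>\<^bsub>V\<^esub> = \<zero>\<^bsub>W\<^esub>"
proof -
  interpret V: kspace V by fact
  interpret W: kspace W by fact
  have "f (0 \<odot>\<^bsub>V\<^esub> \<zero>\<^bsub>V\<^esub>) = 0 \<odot>\<^bsub>W\<^esub> f \<zero>\<^bsub>V\<^esub>"
    by (rule linear_mapD(3)[OF assms(1)]) simp
  then show ?thesis using linear_mapD(1)[OF assms(1)] by simp
qed

lemma linear_map_lin:
  assumes "linear_map V W F" "kspace V" "kspace W" "\<And>x. x \<in> keys c \<Longrightarrow> f x \<in> carrier V"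
  shows "F (lin V f c) = lin W (\<lambda>x. F (f x)) c"
proof -
  interpret V: kspace V by fact
  interpret W: kspace W by fact
  have "F (\<Oplus>\<^bsub>V\<^esub>x\<in>S. lookup c x \<odot>\<^bsub>V\<^esub> f x) = (\<Oplus>\<^bsub>W\<^esub>x\<in>S. lookup c x \<odot>\<^bsub>W\<^esub> F (f x))"
    if "finite S" "\<And>x. x \<in> S \<Longrightarrow> f x \<in> carrier V" for S
    using that by (induction S)
      (auto simp: linear_map_zero[OF assms(1-3)] linear_mapD[OF assms(1)] Pi_def)
  then show ?thesis using assms(4) by (simp add: lin_def)
qed

lemma bilinear_mapD:
  assumes "bilinear_map V W U f"
  shows "v \<in> carrier V \<Longrightarrow> linear_map W U (f v)" "w \<in> carrier W \<Longrightarrow> linear_map V U (\<lambda>v. f v w)"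
    "v \<in> carrier V \<Longrightarrow> w \<in> carrier W \<Longrightarrow> f v w \<in> carrier U"
  using assms by (auto simp: bilinear_map_def linear_map_def)

lemma bilinear_mapI:
  assumes "\<And>v. v \<in> carrier V \<Longrightarrow> linear_map W U (f v)" "\<And>w. w \<in> carrier W \<Longrightarrow> linear_map V U (\<lambda>v. f v w)"
  shows "bilinear_map V W U f"
  using assms by (auto simp: bilinear_map_def)

lemma linear_map_comp: "linear_map V W f \<Longrightarrow> linear_map U V g \<Longrightarrow> linear_map U W (\<lambda>x. f (g x))"
  by (auto simp: linear_map_def Pi_def)

lemma linear_map_cong:
  assumes "linear_map V U f" "kspace V" "\<And>x. x \<in> carrier V \<Longrightarrow> f x = f' x"
  shows "linear_map V U f'"
proof -
  interpret V: kspace V by fact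
  show ?thesis using assms(1,3) by (auto simp: linear_map_def Pi_def)
qed

lemma linear_map_lin_fun:
  assumes "kspace U" "\<And>k. k \<in> keys c \<Longrightarrow> linear_map V U (\<lambda>x. F x k)"
  shows "linear_map V U (\<lambda>x. lin U (F x) c)"
proof (rule linear_mapI)
  interpret U: kspace U by fact
  fix x y assume x: "x \<in> carrier V" and y: "y \<in> carrier V"
  note F = linear_mapD[OF assms(2)]
  show "lin U (F x) c \<in> carrier U" using F x by auto
  have "lin U (F (x \<oplus>\<^bsub>V\<^esub> y)) c = (\<Oplus>\<^bsub>U\<^esub>k\<in>keys c. lookup c k \<odot>\<^bsub>U\<^esub> F x k \<oplus>\<^bsub>U\<^esub> lookup c k \<odot>\<^bsub>U\<^esub> F y k)"
    unfolding lin_def by (rule U.M.finsum_cong') (use F x y in \<open>auto simp: U.smult_right_distrib\<close>)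
  also have "\<dots> = lin U (F x) c \<oplus>\<^bsub>U\<^esub> lin U (F y) c"
    unfolding lin_def by (rule U.M.finsum_addf) (use F x y in auto)
  finally show "lin U (F (x \<oplus>\<^bsub>V\<^esub> y)) c = lin U (F x) c \<oplus>\<^bsub>U\<^esub> lin U (F y) c" .
next
  interpret U: kspace U by fact
  fix a x assume x: "x \<in> carrier V"
  note F = linear_mapD[OF assms(2)]
  have "lin U (F (a \<odot>\<^bsub>V\<^esub> x)) c = (\<Oplus>\<^bsub>U\<^esub>k\<in>keys c. a \<odot>\<^bsub>U\<^esub> (lookup c k \<odot>\<^bsub>U\<^esub> F x k))"
    unfolding lin_def by (rule U.M.finsum_cong') (use F x in \<open>auto simp: U.smult_smult mult.commute\<close>)
  also have "\<dots> = a \<odot>\<^bsub>U\<^esub> lin U (F x) c"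
    unfolding lin_def by (rule U.finsum_smult_ldistr[symmetric]) (use F x in auto)
  finally show "lin U (F (a \<odot>\<^bsub>V\<^esub> x)) c = a \<odot>\<^bsub>U\<^esub> lin U (F x) c" .
qed

section \<open>Spaces of formal sums and their quotients\<close>

locale formal_space =
  fixes M :: "('k::field, 'x \<Rightarrow>\<^sub>0 'k, 'm) module_scheme"
  assumes add_M [simp]: "add M = (+)" and zero_M [simp]: "zero M = 0" and smult_M [simp]: "smult M = scale"
    and subspace_M: "pm.subspace (carrier M)"
begin

lemma kspace_M: "kspace M"
proof (intro kspaceI moduleI cring_scalars abelian_groupI)
  fix x assume "x \<in> carrier M"
  then show "\<exists>y\<in>carrier M. y \<oplus>\<^bsub>M\<^esub> x = \<zero>\<^bsub>M\<^esub>"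
    by (intro bexI[of _ "- x"]) (auto simp: pm.subspace_neg subspace_M)
qed (auto simp: subspace_M pm.subspace_add pm.subspace_0 pm.subspace_scale algebra_simps pm.scale_left_distrib pm.scale_right_distrib)

sublocale kspace M by (rule kspace_M)

lemma submodule_iff: "submodule N scalars M \<longleftrightarrow> N \<subseteq> carrier M \<and> pm.subspace N"
proof
  assume "submodule N scalars M"
  note * = submoduleE[OF this]
  have "0 \<in> N"
    using * by (metis equals0I pm.scale_zero_left scalars_simps(1) smult_M UNIV_I)
  then show "N \<subseteq> carrier M \<and> pm.subspace N" using * by (auto simp: pm.subspace_def)
next
  assume N: "N \<subseteq> carrier M \<and> pm.subspace N"
  have "\<ominus>\<^bsub>M\<^esub> x = - x" if "x \<in> N" for x
    using N that by (intro M.minus_equality) (auto simp: pm.subspace_neg)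
  then show "submodule N scalars M"
    using N by (intro submoduleI) (auto simp: pm.subspace_neg pm.subspace_0 pm.subspace_add pm.subspace_scale)
qed

end

text \<open>Shared by the two quotients that occur: formal pairs modulo \<open>tensor_null\<close>,
  and the free algebra modulo the ideal of relations.\<close>

locale formal_quotient = formal_space M for M :: "('k::field, 'x \<Rightarrow>\<^sub>0 'k, 'm) module_scheme" +
  fixes N :: "('x \<Rightarrow>\<^sub>0 'k) set"
  assumes N_subset: "N \<subseteq> carrier M" and subspace_N: "pm.subspace N"
begin

abbreviation cls :: "('x \<Rightarrow>\<^sub>0 'k) \<Rightarrow> ('x \<Rightarrow>\<^sub>0 'k) set" where "cls u \<equiv> N +>\<^bsub>M\<^esub> u"

lemma cls_eq_image: "cls u = (\<lambda>n. n + u) ` N"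
  by (auto simp: a_r_coset_def')

lemma mem_cls: "v \<in> cls u \<longleftrightarrow> v - u \<in> N"
  by (auto simp: cls_eq_image image_iff intro: bexI[of _ "v - u"])

lemma cls_eq_iff: "cls u = cls v \<longleftrightarrow> u - v \<in> N"
proof
  assume "cls u = cls v"
  then have "u \<in> cls v" using mem_cls[of u u] by (simp add: pm.subspace_0 subspace_N)
  then show "u - v \<in> N" by (simp add: mem_cls)
next
  assume uv: "u - v \<in> N"
  have "x - u \<in> N \<longleftrightarrow> x - v \<in> N" for x
    using pm.subspace_add[OF subspace_N _ uv, of "x - u"] pm.subspace_diff[OF subspace_N _ uv, of "x - v"] by auto
  then show "cls u = cls v" by (auto simp: mem_cls set_eq_iff)
qed

text \<open>Maps on quotients are computed on a representative chosen by \<open>SOME\<close>; all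
  that is known about it is that it differs from a given one by an element of
  \<open>N\<close>.\<close>

lemma some_mem_cls: "u \<in> carrier M \<Longrightarrow> (SOME v. v \<in> cls u) \<in> carrier M \<and> (SOME v. v \<in> cls u) - u \<in> N"
proof -
  assume u: "u \<in> carrier M"
  have "u \<in> cls u" by (simp add: mem_cls pm.subspace_0 subspace_N)
  then have 1: "(SOME v. v \<in> cls u) - u \<in> N" using someI[of "\<lambda>v. v \<in> cls u" u] by (simp add: mem_cls)
  then have "(SOME v. v \<in> cls u) - u + u \<in> carrier M"
    using N_subset u by (intro pm.subspace_add[OF subspace_M]) auto
  then show ?thesis using 1 by simp
qed

lemma carrier_quotient: "carrier (quotient M N) = cls ` carrier M"
  by (auto simp: quotient_def ring.defs module.defs FactRing_def A_RCOSETS_def')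

lemma mult_quotient: "x \<otimes>\<^bsub>quotient M N\<^esub> y = (\<Union>a\<in>x. \<Union>b\<in>y. cls (a \<otimes>\<^bsub>M\<^esub> b))"
  by (simp add: quotient_def ring.defs module.defs FactRing_def rcoset_mult_def)

lemma one_quotient: "\<one>\<^bsub>quotient M N\<^esub> = cls \<one>\<^bsub>M\<^esub>"
  by (simp add: quotient_def ring.defs module.defs FactRing_def)

lemma zero_quotient: "\<zero>\<^bsub>quotient M N\<^esub> = cls 0"
  by (auto simp: quotient_def ring.defs module.defs FactRing_def cls_eq_image)

lemma add_quotient [simp]: "cls u \<oplus>\<^bsub>quotient M N\<^esub> cls v = cls (u + v)"
proof -
  have "cls u \<oplus>\<^bsub>quotient M N\<^esub> cls v = (\<Union>h\<in>cls u. \<Union>k\<in>cls v. {h + k})"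
    by (simp add: quotient_def ring.defs module.defs FactRing_def set_add_def')
  also have "\<dots> = cls (u + v)"
  proof (intro equalityI subsetI)
    fix x assume "x \<in> (\<Union>h\<in>cls u. \<Union>k\<in>cls v. {h + k})"
    then obtain h k where "h - u \<in> N" "k - v \<in> N" "x = h + k" by (auto simp: mem_cls)
    then show "x \<in> cls (u + v)" using pm.subspace_add[OF subspace_N, of "h - u" "k - v"]
      by (simp add: mem_cls algebra_simps)
  next
    fix x assume "x \<in> cls (u + v)"
    then have "x - v \<in> cls u" "v \<in> cls v" by (auto simp: mem_cls algebra_simps pm.subspace_0 subspace_N)
    then show "x \<in> (\<Union>h\<in>cls u. \<Union>k\<in>cls v. {h + k})" by (intro UN_I[of "x - v"] UN_I[of v]) simp_all
  qed
  finally show ?thesis .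
qed

lemma smult_quotient [simp]: "a \<odot>\<^bsub>quotient M N\<^esub> cls u = cls (scale a u)"
proof -
  have "a \<odot>\<^bsub>quotient M N\<^esub> cls u = (\<Union>x\<in>cls u. cls (scale a x))"
    by (simp add: quotient_def ring.defs module.defs)
  also have "cls (scale a x) = cls (scale a u)" if "x \<in> cls u" for x
    using that pm.subspace_scale[OF subspace_N, of "x - u" a] by (simp add: mem_cls cls_eq_iff pm.scale_right_diff_distrib)
  then have "(\<Union>x\<in>cls u. cls (scale a x)) = (\<Union>x\<in>cls u. cls (scale a u))" by (rule SUP_cong[OF refl])
  also have "\<dots> = cls (scale a u)"
    using mem_cls[of u u] pm.subspace_0[OF subspace_N] by (intro SUP_eq_const) auto
  finally show ?thesis .
qed

lemma kspace_quotient: "kspace (quotient M N)"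
proof (intro kspaceI moduleI cring_scalars abelian_groupI)
  fix x assume "x \<in> carrier (quotient M N)"
  then obtain u where "u \<in> carrier M" "x = cls u" by (auto simp: carrier_quotient)
  then show "\<exists>y\<in>carrier (quotient M N). y \<oplus>\<^bsub>quotient M N\<^esub> x = \<zero>\<^bsub>quotient M N\<^esub>"
    by (intro bexI[of _ "cls (- u)"]) (auto simp: carrier_quotient zero_quotient pm.subspace_neg subspace_M)
qed (auto simp: carrier_quotient zero_quotient subspace_M pm.subspace_add pm.subspace_0 pm.subspace_scale
    algebra_simps pm.scale_left_distrib pm.scale_right_distrib)

lemma cls_closed [intro]: "u \<in> carrier M \<Longrightarrow> cls u \<in> carrier (quotient M N)"
  by (auto simp: carrier_quotient)

lemma linear_cls: "linear_map M (quotient M N) cls"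
  by (rule linear_mapI) auto

lemma mult_cls:
  assumes "u \<in> carrier M" "v \<in> carrier M"
    and "\<And>n w. n \<in> N \<Longrightarrow> w \<in> carrier M \<Longrightarrow> n \<otimes>\<^bsub>M\<^esub> w \<in> N" "\<And>n w. n \<in> N \<Longrightarrow> w \<in> carrier M \<Longrightarrow> w \<otimes>\<^bsub>M\<^esub> n \<in> N"
    and "\<And>x y z. (x + y) \<otimes>\<^bsub>M\<^esub> z = x \<otimes>\<^bsub>M\<^esub> z + y \<otimes>\<^bsub>M\<^esub> z" "\<And>x y z. z \<otimes>\<^bsub>M\<^esub> (x + y) = z \<otimes>\<^bsub>M\<^esub> x + z \<otimes>\<^bsub>M\<^esub> y"
  shows "cls u \<otimes>\<^bsub>quotient M N\<^esub> cls v = cls (u \<otimes>\<^bsub>M\<^esub> v)"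
proof -
  have "cls (a \<otimes>\<^bsub>M\<^esub> b) = cls (u \<otimes>\<^bsub>M\<^esub> v)" if "a \<in> cls u" "b \<in> cls v" for a b
  proof -
    have a: "a - u \<in> N" and b: "b - v \<in> N" using that by (auto simp: mem_cls)
    then have "b - v + v \<in> carrier M" using assms(2) N_subset by (intro pm.subspace_add[OF subspace_M]) auto
    then have "(a - u) \<otimes>\<^bsub>M\<^esub> b + u \<otimes>\<^bsub>M\<^esub> (b - v) \<in> N"
      using assms(1,3,4) a b by (intro pm.subspace_add[OF subspace_N]) auto
    moreover have "a \<otimes>\<^bsub>M\<^esub> b = (a - u) \<otimes>\<^bsub>M\<^esub> b + u \<otimes>\<^bsub>M\<^esub> b" using assms(5)[of "a - u" u b] by simp
    moreover have "u \<otimes>\<^bsub>M\<^esub> b = u \<otimes>\<^bsub>M\<^esub> (b - v) + u \<otimes>\<^bsub>M\<^esub> v" using assms(6)[of u "b - v" v] by simp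
    ultimately show ?thesis by (simp add: cls_eq_iff)
  qed
  moreover have "u \<in> cls u" "v \<in> cls v" by (auto simp: mem_cls pm.subspace_0 subspace_N)
  ultimately show ?thesis unfolding mult_quotient by blast
qed

end

section \<open>Tensor products of modules\<close>

lemma formal_pairs_simps [simp]: "add (formal_pairs V W) = (+)" "zero (formal_pairs V W) = 0"
  "smult (formal_pairs V W) = scale" "one (formal_pairs V W) = basis (\<one>\<^bsub>V\<^esub>, \<one>\<^bsub>W\<^esub>)"
  "carrier (formal_pairs V W) = {u. keys u \<subseteq> carrier V \<times> carrier W}"
  by (simp_all add: formal_pairs_def)

lemma subspace_keys: "pm.subspace {u :: 'x \<Rightarrow>\<^sub>0 'k::field. keys u \<subseteq> S}"
proof -
  have "keys (x + y) \<subseteq> S" if "keys x \<subseteq> S" "keys y \<subseteq> S" for x y :: "'x \<Rightarrow>\<^sub>0 'k"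
    by (rule order.trans[OF Poly_Mapping.keys_add Un_least[OF that]])
  moreover have "keys (scale a x) \<subseteq> S" if "keys x \<subseteq> S" for a and x :: "'x \<Rightarrow>\<^sub>0 'k"
    by (rule order.trans[OF keys_scale_subset that])
  ultimately show ?thesis by (simp add: pm.subspace_def)
qed

definition tcls :: "('k::field, 'a, 'm) module_scheme \<Rightarrow> ('k, 'b, 'n) module_scheme \<Rightarrow>
    (('a \<times> 'b) \<Rightarrow>\<^sub>0 'k) \<Rightarrow> (('a \<times> 'b) \<Rightarrow>\<^sub>0 'k) set" where
  "tcls V W u = tensor_null V W +>\<^bsub>formal_pairs V W\<^esub> u"

lemma pure_eq_tcls: "pure V W v w = tcls V W (basis (v, w))"
  by (simp add: pure_def tcls_def)

locale tensor_pair = V: kspace V + W: kspace W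
  for V :: "('k::field, 'a, 'm) module_scheme" and W :: "('k, 'b, 'n) module_scheme"
begin

sublocale FP: formal_space "formal_pairs V W"
  by unfold_locales (simp_all add: subspace_keys)

lemma keys_single2: "v \<in> carrier V \<Longrightarrow> w \<in> carrier W \<Longrightarrow> single (v, w) a \<in> carrier (formal_pairs V W)"
  by simp

lemma tensor_relators_subset: "tensor_relators V W \<subseteq> carrier (formal_pairs V W)"
proof -
  have "x - y \<in> carrier (formal_pairs V W)"
    if "x \<in> carrier (formal_pairs V W)" "y \<in> carrier (formal_pairs V W)" for x y
    using that by (rule pm.subspace_diff[OF FP.subspace_M])
  then show ?thesis
    unfolding tensor_relators_def using keys_single2
    by (auto simp del: formal_pairs_simps(5))
qed

lemma tensor_relators_cases:
  assumes "x \<in> tensor_relators V W"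
  obtains (1) v v' w where "v \<in> carrier V" "v' \<in> carrier V" "w \<in> carrier W"
        "x = basis (v \<oplus>\<^bsub>V\<^esub> v', w) - (basis (v, w) + basis (v', w))"
      | (2) v w w' where "v \<in> carrier V" "w \<in> carrier W" "w' \<in> carrier W"
        "x = basis (v, w \<oplus>\<^bsub>W\<^esub> w') - (basis (v, w) + basis (v, w'))"
      | (3) c v w where "v \<in> carrier V" "w \<in> carrier W" "x = basis (c \<odot>\<^bsub>V\<^esub> v, w) - single (v, w) c"
      | (4) c v w where "v \<in> carrier V" "w \<in> carrier W" "x = basis (v, c \<odot>\<^bsub>W\<^esub> w) - single (v, w) c"
  using assms unfolding tensor_relators_def diff_diff_eq by (elim UnE CollectE exE conjE) metis+

lemma tensor_relatorsI:
  "v \<in> carrier V \<Longrightarrow> v' \<in> carrier V \<Longrightarrow> w \<in> carrier W \<Longrightarrow>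
    basis (v \<oplus>\<^bsub>V\<^esub> v', w) - (basis (v, w) + basis (v', w)) \<in> tensor_relators V W"
  "v \<in> carrier V \<Longrightarrow> w \<in> carrier W \<Longrightarrow> w' \<in> carrier W \<Longrightarrow>
    basis (v, w \<oplus>\<^bsub>W\<^esub> w') - (basis (v, w) + basis (v, w')) \<in> tensor_relators V W"
  "v \<in> carrier V \<Longrightarrow> w \<in> carrier W \<Longrightarrow> basis (c \<odot>\<^bsub>V\<^esub> v, w) - single (v, w) c \<in> tensor_relators V W"
  "v \<in> carrier V \<Longrightarrow> w \<in> carrier W \<Longrightarrow> basis (v, c \<odot>\<^bsub>W\<^esub> w) - single (v, w) c \<in> tensor_relators V W"
  unfolding tensor_relators_def diff_diff_eq by blast+

lemma
  shows tensor_null_subset: "tensor_null V W \<subseteq> carrier (formal_pairs V W)"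
    and subspace_tensor_null: "pm.subspace (tensor_null V W)"
    and tensor_relators_null: "tensor_relators V W \<subseteq> tensor_null V W"
    and tensor_null_least: "\<And>N. N \<subseteq> carrier (formal_pairs V W) \<Longrightarrow> pm.subspace N \<Longrightarrow> tensor_relators V W \<subseteq> N \<Longrightarrow> tensor_null V W \<subseteq> N"
proof -
  have eq: "tensor_null V W = \<Inter>{N. (N \<subseteq> carrier (formal_pairs V W) \<and> pm.subspace N) \<and> tensor_relators V W \<subseteq> N}"
    unfolding tensor_null_def FP.submodule_iff ..
  have "carrier (formal_pairs V W) \<in> {N. (N \<subseteq> carrier (formal_pairs V W) \<and> pm.subspace N) \<and> tensor_relators V W \<subseteq> N}"
    using FP.subspace_M tensor_relators_subset by blast
  then show "tensor_null V W \<subseteq> carrier (formal_pairs V W)" unfolding eq by (rule Inter_lower)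
  show "pm.subspace (tensor_null V W)" unfolding eq by (rule pm.subspace_Inter) auto
  show "tensor_relators V W \<subseteq> tensor_null V W" unfolding eq by blast
  show "tensor_null V W \<subseteq> N" if "N \<subseteq> carrier (formal_pairs V W)" "pm.subspace N" "tensor_relators V W \<subseteq> N" for N
    unfolding eq using that by blast
qed

sublocale T: formal_quotient "formal_pairs V W" "tensor_null V W"
  by unfold_locales (rule tensor_null_subset subspace_tensor_null)+

lemma kspace_tensor: "kspace (tensor V W)"
  unfolding tensor_def by (rule T.kspace_quotient)

lemma tcls_closed: "keys u \<subseteq> carrier V \<times> carrier W \<Longrightarrow> tcls V W u \<in> carrier (tensor V W)"
  unfolding tensor_def tcls_def by (rule T.cls_closed) simp

lemma tcls_simps: "tcls V W u \<oplus>\<^bsub>tensor V W\<^esub> tcls V W v = tcls V W (u + v)"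
  "a \<odot>\<^bsub>tensor V W\<^esub> tcls V W u = tcls V W (scale a u)"
  by (simp_all add: tensor_def tcls_def)

lemma tcls_one: "\<one>\<^bsub>tensor V W\<^esub> = tcls V W (basis (\<one>\<^bsub>V\<^esub>, \<one>\<^bsub>W\<^esub>))"
  by (simp add: tensor_def tcls_def T.one_quotient)

lemma linear_tcls: "linear_map (formal_pairs V W) (tensor V W) (tcls V W)"
  unfolding tensor_def using T.linear_cls by (simp add: tcls_def[abs_def])

text \<open>The formal sums on which the induced map vanishes form a subspace that contains the
  relators, and \<open>tensor_null\<close> is the least such subspace.\<close>

lemma lin_bilinear_null:
  assumes U: "kspace U" and f: "bilinear_map V W U f" and n: "n \<in> tensor_null V W"
  shows "lin U (\<lambda>p. f (fst p) (snd p)) n = \<zero>\<^bsub>U\<^esub>"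
proof -
  interpret U: kspace U by fact
  let ?F = "lin U (\<lambda>p. f (fst p) (snd p))"
  let ?N = "{u \<in> carrier (formal_pairs V W). ?F u = \<zero>\<^bsub>U\<^esub>}"
  note f1 = bilinear_mapD(1)[OF f] and f2 = bilinear_mapD(2)[OF f] and f3 = bilinear_mapD(3)[OF f]
  have add: "?F (x + y) = ?F x \<oplus>\<^bsub>U\<^esub> ?F y" if "x \<in> carrier (formal_pairs V W)" "y \<in> carrier (formal_pairs V W)" for x y
    using that by (intro U.lin_add) (auto intro!: f3)
  have scl: "?F (scale a x) = a \<odot>\<^bsub>U\<^esub> ?F x" if "x \<in> carrier (formal_pairs V W)" for a x
    using that by (intro U.lin_scale) (auto intro!: f3)
  have cl: "?F x \<in> carrier U" if "x \<in> carrier (formal_pairs V W)" for x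
    using that by (intro U.lin_closed) (auto intro!: f3)
  have sub: "pm.subspace ?N"
    using FP.subspace_M by (auto simp: pm.subspace_def add scl simp del: formal_pairs_simps)
  have N: "x - y \<in> ?N" if "x \<in> carrier (formal_pairs V W)" "y \<in> carrier (formal_pairs V W)" "?F x = ?F y" for x y
  proof -
    have "?F (x + scale (-1) y) = ?F x \<oplus>\<^bsub>U\<^esub> ?F (scale (-1) y)"
      by (rule add[OF that(1) pm.subspace_scale[OF FP.subspace_M that(2)]])
    also have "\<dots> = ?F x \<oplus>\<^bsub>U\<^esub> (-1) \<odot>\<^bsub>U\<^esub> ?F y" by (simp only: scl[OF that(2)])
    also have "\<dots> = 1 \<odot>\<^bsub>U\<^esub> ?F y \<oplus>\<^bsub>U\<^esub> (-1) \<odot>\<^bsub>U\<^esub> ?F y" using that cl by simp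
    also have "\<dots> = (1 + - 1) \<odot>\<^bsub>U\<^esub> ?F y" by (rule U.smult_left_distrib[symmetric]) (rule cl[OF that(2)])
    also have "\<dots> = \<zero>\<^bsub>U\<^esub>" using cl[OF that(2)] by simp
    finally have "?F (x - y) = \<zero>\<^bsub>U\<^esub>" by simp
    then show ?thesis using that pm.subspace_diff[OF FP.subspace_M] by auto
  qed
  have F: "?F (single (v, w) a) = a \<odot>\<^bsub>U\<^esub> f v w" if "v \<in> carrier V" "w \<in> carrier W" for v w a
    using f3[OF that] by simp
  have "tensor_relators V W \<subseteq> ?N"
  proof
    fix x assume "x \<in> tensor_relators V W"
    then show "x \<in> ?N"
    proof (cases rule: tensor_relators_cases)
      case (1 v v' w)
      have "basis (v, w) + basis (v', w) \<in> carrier (formal_pairs V W)"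
        using 1 by (intro pm.subspace_add[OF FP.subspace_M]) simp_all
      then show ?thesis unfolding 1(4)
        by (rule N[rotated]; (subst add)?; use 1 in \<open>simp add: F f3 linear_mapD[OF f2]\<close>)
    next
      case (2 v w w')
      have "basis (v, w) + basis (v, w') \<in> carrier (formal_pairs V W)"
        using 2 by (intro pm.subspace_add[OF FP.subspace_M]) simp_all
      then show ?thesis unfolding 2(4)
        by (rule N[rotated]; (subst add)?; use 2 in \<open>simp add: F f3 linear_mapD[OF f1]\<close>)
    next
      case (3 c v w)
      show ?thesis unfolding 3(3)
        by (rule N) (use 3 in \<open>auto simp: F f3 linear_mapD[OF f2]\<close>)
    next
      case (4 c v w)
      show ?thesis unfolding 4(3)
        by (rule N) (use 4 in \<open>auto simp: F f3 linear_mapD[OF f1]\<close>)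
    qed
  qed
  then have "tensor_null V W \<subseteq> ?N" by (intro tensor_null_least sub) auto
  then show ?thesis using n by auto
qed

text \<open>For bilinear \<open>f\<close> the choice inside \<open>tensor_lift\<close> does not
  matter, so Sweedler sums may be computed on any convenient formal sum.\<close>

lemma tensor_lift_tcls:
  assumes U: "kspace U" and f: "bilinear_map V W U f" and u: "keys u \<subseteq> carrier V \<times> carrier W"
  shows "tensor_lift U f (tcls V W u) = lin U (\<lambda>p. f (fst p) (snd p)) u"
proof -
  interpret U: kspace U by fact
  let ?F = "lin U (\<lambda>p. f (fst p) (snd p))"
  define v where "v = (SOME v. v \<in> tcls V W u)"
  have v: "v - u \<in> tensor_null V W"
    using T.some_mem_cls[of u] u by (simp add: v_def tcls_def)
  then have "keys (v - u) \<subseteq> carrier V \<times> carrier W" using tensor_null_subset by auto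
  then have "?F ((v - u) + u) = ?F (v - u) \<oplus>\<^bsub>U\<^esub> ?F u"
    using u by (intro U.lin_add) (auto intro!: bilinear_mapD(3)[OF f])
  also have "\<dots> = ?F u"
  proof -
    have "?F u \<in> carrier U" using u by (intro U.lin_closed) (auto intro!: bilinear_mapD(3)[OF f])
    then show ?thesis by (simp add: lin_bilinear_null[OF U f v])
  qed
  finally show ?thesis by (simp add: tensor_lift_def v_def lin_def Let_def)
qed

lemma bilinear_pure: "bilinear_map V W (tensor V W) (pure V W)"
proof -
  have rel: "tcls V W x = tcls V W y" if "x - y \<in> tensor_relators V W" for x y
    using that tensor_relators_null by (auto simp: tcls_def T.cls_eq_iff)
  show ?thesis
    by (intro bilinear_mapI linear_mapI)
      (simp_all only: pure_eq_tcls tcls_simps tensor_relatorsI[THEN rel] scale_single mult_1_right,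
      simp_all add: tcls_closed)
qed

lemma tcls_ext:
  assumes "\<And>x. x \<in> keys c \<Longrightarrow> keys (f x) \<subseteq> carrier V \<times> carrier W"
  shows "tcls V W (ext f c) = lin (tensor V W) (\<lambda>x. tcls V W (f x)) c"
proof -
  have "lin (formal_pairs V W) f c = ext f c"
  proof -
    have "(\<Oplus>\<^bsub>formal_pairs V W\<^esub>x\<in>S. h x) = (\<Sum>x\<in>S. h x)"
      if "finite S" "\<And>x. x \<in> S \<Longrightarrow> h x \<in> carrier (formal_pairs V W)" for S and h :: "'c \<Rightarrow> _"
      using that by (induction) (auto simp: Pi_def FP.M.finsum_insert[simplified])
    moreover have "keys (scale (lookup c x) (f x)) \<subseteq> carrier V \<times> carrier W" if "x \<in> keys c" for x
      by (rule order.trans[OF keys_scale_subset assms[OF that]])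
    ultimately show ?thesis by (simp add: lin_def lext_def)
  qed
  then show ?thesis
    using linear_map_lin[OF linear_tcls FP.kspace_M kspace_tensor, of c f] assms by simp
qed

end

lemma lin_ext:
  assumes "kspace U" "\<And>y. f y \<in> carrier U"
  shows "lin U f (ext g c) = lin U (\<lambda>x. lin U f (g x)) c"
proof -
  interpret kspace U by fact
  show ?thesis
  proof (induction c rule: poly_mapping_ext_induct)
    case (single x a)
    then show ?case using assms(2) by (simp add: lin_scale)
  next
    case (add c d)
    then show ?case using assms(2) by (simp add: lin_add pm.lext_add)
  qed simp
qed

lemma (in kspace) tensor_pair_self: "tensor_pair U U"
  by (simp add: tensor_pair_def kspace_axioms)

section \<open>Multiplication in tensor squares\<close>

locale kalgebra = kspace A + ring A for A :: "('k::field, 'a, 'm) module_scheme" (structure) +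
  assumes smult_mult_left: "\<lbrakk>x \<in> carrier A; y \<in> carrier A\<rbrakk> \<Longrightarrow> (c \<odot> x) \<otimes> y = c \<odot> (x \<otimes> y)"
    and smult_mult_right: "\<lbrakk>x \<in> carrier A; y \<in> carrier A\<rbrakk> \<Longrightarrow> x \<otimes> (c \<odot> y) = c \<odot> (x \<otimes> y)"
begin

sublocale TP: tensor_pair A A by (rule tensor_pair_self)

lemma mult_formal_pairs:
  "u \<otimes>\<^bsub>formal_pairs A A\<^esub> v = ext (\<lambda>p. ext (\<lambda>p'. basis (fst p \<otimes> fst p', snd p \<otimes> snd p')) v) u"
  by (simp add: formal_pairs_def lext_def pm.scale_sum_right)

text \<open>\<phi> \<otimes> \<psi> sends relators to relators. With \<phi> and \<psi>
  multiplications by fixed elements, this makes the null space a two-sided ideal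
  (\<open>tensor_null_mult\<close>).\<close>

lemma tensor_null_map:
  assumes "linear_map A A \<phi>" "linear_map A A \<psi>" "n \<in> tensor_null A A"
  shows "ext (\<lambda>p. basis (\<phi> (fst p), \<psi> (snd p))) n \<in> tensor_null A A" (is "?L n \<in> _")
proof -
  let ?N = "{n \<in> carrier (formal_pairs A A). ?L n \<in> tensor_null A A}"
  have "pm.subspace ?N"
    using TP.FP.subspace_M TP.subspace_tensor_null
    by (auto simp: pm.subspace_def pm.lext_add pm.lext_scale simp del: formal_pairs_simps(5))
  moreover have "?L ` tensor_relators A A \<subseteq> tensor_relators A A"
  proof
    fix y assume "y \<in> ?L ` tensor_relators A A"
    then obtain x where x: "x \<in> tensor_relators A A" and y: "y = ?L x" by auto
    note l1 = linear_mapD[OF assms(1)] and l2 = linear_mapD[OF assms(2)]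
    from x show "y \<in> tensor_relators A A"
    proof (cases rule: TP.tensor_relators_cases)
      case (1 v v' w)
      have "y = basis (\<phi> v \<oplus> \<phi> v', \<psi> w) - (basis (\<phi> v, \<psi> w) + basis (\<phi> v', \<psi> w))"
        using 1 by (simp add: y pm.lext_diff pm.lext_add l1)
      then show ?thesis using 1 by (simp add: TP.tensor_relatorsI l1(1) l2(1))
    next
      case (2 v w w')
      have "y = basis (\<phi> v, \<psi> w \<oplus> \<psi> w') - (basis (\<phi> v, \<psi> w) + basis (\<phi> v, \<psi> w'))"
        using 2 by (simp add: y pm.lext_diff pm.lext_add l2)
      then show ?thesis using 2 by (simp add: TP.tensor_relatorsI l1(1) l2(1))
    next
      case (3 c v w)
      have "y = basis (c \<odot> \<phi> v, \<psi> w) - single (\<phi> v, \<psi> w) c"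
        using 3 by (simp add: y pm.lext_diff pm.lext_add l1)
      then show ?thesis using 3 by (simp add: TP.tensor_relatorsI l1(1) l2(1))
    next
      case (4 c v w)
      have "y = basis (\<phi> v, c \<odot> \<psi> w) - single (\<phi> v, \<psi> w) c"
        using 4 by (simp add: y pm.lext_diff pm.lext_add l2)
      then show ?thesis using 4 by (simp add: TP.tensor_relatorsI l1(1) l2(1))
    qed
  qed
  then have "tensor_relators A A \<subseteq> ?N"
    using TP.tensor_relators_subset TP.tensor_relators_null by blast
  ultimately have "tensor_null A A \<subseteq> ?N" by (intro TP.tensor_null_least) auto
  then show ?thesis using assms(3) by auto
qed

lemma ext_mem_subspace: "pm.subspace N \<Longrightarrow> (\<And>x. x \<in> keys c \<Longrightarrow> f x \<in> N) \<Longrightarrow> ext f c \<in> N"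
  unfolding lext_def by (intro pm.subspace_sum pm.subspace_scale)

lemma tensor_null_mult:
  assumes "n \<in> tensor_null A A" "w \<in> carrier (formal_pairs A A)"
  shows "n \<otimes>\<^bsub>formal_pairs A A\<^esub> w \<in> tensor_null A A" "w \<otimes>\<^bsub>formal_pairs A A\<^esub> n \<in> tensor_null A A"
proof -
  have p: "fst p \<in> carrier A" "snd p \<in> carrier A" if "p \<in> keys w" for p
    using that assms(2) by auto
  have l: "linear_map A A (\<lambda>x. x \<otimes> a)" "linear_map A A (\<lambda>x. a \<otimes> x)" if "a \<in> carrier A" for a
    using that by (auto intro!: linear_mapI simp: l_distr r_distr smult_mult_left smult_mult_right)
  show "n \<otimes>\<^bsub>formal_pairs A A\<^esub> w \<in> tensor_null A A"
    unfolding mult_formal_pairs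
    by (subst pm.lext_swap) (intro ext_mem_subspace TP.subspace_tensor_null tensor_null_map l p assms(1))
  show "w \<otimes>\<^bsub>formal_pairs A A\<^esub> n \<in> tensor_null A A"
    unfolding mult_formal_pairs
    by (intro ext_mem_subspace TP.subspace_tensor_null tensor_null_map l p assms(1))
qed

lemma tcls_mult:
  assumes "u \<in> carrier (formal_pairs A A)" "v \<in> carrier (formal_pairs A A)"
  shows "tcls A A u \<otimes>\<^bsub>tensor A A\<^esub> tcls A A v =
    tcls A A (ext (\<lambda>p. ext (\<lambda>p'. basis (fst p \<otimes> fst p', snd p \<otimes> snd p')) v) u)"
  unfolding tcls_def tensor_def mult_formal_pairs[symmetric]
  by (rule TP.T.mult_cls[OF assms tensor_null_mult])
    (simp_all add: mult_formal_pairs pm.lext_add pm.lext_fun_add)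

end

section \<open>Hopf algebras with the given structure constants\<close>

text \<open>A structure \<open>R\<close> identified by the coordinates \<kappa> with C(p, p). The
  presented algebras and the twist are both of this kind, so that the Hopf axioms and the
  isomorphism are proved once. Coordinates are unique only among sums supported in
  \<open>idx\<close>; the other basis vectors go to 0.\<close>

locale quantum_plane_model = quantum_plane G g1 g2 \<chi>1 \<chi>2 q r
  for G :: "('g, 'm) monoid_scheme" (structure) and g1 g2 :: 'g and \<chi>1 \<chi>2 :: "'g \<Rightarrow> 'k::field"
    and q r +
  fixes p :: "'k params" and R :: "('k, 'a, 'n) hopf_scheme" and \<kappa> :: "('g, 'k) formal \<Rightarrow> 'a"
  assumes kap_closed [simp, intro]: "\<kappa> c \<in> carrier R"
    and kap_surj: "x \<in> carrier R \<Longrightarrow> \<exists>c. keys c \<subseteq> idx \<and> \<kappa> c = x"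
    and kap_inj: "keys c \<subseteq> idx \<Longrightarrow> keys d \<subseteq> idx \<Longrightarrow> \<kappa> c = \<kappa> d \<Longrightarrow> c = d"
    and kap_outside: "k \<notin> idx \<Longrightarrow> \<kappa> (basis k) = \<zero>\<^bsub>R\<^esub>"
    and kap_add: "\<kappa> (c + d) = \<kappa> c \<oplus>\<^bsub>R\<^esub> \<kappa> d"
    and kap_scale: "\<kappa> (scale a c) = a \<odot>\<^bsub>R\<^esub> \<kappa> c"
    and kap_zero: "\<kappa> 0 = \<zero>\<^bsub>R\<^esub>"
    and kap_mult: "keys c \<subseteq> idx \<Longrightarrow> keys d \<subseteq> idx \<Longrightarrow> \<kappa> c \<otimes>\<^bsub>R\<^esub> \<kappa> d = \<kappa> (prd p p c d)"
    and kap_one: "\<one>\<^bsub>R\<^esub> = \<kappa> (basis e0)"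
    and comult_kap: "keys c \<subseteq> idx \<Longrightarrow>
       comult R (\<kappa> c) = tcls R R (ext (\<lambda>(k, l). basis (\<kappa> (basis k), \<kappa> (basis l))) (cop c))"
    and counit_kap: "keys c \<subseteq> idx \<Longrightarrow> counit R (\<kappa> c) = eps c"
begin

lemma kap_cases:
  assumes "x \<in> carrier R"
  obtains c where "keys c \<subseteq> idx" "x = \<kappa> c"
  using kap_surj[OF assms] by auto

lemma abelian_group_R: "abelian_group R"
proof (rule abelian_groupI)
  fix x assume "x \<in> carrier R"
  then obtain c where c: "x = \<kappa> c" by (rule kap_cases)
  show "\<exists>y\<in>carrier R. y \<oplus>\<^bsub>R\<^esub> x = \<zero>\<^bsub>R\<^esub>"
    by (rule bexI[of _ "\<kappa> (- c)"]) (simp_all add: c kap_zero flip: kap_add)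
next
  fix x y z assume "x \<in> carrier R" "y \<in> carrier R" "z \<in> carrier R"
  then obtain c d e where "x = \<kappa> c" "y = \<kappa> d" "z = \<kappa> e" by (metis kap_surj)
  then show "(x \<oplus>\<^bsub>R\<^esub> y) \<oplus>\<^bsub>R\<^esub> z = x \<oplus>\<^bsub>R\<^esub> (y \<oplus>\<^bsub>R\<^esub> z)"
    by (simp add: add.assoc flip: kap_add)
next
  fix x y assume "x \<in> carrier R" "y \<in> carrier R"
  then obtain c d where cd: "x = \<kappa> c" "y = \<kappa> d" by (metis kap_surj)
  show "x \<oplus>\<^bsub>R\<^esub> y \<in> carrier R" "x \<oplus>\<^bsub>R\<^esub> y = y \<oplus>\<^bsub>R\<^esub> x"
    by (simp_all add: cd add.commute flip: kap_add)
next
  fix x assume "x \<in> carrier R"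
  then obtain c where "x = \<kappa> c" by (rule kap_cases)
  then show "\<zero>\<^bsub>R\<^esub> \<oplus>\<^bsub>R\<^esub> x = x" by (simp flip: kap_add kap_zero)
qed (simp flip: kap_zero)

lemma keys_add_idx: "keys c \<subseteq> idx \<Longrightarrow> keys d \<subseteq> idx \<Longrightarrow> keys (c + d) \<subseteq> idx"
  by (rule order.trans[OF Poly_Mapping.keys_add Un_least])

lemma keys_scale_idx: "keys c \<subseteq> idx \<Longrightarrow> keys (scale a c) \<subseteq> idx"
  by (rule order.trans[OF keys_scale_subset])

sublocale R: kalgebra R
proof (unfold kalgebra_def kalgebra_axioms_def, intro conjI allI impI)
  show ring_R: "ring R"
  proof (rule ringI[OF abelian_group_R])
    show "Group.monoid R"
    proof (rule monoidI)
      fix x y z assume "x \<in> carrier R" "y \<in> carrier R" "z \<in> carrier R"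
      then obtain c d e where "x = \<kappa> c" "y = \<kappa> d" "z = \<kappa> e" "keys c \<subseteq> idx" "keys d \<subseteq> idx" "keys e \<subseteq> idx"
        by (metis kap_surj)
      then show "(x \<otimes>\<^bsub>R\<^esub> y) \<otimes>\<^bsub>R\<^esub> z = x \<otimes>\<^bsub>R\<^esub> (y \<otimes>\<^bsub>R\<^esub> z)"
        by (simp add: kap_mult keys_prd prd_assoc)
    next
      fix x y assume "x \<in> carrier R" "y \<in> carrier R"
      then obtain c d where "x = \<kappa> c" "y = \<kappa> d" "keys c \<subseteq> idx" "keys d \<subseteq> idx" by (metis kap_surj)
      then show "x \<otimes>\<^bsub>R\<^esub> y \<in> carrier R" by (simp add: kap_mult)
    next
      fix x assume "x \<in> carrier R"
      then obtain c where "x = \<kappa> c" "keys c \<subseteq> idx" by (metis kap_surj)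
      then show "\<one>\<^bsub>R\<^esub> \<otimes>\<^bsub>R\<^esub> x = x" "x \<otimes>\<^bsub>R\<^esub> \<one>\<^bsub>R\<^esub> = x"
        by (simp_all add: kap_one kap_mult prd_e0_left prd_e0_right)
    qed (simp add: kap_one)
  next
    fix x y z assume "x \<in> carrier R" "y \<in> carrier R" "z \<in> carrier R"
    then obtain c d e where "x = \<kappa> c" "y = \<kappa> d" "z = \<kappa> e" "keys c \<subseteq> idx" "keys d \<subseteq> idx" "keys e \<subseteq> idx"
      by (metis kap_surj)
    then show "(x \<oplus>\<^bsub>R\<^esub> y) \<otimes>\<^bsub>R\<^esub> z = x \<otimes>\<^bsub>R\<^esub> z \<oplus>\<^bsub>R\<^esub> y \<otimes>\<^bsub>R\<^esub> z" "z \<otimes>\<^bsub>R\<^esub> (x \<oplus>\<^bsub>R\<^esub> y) = z \<otimes>\<^bsub>R\<^esub> x \<oplus>\<^bsub>R\<^esub> z \<otimes>\<^bsub>R\<^esub> y"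
      by (simp_all add: kap_mult keys_add_idx prd_simps flip: kap_add)
  qed
  show "kspace R"
  proof (rule kspaceI, rule moduleI[OF cring_scalars abelian_group_R])
    fix a b x y assume "x \<in> carrier R" "y \<in> carrier R"
    then obtain c d where "x = \<kappa> c" "y = \<kappa> d" "keys c \<subseteq> idx" "keys d \<subseteq> idx" by (metis kap_surj)
    then show "a \<odot>\<^bsub>R\<^esub> (x \<oplus>\<^bsub>R\<^esub> y) = a \<odot>\<^bsub>R\<^esub> x \<oplus>\<^bsub>R\<^esub> a \<odot>\<^bsub>R\<^esub> y"
      by (simp add: pm.scale_right_distrib flip: kap_scale kap_add)
  next
    fix a b x assume "x \<in> carrier R"
    then obtain c where "x = \<kappa> c" by (rule kap_cases)
    then show "a \<odot>\<^bsub>R\<^esub> x \<in> carrier R" "(a \<oplus>\<^bsub>scalars\<^esub> b) \<odot>\<^bsub>R\<^esub> x = a \<odot>\<^bsub>R\<^esub> x \<oplus>\<^bsub>R\<^esub> b \<odot>\<^bsub>R\<^esub> x"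
      "(a \<otimes>\<^bsub>scalars\<^esub> b) \<odot>\<^bsub>R\<^esub> x = a \<odot>\<^bsub>R\<^esub> (b \<odot>\<^bsub>R\<^esub> x)" "\<one>\<^bsub>scalars\<^esub> \<odot>\<^bsub>R\<^esub> x = x"
      by (simp_all add: pm.scale_left_distrib flip: kap_scale kap_add)
  qed
  fix a x y assume "x \<in> carrier R" "y \<in> carrier R"
  then obtain c d where "x = \<kappa> c" "y = \<kappa> d" "keys c \<subseteq> idx" "keys d \<subseteq> idx" by (metis kap_surj)
  then show "(a \<odot>\<^bsub>R\<^esub> x) \<otimes>\<^bsub>R\<^esub> y = a \<odot>\<^bsub>R\<^esub> (x \<otimes>\<^bsub>R\<^esub> y)" "x \<otimes>\<^bsub>R\<^esub> (a \<odot>\<^bsub>R\<^esub> y) = a \<odot>\<^bsub>R\<^esub> (x \<otimes>\<^bsub>R\<^esub> y)"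
    by (simp_all add: kap_mult keys_scale_idx prd_simps flip: kap_scale)
qed

lemma kap_ext: "\<kappa> (ext f c) = lin R (\<lambda>x. \<kappa> (f x)) c"
  by (induction c rule: poly_mapping_ext_induct)
    (simp_all add: kap_zero kap_scale kap_add pm.lext_add R.lin_add)

lemma kap_eq_lin: "\<kappa> c = lin R (\<lambda>k. \<kappa> (basis k)) c"
  using kap_ext[of basis c] by simp

abbreviation kap2 :: "('g mono \<times> 'g mono \<Rightarrow>\<^sub>0 'k) \<Rightarrow> ('a \<times> 'a) \<Rightarrow>\<^sub>0 'k" where
  "kap2 \<equiv> ext (\<lambda>(k, l). basis (\<kappa> (basis k), \<kappa> (basis l)))"

lemma keys_kap2: "keys (kap2 z) \<subseteq> carrier R \<times> carrier R"
  by (intro keys_ext_subsetI) auto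

lemma kspace_RR: "kspace (tensor R R)"
  by (rule R.TP.kspace_tensor)

lemma pure_closed: "x \<in> carrier R \<Longrightarrow> y \<in> carrier R \<Longrightarrow> pure R R x y \<in> carrier (tensor R R)"
  by (rule bilinear_mapD(3)[OF R.TP.bilinear_pure])

lemma tcls_kap2: "tcls R R (kap2 z) = lin (tensor R R) (\<lambda>(k, l). pure R R (\<kappa> (basis k)) (\<kappa> (basis l))) z"
  by (subst R.TP.tcls_ext) (auto simp: pure_eq_tcls split_def)

lemma tcls_kap2_otimes: "tcls R R (kap2 (otimes c d)) = pure R R (\<kappa> c) (\<kappa> d)"
proof -
  interpret RR: kspace "tensor R R" by (rule kspace_RR)
  have "pure R R (\<kappa> c) (\<kappa> d) = pure R R (lin R (\<lambda>k. \<kappa> (basis k)) c) (\<kappa> d)"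
    by (simp flip: kap_eq_lin)
  also have "\<dots> = lin (tensor R R) (\<lambda>k. pure R R (\<kappa> (basis k)) (\<kappa> d)) c"
    by (rule linear_map_lin[OF bilinear_mapD(2)[OF R.TP.bilinear_pure]])
      (simp_all add: R.kspace_axioms kspace_RR)
  also have "(\<lambda>k. pure R R (\<kappa> (basis k)) (\<kappa> d)) = (\<lambda>k. lin (tensor R R) (\<lambda>l. pure R R (\<kappa> (basis k)) (\<kappa> (basis l))) d)"
  proof
    fix k
    have "pure R R (\<kappa> (basis k)) (\<kappa> d) = pure R R (\<kappa> (basis k)) (lin R (\<lambda>k. \<kappa> (basis k)) d)"
      by (simp flip: kap_eq_lin)
    also have "\<dots> = lin (tensor R R) (\<lambda>l. pure R R (\<kappa> (basis k)) (\<kappa> (basis l))) d"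
      by (rule linear_map_lin[OF bilinear_mapD(1)[OF R.TP.bilinear_pure]])
        (simp_all add: R.kspace_axioms kspace_RR)
    finally show "pure R R (\<kappa> (basis k)) (\<kappa> d) = lin (tensor R R) (\<lambda>l. pure R R (\<kappa> (basis k)) (\<kappa> (basis l))) d" .
  qed
  finally show ?thesis
    unfolding tcls_kap2 otimes_def
    by (simp add: lin_ext[OF kspace_RR] pure_closed split_def)
qed

lemma sweedler_kap:
  assumes U: "kspace U" and f: "bilinear_map R R U f" and c: "keys c \<subseteq> idx"
  shows "sweedler R U f (\<kappa> c) = lin U (\<lambda>(k, l). f (\<kappa> (basis k)) (\<kappa> (basis l))) (cop c)"
proof -
  interpret U: kspace U by fact
  let ?F = "lin U (\<lambda>p. f (fst p) (snd p))"
  have cl: "f (\<kappa> x) (\<kappa> y) \<in> carrier U" for x y by (rule bilinear_mapD(3)[OF f]) simp_all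
  have "sweedler R U f (\<kappa> c) = ?F (kap2 (cop c))"
    unfolding sweedler_def comult_kap[OF c] by (rule R.TP.tensor_lift_tcls[OF U f keys_kap2])
  also have "?F (kap2 z) = lin U (\<lambda>(k, l). f (\<kappa> (basis k)) (\<kappa> (basis l))) z" for z
  proof (induction z rule: poly_mapping_ext_induct)
    case (single x a)
    show ?case by (cases x) (simp add: cl U.lin_scale)
  next
    case (add z z')
    have k: "x \<in> keys (kap2 z) \<union> keys (kap2 z') \<Longrightarrow> f (fst x) (snd x) \<in> carrier U" for x
      using keys_kap2[of z] keys_kap2[of z'] by (auto intro!: bilinear_mapD(3)[OF f])
    have 1: "?F (kap2 z + kap2 z') = ?F (kap2 z) \<oplus>\<^bsub>U\<^esub> ?F (kap2 z')"
      by (rule U.lin_add[OF k])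
    have 2: "lin U (\<lambda>(k, l). f (\<kappa> (basis k)) (\<kappa> (basis l))) (z + z') =
        lin U (\<lambda>(k, l). f (\<kappa> (basis k)) (\<kappa> (basis l))) z \<oplus>\<^bsub>U\<^esub> lin U (\<lambda>(k, l). f (\<kappa> (basis k)) (\<kappa> (basis l))) z'"
      by (rule U.lin_add) (auto simp: cl)
    show ?case by (simp only: pm.lext_add 1 2 add)
  qed simp
  finally show ?thesis .
qed

lemma linear_sweedler:
  assumes U: "kspace U" and f: "bilinear_map R R U f"
  shows "linear_map R U (sweedler R U f)"
proof -
  interpret U: kspace U by fact
  have cl: "f (\<kappa> x) (\<kappa> y) \<in> carrier U" for x y by (rule bilinear_mapD(3)[OF f]) simp_all
  show ?thesis
  proof (rule linear_mapI)
    fix x y assume "x \<in> carrier R" "y \<in> carrier R"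
    then obtain c d where "x = \<kappa> c" "y = \<kappa> d" "keys c \<subseteq> idx" "keys d \<subseteq> idx" by (metis kap_surj)
    then show "sweedler R U f (x \<oplus>\<^bsub>R\<^esub> y) = sweedler R U f x \<oplus>\<^bsub>U\<^esub> sweedler R U f y"
      by (simp add: sweedler_kap[OF assms] keys_add_idx cop_simps U.lin_add cl split_def flip: kap_add)
  next
    fix a x assume "x \<in> carrier R"
    then obtain c where "x = \<kappa> c" "keys c \<subseteq> idx" by (metis kap_surj)
    then show "sweedler R U f x \<in> carrier U" "sweedler R U f (a \<odot>\<^bsub>R\<^esub> x) = a \<odot>\<^bsub>U\<^esub> sweedler R U f x"
      by (simp_all add: sweedler_kap[OF assms] keys_scale_idx cop_simps U.lin_scale cl split_def flip: kap_scale)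
  qed
qed

text \<open>A Sweedler sum can be expanded on coordinates only if its integrand is bilinear. For
  iterated sums the integrand is itself a Sweedler sum, and this supplies its linearity in the
  remaining variable.\<close>

lemma linear_sweedler_param:
  assumes U: "kspace U" and V: "kspace V" and f: "\<And>v. v \<in> carrier V \<Longrightarrow> bilinear_map R R U (\<lambda>x y. f x y v)"
    and g: "\<And>x y. x \<in> carrier R \<Longrightarrow> y \<in> carrier R \<Longrightarrow> linear_map V U (f x y)" and x: "x \<in> carrier R"
  shows "linear_map V U (\<lambda>v. sweedler R U (\<lambda>x y. f x y v) x)"
proof -
  obtain c where c: "x = \<kappa> c" "keys c \<subseteq> idx" using x by (rule kap_cases)
  have "linear_map V U (\<lambda>v. lin U (\<lambda>(k, l). f (\<kappa> (basis k)) (\<kappa> (basis l)) v) (cop c))"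
    by (rule linear_map_lin_fun[OF U]) (use g in \<open>auto split: prod.split\<close>)
  then show ?thesis
    by (rule linear_map_cong[OF _ V]) (simp add: c sweedler_kap[OF U f])
qed

lemma keys_basis_idx: "k \<in> idx \<Longrightarrow> keys (basis k) \<subseteq> idx"
  by simp

lemma keys_copD: "(k, l) \<in> keys (cop c) \<Longrightarrow> k \<in> idx \<and> l \<in> idx"
  using keys_cop[of c] by auto

lemma coassoc_lin:
  assumes U: "kspace U" and c: "keys c \<subseteq> idx" and f: "\<And>k l m. f k l m \<in> carrier U"
  shows "lin U (\<lambda>(x, k3). lin U (\<lambda>(k1, k2). f k1 k2 k3) (copb x)) (cop c) =
    lin U (\<lambda>(k1, x). lin U (\<lambda>(k2, k3). f k1 k2 k3) (copb x)) (cop c)"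
proof -
  interpret U: kspace U by fact
  let ?f = "\<lambda>t. f (fst t) (fst (snd t)) (snd (snd t))"
  have L: "lin U ?f (ext g z) = lin U (\<lambda>x. lin U ?f (g x)) z"
    for g and z :: "'g mono \<times> 'g mono \<Rightarrow>\<^sub>0 'k"
    by (rule lin_ext[OF U f])
  have "lin U ?f (ext (\<lambda>(x, k3). ext (\<lambda>(k1, k2). basis (k1, k2, k3)) (copb x)) (cop c)) =
      lin U ?f (ext (\<lambda>(k1, x). ext (\<lambda>(k2, k3). basis (k1, k2, k3)) (copb x)) (cop c))"
    using coassoc_lext[OF pm.vector_space_axioms c, of "\<lambda>k1 k2 k3. basis (k1, k2, k3)"] by simp
  then show ?thesis
    by (simp add: L split_def f)
qed

definition ant :: "'a \<Rightarrow> 'a" where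
  "ant x = \<kappa> (ext (antb p) (SOME c. keys c \<subseteq> idx \<and> \<kappa> c = x))"

lemma ant_kap: "keys c \<subseteq> idx \<Longrightarrow> ant (\<kappa> c) = \<kappa> (ext (antb p) c)"
proof -
  assume c: "keys c \<subseteq> idx"
  have "(SOME d. keys d \<subseteq> idx \<and> \<kappa> d = \<kappa> c) = c"
    by (rule some_equality) (use c kap_inj in auto)
  then show ?thesis by (simp add: ant_def)
qed

lemma linear_ant: "linear_map R R ant"
proof (rule linear_mapI)
  fix x y assume "x \<in> carrier R" "y \<in> carrier R"
  then obtain c d where "x = \<kappa> c" "y = \<kappa> d" "keys c \<subseteq> idx" "keys d \<subseteq> idx" by (metis kap_surj)
  then show "ant (x \<oplus>\<^bsub>R\<^esub> y) = ant x \<oplus>\<^bsub>R\<^esub> ant y"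
    by (simp add: ant_kap keys_add_idx pm.lext_add flip: kap_add)
next
  fix a x assume "x \<in> carrier R"
  then obtain c where "x = \<kappa> c" "keys c \<subseteq> idx" by (metis kap_surj)
  then show "ant x \<in> carrier R" "ant (a \<odot>\<^bsub>R\<^esub> x) = a \<odot>\<^bsub>R\<^esub> ant x"
    by (simp_all add: ant_kap keys_scale_idx pm.lext_scale flip: kap_scale)
qed

lemma bilinear_mult: "bilinear_map R R R (\<otimes>\<^bsub>R\<^esub>)"
  by (intro bilinear_mapI linear_mapI)
    (simp_all add: R.l_distr R.r_distr R.smult_mult_left R.smult_mult_right)

lemma bilinear_map_comp:
  assumes "bilinear_map R R U f" "linear_map R R F" "linear_map R R F'"
  shows "bilinear_map R R U (\<lambda>x y. f (F x) (F' y))"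
proof (rule bilinear_mapI)
  fix v assume "v \<in> carrier R"
  then show "linear_map R U (\<lambda>y. f (F v) (F' y))"
    by (intro linear_map_comp[OF bilinear_mapD(1)[OF assms(1)] assms(3)] linear_mapD(1)[OF assms(2)])
next
  fix w assume "w \<in> carrier R"
  then show "linear_map R U (\<lambda>x. f (F x) (F' w))"
    by (intro linear_map_comp[OF bilinear_mapD(2)[OF assms(1)] assms(2)] linear_mapD(1)[OF assms(3)])
qed

lemma linear_id: "linear_map R R (\<lambda>x. x)"
  by (rule linear_mapI) auto

lemma bilinear_smult:
  assumes "linear_map R scalars e"
  shows "bilinear_map R R R (\<lambda>x y. e x \<odot>\<^bsub>R\<^esub> y)" "bilinear_map R R R (\<lambda>x y. e y \<odot>\<^bsub>R\<^esub> x)"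
  using linear_mapD[OF assms]
  by (auto intro!: bilinear_mapI linear_mapI simp: R.smult_smult R.smult_left_distrib R.smult_right_distrib mult.commute)

lemma linear_counit: "linear_map R scalars (counit R)"
proof (rule linear_mapI)
  fix x y assume "x \<in> carrier R" "y \<in> carrier R"
  then obtain c d where "x = \<kappa> c" "y = \<kappa> d" "keys c \<subseteq> idx" "keys d \<subseteq> idx" by (metis kap_surj)
  then show "counit R (x \<oplus>\<^bsub>R\<^esub> y) = counit R x \<oplus>\<^bsub>scalars\<^esub> counit R y"
    by (simp add: counit_kap keys_add_idx eps_simps flip: kap_add)
next
  fix a x assume "x \<in> carrier R"
  then obtain c where "x = \<kappa> c" "keys c \<subseteq> idx" by (metis kap_surj)
  then show "counit R x \<in> carrier scalars" "counit R (a \<odot>\<^bsub>R\<^esub> x) = a \<odot>\<^bsub>scalars\<^esub> counit R x"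
    by (simp_all add: counit_kap keys_scale_idx eps_simps flip: kap_scale)
qed

lemma linear_comult: "linear_map R (tensor R R) (comult R)"
proof (rule linear_mapI)
  fix x y assume "x \<in> carrier R" "y \<in> carrier R"
  then obtain c d where "x = \<kappa> c" "y = \<kappa> d" "keys c \<subseteq> idx" "keys d \<subseteq> idx" by (metis kap_surj)
  then show "comult R (x \<oplus>\<^bsub>R\<^esub> y) = comult R x \<oplus>\<^bsub>tensor R R\<^esub> comult R y"
    by (simp add: comult_kap keys_add_idx cop_simps pm.lext_add R.TP.tcls_simps flip: kap_add)
next
  fix a x assume "x \<in> carrier R"
  then obtain c where "x = \<kappa> c" "keys c \<subseteq> idx" by (metis kap_surj)
  then show "comult R x \<in> carrier (tensor R R)" "comult R (a \<odot>\<^bsub>R\<^esub> x) = a \<odot>\<^bsub>tensor R R\<^esub> comult R x"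
    by (simp_all add: comult_kap keys_scale_idx cop_simps pm.lext_scale R.TP.tcls_simps R.TP.tcls_closed keys_kap2 flip: kap_scale)
qed

lemma tcls_kap2_ext:
  "tcls R R (ext (\<lambda>p. basis (\<kappa> (basis (fst p)), \<kappa> (basis (snd p)))) (ext f z)) =
    lin (tensor R R) (\<lambda>x. tcls R R (ext (\<lambda>p. basis (\<kappa> (basis (fst p)), \<kappa> (basis (snd p)))) (f x))) z"
  unfolding pm.lext_ext by (rule R.TP.tcls_ext) (auto intro!: keys_ext_subsetI)

text \<open>\<open>cop_prd\<close> with all three parameters equal to \<open>p\<close>, carried over
  to the abstract tensor square.\<close>

lemma comult_mult:
  assumes "x \<in> carrier R" "y \<in> carrier R"
  shows "comult R (x \<otimes>\<^bsub>R\<^esub> y) = comult R x \<otimes>\<^bsub>tensor R R\<^esub> comult R y"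
proof -
  obtain c d where c: "x = \<kappa> c" "keys c \<subseteq> idx" and d: "y = \<kappa> d" "keys d \<subseteq> idx"
    using assms by (metis kap_surj)
  interpret RR: kspace "tensor R R" by (rule kspace_RR)
  let ?t = "\<lambda>k l k' l'. pure R R (\<kappa> (prd p p (basis k) (basis l))) (\<kappa> (prd p p (basis k') (basis l')))"
  have "comult R x \<otimes>\<^bsub>tensor R R\<^esub> comult R y =
      tcls R R (ext (\<lambda>p. ext (\<lambda>p'. basis (fst p \<otimes>\<^bsub>R\<^esub> fst p', snd p \<otimes>\<^bsub>R\<^esub> snd p')) (kap2 (cop d))) (kap2 (cop c)))"
    unfolding c d comult_kap[OF c(2)] comult_kap[OF d(2)]
    by (rule R.tcls_mult) (simp_all add: keys_kap2)
  also have "\<dots> = tcls R R (ext (\<lambda>(k, k'). ext (\<lambda>(l, l').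
      basis (\<kappa> (basis k) \<otimes>\<^bsub>R\<^esub> \<kappa> (basis l), \<kappa> (basis k') \<otimes>\<^bsub>R\<^esub> \<kappa> (basis l'))) (cop d)) (cop c))"
    by (simp add: pm.lext_ext split_def)
  also have "ext (\<lambda>(k, k'). ext (\<lambda>(l, l').
      basis (\<kappa> (basis k) \<otimes>\<^bsub>R\<^esub> \<kappa> (basis l), \<kappa> (basis k') \<otimes>\<^bsub>R\<^esub> \<kappa> (basis l'))) (cop d)) (cop c) =
      ext (\<lambda>(k, k'). ext (\<lambda>(l, l'). basis (\<kappa> (prd p p (basis k) (basis l)), \<kappa> (prd p p (basis k') (basis l')))) (cop d)) (cop c)"
    by (auto intro!: lext_cong simp: kap_mult dest!: keys_copD)
  also have "tcls R R \<dots> = lin (tensor R R) (\<lambda>(k, k'). tcls R R (ext (\<lambda>(l, l'). basis (\<kappa> (prd p p (basis k) (basis l)), \<kappa> (prd p p (basis k') (basis l')))) (cop d))) (cop c)"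
    by (subst R.TP.tcls_ext) (auto intro!: keys_ext_subsetI simp: split_def)
  also have "\<dots> = lin (tensor R R) (\<lambda>(k, k'). lin (tensor R R) (\<lambda>(l, l'). ?t k l k' l') (cop d)) (cop c)"
    by (subst R.TP.tcls_ext) (auto simp: split_def pure_eq_tcls)
  also have "\<dots> = tcls R R (kap2 (prd2 p p p (cop c) (cop d)))"
    by (simp add: prd2_def tmap_def split_def tcls_kap2_ext tcls_kap2_otimes[unfolded split_def])
  also have "\<dots> = comult R (x \<otimes>\<^bsub>R\<^esub> y)"
    using c d by (simp add: kap_mult comult_kap keys_prd cop_prd[OF c(2), where p' = p])
  finally show ?thesis ..
qed

theorem hopf_algebra_R: "hopf_algebra R"
proof (unfold hopf_algebra_def hopf_algebra_axioms_def, intro conjI allI impI)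
  show "ring R" by (rule R.ring_axioms)
  show "Module.module scalars R" by (rule R.module_U)
  show "linear_map R (tensor R R) (comult R)" by (rule linear_comult)
  show "linear_map R scalars (counit R)" by (rule linear_counit)
  show "comult R \<in> ring_hom R (tensor R R)"
  proof (rule ring_hom_memI)
    show "comult R \<one>\<^bsub>R\<^esub> = \<one>\<^bsub>tensor R R\<^esub>"
      by (simp add: R.TP.tcls_one) (simp add: kap_one comult_kap copb_group)
  qed (simp_all add: linear_mapD[OF linear_comult] comult_mult)
  show "counit R \<in> ring_hom R scalars"
  proof (rule ring_hom_memI)
    fix x y assume "x \<in> carrier R" "y \<in> carrier R"
    then obtain c d where "x = \<kappa> c" "y = \<kappa> d" "keys c \<subseteq> idx" "keys d \<subseteq> idx" by (metis kap_surj)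
    then show "counit R (x \<otimes>\<^bsub>R\<^esub> y) = counit R x \<otimes>\<^bsub>scalars\<^esub> counit R y"
      by (simp add: kap_mult counit_kap keys_prd eps_prd)
  qed (use linear_mapD[OF linear_counit] in \<open>auto simp: kap_one counit_kap\<close>)
  show "(a \<odot>\<^bsub>R\<^esub> x) \<otimes>\<^bsub>R\<^esub> y = a \<odot>\<^bsub>R\<^esub> (x \<otimes>\<^bsub>R\<^esub> y)" "x \<otimes>\<^bsub>R\<^esub> (a \<odot>\<^bsub>R\<^esub> y) = a \<odot>\<^bsub>R\<^esub> (x \<otimes>\<^bsub>R\<^esub> y)"
    if "x \<in> carrier R" "y \<in> carrier R" for x y a
    using that by (simp_all add: R.smult_mult_left R.smult_mult_right)
  have S: "sweedler R R (\<lambda>x1 x2. ant x1 \<otimes>\<^bsub>R\<^esub> x2) x = counit R x \<odot>\<^bsub>R\<^esub> \<one>\<^bsub>R\<^esub> \<and>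
      sweedler R R (\<lambda>x1 x2. x1 \<otimes>\<^bsub>R\<^esub> ant x2) x = counit R x \<odot>\<^bsub>R\<^esub> \<one>\<^bsub>R\<^esub>" if x: "x \<in> carrier R" for x
  proof -
    obtain c where c: "x = \<kappa> c" "keys c \<subseteq> idx" using x by (rule kap_cases)
    have "sweedler R R (\<lambda>x1 x2. ant x1 \<otimes>\<^bsub>R\<^esub> x2) x = lin R (\<lambda>(k, l). ant (\<kappa> (basis k)) \<otimes>\<^bsub>R\<^esub> \<kappa> (basis l)) (cop c)"
      unfolding c(1) by (rule sweedler_kap[OF R.kspace_axioms bilinear_map_comp[OF bilinear_mult linear_ant linear_id] c(2)])
    also have "\<dots> = lin R (\<lambda>(k, l). \<kappa> (prd p p (antb p k) (basis l))) (cop c)"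
      by (rule R.lin_cong) (auto dest!: keys_copD simp: ant_kap kap_mult keys_antb)
    also have "\<dots> = \<kappa> (ext (\<lambda>(k, l). prd p p (antb p k) (basis l)) (cop c))"
      by (simp add: kap_ext split_def)
    finally have 1: "sweedler R R (\<lambda>x1 x2. ant x1 \<otimes>\<^bsub>R\<^esub> x2) x = counit R x \<odot>\<^bsub>R\<^esub> \<one>\<^bsub>R\<^esub>"
      using c by (simp add: antipode_left_pm counit_kap kap_one flip: kap_scale)
    have "sweedler R R (\<lambda>x1 x2. x1 \<otimes>\<^bsub>R\<^esub> ant x2) x = lin R (\<lambda>(k, l). \<kappa> (basis k) \<otimes>\<^bsub>R\<^esub> ant (\<kappa> (basis l))) (cop c)"
      unfolding c(1) by (rule sweedler_kap[OF R.kspace_axioms bilinear_map_comp[OF bilinear_mult linear_id linear_ant] c(2)])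
    also have "\<dots> = lin R (\<lambda>(k, l). \<kappa> (prd p p (basis k) (antb p l))) (cop c)"
      by (rule R.lin_cong) (auto dest!: keys_copD simp: ant_kap kap_mult keys_antb)
    also have "\<dots> = \<kappa> (ext (\<lambda>(k, l). prd p p (basis k) (antb p l)) (cop c))"
      by (simp add: kap_ext split_def)
    finally have 2: "sweedler R R (\<lambda>x1 x2. x1 \<otimes>\<^bsub>R\<^esub> ant x2) x = counit R x \<odot>\<^bsub>R\<^esub> \<one>\<^bsub>R\<^esub>"
      using c by (simp add: antipode_right_pm counit_kap kap_one flip: kap_scale)
    show ?thesis using 1 2 ..
  qed
  then show "\<exists>S. linear_map R R S \<and> (\<forall>x\<in>carrier R. sweedler R R (\<lambda>x1 x2. S x1 \<otimes>\<^bsub>R\<^esub> x2) x = counit R x \<odot>\<^bsub>R\<^esub> \<one>\<^bsub>R\<^esub> \<and>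
                     sweedler R R (\<lambda>x1 x2. x1 \<otimes>\<^bsub>R\<^esub> S x2) x = counit R x \<odot>\<^bsub>R\<^esub> \<one>\<^bsub>R\<^esub>)"
    using linear_ant by blast
  show "sweedler R R (\<lambda>x1 x2. counit R x1 \<odot>\<^bsub>R\<^esub> x2) x = x" "sweedler R R (\<lambda>x1 x2. counit R x2 \<odot>\<^bsub>R\<^esub> x1) x = x"
    if x: "x \<in> carrier R" for x
  proof -
    obtain c where c: "x = \<kappa> c" "keys c \<subseteq> idx" using x by (rule kap_cases)
    have e: "counit R (\<kappa> (basis k)) = epsb k" if "k \<in> idx" for k
      using that by (simp add: counit_kap eps_simps)
    have "sweedler R R (\<lambda>x1 x2. counit R x1 \<odot>\<^bsub>R\<^esub> x2) x = lin R (\<lambda>(k, l). counit R (\<kappa> (basis k)) \<odot>\<^bsub>R\<^esub> \<kappa> (basis l)) (cop c)"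
      unfolding c(1) by (rule sweedler_kap[OF R.kspace_axioms bilinear_smult(1)[OF linear_counit] c(2)])
    also have "\<dots> = lin R (\<lambda>(k, l). \<kappa> (single l (epsb k))) (cop c)"
      by (rule R.lin_cong) (auto dest!: keys_copD simp: e simp flip: kap_scale)
    also have "\<dots> = \<kappa> (ext (\<lambda>(k, l). single l (epsb k)) (cop c))"
      by (simp add: kap_ext split_def)
    finally show "sweedler R R (\<lambda>x1 x2. counit R x1 \<odot>\<^bsub>R\<^esub> x2) x = x"
      using c by (simp add: counit_left_pm)
    have "sweedler R R (\<lambda>x1 x2. counit R x2 \<odot>\<^bsub>R\<^esub> x1) x = lin R (\<lambda>(k, l). counit R (\<kappa> (basis l)) \<odot>\<^bsub>R\<^esub> \<kappa> (basis k)) (cop c)"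
      unfolding c(1) by (rule sweedler_kap[OF R.kspace_axioms bilinear_smult(2)[OF linear_counit] c(2)])
    also have "\<dots> = lin R (\<lambda>(k, l). \<kappa> (single k (epsb l))) (cop c)"
      by (rule R.lin_cong) (auto dest!: keys_copD simp: e simp flip: kap_scale)
    also have "\<dots> = \<kappa> (ext (\<lambda>(k, l). single k (epsb l)) (cop c))"
      by (simp add: kap_ext split_def)
    finally show "sweedler R R (\<lambda>x1 x2. counit R x2 \<odot>\<^bsub>R\<^esub> x1) x = x"
      using c by (simp add: counit_right_pm)
  qed
  show "sweedler R (tensor R (tensor R R)) (\<lambda>x' x3. sweedler R (tensor R (tensor R R))
          (\<lambda>x1 x2. pure R (tensor R R) x1 (pure R R x2 x3)) x') x =
      sweedler R (tensor R (tensor R R)) (\<lambda>x1 x'. pure R (tensor R R) x1 (comult R x')) x"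
    if x: "x \<in> carrier R" for x
  proof -
    obtain c where c: "x = \<kappa> c" "keys c \<subseteq> idx" using x by (rule kap_cases)
    let ?T = "tensor R (tensor R R)"
    interpret P3: tensor_pair R "tensor R R"
      by (simp add: tensor_pair_def R.kspace_axioms kspace_RR)
    note P = R.TP.bilinear_pure and P' = P3.bilinear_pure
    have T: "kspace ?T" by (rule P3.kspace_tensor)
    interpret T: kspace ?T by (rule T)
    let ?f = "\<lambda>x1 x2 x3. pure R (tensor R R) x1 (pure R R x2 x3)"
    have fb: "bilinear_map R R ?T (\<lambda>x1 x2. ?f x1 x2 x3)" if "x3 \<in> carrier R" for x3
    proof (rule bilinear_mapI)
      show "linear_map R ?T (\<lambda>x2. ?f v x2 x3)" if "v \<in> carrier R" for v
        by (rule linear_map_comp[OF bilinear_mapD(1)[OF P' that] bilinear_mapD(2)[OF P \<open>x3 \<in> carrier R\<close>]])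
      show "linear_map R ?T (\<lambda>x1. ?f x1 w x3)" if "w \<in> carrier R" for w
        by (rule bilinear_mapD(2)[OF P' bilinear_mapD(3)[OF P that \<open>x3 \<in> carrier R\<close>]])
    qed
    have fl: "linear_map R ?T (?f x1 x2)" if "x1 \<in> carrier R" "x2 \<in> carrier R" for x1 x2
      by (rule linear_map_comp[OF bilinear_mapD(1)[OF P' that(1)] bilinear_mapD(1)[OF P that(2)]])
    have b1: "bilinear_map R R ?T (\<lambda>x' x3. sweedler R ?T (\<lambda>x1 x2. ?f x1 x2 x3) x')"
    proof (rule bilinear_mapI)
      show "linear_map R ?T (\<lambda>x3. sweedler R ?T (\<lambda>x1 x2. ?f x1 x2 x3) v)" if "v \<in> carrier R" for v
        by (rule linear_sweedler_param[OF T R.kspace_axioms fb fl that])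
      show "linear_map R ?T (\<lambda>x'. sweedler R ?T (\<lambda>x1 x2. ?f x1 x2 w) x')" if "w \<in> carrier R" for w
        by (rule linear_sweedler[OF T fb[OF that]])
    qed
    have b2: "bilinear_map R R ?T (\<lambda>x1 x'. pure R (tensor R R) x1 (comult R x'))"
    proof (rule bilinear_mapI)
      show "linear_map R ?T (\<lambda>x'. pure R (tensor R R) v (comult R x'))" if "v \<in> carrier R" for v
        by (rule linear_map_comp[OF bilinear_mapD(1)[OF P' that] linear_comult])
      show "linear_map R ?T (\<lambda>x1. pure R (tensor R R) x1 (comult R w))" if "w \<in> carrier R" for w
        by (rule bilinear_mapD(2)[OF P' linear_mapD(1)[OF linear_comult that]])
    qed
    let ?F = "\<lambda>k1 k2 k3. ?f (\<kappa> (basis k1)) (\<kappa> (basis k2)) (\<kappa> (basis k3))"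
    have F: "?F k1 k2 k3 \<in> carrier ?T" for k1 k2 k3
      by (intro bilinear_mapD(3)[OF fb]) auto
    have "sweedler R ?T (\<lambda>x' x3. sweedler R ?T (\<lambda>x1 x2. ?f x1 x2 x3) x') x =
       lin ?T (\<lambda>(k, k3). sweedler R ?T (\<lambda>x1 x2. ?f x1 x2 (\<kappa> (basis k3))) (\<kappa> (basis k))) (cop c)"
      unfolding c(1) by (rule sweedler_kap[OF T b1 c(2)])
    also have "\<dots> = lin ?T (\<lambda>(k, k3). lin ?T (\<lambda>(k1, k2). ?F k1 k2 k3) (copb k)) (cop c)"
      by (rule T.lin_cong) (auto dest!: keys_copD simp: sweedler_kap[OF T fb] F split_def)
    also have "\<dots> = lin ?T (\<lambda>(k1, k). lin ?T (\<lambda>(k2, k3). ?F k1 k2 k3) (copb k)) (cop c)"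
      by (rule coassoc_lin[OF T c(2) F])
    also have "\<dots> = lin ?T (\<lambda>(k1, k). pure R (tensor R R) (\<kappa> (basis k1)) (comult R (\<kappa> (basis k)))) (cop c)"
    proof (rule T.lin_cong)
      fix z assume "z \<in> keys (cop c)"
      then obtain k1 k where z: "z = (k1, k)" "k \<in> idx" by (cases z) (auto dest: keys_copD)
      have "comult R (\<kappa> (basis k)) = lin (tensor R R) (\<lambda>(k, l). pure R R (\<kappa> (basis k)) (\<kappa> (basis l))) (copb k)"
        using z comult_kap[of "basis k"] by (simp add: tcls_kap2)
      then have "pure R (tensor R R) (\<kappa> (basis k1)) (comult R (\<kappa> (basis k))) =
          lin ?T (\<lambda>x. pure R (tensor R R) (\<kappa> (basis k1)) (case x of (k, l) \<Rightarrow> pure R R (\<kappa> (basis k)) (\<kappa> (basis l)))) (copb k)"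
        by (simp only:) (rule linear_map_lin[OF bilinear_mapD(1)[OF P'] kspace_RR T], auto simp: pure_closed)
      then show "(case z of (k1, k) \<Rightarrow> lin ?T (\<lambda>(k2, k3). ?F k1 k2 k3) (copb k)) =
          (case z of (k1, k) \<Rightarrow> pure R (tensor R R) (\<kappa> (basis k1)) (comult R (\<kappa> (basis k))))"
        by (simp add: z split_def)
      show "(case z of (k1, k) \<Rightarrow> pure R (tensor R R) (\<kappa> (basis k1)) (comult R (\<kappa> (basis k)))) \<in> carrier ?T"
        by (simp add: z bilinear_mapD(3)[OF b2])
    qed
    also have "\<dots> = sweedler R ?T (\<lambda>x1 x'. pure R (tensor R R) x1 (comult R x')) x"
      unfolding c(1) by (rule sweedler_kap[OF T b2 c(2), symmetric])
    finally show ?thesis .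
  qed
qed

end

lemma (in tensor_pair) pure_lin_lin:
  assumes f: "\<And>x. f x \<in> carrier V" and g: "\<And>y. g y \<in> carrier W"
  shows "pure V W (lin V f c) (lin W g d) = lin (tensor V W) (\<lambda>(x, y). pure V W (f x) (g y)) (otimes c d)"
proof -
  have cl: "pure V W (f x) (g y) \<in> carrier (tensor V W)" for x y
    by (rule bilinear_mapD(3)[OF bilinear_pure f g])
  interpret TT: kspace "tensor V W" by (rule kspace_tensor)
  have "pure V W (lin V f c) (lin W g d) = lin (tensor V W) (\<lambda>x. pure V W (f x) (lin W g d)) c"
    by (rule linear_map_lin[OF bilinear_mapD(2)[OF bilinear_pure] V.kspace_axioms kspace_tensor f])
      (simp add: W.lin_closed g)
  also have "(\<lambda>x. pure V W (f x) (lin W g d)) = (\<lambda>x. lin (tensor V W) (\<lambda>y. pure V W (f x) (g y)) d)"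
    by (rule HOL.ext) (rule linear_map_lin[OF bilinear_mapD(1)[OF bilinear_pure f] W.kspace_axioms kspace_tensor g])
  finally show ?thesis
    unfolding otimes_def by (simp add: lin_ext[OF kspace_tensor] cl split_def)
qed

text \<open>As a vector space the tensor square does not see the multiplication, so a twist, which
  changes nothing else, has the same tensor square.\<close>

lemma tensor_null_cong:
  assumes "carrier V = carrier V'" "add V = add V'" "smult V = smult V'"
    "carrier W = carrier W'" "add W = add W'" "smult W = smult W'"
  shows "tensor_null V W = tensor_null V' W'"
  by (simp add: tensor_null_def submodule_def submodule_axioms_def tensor_relators_def assms)

lemma tcls_cong:
  assumes "carrier V = carrier V'" "add V = add V'" "smult V = smult V'"
    "carrier W = carrier W'" "add W = add W'" "smult W = smult W'"
  shows "tcls V W u = tcls V' W' u"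
  by (simp add: tcls_def a_r_coset_def' tensor_null_cong[OF assms])

section \<open>Free algebras\<close>

lemma plus_list [simp]: "x + y = x @ (y :: 'x list)"
  by (simp add: plus_list_def)

lemma zero_list [simp]: "(0 :: 'x list) = []"
  by (simp add: zero_list_def)

lemma free_algebra_simps [simp]: "add (free_algebra X) = (+)" "zero (free_algebra X) = 0"
  "smult (free_algebra X) = scale" "mult (free_algebra X) = (*)" "one (free_algebra X) = 1"
  "carrier (free_algebra X) = {f. keys f \<subseteq> lists X}"
  by (simp_all add: free_algebra_def)

interpretation FA: formal_space "free_algebra X" for X
  by unfold_locales (simp_all add: subspace_keys)

lemma basis_Nil: "basis [] = 1"
  using single_one[where 'a = "'a list"] by simp

lemma one_pairs: "(1 :: ('x list \<times> 'y list) \<Rightarrow>\<^sub>0 'k::field) = basis ([], [])"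
proof -
  have "([], []) = (0 :: 'x list \<times> 'y list)" by (simp add: zero_prod_def)
  then show ?thesis by (simp only: single_one)
qed

lemma keys_mult_lists:
  fixes f g :: "'x list \<Rightarrow>\<^sub>0 'k::field"
  assumes "keys f \<subseteq> lists X" "keys g \<subseteq> lists X"
  shows "keys (f * g) \<subseteq> lists X"
proof
  fix w assume "w \<in> keys (f * g)"
  then have "w \<in> {a + b |a b. a \<in> keys f \<and> b \<in> keys g}" using Poly_Mapping.keys_mult by blast
  then obtain a b where "w = a @ b" "a \<in> keys f" "b \<in> keys g" by auto
  then show "w \<in> lists X" using assms by auto
qed

lemma ring_free_algebra: "ring (free_algebra X :: ('k::field, _) module)"
proof (rule ringI)
  show "abelian_group (free_algebra X :: ('k, _) module)"
    using FA.kspace_M[of X] by (auto dest!: kspace.module_U simp: Module.module_def)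
  show "Group.monoid (free_algebra X :: ('k, _) module)"
  proof (rule monoidI)
    show "\<one>\<^bsub>free_algebra X\<^esub> \<in> carrier (free_algebra X :: ('k, _) module)"
      by (simp flip: basis_Nil)
  qed (simp_all add: keys_mult_lists mult.assoc)
qed (simp_all add: distrib_left distrib_right)

lemma gen_mult_basis: "gen x * basis w = basis (x # w)"
  by (simp add: mult_single)

section \<open>The presented algebra on the monomial basis\<close>

locale quantum_plane_lifting = quantum_plane G g1 g2 \<chi>1 \<chi>2 q r
  for G :: "('g, 'm) monoid_scheme" (structure) and g1 g2 :: 'g and \<chi>1 \<chi>2 :: "'g \<Rightarrow> 'k::field"
    and q r +
  fixes a1 a2 a :: 'k
begin

abbreviation par :: "'k params" where "par \<equiv> (a1, a2, a)"

abbreviation FA :: "('k, 'g gen list \<Rightarrow>\<^sub>0 'k) module" where "FA \<equiv> free_algebra (gens G)"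

definition rels :: "('g gen list \<Rightarrow>\<^sub>0 'k) set" where
  "rels = relators G \<chi>1 \<chi>2 q r (scale a1 (1 - gen (Grp g1) ^ r)) (scale a2 (1 - gen (Grp g2) ^ r))
     (scale a (1 - gen (Grp g1) * gen (Grp g2)))"

abbreviation I :: "('g gen list \<Rightarrow>\<^sub>0 'k) set" where "I \<equiv> Idl\<^bsub>FA\<^esub> rels"

abbreviation Q where "Q \<equiv> quotient FA I"

lemma carrier_simps: "f \<in> carrier FA \<Longrightarrow> f' \<in> carrier FA \<Longrightarrow> f * f' \<in> carrier FA"
  "f \<in> carrier FA \<Longrightarrow> f' \<in> carrier FA \<Longrightarrow> f + f' \<in> carrier FA"
  "f \<in> carrier FA \<Longrightarrow> f' \<in> carrier FA \<Longrightarrow> f - f' \<in> carrier FA"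
  "f \<in> carrier FA \<Longrightarrow> scale b f \<in> carrier FA"
  "x \<in> gens G \<Longrightarrow> gen x \<in> carrier FA" "1 \<in> carrier FA" "0 \<in> carrier FA"
proof -
  show "f \<in> carrier FA \<Longrightarrow> f' \<in> carrier FA \<Longrightarrow> f * f' \<in> carrier FA" by (simp add: keys_mult_lists)
  show "f \<in> carrier FA \<Longrightarrow> f' \<in> carrier FA \<Longrightarrow> f + f' \<in> carrier FA" by (rule pm.subspace_add[OF FA.subspace_M])
  show "f \<in> carrier FA \<Longrightarrow> f' \<in> carrier FA \<Longrightarrow> f - f' \<in> carrier FA" by (rule pm.subspace_diff[OF FA.subspace_M])
  show "f \<in> carrier FA \<Longrightarrow> scale b f \<in> carrier FA" by (rule pm.subspace_scale[OF FA.subspace_M])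
  show "x \<in> gens G \<Longrightarrow> gen x \<in> carrier FA" by simp
  show "1 \<in> carrier FA" by (simp flip: basis_Nil)
  show "0 \<in> carrier FA" by simp
qed

lemma carrier_power: "f \<in> carrier FA \<Longrightarrow> f ^ n \<in> carrier FA"
  by (induction n) (simp_all only: power_0 power_Suc carrier_simps)

lemma rels_subset: "rels \<subseteq> carrier FA"
  unfolding rels_def relators_def
  by (auto simp del: free_algebra_simps(6) intro!: carrier_simps carrier_power)

lemma ideal_I: "ideal I FA"
  by (rule ring.genideal_ideal[OF ring_free_algebra rels_subset])

lemma rels_in_I: "f \<in> rels \<Longrightarrow> f \<in> I"
  using ring.genideal_self[OF ring_free_algebra rels_subset] by auto

lemma I_subset: "I \<subseteq> carrier FA"
  using ideal.axioms(1)[OF ideal_I] additive_subgroup.a_subset by blast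

lemma I_mult: "f \<in> I \<Longrightarrow> f' \<in> carrier FA \<Longrightarrow> f * f' \<in> I" "f \<in> I \<Longrightarrow> f' \<in> carrier FA \<Longrightarrow> f' * f \<in> I"
  using ideal.I_r_closed[OF ideal_I, of f f'] ideal.I_l_closed[OF ideal_I, of f f'] by simp_all

lemma subspace_I: "pm.subspace I"
proof -
  have "scale b f \<in> I" if "f \<in> I" for b f
  proof -
    have "scale b f = scale b 1 * f" by (simp add: scale_mult_left)
    then show ?thesis using I_mult(2)[OF that carrier_simps(4)[OF carrier_simps(6)]] by metis
  qed
  then show ?thesis
    using additive_subgroup.zero_closed[OF ideal.axioms(1)[OF ideal_I]] additive_subgroup.a_closed[OF ideal.axioms(1)[OF ideal_I]]
    by (auto simp: pm.subspace_def)
qed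

sublocale Q: formal_quotient FA I
  by unfold_locales (rule I_subset subspace_I)+

text \<open>The algebra map from the free algebra to C(par, par): a word acts on the unit through
  the operators of its letters.\<close>

definition pi :: "('g gen list \<Rightarrow>\<^sub>0 'k) \<Rightarrow> ('g, 'k) formal" where
  "pi = ext (\<lambda>w. foldr (op par par) w (basis e0))"

lemma linear_pi [simp]: "pmlinear pi"
  by (simp add: pi_def)

lemmas pi_simps = linear_pm_simps[OF linear_pi]

lemma pi_single: "pi (single w b) = scale b (foldr (op par par) w (basis e0))"
  by (simp add: pi_def)

lemma keys_foldr_op: "keys (foldr (op par par) w (basis e0)) \<subseteq> idx"
  by (cases w) (simp_all add: keys_op)

lemma keys_pi: "keys (pi f) \<subseteq> idx"
  unfolding pi_def by (intro keys_ext_subsetI keys_foldr_op)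

text \<open>Letters \<open>Grp h\<close> with \<open>h\<close> outside the group act as 0, so
  \<open>pi\<close> can be treated as multiplicative on the whole type.\<close>

lemma prd_op_left_all: "prd p p' (op p p' x c) d = op p p' x (prd p p' c d)"
proof (cases "x \<in> gens G")
  case False
  then obtain h where "x = Grp h" "h \<notin> carrier G" by (cases x) auto
  then have "op p p' x c = 0" for c
    by (simp add: op_def bop_Grp_outside lext_def)
  then show ?thesis by (simp add: prd_simps)
qed (rule prd_op_left)

lemma pi_mult: "pi (f * f') = prd par par (pi f) (pi f')"
proof (induction f rule: poly_mapping_ext_induct)
  case (single w b)
  have "pi (basis w * f') = prd par par (pi (basis w)) (pi f')"
  proof (induction f' rule: poly_mapping_ext_induct)
    case (single w' c)
    have "prd par par (foldr (op par par) w (basis e0)) (foldr (op par par) w' (basis e0)) =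
        foldr (op par par) w (foldr (op par par) w' (basis e0))"
      by (induction w) (simp_all add: prd_op_left_all prd_e0_left keys_foldr_op)
    then show ?case by (simp add: mult_single pi_single prd_simps)
  qed (simp_all add: distrib_left pi_simps prd_simps)
  then have "pi (scale b (basis w) * f') = prd par par (pi (scale b (basis w))) (pi f')"
    unfolding scale_mult_left by (simp only: pi_simps prd_simps)
  then show ?case by simp
qed (simp_all add: distrib_right pi_simps prd_simps)

lemma pi_1: "pi 1 = basis e0"
  by (simp add: pi_single flip: basis_Nil)

lemma pi_gen_mult: "pi (gen x * f) = op par par x (pi f)"
proof -
  have "pi (gen x) = op par par x (basis e0)" by (simp add: pi_single)
  then show ?thesis by (simp add: pi_mult prd_op_left_all prd_e0_left keys_pi del: op_basis)
qed

lemma pi_gen: "pi (gen x) = op par par x (basis e0)"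
  by (simp add: pi_single)

lemma pi_gen_pow: "pi (gen x ^ n * f) = (op par par x ^^ n) (pi f)"
  by (induction n) (simp_all add: mult.assoc pi_gen_mult)

lemma pi_gen_pow': "pi (gen x ^ n) = (op par par x ^^ n) (basis e0)"
  using pi_gen_pow[of x n 1] by (simp add: pi_1)

lemma pi_rels: "f \<in> rels \<Longrightarrow> pi f = 0"
proof -
  have e0: "op par par (Grp \<one>) (basis e0) = basis e0" by (rule op_one) simp
  have g: "(op par par (Grp g1) ^^ r) (basis e0) = op par par (Grp (g1 [^] r)) (basis e0)"
    "(op par par (Grp g2) ^^ r) (basis e0) = op par par (Grp (g2 [^] r)) (basis e0)"
    by (rule op_Grp_pow; simp)+
  assume "f \<in> rels"
  then consider (1) h h' where "h \<in> carrier G" "h' \<in> carrier G" "f = gen (Grp h) * gen (Grp h') - gen (Grp (h \<otimes> h'))"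
    | (2) "f = gen (Grp \<one>) - 1"
    | (3) h where "h \<in> carrier G" "f = gen (Grp h) * gen X1 - scale (\<chi>1 h) (gen X1 * gen (Grp h))"
    | (4) h where "h \<in> carrier G" "f = gen (Grp h) * gen X2 - scale (\<chi>2 h) (gen X2 * gen (Grp h))"
    | (5) "f = gen X1 ^ r - scale a1 (1 - gen (Grp g1) ^ r)"
    | (6) "f = gen X2 ^ r - scale a2 (1 - gen (Grp g2) ^ r)"
    | (7) "f = gen X2 * gen X1 - (scale q (gen X1 * gen X2) + scale a (1 - gen (Grp g1) * gen (Grp g2)))"
    unfolding rels_def relators_def by blast
  then show ?thesis
    by cases (simp_all only: pi_simps pi_gen_mult pi_gen pi_1 pi_gen_pow' op_Grp_Grp op_Grp_X1 op_Grp_X2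
        op_X1_r op_X2_r op_X2_X1 e0 g g1 g2 fst_conv snd_conv,
      simp_all add: pm.scale_right_diff_distrib del: op_basis)
qed

text \<open>The kernel of \<open>pi\<close> within the free algebra is an ideal that contains the
  relators. Hence \<open>pi\<close> factors through the presented algebra and separates its
  monomials.\<close>

lemma pi_I: "f \<in> I \<Longrightarrow> pi f = 0"
proof -
  let ?J = "{f \<in> carrier FA. pi f = 0}"
  have "pm.subspace ?J"
    using FA.subspace_M[of "gens G"] by (auto simp: pm.subspace_def pi_simps simp del: free_algebra_simps(6))
  then have "submodule ?J scalars FA" by (subst FA.submodule_iff) blast
  then have "ideal ?J FA"
    by (intro idealI ring_free_algebra submodule.axioms(1)) (auto simp: pi_mult prd_simps keys_mult_lists)
  then have "I \<subseteq> ?J"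
    by (rule ring.genideal_minimal[OF ring_free_algebra]) (use rels_subset pi_rels in blast)
  then show "f \<in> I \<Longrightarrow> pi f = 0" by blast
qed

text \<open>A representation acts on the whole type, which also has words with letters outside
  \<open>gens G\<close>, whereas the ideal lies in the free algebra on \<open>gens G\<close>.
  Working modulo the sums whose restriction lies in the ideal reconciles the two.\<close>

definition restr :: "('g gen list \<Rightarrow>\<^sub>0 'k) \<Rightarrow> ('g gen list \<Rightarrow>\<^sub>0 'k)" where
  "restr = ext (\<lambda>w. if w \<in> lists (gens G) then basis w else 0)"

lemma linear_restr [simp]: "pmlinear restr"
  by (simp add: restr_def)

lemmas restr_simps = linear_pm_simps[OF linear_restr]

lemma restr_closed: "restr f \<in> carrier FA"
proof -
  have "keys (restr f) \<subseteq> lists (gens G)" unfolding restr_def by (rule keys_ext_subsetI) auto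
  then show ?thesis by simp
qed

lemma restr_id: "f \<in> carrier FA \<Longrightarrow> restr f = f"
proof -
  assume "f \<in> carrier FA"
  then have "restr f = ext basis f" unfolding restr_def by (intro lext_cong) auto
  then show ?thesis by simp
qed

lemma restr_gen_mult: "x \<in> gens G \<Longrightarrow> restr (gen x * f) = gen x * restr f"
proof (induction f rule: poly_mapping_ext_induct)
  case (single w b)
  then show ?case by (auto simp: restr_def mult_single)
qed (simp_all add: distrib_left restr_simps)

abbreviation T :: "'g gen \<Rightarrow> ('g gen list \<Rightarrow>\<^sub>0 'k) \<Rightarrow> ('g gen list \<Rightarrow>\<^sub>0 'k)" where
  "T \<equiv> \<lambda>x f. gen x * f"

lemma T_pow: "(T x ^^ n) f = gen x ^ n * f"
  by (induction n) (simp_all add: mult.assoc)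

lemma restr_gen_pow: "x \<in> gens G \<Longrightarrow> restr (gen x ^ n * f) = gen x ^ n * restr f"
  by (induction n) (simp_all add: mult.assoc restr_gen_mult)

text \<open>The presentation uses powers of the letter \<open>Grp h\<close> and the empty word, the
  representation the letters \<open>Grp (h [^] n)\<close> and \<open>Grp \<one>\<close>; modulo the
  ideal they agree.\<close>

lemma Grp_pow_I: "h \<in> carrier G \<Longrightarrow> gen (Grp h) ^ n - gen (Grp (h [^] n)) \<in> I"
proof (induction n)
  case 0
  have "gen (Grp \<one>) - 1 \<in> I" by (rule rels_in_I) (simp add: rels_def relators_def)
  then show ?case using pm.subspace_neg[OF subspace_I] by fastforce
next
  case (Suc n)
  have 1: "(gen (Grp h) ^ n - gen (Grp (h [^] n))) * gen (Grp h) \<in> I"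
    using Suc by (intro I_mult carrier_simps) auto
  have 2: "gen (Grp (h [^] n)) * gen (Grp h) - gen (Grp (h [^] n \<otimes> h)) \<in> I"
    by (rule rels_in_I) (use Suc in \<open>auto simp: rels_def relators_def\<close>)
  have eq: "gen (Grp h) ^ Suc n - gen (Grp (h [^] Suc n)) =
    (gen (Grp h) ^ n - gen (Grp (h [^] n))) * gen (Grp h) + (gen (Grp (h [^] n)) * gen (Grp h) - gen (Grp (h [^] n \<otimes> h)))"
    by (simp add: left_diff_distrib power_Suc2 del: power_Suc)
  show ?case unfolding eq by (rule pm.subspace_add[OF subspace_I 1 2])
qed

lemma one_I: "gen (Grp \<one>) - 1 \<in> I"
  by (rule rels_in_I) (simp add: rels_def relators_def)

lemma X_pow_I:
  assumes "gen x ^ r - scale b (1 - gen (Grp h) ^ r) \<in> rels" "h \<in> carrier G"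
  shows "gen x ^ r - (scale b (gen (Grp \<one>)) - scale b (gen (Grp (h [^] r)))) \<in> I"
proof -
  have "gen x ^ r - (scale b (gen (Grp \<one>)) - scale b (gen (Grp (h [^] r)))) =
    (gen x ^ r - scale b (1 - gen (Grp h) ^ r)) - scale b (gen (Grp \<one>) - 1) -
      scale b (gen (Grp h) ^ r - gen (Grp (h [^] r)))"
    by (simp add: pm.scale_right_diff_distrib del: scale_single)
  also have "\<dots> \<in> I"
    using assms by (intro pm.subspace_diff[OF subspace_I] pm.subspace_scale[OF subspace_I] rels_in_I one_I Grp_pow_I)
  finally show ?thesis .
qed

text \<open>This instance turns \<open>T_lext_mon\<close> into the rewriting of words modulo the
  ideal, on which \<open>sec_pi\<close> rests.\<close>

lemma free_rep: "quantum_plane_rep G g1 g2 \<chi>1 \<chi>2 q r scale {f. restr f \<in> I} T par par"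
proof (intro quantum_plane_rep.intro quantum_plane_axioms pm.vector_space_axioms quantum_plane_rep_axioms.intro)
  show "Vector_Spaces.linear scale scale (T x)" for x
    by (rule linearI') (simp_all add: pm.vector_space_axioms distrib_left scale_mult_right)
  show "pm.subspace {f. restr f \<in> I}"
    using subspace_I by (auto simp: pm.subspace_def restr_simps)
  show "T x u \<in> {f. restr f \<in> I}" if "x \<in> gens G" "u \<in> {f. restr f \<in> I}" for x u
    using that by (auto simp: restr_gen_mult intro!: I_mult carrier_simps)
  have cl: "f * restr u \<in> I" if "f \<in> I" for f u
    using that by (rule I_mult) (rule restr_closed)
  fix h h' u assume "h \<in> carrier G" "h' \<in> carrier G"
  then show "T (Grp h) (T (Grp h') u) - T (Grp (h \<otimes> h')) u \<in> {f. restr f \<in> I}"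
    using cl[OF rels_in_I, of "gen (Grp h) * gen (Grp h') - gen (Grp (h \<otimes> h'))" u]
    by (auto simp: restr_simps restr_gen_mult left_diff_distrib mult.assoc rels_def relators_def)
next
  have cl: "f * restr u \<in> I" if "f \<in> I" for f u
    using that by (rule I_mult) (rule restr_closed)
  fix h u assume "h \<in> carrier G"
  then show "T (Grp h) (T X1 u) - scale (\<chi>1 h) (T X1 (T (Grp h) u)) \<in> {f. restr f \<in> I}"
    "T (Grp h) (T X2 u) - scale (\<chi>2 h) (T X2 (T (Grp h) u)) \<in> {f. restr f \<in> I}"
    using cl[OF rels_in_I, of "gen (Grp h) * gen X1 - scale (\<chi>1 h) (gen X1 * gen (Grp h))" u]
      cl[OF rels_in_I, of "gen (Grp h) * gen X2 - scale (\<chi>2 h) (gen X2 * gen (Grp h))" u]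
    by (auto simp: restr_simps restr_gen_mult left_diff_distrib mult.assoc scale_mult_left rels_def relators_def)
next
  have cl: "f * restr u \<in> I" if "f \<in> I" for f u
    using that by (rule I_mult) (rule restr_closed)
  fix u
  have "gen X1 ^ r - scale a1 (1 - gen (Grp g1) ^ r) \<in> rels" "gen X2 ^ r - scale a2 (1 - gen (Grp g2) ^ r) \<in> rels"
    by (simp_all add: rels_def relators_def)
  from this[THEN X_pow_I, THEN cl, of u]
  show "(T X1 ^^ r) u - (scale (par1 par) (T (Grp \<one>) u) - scale (par1 par) (T (Grp (g1 [^] r)) u)) \<in> {f. restr f \<in> I}"
    "(T X2 ^^ r) u - (scale (par2 par) (T (Grp \<one>) u) - scale (par2 par) (T (Grp (g2 [^] r)) u)) \<in> {f. restr f \<in> I}"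
    by (simp_all add: T_pow restr_simps restr_gen_mult restr_gen_pow left_diff_distrib scale_mult_left del: scale_single)
  have e1: "gen X2 * gen X1 - (scale q (gen X1 * gen X2) + scale a (1 - gen (Grp g1) * gen (Grp g2))) \<in> I"
    by (rule rels_in_I) (simp add: rels_def relators_def)
  have e2: "gen (Grp g1) * gen (Grp g2) - gen (Grp (g1 \<otimes> g2)) \<in> I"
    by (rule rels_in_I) (use g1 g2 in \<open>unfold rels_def relators_def, blast\<close>)
  \<comment> \<open>The two forms of the relation differ by multiples of
    \<open>gen (Grp \<one>) - 1\<close> and of the group relator for \<open>g1\<close> and
    \<open>g2\<close>.\<close>
  have e3: "gen X2 * gen X1 - (scale q (gen X1 * gen X2) + scale a (gen (Grp \<one>)) - scale a (gen (Grp (g1 \<otimes> g2)))) =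
    gen X2 * gen X1 - (scale q (gen X1 * gen X2) + scale a (1 - gen (Grp g1) * gen (Grp g2))) - scale a (gen (Grp \<one>) - 1)
     - scale a (gen (Grp g1) * gen (Grp g2) - gen (Grp (g1 \<otimes> g2)))"
    by (simp add: pm.scale_right_diff_distrib del: scale_single)
  have "gen X2 * gen X1 - (scale q (gen X1 * gen X2) + scale a (gen (Grp \<one>)) - scale a (gen (Grp (g1 \<otimes> g2)))) \<in> I"
    unfolding e3
    by (rule pm.subspace_diff[OF subspace_I pm.subspace_diff[OF subspace_I e1 pm.subspace_scale[OF subspace_I one_I]]
          pm.subspace_scale[OF subspace_I e2]])
  from cl[OF this, of u]
  show "T X2 (T X1 u) - (scale q (T X1 (T X2 u)) + scale (par0 par) (T (Grp \<one>) u) - scale (par0 par) (T (Grp (g1 \<otimes> g2)) u)) \<in> {f. restr f \<in> I}"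
    by (simp add: restr_simps restr_gen_mult left_diff_distrib distrib_right scale_mult_left mult.assoc del: scale_single)
qed

interpretation F: quantum_plane_rep G g1 g2 \<chi>1 \<chi>2 q r scale "{f. restr f \<in> I}" T par par
  by (rule free_rep)

text \<open>The monomials as products of generators in the free algebra. That \<open>sec\<close>
  inverts \<open>pi\<close> says in \<open>pi_sec\<close> that they are independent modulo the
  ideal, and in \<open>sec_pi\<close> that they span.\<close>

definition sec :: "('g, 'k) formal \<Rightarrow> ('g gen list \<Rightarrow>\<^sub>0 'k)" where
  "sec = ext (mon T 1)"

lemma sec_closed: "sec c \<in> carrier FA"
proof -
  have *: "(T x ^^ n) f \<in> carrier FA" if "x \<in> gens G" "f \<in> carrier FA" for x n f
    unfolding T_pow using that by (intro carrier_simps carrier_power)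
  have "mon T 1 k \<in> carrier FA" for k
  proof (cases "k \<in> idx")
    case True
    obtain i j g where k: "k = (i, j, g)" by (cases k)
    have "(T X1 ^^ i) ((T X2 ^^ j) (T (Grp g) 1)) \<in> carrier FA"
      using True k by (intro * carrier_simps) auto
    then show ?thesis using True by (simp add: k mon_eq del: free_algebra_simps(6))
  qed simp
  then show ?thesis unfolding sec_def lext_def
    by (intro pm.subspace_sum[OF FA.subspace_M] pm.subspace_scale[OF FA.subspace_M])
qed

lemma pi_sec: "keys c \<subseteq> idx \<Longrightarrow> pi (sec c) = c"
proof -
  assume c: "keys c \<subseteq> idx"
  have "pi (mon T 1 k) = basis k" if "k \<in> idx" for k
    using mon_intertwine[where F = pi and T = T and T' = "op par par" and u = 1] that
    by (simp add: pi_gen_mult pi_simps pi_1 mon_op_e0)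
  then have "ext (\<lambda>k. pi (mon T 1 k)) c = ext basis c"
    using c by (intro lext_cong) auto
  then show ?thesis
    using linear_lext_comp[OF linear_pi, of "mon T 1" c] by (simp add: sec_def)
qed

text \<open>Induction on words: by \<open>T_lext_mon\<close>, a letter times a combination of
  monomials is again congruent to such a combination. The empty word is congruent to the monomial
  \<open>Grp \<one>\<close>.\<close>

lemma sec_pi: "f \<in> carrier FA \<Longrightarrow> f - sec (pi f) \<in> I"
proof -
  assume f: "f \<in> carrier FA"
  have w: "F.eqv (basis w) (sec (pi (basis w)))" if "w \<in> lists (gens G)" for w
    using that
  proof (induction w)
    case Nil
    have "1 - gen (Grp \<one>) \<in> I" using pm.subspace_neg[OF subspace_I one_I] by simp
    moreover have "1 - gen (Grp \<one>) \<in> carrier FA" by (intro carrier_simps) auto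
    ultimately show ?case
      by (simp add: F.eqv_def pi_1 sec_def mon_eq restr_id basis_Nil del: free_algebra_simps(6))
  next
    case (Cons x w)
    have "F.eqv (T x (basis w)) (T x (sec (pi (basis w))))"
      using Cons by (intro F.eqv_T) auto
    also have "F.eqv (T x (sec (pi (basis w)))) (sec (op par par x (pi (basis w))))"
      unfolding sec_def using Cons by (intro F.T_lext_mon) auto
    finally show ?case by (simp add: gen_mult_basis pi_single)
  qed
  have "ext (\<lambda>w. basis w - sec (pi (basis w))) f \<in> {f. restr f \<in> I}"
    unfolding lext_def
  proof (intro pm.subspace_sum[OF F.N_subspace] pm.subspace_scale[OF F.N_subspace])
    fix x assume "x \<in> keys f"
    then have "x \<in> lists (gens G)" using f by auto
    then show "basis x - sec (pi (basis x)) \<in> {f. restr f \<in> I}" using w by (simp only: F.eqv_def)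
  qed
  moreover have "ext (\<lambda>w. sec (pi (basis w))) f = sec (pi f)"
    by (rule linear_eq_lext[symmetric]) (auto simp: sec_def intro: linear_comp[OF linear_ext])
  ultimately have "restr (f - sec (pi f)) \<in> I"
    by (simp add: pm.lext_fun_diff)
  then show ?thesis using restr_id[OF carrier_simps(3)[OF f sec_closed]] by simp
qed

definition kap :: "('g, 'k) formal \<Rightarrow> ('g gen list \<Rightarrow>\<^sub>0 'k) set" where
  "kap c = Q.cls (sec c)"

lemma cls_eq_kap: "f \<in> carrier FA \<Longrightarrow> Q.cls f = kap (pi f)"
  using sec_pi by (simp add: kap_def Q.cls_eq_iff)

section \<open>The structure maps of the presented algebra in coordinates\<close>

abbreviation L where "L \<equiv> lifting G g1 g2 \<chi>1 \<chi>2 q r a1 a2 a"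

lemma L_eq: "L = presented_hopf (gens G) rels (gen_comult g1 g2) gen_counit"
  by (simp add: lifting_def rels_def)

lemma L_simps [simp]: "carrier L = carrier Q" "add L = add Q" "zero L = zero Q" "smult L = smult Q"
  "mult L = mult Q" "one L = one Q"
  by (simp_all add: L_eq presented_hopf_def Let_def module.defs)

lemma comult_L: "comult L c = lin (tensor Q Q) (\<lambda>p. pure Q Q (Q.cls (basis (fst p))) (Q.cls (basis (snd p))))
    (ext (\<lambda>w. prod_list (map (gen_comult g1 g2) w)) (SOME f. f \<in> c))"
  by (simp add: L_eq presented_hopf_def Let_def module.defs hopf.defs lin_def lext_def presented_class_def)

lemma counit_L: "counit L c = fext (\<lambda>w. prod_list (map gen_counit w)) (SOME f. f \<in> c)"
  by (simp add: L_eq presented_hopf_def Let_def module.defs hopf.defs lext_def)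

text \<open>Comultiplication and counit are computed on an unknown representative; \<open>pi\<close>
  recovers the coordinates from it because it vanishes on the ideal.\<close>

lemma some_kap: "keys c \<subseteq> idx \<Longrightarrow> (SOME f. f \<in> kap c) \<in> carrier FA \<and> pi (SOME f. f \<in> kap c) = c"
proof -
  assume c: "keys c \<subseteq> idx"
  have 1: "(SOME f. f \<in> kap c) \<in> carrier FA" "(SOME f. f \<in> kap c) - sec c \<in> I"
    using Q.some_mem_cls[OF sec_closed, of c] by (simp_all add: kap_def)
  then show ?thesis using pi_I[OF 1(2)] pi_sec[OF c] by (simp add: pi_simps)
qed

text \<open>Under \<open>pi \<otimes> pi\<close>, multiplication by the comultiplication of a letter
  becomes \<open>top\<close> with all parameters equal to \<open>par\<close>; by
  \<open>cop_op\<close> the map \<open>cop\<close> obeys the same recursion.\<close>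

lemma cop_pi: "w \<in> lists (gens G) \<Longrightarrow> tmap pi pi (prod_list (map (gen_comult g1 g2) w)) = cop (pi (basis w))"
proof -
  have step: "tmap pi pi (gen_comult g1 g2 x * z) = top par par par x (tmap pi pi z)" for x z
  proof (induction z rule: poly_mapping_ext_induct)
    case (single ww b)
    obtain w w' where ww: "ww = (w, w')" by (cases ww)
    have "tmap pi pi (gen_comult g1 g2 x * basis ww) = top par par par x (tmap pi pi (basis ww))"
      by (cases x) (simp_all add: ww mult_single distrib_right tmap_simps pi_single top_otimes op_one keys_foldr_op
          linear_pm_simps[OF linear_tmap] add.commute)
    then have "tmap pi pi (gen_comult g1 g2 x * scale b (basis ww)) = top par par par x (tmap pi pi (scale b (basis ww)))"
      unfolding scale_mult_right by (simp only: tmap_simps top_simps)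
    then show ?case by simp
  qed (simp_all add: distrib_left tmap_simps top_simps)
  assume "w \<in> lists (gens G)"
  then show ?thesis
  proof (induction w)
    case Nil
    show ?case
      by (simp only: list.map prod_list.Nil one_pairs tmap_basis) (simp add: basis_Nil pi_1 copb_group)
  next
    case (Cons x w)
    then show ?case by (simp add: step cop_op[where p' = par] pi_single)
  qed
qed

lemma keys_gen_comult: "w \<in> lists (gens G) \<Longrightarrow> keys (prod_list (map (gen_comult g1 g2) w) :: _ \<Rightarrow>\<^sub>0 'k) \<subseteq> lists (gens G) \<times> lists (gens G)"
proof (induction w)
  case Nil
  show ?case by (simp only: list.map prod_list.Nil one_pairs) simp
next
  case (Cons x w)
  let ?d = "gen_comult g1 g2 x :: _ \<Rightarrow>\<^sub>0 'k" and ?z = "prod_list (map (gen_comult g1 g2) w) :: _ \<Rightarrow>\<^sub>0 'k"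
  have d: "keys ?d \<subseteq> lists (gens G) \<times> lists (gens G)"
    using Cons by (cases x) (auto intro!: order.trans[OF Poly_Mapping.keys_add])
  have "keys (?d * ?z) \<subseteq> {a + b |a b. a \<in> keys ?d \<and> b \<in> keys ?z}" by (rule Poly_Mapping.keys_mult)
  also have "\<dots> \<subseteq> lists (gens G) \<times> lists (gens G)"
    using d Cons by fastforce
  finally show ?case by simp
qed

lemma eps_pi: "w \<in> lists (gens G) \<Longrightarrow> eps (pi (basis w)) = prod_list (map gen_counit w)"
proof (induction w)
  case (Cons x w)
  then show ?case by (cases x) (simp_all add: pi_single eps_Grp eps_X1 eps_X2)
qed (simp add: pi_single)

lemma kap_lin: "kap c = lin Q (\<lambda>k. kap (basis k)) c"
proof -
  interpret Q': kspace Q by (rule Q.kspace_quotient)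
  have cl: "kap c \<in> carrier Q" for c unfolding kap_def by (rule Q.cls_closed[OF sec_closed])
  have add: "kap (c + d) = kap c \<oplus>\<^bsub>Q\<^esub> kap d" for c d by (simp add: kap_def sec_def pm.lext_add)
  have scl: "kap (scale b c) = b \<odot>\<^bsub>Q\<^esub> kap c" for b c by (simp add: kap_def sec_def pm.lext_scale)
  show ?thesis
  proof (induction c rule: poly_mapping_ext_induct)
    case zero
    then show ?case by (simp add: kap_def sec_def Q.zero_quotient)
  next
    case (single k b)
    then show ?case using scl[of b "basis k"] cl by simp
  next
    case (add c d)
    then show ?case using cl by (simp add: \<open>\<And>c d. kap (c + d) = _\<close> Q'.lin_add)
  qed
qed

theorem lifting_model: "quantum_plane_model G g1 g2 \<chi>1 \<chi>2 q r par L kap"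
proof unfold_locales
  show cl: "kap c \<in> carrier L" for c unfolding L_simps kap_def by (rule Q.cls_closed[OF sec_closed])
  show "\<exists>c. keys c \<subseteq> idx \<and> kap c = x" if "x \<in> carrier L" for x
  proof -
    obtain f where f: "f \<in> carrier FA" "x = Q.cls f"
      using \<open>x \<in> carrier L\<close> by (auto simp: Q.carrier_quotient simp del: free_algebra_simps(6))
    show ?thesis using cls_eq_kap[OF f(1)] keys_pi[of f] f(2) by metis
  qed
  show "c = d" if "keys c \<subseteq> idx" "keys d \<subseteq> idx" "kap c = kap d" for c d
  proof -
    have "pi (sec c - sec d) = 0" using that(3) by (intro pi_I) (simp add: kap_def Q.cls_eq_iff)
    then show ?thesis using that by (simp add: pi_simps pi_sec)
  qed
  show "kap (basis k) = \<zero>\<^bsub>L\<^esub>" if "k \<notin> idx" for k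
    using that by (simp add: kap_def sec_def Q.zero_quotient)
  show "kap (c + d) = kap c \<oplus>\<^bsub>L\<^esub> kap d" for c d by (simp add: kap_def sec_def pm.lext_add)
  show "kap (scale b c) = b \<odot>\<^bsub>L\<^esub> kap c" for b c by (simp add: kap_def sec_def pm.lext_scale)
  show "kap 0 = \<zero>\<^bsub>L\<^esub>" by (simp add: kap_def sec_def Q.zero_quotient)
  show "kap c \<otimes>\<^bsub>L\<^esub> kap d = kap (prd par par c d)" if "keys c \<subseteq> idx" "keys d \<subseteq> idx" for c d
  proof -
    have "kap c \<otimes>\<^bsub>L\<^esub> kap d = Q.cls (sec c \<otimes>\<^bsub>FA\<^esub> sec d)"
      unfolding L_simps kap_def by (rule Q.mult_cls) (simp_all add: I_mult sec_closed[simplified] distrib_left distrib_right)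
    also have "\<dots> = kap (pi (sec c * sec d))"
      using cls_eq_kap[OF carrier_simps(1)[OF sec_closed sec_closed]] by simp
    finally show ?thesis using that by (simp add: pi_mult pi_sec)
  qed
  show "\<one>\<^bsub>L\<^esub> = kap (basis e0)"
    using cls_eq_kap[OF carrier_simps(6)] by (simp add: Q.one_quotient pi_1)
  fix c :: "('g, 'k) formal" assume c: "keys c \<subseteq> idx"
  define f where "f = (SOME f. f \<in> kap c)"
  have f: "f \<in> carrier FA" "pi f = c" using some_kap[OF c] by (simp_all add: f_def)
  have fw: "w \<in> lists (gens G)" if "w \<in> keys f" for w using f(1) that by auto
  have "eps (pi f) = fext (\<lambda>w. prod_list (map gen_counit w)) f"
  proof -
    have "eps (pi f) = fext (\<lambda>w. eps (pi (basis w))) f"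
      by (rule linear_eq_lext) (rule linear_comp[OF linear_eps linear_pi])
    then show ?thesis by (simp add: lext_def eps_pi fw)
  qed
  then show "counit L (kap c) = eps c" by (simp add: counit_L f flip: f_def)
  interpret QQ: tensor_pair Q Q by (simp add: tensor_pair_def Q.kspace_quotient)
  let ?T = "tensor Q Q" and ?h = "\<lambda>(k, l). pure Q Q (kap (basis k)) (kap (basis l))"
  interpret T: kspace ?T by (rule QQ.kspace_tensor)
  have clQ: "kap c \<in> carrier Q" for c using cl by simp
  have h: "?h x \<in> carrier ?T" for x by (simp add: split_def bilinear_mapD(3)[OF QQ.bilinear_pure clQ clQ])
  let ?d = "ext (\<lambda>w. prod_list (map (gen_comult g1 g2) w)) f"
  have d: "keys ?d \<subseteq> lists (gens G) \<times> lists (gens G)"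
    by (intro keys_ext_subsetI keys_gen_comult fw)
  have pure: "pure Q Q (Q.cls (basis w)) (Q.cls (basis w')) = lin ?T ?h (otimes (pi (basis w)) (pi (basis w')))"
    if "w \<in> lists (gens G)" "w' \<in> lists (gens G)" for w w'
  proof -
    have "pure Q Q (Q.cls (basis w)) (Q.cls (basis w')) = pure Q Q (kap (pi (basis w))) (kap (pi (basis w')))"
      using that by (simp add: cls_eq_kap)
    also have "\<dots> = lin ?T ?h (otimes (pi (basis w)) (pi (basis w')))"
      by (subst (1 2) kap_lin) (rule QQ.pure_lin_lin[OF clQ clQ])
    finally show ?thesis .
  qed
  have "comult L (kap c) = lin ?T (\<lambda>p. pure Q Q (Q.cls (basis (fst p))) (Q.cls (basis (snd p)))) ?d"
    by (simp add: comult_L f_def)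
  also have "\<dots> = lin ?T (\<lambda>p. lin ?T ?h (case p of (w, w') \<Rightarrow> otimes (pi (basis w)) (pi (basis w')))) ?d"
  proof (rule T.lin_cong)
    fix ww assume "ww \<in> keys ?d"
    then obtain w w' where ww: "ww = (w, w')" and "w \<in> lists (gens G)" "w' \<in> lists (gens G)"
      using d by (cases ww) blast
    then show "pure Q Q (Q.cls (basis (fst ww))) (Q.cls (basis (snd ww))) =
        lin ?T ?h (case ww of (w, w') \<Rightarrow> otimes (pi (basis w)) (pi (basis w')))"
      by (simp only: fst_conv snd_conv prod.case pure)
    show "lin ?T ?h (case ww of (w, w') \<Rightarrow> otimes (pi (basis w)) (pi (basis w'))) \<in> carrier ?T"
      by (rule T.lin_closed[OF h])
  qed
  also have "\<dots> = lin ?T ?h (tmap pi pi ?d)"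
    unfolding tmap_def by (rule lin_ext[OF QQ.kspace_tensor h, symmetric])
  also have "tmap pi pi ?d = ext (\<lambda>w. tmap pi pi (prod_list (map (gen_comult g1 g2) w))) f"
    by (rule linear_lext_comp) simp
  also have "\<dots> = ext (\<lambda>w. cop (pi (basis w))) f"
    by (intro lext_cong cop_pi fw)
  also have "\<dots> = cop (pi f)"
    by (rule linear_eq_lext[symmetric]) (rule linear_comp[OF linear_cop linear_pi])
  finally have "comult L (kap c) = lin ?T ?h (cop c)" by (simp add: f)
  also have "\<dots> = tcls Q Q (ext (\<lambda>(k, l). basis (kap (basis k), kap (basis l))) (cop c))"
    by (subst QQ.tcls_ext) (auto simp: clQ pure_eq_tcls split_def)
  also have "\<dots> = tcls L L (ext (\<lambda>(k, l). basis (kap (basis k), kap (basis l))) (cop c))"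
    by (rule tcls_cong) simp_all
  finally show "comult L (kap c) = tcls L L (ext (\<lambda>(k, l). basis (kap (basis k), kap (basis l))) (cop c))" .
qed

end

lemma bilinear_times:
  assumes "linear_map V scalars f" "linear_map W scalars g"
  shows "bilinear_map V W scalars (\<lambda>x y. f x * g y)"
  using linear_mapD[OF assms(1)] linear_mapD[OF assms(2)]
  by (auto intro!: bilinear_mapI linear_mapI simp: algebra_simps)

lemma linear_times_left: "linear_map V scalars f \<Longrightarrow> linear_map V scalars (\<lambda>x. f x * c)"
  and linear_times_right: "linear_map V scalars f \<Longrightarrow> linear_map V scalars (\<lambda>x. c * f x)"
  by (auto simp: linear_map_def algebra_simps)

lemma linear_fext: "Vector_Spaces.linear s (*) (f :: _ \<Rightarrow> 'k::field) \<Longrightarrow> f (lext s g c) = fext (\<lambda>x. f (g x)) c"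
  by (rule linear_lext_comp)

context quantum_plane_model
begin

section \<open>Sweedler sums in a model\<close>

lemma sweedler_kap_scalars:
  assumes "bilinear_map R R scalars f" "keys c \<subseteq> idx"
  shows "sweedler R scalars f (\<kappa> c) = fext (\<lambda>(k, l). f (\<kappa> (basis k)) (\<kappa> (basis l))) (cop c)"
  using sweedler_kap[OF kspace_scalars assms] by (simp add: lin_scalars)

lemma double_sweedler_kap:
  assumes h1: "\<And>x1 x2. x1 \<in> carrier R \<Longrightarrow> x2 \<in> carrier R \<Longrightarrow> bilinear_map R R scalars (h x1 x2)"
    and h2: "\<And>y1 y2. y1 \<in> carrier R \<Longrightarrow> y2 \<in> carrier R \<Longrightarrow> bilinear_map R R scalars (\<lambda>x1 x2. h x1 x2 y1 y2)"
    and c: "keys c \<subseteq> idx" and d: "keys d \<subseteq> idx"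
  shows "sweedler R scalars (\<lambda>x1 x2. sweedler R scalars (h x1 x2) (\<kappa> d)) (\<kappa> c) =
    fext (\<lambda>(k, k'). fext (\<lambda>(l, l'). h (\<kappa> (basis k)) (\<kappa> (basis k')) (\<kappa> (basis l)) (\<kappa> (basis l'))) (cop d)) (cop c)"
proof -
  have "bilinear_map R R scalars (\<lambda>x1 x2. sweedler R scalars (h x1 x2) (\<kappa> d))"
  proof (rule bilinear_mapI)
    fix v assume v: "v \<in> carrier R"
    show "linear_map R scalars (\<lambda>x2. sweedler R scalars (h v x2) (\<kappa> d))"
      by (rule linear_sweedler_param[OF kspace_scalars R.kspace_axioms h1[OF v] bilinear_mapD(1)[OF h2 v]]) auto
    show "linear_map R scalars (\<lambda>x1. sweedler R scalars (h x1 v) (\<kappa> d))"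
      by (rule linear_sweedler_param[OF kspace_scalars R.kspace_axioms h1[OF _ v] bilinear_mapD(2)[OF h2 v]]) auto
  qed
  then show ?thesis
    by (simp add: sweedler_kap_scalars c d h1)
qed

lemma bilinear_kap:
  assumes f: "bilinear_map R R scalars f"
  shows "f (\<kappa> c) (\<kappa> d) = fext (\<lambda>k. fext (\<lambda>l. f (\<kappa> (basis k)) (\<kappa> (basis l))) d) c"
proof -
  have "f (\<kappa> c) (\<kappa> d) = f (lin R (\<lambda>k. \<kappa> (basis k)) c) (\<kappa> d)" by (simp flip: kap_eq_lin)
  also have "\<dots> = fext (\<lambda>k. f (\<kappa> (basis k)) (\<kappa> d)) c"
    using linear_map_lin[OF bilinear_mapD(2)[OF f, of "\<kappa> d"] R.kspace_axioms kspace_scalars, of c "\<lambda>k. \<kappa> (basis k)"]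
    by (simp add: lin_scalars)
  also have "(\<lambda>k. f (\<kappa> (basis k)) (\<kappa> d)) = (\<lambda>k. fext (\<lambda>l. f (\<kappa> (basis k)) (\<kappa> (basis l))) d)"
  proof
    fix k
    have "f (\<kappa> (basis k)) (\<kappa> d) = f (\<kappa> (basis k)) (lin R (\<lambda>k. \<kappa> (basis k)) d)" by (simp flip: kap_eq_lin)
    then show "f (\<kappa> (basis k)) (\<kappa> d) = fext (\<lambda>l. f (\<kappa> (basis k)) (\<kappa> (basis l))) d"
      using linear_map_lin[OF bilinear_mapD(1)[OF f, of "\<kappa> (basis k)"] R.kspace_axioms kspace_scalars, of d "\<lambda>k. \<kappa> (basis k)"]
      by (simp add: lin_scalars)
  qed
  finally show ?thesis .
qed

text \<open>Agreement with \<open>gam p1 p2\<close> is asked only on the carrier, since the maps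
  chosen by \<open>SOME\<close> are not determined elsewhere.\<close>

definition form :: "'k params \<Rightarrow> 'k params \<Rightarrow> ('a \<Rightarrow> 'a \<Rightarrow> 'k) \<Rightarrow> bool" where
  "form p1 p2 \<gamma> \<longleftrightarrow> (\<forall>c d. keys c \<subseteq> idx \<longrightarrow> keys d \<subseteq> idx \<longrightarrow> \<gamma> (\<kappa> c) (\<kappa> d) = gam p1 p2 c d)"

lemma formD: "form p1 p2 \<gamma> \<Longrightarrow> keys c \<subseteq> idx \<Longrightarrow> keys d \<subseteq> idx \<Longrightarrow> \<gamma> (\<kappa> c) (\<kappa> d) = gam p1 p2 c d"
  by (simp add: form_def)

lemma form_bilinear:
  assumes "form p1 p2 \<gamma>"
  shows "bilinear_map R R scalars \<gamma>"
proof (rule bilinear_mapI)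
  note f = formD[OF assms]
  fix v assume "v \<in> carrier R"
  then obtain e where e: "v = \<kappa> e" "keys e \<subseteq> idx" by (rule kap_cases)
  have 1: "\<gamma> v (x \<oplus>\<^bsub>R\<^esub> y) = \<gamma> v x + \<gamma> v y" "\<gamma> (x \<oplus>\<^bsub>R\<^esub> y) v = \<gamma> x v + \<gamma> y v"
    if "x \<in> carrier R" "y \<in> carrier R" for x y
  proof -
    obtain c d where "x = \<kappa> c" "y = \<kappa> d" "keys c \<subseteq> idx" "keys d \<subseteq> idx" using \<open>x \<in> _\<close> \<open>y \<in> _\<close> by (metis kap_surj)
    then show "\<gamma> v (x \<oplus>\<^bsub>R\<^esub> y) = \<gamma> v x + \<gamma> v y" "\<gamma> (x \<oplus>\<^bsub>R\<^esub> y) v = \<gamma> x v + \<gamma> y v"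
      using e by (simp_all add: f keys_add_idx gam_simps flip: kap_add)
  qed
  have 2: "\<gamma> v (b \<odot>\<^bsub>R\<^esub> x) = b * \<gamma> v x" "\<gamma> (b \<odot>\<^bsub>R\<^esub> x) v = b * \<gamma> x v" if "x \<in> carrier R" for x b
  proof -
    obtain c where "x = \<kappa> c" "keys c \<subseteq> idx" using \<open>x \<in> _\<close> by (rule kap_cases)
    then show "\<gamma> v (b \<odot>\<^bsub>R\<^esub> x) = b * \<gamma> v x" "\<gamma> (b \<odot>\<^bsub>R\<^esub> x) v = b * \<gamma> x v"
      using e by (simp_all add: f keys_scale_idx gam_simps flip: kap_scale)
  qed
  show "linear_map R scalars (\<gamma> v)" "linear_map R scalars (\<lambda>x. \<gamma> x v)"
    by (rule linear_mapI; simp add: 1 2)+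
qed

lemma form_cong_basis:
  assumes "bilinear_map R R scalars \<gamma>" "\<And>k l. k \<in> idx \<Longrightarrow> l \<in> idx \<Longrightarrow> \<gamma> (\<kappa> (basis k)) (\<kappa> (basis l)) = gam p1 p2 (basis k) (basis l)"
  shows "form p1 p2 \<gamma>"
  unfolding form_def
proof (intro allI impI)
  fix c d :: "('g, 'k) formal" assume c: "keys c \<subseteq> idx" and d: "keys d \<subseteq> idx"
  have 1: "fext (\<lambda>l. gam p1 p2 (basis k) (basis l)) d = gam p1 p2 (basis k) d" for k
    by (rule linear_eq_lext[symmetric]) (simp add: Vector_Spaces.linear_iff gam_simps pm.vector_space_axioms fld.vector_space_axioms)
  have 2: "fext (\<lambda>k. gam p1 p2 (basis k) d) c = gam p1 p2 c d"
    by (rule linear_eq_lext[symmetric]) (simp add: Vector_Spaces.linear_iff gam_simps pm.vector_space_axioms fld.vector_space_axioms)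
  have "fext (\<lambda>k. fext (\<lambda>l. \<gamma> (\<kappa> (basis k)) (\<kappa> (basis l))) d) c = fext (\<lambda>k. fext (\<lambda>l. gam p1 p2 (basis k) (basis l)) d) c"
    using c d by (intro lext_cong assms(2)) auto
  then show "\<gamma> (\<kappa> c) (\<kappa> d) = gam p1 p2 c d"
    unfolding bilinear_kap[OF assms(1), of c d] by (simp only: 1 2)
qed

lemma convolution_kap:
  assumes \<gamma>: "bilinear_map R R scalars \<gamma>" and \<delta>: "bilinear_map R R scalars \<delta>"
    and c: "keys c \<subseteq> idx" and d: "keys d \<subseteq> idx"
  shows "convolution R \<gamma> \<delta> (\<kappa> c) (\<kappa> d) = fext (\<lambda>(k, k'). fext (\<lambda>(l, l').
     \<gamma> (\<kappa> (basis k)) (\<kappa> (basis l)) * \<delta> (\<kappa> (basis k')) (\<kappa> (basis l'))) (cop d)) (cop c)"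
  unfolding convolution_def
  by (rule double_sweedler_kap[OF _ _ c d])
    (auto intro!: bilinear_times bilinear_mapD[OF \<gamma>] bilinear_mapD[OF \<delta>])

lemma fext_cop_cong:
  assumes "\<And>k k' l l'. k \<in> idx \<Longrightarrow> k' \<in> idx \<Longrightarrow> l \<in> idx \<Longrightarrow> l' \<in> idx \<Longrightarrow> f k k' l l' = f' k k' l l'"
  shows "lext s (\<lambda>(k, k'). lext s (\<lambda>(l, l'). f k k' l l') (cop d)) (cop c) =
    lext s (\<lambda>(k, k'). lext s (\<lambda>(l, l'). f' k k' l l') (cop d)) (cop c)"
  by (auto intro!: lext_cong assms dest!: keys_copD)

lemma form_convolution:
  assumes "form p1 p2 \<gamma>" "form p2 p3 \<delta>"
  shows "form p1 p3 (convolution R \<gamma> \<delta>)"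
  unfolding form_def
proof (intro allI impI)
  fix c d :: "('g, 'k) formal" assume c: "keys c \<subseteq> idx" and d: "keys d \<subseteq> idx"
  show "convolution R \<gamma> \<delta> (\<kappa> c) (\<kappa> d) = gam p1 p3 c d"
    unfolding convolution_kap[OF form_bilinear[OF assms(1)] form_bilinear[OF assms(2)] c d] gam_comp[OF c, where p' = p2]
    by (rule fext_cop_cong) (simp add: formD[OF assms(1)] formD[OF assms(2)])
qed

definition kinv :: "'a \<Rightarrow> ('g, 'k) formal" where
  "kinv x = (SOME c. keys c \<subseteq> idx \<and> \<kappa> c = x)"

lemma kinv_kap: "keys c \<subseteq> idx \<Longrightarrow> kinv (\<kappa> c) = c"
  unfolding kinv_def by (rule some_equality) (use kap_inj in auto)

lemma form_exists: "form p1 p2 (\<lambda>x y. gam p1 p2 (kinv x) (kinv y))"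
  by (simp add: form_def kinv_kap)

section \<open>Uniqueness of convolution inverses\<close>

text \<open>Convolution of arbitrary functions on pairs of basis vectors. Bilinearity is automatic
  here, so associativity needs no conditions on the integrands.\<close>

definition bconv :: "('g mono \<Rightarrow> 'g mono \<Rightarrow> 'k) \<Rightarrow> ('g mono \<Rightarrow> 'g mono \<Rightarrow> 'k) \<Rightarrow>
    'g mono \<Rightarrow> 'g mono \<Rightarrow> 'k" where
  "bconv F H x y = fext (\<lambda>(k, k'). fext (\<lambda>(l, l'). F k l * H k' l') (copb y)) (copb x)"

text \<open>Coassociativity is applied in each argument separately. \<open>?\<Phi>\<close> and
  \<open>?\<Psi>\<close> are the sums over the second argument bracketed to the left and to the
  right; exchanging sums brings the sum over the second argument inside.\<close>

lemma bconv_assoc: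
  assumes "x \<in> idx" "y \<in> idx"
  shows "bconv (bconv F H) K x y = bconv F (bconv H K) x y"
proof -
  have x: "keys (basis x) \<subseteq> idx" and y: "keys (basis y) \<subseteq> idx" using assms by simp_all
  let ?t = "\<lambda>k1 k2 k3 l1 l2 l3. F k1 l1 * H k2 l2 * K k3 l3"
  let ?\<Phi> = "\<lambda>k1 k2 k3. fext (\<lambda>(y', l3). fext (\<lambda>(l1, l2). ?t k1 k2 k3 l1 l2 l3) (copb y')) (copb y)"
  let ?\<Psi> = "\<lambda>k1 k2 k3. fext (\<lambda>(l1, y'). fext (\<lambda>(l2, l3). ?t k1 k2 k3 l1 l2 l3) (copb y')) (copb y)"
  have right: "fext f c * b = fext (\<lambda>x. f x * b) c" for f :: "'g mono \<times> 'g mono \<Rightarrow> 'k" and b c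
    using fld.lext_fun_scale[of b f c] by (simp add: mult.commute)
  have left: "b * fext f c = fext (\<lambda>x. b * f x) c" for f :: "'g mono \<times> 'g mono \<Rightarrow> 'k" and b c
    using fld.lext_fun_scale[of b f c] by simp
  have "bconv (bconv F H) K x y = fext (\<lambda>(x', k3). fext (\<lambda>(k1, k2). ?\<Phi> k1 k2 k3) (copb x')) (copb x)"
  proof -
    have "fext (\<lambda>b. bconv F H x' (fst b) * K k3 (snd b)) (copb y) = fext (\<lambda>(k1, k2). ?\<Phi> k1 k2 k3) (copb x')" for x' k3
    proof -
      have "fext (\<lambda>b. bconv F H x' (fst b) * K k3 (snd b)) (copb y) =
        fext (\<lambda>b. fext (\<lambda>a. fext (\<lambda>l. ?t (fst a) (snd a) k3 (fst l) (snd l) (snd b)) (copb (fst b))) (copb x')) (copb y)"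
        unfolding bconv_def split_def right ..
      also have "\<dots> = fext (\<lambda>a. fext (\<lambda>b. fext (\<lambda>l. ?t (fst a) (snd a) k3 (fst l) (snd l) (snd b)) (copb (fst b))) (copb y)) (copb x')"
        by (rule fld.lext_swap[symmetric])
      finally show ?thesis by (simp add: split_def)
    qed
    then show ?thesis by (simp add: bconv_def[of "bconv F H"] split_def)
  qed
  also have "\<dots> = fext (\<lambda>(k1, x'). fext (\<lambda>(k2, k3). ?\<Phi> k1 k2 k3) (copb x')) (copb x)"
    using coassoc_lext[OF vector_space_field x, of ?\<Phi>] by simp
  also have "\<dots> = fext (\<lambda>(k1, x'). fext (\<lambda>(k2, k3). ?\<Psi> k1 k2 k3) (copb x')) (copb x)"
  proof -
    have "?\<Phi> k1 k2 k3 = ?\<Psi> k1 k2 k3" for k1 k2 k3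
      using coassoc_lext[OF vector_space_field y, of "?t k1 k2 k3"] by simp
    then show ?thesis by (simp only:)
  qed
  also have "\<dots> = bconv F (bconv H K) x y"
  proof -
    have "fext (\<lambda>b. F k1 (fst b) * bconv H K x' (snd b)) (copb y) = fext (\<lambda>(k2, k3). ?\<Psi> k1 k2 k3) (copb x')" for k1 x'
    proof -
      have "fext (\<lambda>b. F k1 (fst b) * bconv H K x' (snd b)) (copb y) =
        fext (\<lambda>b. fext (\<lambda>a. fext (\<lambda>l. ?t k1 (fst a) (snd a) (fst b) (fst l) (snd l)) (copb (snd b))) (copb x')) (copb y)"
        unfolding bconv_def split_def left mult.assoc ..
      also have "\<dots> = fext (\<lambda>a. fext (\<lambda>b. fext (\<lambda>l. ?t k1 (fst a) (snd a) (fst b) (fst l) (snd l)) (copb (snd b))) (copb y)) (copb x')"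
        by (rule fld.lext_swap[symmetric])
      finally show ?thesis by (simp add: split_def)
    qed
    then show ?thesis by (simp add: bconv_def[of F] split_def)
  qed
  finally show ?thesis .
qed

lemma fext_counit:
  assumes "x \<in> idx"
  shows "fext (\<lambda>(k, k'). epsb k * f k') (copb x) = f x" "fext (\<lambda>(k, k'). f k * epsb k') (copb x) = f x"
proof -
  have x: "keys (basis x) \<subseteq> idx" using assms by simp
  have "fext f (basis x) = fext f (ext (\<lambda>(k, l). single l (epsb k)) (cop (basis x)))"
    by (simp only: counit_left_pm[OF x])
  then show "fext (\<lambda>(k, k'). epsb k * f k') (copb x) = f x"
    by (simp add: fld.lext_ext split_def)
  have "fext f (basis x) = fext f (ext (\<lambda>(k, l). single k (epsb l)) (cop (basis x)))"
    by (simp only: counit_right_pm[OF x])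
  then show "fext (\<lambda>(k, k'). f k * epsb k') (copb x) = f x"
    by (simp add: fld.lext_ext split_def mult.commute)
qed

lemma bconv_unit:
  assumes "x \<in> idx" "y \<in> idx"
  shows "bconv (\<lambda>k l. epsb k * epsb l) F x y = F x y" "bconv F (\<lambda>k l. epsb k * epsb l) x y = F x y"
proof -
  have "fext (\<lambda>(l, l'). epsb k * epsb l * F k' l') (copb y) = epsb k * F k' y" for k k'
  proof -
    have "fext (\<lambda>(l, l'). epsb k * epsb l * F k' l') (copb y) = epsb k * fext (\<lambda>(l, l'). epsb l * F k' l') (copb y)"
      using fld.lext_fun_scale[of "epsb k" "\<lambda>(l, l'). epsb l * F k' l'" "copb y"] by (simp add: split_def mult.assoc)
    then show ?thesis by (simp add: fext_counit assms)
  qed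
  then show "bconv (\<lambda>k l. epsb k * epsb l) F x y = F x y" by (simp add: bconv_def fext_counit assms)
  have "fext (\<lambda>(l, l'). F k l * (epsb k' * epsb l')) (copb y) = F k y * epsb k'" for k k'
  proof -
    have "fext (\<lambda>(l, l'). F k l * (epsb k' * epsb l')) (copb y) = epsb k' * fext (\<lambda>(l, l'). F k l * epsb l') (copb y)"
      using fld.lext_fun_scale[of "epsb k'" "\<lambda>(l, l'). F k l * epsb l'" "copb y"] by (simp add: split_def mult.left_commute)
    then show ?thesis by (simp add: fext_counit assms mult.commute)
  qed
  then show "bconv F (\<lambda>k l. epsb k * epsb l) x y = F x y" by (simp add: bconv_def fext_counit assms)
qed

lemma bconv_cong:
  assumes "\<And>k l. k \<in> idx \<Longrightarrow> l \<in> idx \<Longrightarrow> F k l = F' k l" "\<And>k l. k \<in> idx \<Longrightarrow> l \<in> idx \<Longrightarrow> H k l = H' k l"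
  shows "bconv F H x y = bconv F' H' x y"
  unfolding bconv_def using fext_cop_cong[of "\<lambda>k k' l l'. F k l * H k' l'" "\<lambda>k k' l l'. F' k l * H' k' l'" "(*)" "basis y" "basis x"]
  by (simp add: assms)

lemma convolution_basis:
  assumes "bilinear_map R R scalars \<gamma>" "bilinear_map R R scalars \<delta>" "x \<in> idx" "y \<in> idx"
  shows "convolution R \<gamma> \<delta> (\<kappa> (basis x)) (\<kappa> (basis y)) =
    bconv (\<lambda>k l. \<gamma> (\<kappa> (basis k)) (\<kappa> (basis l))) (\<lambda>k l. \<delta> (\<kappa> (basis k)) (\<kappa> (basis l))) x y"
  using convolution_kap[OF assms(1,2), of "basis x" "basis y"] assms(3,4) by (simp add: bconv_def)

lemma counit_basis: "k \<in> idx \<Longrightarrow> counit R (\<kappa> (basis k)) = epsb k"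
  by (simp add: counit_kap eps_simps)

text \<open>\<gamma>(p1, p2) and \<gamma>(p2, p1) are inverse by composition of forms and
  \<open>gam_self\<close>. Any other inverse agrees with the latter on the carrier, by the usual
  comparison of a left with a right inverse; this controls the \<open>SOME\<close> in
  \<open>twist\<close>.\<close>

lemma form_inverse:
  assumes "form p1 p2 \<gamma>"
  shows "convolution_inverse R \<gamma> \<delta> \<longleftrightarrow> form p2 p1 \<delta>"
proof
  assume \<delta>: "form p2 p1 \<delta>"
  have "convolution R \<gamma> \<delta> x y = counit R x * counit R y \<and> convolution R \<delta> \<gamma> x y = counit R x * counit R y"
    if "x \<in> carrier R" "y \<in> carrier R" for x y
  proof -
    obtain c d where "x = \<kappa> c" "y = \<kappa> d" "keys c \<subseteq> idx" "keys d \<subseteq> idx" using \<open>x \<in> _\<close> \<open>y \<in> _\<close> by (metis kap_surj)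
    then show ?thesis
      using formD[OF form_convolution[OF assms \<delta>]] formD[OF form_convolution[OF \<delta> assms]]
      by (simp add: gam_self counit_kap)
  qed
  then show "convolution_inverse R \<gamma> \<delta>"
    by (simp add: convolution_inverse_def form_bilinear[OF \<delta>])
next
  assume inv: "convolution_inverse R \<gamma> \<delta>"
  note \<gamma> = form_bilinear[OF assms]
  have \<delta>: "bilinear_map R R scalars \<delta>"
    and 1: "\<And>x y. x \<in> carrier R \<Longrightarrow> y \<in> carrier R \<Longrightarrow> convolution R \<gamma> \<delta> x y = counit R x * counit R y"
    using inv by (auto simp: convolution_inverse_def)
  let ?g = "\<lambda>k l. gam p1 p2 (basis k) (basis l)" and ?h = "\<lambda>k l. gam p2 p1 (basis k) (basis l)"
    and ?d = "\<lambda>k l. \<delta> (\<kappa> (basis k)) (\<kappa> (basis l))" and ?e = "\<lambda>k l. epsb k * epsb l"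
  have gd: "bconv ?g ?d x y = ?e x y" if "x \<in> idx" "y \<in> idx" for x y
  proof -
    have "bconv ?g ?d x y = bconv (\<lambda>k l. \<gamma> (\<kappa> (basis k)) (\<kappa> (basis l))) ?d x y"
      by (rule bconv_cong) (simp_all add: formD[OF assms])
    then show ?thesis using convolution_basis[OF \<gamma> \<delta> that] 1[of "\<kappa> (basis x)" "\<kappa> (basis y)"] that
      by (simp add: counit_basis)
  qed
  have hg: "bconv ?h ?g x y = ?e x y" if "x \<in> idx" "y \<in> idx" for x y
    using gam_comp[of "basis x" p2 p2 "basis y" p1] gam_self[of "basis x" p2 "basis y"] that
    by (simp add: bconv_def eps_simps)
  have "?d x y = ?h x y" if xy: "x \<in> idx" "y \<in> idx" for x y
  proof -
    have "?d x y = bconv ?e ?d x y" by (simp add: bconv_unit xy)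
    also have "\<dots> = bconv (bconv ?h ?g) ?d x y" by (rule bconv_cong) (simp_all add: hg)
    also have "\<dots> = bconv ?h (bconv ?g ?d) x y" by (rule bconv_assoc[OF xy])
    also have "\<dots> = bconv ?h ?e x y" by (rule bconv_cong) (simp_all add: gd)
    also have "\<dots> = ?h x y" by (simp add: bconv_unit xy)
    finally show ?thesis .
  qed
  then show "form p2 p1 \<delta>" by (rule form_cong_basis[OF \<delta>])
qed

section \<open>Isomorphisms between models\<close>

lemma sweedler3_kap:
  assumes U: "kspace U"
    and f1: "\<And>x3. x3 \<in> carrier R \<Longrightarrow> bilinear_map R R U (\<lambda>x1 x2. f x1 x2 x3)"
    and f2: "\<And>x1 x2. x1 \<in> carrier R \<Longrightarrow> x2 \<in> carrier R \<Longrightarrow> linear_map R U (f x1 x2)"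
    and c: "keys c \<subseteq> idx"
  shows "sweedler3 R U f (\<kappa> c) = lin U (\<lambda>(k, k3). lin U (\<lambda>(k1, k2).
     f (\<kappa> (basis k1)) (\<kappa> (basis k2)) (\<kappa> (basis k3))) (copb k)) (cop c)"
proof -
  interpret U: kspace U by fact
  have F: "f (\<kappa> k1) (\<kappa> k2) (\<kappa> k3) \<in> carrier U" for k1 k2 k3
    by (rule bilinear_mapD(3)[OF f1]) auto
  have "bilinear_map R R U (\<lambda>x' x3. sweedler R U (\<lambda>x1 x2. f x1 x2 x3) x')"
    by (rule bilinear_mapI[OF linear_sweedler_param[OF U R.kspace_axioms f1 f2] linear_sweedler[OF U f1]])
  then have "sweedler3 R U f (\<kappa> c) = lin U (\<lambda>(k, k3). sweedler R U (\<lambda>x1 x2. f x1 x2 (\<kappa> (basis k3))) (\<kappa> (basis k))) (cop c)"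
    unfolding sweedler3_def by (rule sweedler_kap[OF U _ c])
  also have "\<dots> = lin U (\<lambda>(k, k3). lin U (\<lambda>(k1, k2). f (\<kappa> (basis k1)) (\<kappa> (basis k2)) (\<kappa> (basis k3))) (copb k)) (cop c)"
    by (rule U.lin_cong) (auto dest!: keys_copD simp: sweedler_kap[OF U f1] F split_def)
  finally show ?thesis .
qed

text \<open>Models with the same parameter have the same structure constants, so matching
  coordinates is an isomorphism.\<close>

lemma hopf_isomorphic_models:
  assumes "quantum_plane_model G g1 g2 \<chi>1 \<chi>2 q r p R' \<kappa>'"
  shows "hopf_isomorphic R R'"
proof -
  interpret M: quantum_plane_model G g1 g2 \<chi>1 \<chi>2 q r p R' \<kappa>' by fact
  let ?\<phi> = "\<lambda>x. \<kappa>' (kinv x)"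
  have phi: "?\<phi> (\<kappa> c) = \<kappa>' c" if "keys c \<subseteq> idx" for c using that by (simp add: kinv_kap)
  have phib: "?\<phi> (\<kappa> (basis k)) = \<kappa>' (basis k)" if "k \<in> idx" for k using that by (simp add: phi)
  have lin: "linear_map R R' ?\<phi>"
  proof (rule linear_mapI)
    fix x y assume "x \<in> carrier R" "y \<in> carrier R"
    then obtain c d where "x = \<kappa> c" "y = \<kappa> d" "keys c \<subseteq> idx" "keys d \<subseteq> idx" by (metis kap_surj)
    then show "?\<phi> (x \<oplus>\<^bsub>R\<^esub> y) = ?\<phi> x \<oplus>\<^bsub>R'\<^esub> ?\<phi> y"
      by (simp add: phi keys_add_idx M.kap_add flip: kap_add)
  next
    fix b x assume "x \<in> carrier R"
    then obtain c where "x = \<kappa> c" "keys c \<subseteq> idx" by (metis kap_surj)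
    then show "?\<phi> x \<in> carrier R'" "?\<phi> (b \<odot>\<^bsub>R\<^esub> x) = b \<odot>\<^bsub>R'\<^esub> ?\<phi> x"
      by (simp_all add: phi keys_scale_idx M.kap_scale flip: kap_scale)
  qed
  have iso: "?\<phi> \<in> ring_iso R R'"
  proof (rule ring_iso_memI)
    fix x y assume "x \<in> carrier R" "y \<in> carrier R"
    then obtain c d where "x = \<kappa> c" "y = \<kappa> d" "keys c \<subseteq> idx" "keys d \<subseteq> idx" by (metis kap_surj)
    then show "?\<phi> (x \<otimes>\<^bsub>R\<^esub> y) = ?\<phi> x \<otimes>\<^bsub>R'\<^esub> ?\<phi> y"
      by (simp add: phi kap_mult M.kap_mult keys_prd)
  next
    show "?\<phi> \<one>\<^bsub>R\<^esub> = \<one>\<^bsub>R'\<^esub>" by (simp add: kap_one M.kap_one phi)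
    show "bij_betw ?\<phi> (carrier R) (carrier R')"
    proof (rule bij_betwI')
      fix x y assume "x \<in> carrier R" "y \<in> carrier R"
      then obtain c d where "x = \<kappa> c" "y = \<kappa> d" "keys c \<subseteq> idx" "keys d \<subseteq> idx" by (metis kap_surj)
      then show "?\<phi> x = ?\<phi> y \<longleftrightarrow> x = y" using M.kap_inj[of c d] kap_inj[of c d] phi[of c] phi[of d] by metis
    next
      fix y assume "y \<in> carrier R'"
      then obtain c where "y = \<kappa>' c" "keys c \<subseteq> idx" by (metis M.kap_surj)
      then show "\<exists>x\<in>carrier R. y = ?\<phi> x" by (intro bexI[of _ "\<kappa> c"]) (simp_all add: phi)
    qed (use linear_mapD[OF lin] in auto)
  qed (use linear_mapD[OF lin] in auto)
  have "comult R' (?\<phi> x) = sweedler R (tensor R' R') (\<lambda>x1 x2. pure R' R' (?\<phi> x1) (?\<phi> x2)) x \<and>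
           counit R' (?\<phi> x) = counit R x" if x: "x \<in> carrier R" for x
  proof -
    obtain c where c: "x = \<kappa> c" "keys c \<subseteq> idx" using x by (rule kap_cases)
    interpret T: kspace "tensor R' R'" by (rule M.kspace_RR)
    note P = M.R.TP.bilinear_pure
    have "bilinear_map R R (tensor R' R') (\<lambda>x1 x2. pure R' R' (?\<phi> x1) (?\<phi> x2))"
      by (rule bilinear_mapI)
        (rule linear_map_comp[OF bilinear_mapD(1)[OF P] lin] linear_map_comp[OF bilinear_mapD(2)[OF P] lin], rule linear_mapD(1)[OF lin], assumption)+
    then have "sweedler R (tensor R' R') (\<lambda>x1 x2. pure R' R' (?\<phi> x1) (?\<phi> x2)) x =
        lin (tensor R' R') (\<lambda>(k, l). pure R' R' (?\<phi> (\<kappa> (basis k))) (?\<phi> (\<kappa> (basis l)))) (cop c)"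
      unfolding c(1) by (rule sweedler_kap[OF M.kspace_RR _ c(2)])
    also have "\<dots> = lin (tensor R' R') (\<lambda>(k, l). pure R' R' (\<kappa>' (basis k)) (\<kappa>' (basis l))) (cop c)"
      by (rule T.lin_cong) (auto dest!: keys_copD simp: phib M.pure_closed)
    also have "\<dots> = comult R' (?\<phi> x)"
      using c by (simp add: phi M.comult_kap M.tcls_kap2)
    finally show ?thesis using c by (simp add: phi counit_kap M.counit_kap)
  qed
  then show ?thesis
    unfolding hopf_isomorphic_def using hopf_algebra_R M.hopf_algebra_R iso lin by blast
qed

end

section \<open>Cocycles and twists of the biproduct\<close>

text \<open>\<iota> is tied to the coordinates so that the subalgebra H and the monomials in the
  definitions of the cocycles can be located on the basis.\<close>

locale biproduct_model = quantum_plane_model G g1 g2 \<chi>1 \<chi>2 q r 0 R \<kappa>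
  for G :: "('g, 'm) monoid_scheme" (structure) and g1 g2 :: 'g and \<chi>1 \<chi>2 :: "'g \<Rightarrow> 'k::field"
    and q r and R :: "('k, 'a, 'n) hopf_scheme" and \<kappa> +
  fixes \<iota> :: "'g gen \<Rightarrow> 'a"
  assumes finite_G: "finite (carrier G)"
    and iota_eq: "x \<in> gens G \<Longrightarrow> \<iota> x = \<kappa> (op 0 0 x (basis e0))"
begin

abbreviation H where "H \<equiv> group_subalgebra G R \<iota>"

lemma iota_Grp: "h \<in> carrier G \<Longrightarrow> \<iota> (Grp h) = \<kappa> (basis (0, 0, h))"
  by (simp add: iota_eq bop_Grp)

lemma iota_X: "\<iota> X1 = \<kappa> (basis (1, 0, \<one>))" "\<iota> X2 = \<kappa> (basis (0, 1, \<one>))"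
  using r_gt_1 by (simp_all add: iota_eq bop_X1 bop_X2)

lemma mem_H_iff: "x \<in> H \<longleftrightarrow> (\<exists>c. keys c \<subseteq> {0} \<times> {0} \<times> carrier G \<and> x = \<kappa> c)"
proof -
  have *: "(\<Oplus>\<^bsub>R\<^esub>h\<in>carrier G. c h \<odot>\<^bsub>R\<^esub> \<iota> (Grp h)) = \<kappa> (\<Sum>h\<in>carrier G. single (0, 0, h) (c h))" for c
  proof -
    have "(\<Oplus>\<^bsub>R\<^esub>h\<in>S. c h \<odot>\<^bsub>R\<^esub> \<kappa> (basis (0, 0, h))) = \<kappa> (\<Sum>h\<in>S. single (0, 0, h) (c h))" if "finite S" for S
      using that
    proof induction
      case (insert h S)
      then show ?case by (simp add: kap_add flip: kap_scale)
    qed (simp add: kap_zero)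
    moreover have "(\<Oplus>\<^bsub>R\<^esub>h\<in>carrier G. c h \<odot>\<^bsub>R\<^esub> \<iota> (Grp h)) = (\<Oplus>\<^bsub>R\<^esub>h\<in>carrier G. c h \<odot>\<^bsub>R\<^esub> \<kappa> (basis (0, 0, h)))"
      by (rule R.M.finsum_cong') (auto simp: iota_Grp)
    ultimately show ?thesis using finite_G by simp
  qed
  show ?thesis
  proof
    assume "x \<in> H"
    then obtain c where x: "x = \<kappa> (\<Sum>h\<in>carrier G. single (0, 0, h) (c h))"
      by (auto simp: group_subalgebra_def *)
    have "keys (\<Sum>h\<in>carrier G. single (0::nat, 0::nat, h) (c h)) \<subseteq> (\<Union>h\<in>carrier G. keys (single (0::nat, 0::nat, h) (c h)))"
      by (rule Poly_Mapping.keys_sum)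
    also have "\<dots> \<subseteq> {0} \<times> {0} \<times> carrier G" by auto
    finally show "\<exists>c. keys c \<subseteq> {0} \<times> {0} \<times> carrier G \<and> x = \<kappa> c" using x by blast
  next
    assume "\<exists>c. keys c \<subseteq> {0} \<times> {0} \<times> carrier G \<and> x = \<kappa> c"
    then obtain c where c: "keys c \<subseteq> {0} \<times> {0} \<times> carrier G" "x = \<kappa> c" by blast
    have "c = (\<Sum>h\<in>carrier G. single (0, 0, h) (lookup c (0, 0, h)))"
    proof (rule poly_mapping_eqI)
      fix k :: "'g mono"
      obtain i j g where k: "k = (i, j, g)" by (cases k)
      show "lookup c k = lookup (\<Sum>h\<in>carrier G. single (0, 0, h) (lookup c (0, 0, h))) k"
      proof (cases "i = 0 \<and> j = 0 \<and> g \<in> carrier G")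
        case True
        then show ?thesis using finite_G
          by (simp add: k lookup_sum lookup_single when_def)
      next
        case False
        then have "k \<notin> keys c" using c(1) by (auto simp: k)
        moreover have "lookup (single (0, 0, h) (lookup c (0, 0, h))) k = 0" if "h \<in> carrier G" for h
          using False that by (auto simp: k lookup_single when_def)
        ultimately show ?thesis by (simp add: lookup_sum in_keys_iff)
      qed
    qed
    then show "x \<in> H" unfolding c(2) group_subalgebra_def mem_Collect_eq * by (intro exI conjI TrueI) (rule arg_cong[of _ _ \<kappa>])
  qed
qed

lemma group_keys_idx: "keys c \<subseteq> {0} \<times> {0} \<times> carrier G \<Longrightarrow> keys c \<subseteq> idx"
  using r_pos by (auto simp: idx_def)

lemma gam_h:
  assumes c: "keys c \<subseteq> {0} \<times> {0} \<times> carrier G" and c': "keys c' \<subseteq> {0} \<times> {0} \<times> carrier G"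
    and d: "keys d \<subseteq> idx" and d': "keys d' \<subseteq> idx"
  shows "gam p1 p2 (prd 0 0 c d) (prd 0 0 d' c') = eps c * gam p1 p2 d d' * eps c'"
proof -
  have l: "Vector_Spaces.linear scale (*) (\<lambda>c. gam p1 p2 (prd 0 0 c d) y)" "Vector_Spaces.linear scale (*) (\<lambda>c'. gam p1 p2 y (prd 0 0 d' c'))"
    "Vector_Spaces.linear scale (*) (\<lambda>c. eps c * b)" for y b
    by (simp_all add: Vector_Spaces.linear_iff gam_simps prd_simps eps_simps distrib_right pm.vector_space_axioms fld.vector_space_axioms)
  have "gam p1 p2 (prd 0 0 c d) (prd 0 0 d' c') = (\<lambda>c. eps c * gam p1 p2 d (prd 0 0 d' c')) c"
  proof (rule linear_eqI[OF l(1) l(3)])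
    fix k assume "k \<in> keys c"
    then obtain h where h: "k = (0, 0, h)" "h \<in> carrier G" using c by auto
    show "gam p1 p2 (prd 0 0 (basis k) d) (prd 0 0 d' c') = eps (basis k) * gam p1 p2 d (prd 0 0 d' c')"
      using gam_group[OF h(2) one_closed, of p1 p2 d "prd 0 0 d' c'"] h by (simp add: prd_e0_right keys_prd eps_simps epsb_def)
  qed
  also have "gam p1 p2 d (prd 0 0 d' c') = (\<lambda>c'. eps c' * gam p1 p2 d d') c'"
  proof (rule linear_eqI[OF l(2) l(3)])
    fix k assume "k \<in> keys c'"
    then obtain h where h: "k = (0, 0, h)" "h \<in> carrier G" using c' by auto
    show "gam p1 p2 d (prd 0 0 d' (basis k)) = eps (basis k) * gam p1 p2 d d'"
      using gam_group[OF one_closed h(2), of p1 p2 d d'] h d by (simp add: prd_e0_left eps_simps epsb_def)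
  qed
  finally show ?thesis by simp
qed

lemma form_h_bilinear:
  assumes "form p1 p2 \<gamma>"
  shows "h_bilinear R H \<gamma>"
  unfolding h_bilinear_def
proof (intro conjI ballI)
  show "bilinear_map R R scalars \<gamma>" by (rule form_bilinear[OF assms])
  fix h h' x y assume "h \<in> H" "h' \<in> H" "x \<in> carrier R" "y \<in> carrier R"
  then obtain c c' d d' where c: "keys c \<subseteq> {0} \<times> {0} \<times> carrier G" "h = \<kappa> c" "keys c' \<subseteq> {0} \<times> {0} \<times> carrier G" "h' = \<kappa> c'"
    and d: "x = \<kappa> d" "y = \<kappa> d'" "keys d \<subseteq> idx" "keys d' \<subseteq> idx"
    by (metis mem_H_iff kap_surj)
  then show "\<gamma> (h \<otimes>\<^bsub>R\<^esub> x) (y \<otimes>\<^bsub>R\<^esub> h') = counit R h * \<gamma> x y * counit R h'"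
    by (simp add: kap_mult formD[OF assms] keys_prd counit_kap gam_h group_keys_idx)
qed

lemma iota_pow: "l < r \<Longrightarrow> \<iota> X1 [^]\<^bsub>R\<^esub> l = \<kappa> (basis (l, 0, \<one>))" "m < r \<Longrightarrow> \<iota> X2 [^]\<^bsub>R\<^esub> m = \<kappa> (basis (0, m, \<one>))"
proof -
  show "\<iota> X1 [^]\<^bsub>R\<^esub> l = \<kappa> (basis (l, 0, \<one>))" if "l < r" for l :: nat
    using that
  proof (induction l)
    case (Suc l)
    then show ?case using r_gt_1
      by (simp add: iota_X kap_mult prd_basis mon_eq bop_Grp op_X1n)
  qed (simp add: kap_one)
  show "\<iota> X2 [^]\<^bsub>R\<^esub> m = \<kappa> (basis (0, m, \<one>))" if "m < r" for m :: nat
    using that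
  proof (induction m)
    case (Suc m)
    then show ?case using r_gt_1
      by (simp add: iota_X kap_mult prd_basis mon_eq bop_Grp op_X2n)
  qed (simp add: kap_one)
qed

lemma iota_monomial: "l < r \<Longrightarrow> m < r \<Longrightarrow> \<iota> X1 [^]\<^bsub>R\<^esub> l \<otimes>\<^bsub>R\<^esub> \<iota> X2 [^]\<^bsub>R\<^esub> m = \<kappa> (basis (l, m, \<one>))"
  by (simp add: iota_pow kap_mult prd_basis mon_eq bop_Grp op_X1n)

text \<open>\<open>gam\<close> itself witnesses existence for the \<open>SOME\<close>. For
  uniqueness, H-bilinearity strips the group elements off both arguments, and only the tabulated
  values on monomials remain.\<close>

lemma h_bilinear_extension_form:
  assumes v: "\<And>l m n t. l < r \<Longrightarrow> m < r \<Longrightarrow> n < r \<Longrightarrow> t < r \<Longrightarrow>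
      gam p1 p2 (basis (l, m, \<one>)) (basis (n, t, \<one>)) = v l m n t"
  shows "form p1 p2 (h_bilinear_extension R H \<iota> r v)"
proof -
  let ?P = "\<lambda>\<gamma>. h_bilinear R H \<gamma> \<and> (\<forall>l<r. \<forall>m<r. \<forall>n<r. \<forall>t<r.
       \<gamma> (\<iota> X1 [^]\<^bsub>R\<^esub> l \<otimes>\<^bsub>R\<^esub> \<iota> X2 [^]\<^bsub>R\<^esub> m) (\<iota> X1 [^]\<^bsub>R\<^esub> n \<otimes>\<^bsub>R\<^esub> \<iota> X2 [^]\<^bsub>R\<^esub> t) = v l m n t)"
  define \<gamma> where "\<gamma> = h_bilinear_extension R H \<iota> r v"
  have "?P (\<lambda>x y. gam p1 p2 (kinv x) (kinv y))"
    by (intro conjI form_h_bilinear[OF form_exists] allI impI) (simp add: iota_monomial kinv_kap v)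
  then have P: "?P \<gamma>" unfolding \<gamma>_def h_bilinear_extension_def by (rule someI[of ?P])
  then have bil: "bilinear_map R R scalars \<gamma>"
    and hb: "\<And>h h' x y. h \<in> H \<Longrightarrow> h' \<in> H \<Longrightarrow> x \<in> carrier R \<Longrightarrow> y \<in> carrier R \<Longrightarrow>
         \<gamma> (h \<otimes>\<^bsub>R\<^esub> x) (y \<otimes>\<^bsub>R\<^esub> h') = counit R h * \<gamma> x y * counit R h'"
    by (auto simp: h_bilinear_def)
  have val: "\<gamma> (\<kappa> (basis (l, m, \<one>))) (\<kappa> (basis (n, t, \<one>))) = v l m n t" if "l < r" "m < r" "n < r" "t < r" for l m n t
  proof -
    have "\<gamma> (\<iota> X1 [^]\<^bsub>R\<^esub> l \<otimes>\<^bsub>R\<^esub> \<iota> X2 [^]\<^bsub>R\<^esub> m) (\<iota> X1 [^]\<^bsub>R\<^esub> n \<otimes>\<^bsub>R\<^esub> \<iota> X2 [^]\<^bsub>R\<^esub> t) = v l m n t"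
      using P that by blast
    then show ?thesis using that by (simp add: iota_monomial)
  qed
  have "\<gamma> (\<kappa> (basis k)) (\<kappa> (basis l')) = gam p1 p2 (basis k) (basis l')" if k: "k \<in> idx" and l': "l' \<in> idx" for k l'
  proof -
    obtain l m g where kk: "k = (l, m, g)" by (cases k)
    obtain n t h where ll: "l' = (n, t, h)" by (cases l')
    have *: "l < r" "m < r" "g \<in> carrier G" "n < r" "t < r" "h \<in> carrier G"
      using k l' by (simp_all add: kk ll)
    \<comment> \<open>The basis carries the group element on the right, whereas H acts on the first
      argument from the left; \<open>b\<close> is the scalar for moving \<open>g\<close> past the
      monomial, and it is invertible.\<close>
    define b where "b = \<chi>1 g ^ l * \<chi>2 g ^ m"
    have b: "b \<noteq> 0" using chi_nonzero[OF *(3)] by (simp add: b_def)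
    have 1: "prd 0 0 (basis (0, 0, g)) (basis (l, m, \<one>)) = scale b (basis k)"
      using * by (simp add: prd_group bop_Grp b_def kk)
    have 2: "prd 0 0 (basis (n, t, \<one>)) (basis (0, 0, h)) = basis l'"
      using * by (simp add: prd_basis mon_op_group ll)
    have H: "\<kappa> (basis (0, 0, g)) \<in> H" "\<kappa> (basis (0, 0, h)) \<in> H"
      unfolding mem_H_iff by (rule exI[of _ "basis (0, 0, g)"], use * in simp, rule exI[of _ "basis (0, 0, h)"], use * in simp)
    have "b * \<gamma> (\<kappa> (basis k)) (\<kappa> (basis l')) = \<gamma> (b \<odot>\<^bsub>R\<^esub> \<kappa> (basis k)) (\<kappa> (basis l'))"
      using linear_mapD(3)[OF bilinear_mapD(2)[OF bil, of "\<kappa> (basis l')"], of "\<kappa> (basis k)" b] by simp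
    also have "\<dots> = \<gamma> (\<kappa> (basis (0, 0, g)) \<otimes>\<^bsub>R\<^esub> \<kappa> (basis (l, m, \<one>))) (\<kappa> (basis (n, t, \<one>)) \<otimes>\<^bsub>R\<^esub> \<kappa> (basis (0, 0, h)))"
      using * by (simp only: kap_mult[of "basis _" "basis _"] keys_basis_idx idx_iff one_closed r_pos simp_thms 1 2 kap_scale)
    also have "\<dots> = v l m n t"
      using * by (simp add: hb[OF H] val counit_basis epsb_def)
    also have "\<dots> = gam p1 p2 (scale b (basis k)) (basis l')"
      using gam_group[OF *(3,6), of p1 p2 "basis (l, m, \<one>)" "basis (n, t, \<one>)"] * by (simp only: 1 2 v)
    finally show ?thesis by (simp only: gam_simps mult_left_cancel[OF b])
  qed
  then show ?thesis using form_cong_basis[OF bil] by (simp add: \<gamma>_def)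
qed

text \<open>By \<open>prd_twist_left\<close> with middle parameter 0, each sum of products in A
  weighted by \<gamma> is a single product in C(p1, 0). Both sides become the counit of the triple
  product there, with the two bracketings.\<close>

lemma cocycle_identity_form:
  assumes \<gamma>: "form p1 0 \<gamma>" and c: "keys c \<subseteq> idx" and d: "keys d \<subseteq> idx" and e: "keys e \<subseteq> idx"
  shows "sweedler R scalars (\<lambda>y1 y2. sweedler R scalars (\<lambda>z1 z2. \<gamma> y1 z1 * \<gamma> (\<kappa> c) (y2 \<otimes>\<^bsub>R\<^esub> z2)) (\<kappa> e)) (\<kappa> d) =
      sweedler R scalars (\<lambda>x1 x2. sweedler R scalars (\<lambda>y1 y2. \<gamma> x1 y1 * \<gamma> (x2 \<otimes>\<^bsub>R\<^esub> y2) (\<kappa> e)) (\<kappa> d)) (\<kappa> c)"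
    (is "?lhs = ?rhs")
proof -
  note bil = form_bilinear[OF \<gamma>] and m = bilinear_mult
  have g: "\<gamma> (\<kappa> x) (\<kappa> y) = gam p1 0 x y" if "keys x \<subseteq> idx" "keys y \<subseteq> idx" for x y using formD[OF \<gamma> that] .
  have "?lhs = fext (\<lambda>(k, k'). fext (\<lambda>(l, l'). \<gamma> (\<kappa> (basis k)) (\<kappa> (basis l)) *
       \<gamma> (\<kappa> c) (\<kappa> (basis k') \<otimes>\<^bsub>R\<^esub> \<kappa> (basis l'))) (cop e)) (cop d)"
    by (rule double_sweedler_kap[OF _ _ d e])
      (auto intro!: bilinear_times bilinear_mapD[OF bil] linear_map_comp[OF bilinear_mapD(1)[OF bil]] bilinear_mapD[OF m])
  also have "\<dots> = fext (\<lambda>(k, k'). fext (\<lambda>(l, l'). gam p1 0 c (scale (gam p1 0 (basis k) (basis l)) (prd 0 0 (basis k') (basis l')))) (cop e)) (cop d)"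
    by (rule fext_cop_cong) (simp add: g kap_mult keys_prd c gam_simps)
  also have "\<dots> = gam p1 0 c (prd p1 0 d e)"
  proof -
    have l: "Vector_Spaces.linear scale (*) (gam p1 0 c)"
      by (simp add: Vector_Spaces.linear_iff gam_simps pm.vector_space_axioms fld.vector_space_axioms)
    show ?thesis
      by (simp add: prd_twist_left[OF d, where p' = 0] linear_fext[OF l] split_def)
  qed
  finally have 1: "?lhs = gam p1 0 c (prd p1 0 d e)" .
  have "?rhs = fext (\<lambda>(k, k'). fext (\<lambda>(l, l'). \<gamma> (\<kappa> (basis k)) (\<kappa> (basis l)) *
       \<gamma> (\<kappa> (basis k') \<otimes>\<^bsub>R\<^esub> \<kappa> (basis l')) (\<kappa> e)) (cop d)) (cop c)"
    by (rule double_sweedler_kap[OF _ _ c d])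
      (auto intro!: bilinear_times bilinear_mapD[OF bil] linear_map_comp[OF bilinear_mapD(2)[OF bil]] bilinear_mapD[OF m])
  also have "\<dots> = fext (\<lambda>(k, k'). fext (\<lambda>(l, l'). gam p1 0 (scale (gam p1 0 (basis k) (basis l)) (prd 0 0 (basis k') (basis l'))) e) (cop d)) (cop c)"
    by (rule fext_cop_cong) (simp add: g kap_mult keys_prd e gam_simps)
  also have "\<dots> = gam p1 0 (prd p1 0 c d) e"
  proof -
    have l: "Vector_Spaces.linear scale (*) (\<lambda>x. gam p1 0 x e)"
      by (simp add: Vector_Spaces.linear_iff gam_simps pm.vector_space_axioms fld.vector_space_axioms)
    show ?thesis
      by (simp add: prd_twist_left[OF c, where p' = 0] linear_fext[OF l] split_def)
  qed
  finally have 2: "?rhs = gam p1 0 (prd p1 0 c d) e" .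
  show ?thesis unfolding 1 2 by (simp add: gam_def prd_assoc)
qed

lemma form_cocycle:
  assumes \<gamma>: "form p1 0 \<gamma>"
  shows "\<gamma> \<in> cocycles R H"
  unfolding cocycles_def
proof (intro CollectI conjI ballI)
  show "h_bilinear R H \<gamma>" by (rule form_h_bilinear[OF \<gamma>])
  show "\<exists>\<delta>. convolution_inverse R \<gamma> \<delta>"
    by (rule exI[of _ "\<lambda>x y. gam 0 p1 (kinv x) (kinv y)"]) (simp add: form_inverse[OF \<gamma>] form_exists)
  show "sweedler R scalars (\<lambda>y1 y2. sweedler R scalars (\<lambda>z1 z2. \<gamma> y1 z1 * \<gamma> x (y2 \<otimes>\<^bsub>R\<^esub> z2)) z) y =
      sweedler R scalars (\<lambda>x1 x2. sweedler R scalars (\<lambda>y1 y2. \<gamma> x1 y1 * \<gamma> (x2 \<otimes>\<^bsub>R\<^esub> y2) z) y) x"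
    if xyz: "x \<in> carrier R" "y \<in> carrier R" "z \<in> carrier R" for x y z
  proof -
    obtain c d e where "x = \<kappa> c" "y = \<kappa> d" "z = \<kappa> e" "keys c \<subseteq> idx" "keys d \<subseteq> idx" "keys e \<subseteq> idx"
      using xyz by (metis kap_surj)
    then show ?thesis using cocycle_identity_form[OF \<gamma>, of c d e] by simp
  qed
  fix x assume "x \<in> carrier R"
  then obtain c where c: "x = \<kappa> c" "keys c \<subseteq> idx" by (rule kap_cases)
  show "\<gamma> x \<one>\<^bsub>R\<^esub> = counit R x" "\<gamma> \<one>\<^bsub>R\<^esub> x = counit R x"
    using c by (simp_all add: kap_one formD[OF \<gamma>] counit_kap gam_def prd_e0_right prd_e0_left)
qed

lemma twist_simps [simp]: "carrier (twist R \<gamma>) = carrier R" "add (twist R \<gamma>) = add R" "zero (twist R \<gamma>) = zero R"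
  "one (twist R \<gamma>) = one R" "smult (twist R \<gamma>) = smult R" "comult (twist R \<gamma>) = comult R" "counit (twist R \<gamma>) = counit R"
  by (simp_all add: twist_def Let_def)

text \<open>The left factor \<gamma>(p1, 0) turns the product of C(0, 0) into that of C(p1, 0), and
  the right factor \<gamma>(0, p1) turns this into that of C(p1, p1).\<close>

lemma twist_mult:
  assumes \<gamma>: "form p1 0 \<gamma>" and c: "keys c \<subseteq> idx" and d: "keys d \<subseteq> idx"
  shows "\<kappa> c \<otimes>\<^bsub>twist R \<gamma>\<^esub> \<kappa> d = \<kappa> (prd p1 p1 c d)"
proof -
  define \<delta> where "\<delta> = (SOME \<delta>. convolution_inverse R \<gamma> \<delta>)"
  have "convolution_inverse R \<gamma> \<delta>"
    unfolding \<delta>_def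
    by (rule someI[of "convolution_inverse R \<gamma>" "\<lambda>x y. gam 0 p1 (kinv x) (kinv y)"]) (simp add: form_inverse[OF \<gamma>] form_exists)
  then have \<delta>: "form 0 p1 \<delta>" by (simp add: form_inverse[OF \<gamma>])
  note bg = form_bilinear[OF \<gamma>] and bd = form_bilinear[OF \<delta>] and bm = bilinear_mult
  let ?f = "\<lambda>x1 x2 x3 y1 y2 y3. (\<gamma> x1 y1 * \<delta> x3 y3) \<odot>\<^bsub>R\<^esub> (x2 \<otimes>\<^bsub>R\<^esub> y2)"
  have sm: "linear_map R R (\<lambda>x. h x \<odot>\<^bsub>R\<^esub> y)" if "linear_map R scalars h" "y \<in> carrier R" for h y
    using linear_mapD[OF that(1)] that(2) by (auto intro!: linear_mapI simp: R.smult_left_distrib R.smult_smult)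
  have sm': "linear_map R R (\<lambda>x. b \<odot>\<^bsub>R\<^esub> h x)" if "linear_map R R h" for h b
    using linear_mapD[OF that] by (auto intro!: linear_mapI simp: R.smult_right_distrib R.smult_smult mult.commute)
  \<comment> \<open>Both nested threefold sums are expanded on coordinates, which requires linearity
    in each of the six variables.\<close>
  have lins: "linear_map R R (\<lambda>x1. ?f x1 x2 x3 y1 y2 y3)" "linear_map R R (\<lambda>x2. ?f x1 x2 x3 y1 y2 y3)" "linear_map R R (\<lambda>x3. ?f x1 x2 x3 y1 y2 y3)"
    "linear_map R R (\<lambda>y1. ?f x1 x2 x3 y1 y2 y3)" "linear_map R R (\<lambda>y2. ?f x1 x2 x3 y1 y2 y3)" "linear_map R R (\<lambda>y3. ?f x1 x2 x3 y1 y2 y3)"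
    if "x1 \<in> carrier R" "x2 \<in> carrier R" "x3 \<in> carrier R" "y1 \<in> carrier R" "y2 \<in> carrier R" "y3 \<in> carrier R"
    for x1 x2 x3 y1 y2 y3
  proof -
    show "linear_map R R (\<lambda>x1. ?f x1 x2 x3 y1 y2 y3)" by (intro sm linear_times_left bilinear_mapD(2)[OF bg] R.m_closed that)
    show "linear_map R R (\<lambda>x2. ?f x1 x2 x3 y1 y2 y3)" by (intro sm' bilinear_mapD(2)[OF bm] that)
    show "linear_map R R (\<lambda>x3. ?f x1 x2 x3 y1 y2 y3)" by (intro sm linear_times_right bilinear_mapD(2)[OF bd] R.m_closed that)
    show "linear_map R R (\<lambda>y1. ?f x1 x2 x3 y1 y2 y3)" by (intro sm linear_times_left bilinear_mapD(1)[OF bg] R.m_closed that)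
    show "linear_map R R (\<lambda>y2. ?f x1 x2 x3 y1 y2 y3)" by (intro sm' bilinear_mapD(1)[OF bm] that)
    show "linear_map R R (\<lambda>y3. ?f x1 x2 x3 y1 y2 y3)" by (intro sm linear_times_right bilinear_mapD(1)[OF bd] R.m_closed that)
  qed
  let ?S = "\<lambda>x1 x2 x3. lin R (\<lambda>(l, l3). lin R (\<lambda>(l1, l2). ?f x1 x2 x3 (\<kappa> (basis l1)) (\<kappa> (basis l2)) (\<kappa> (basis l3))) (copb l)) (cop d)"
  have S: "sweedler3 R R (?f x1 x2 x3) (\<kappa> d) = ?S x1 x2 x3"
    if "x1 \<in> carrier R" "x2 \<in> carrier R" "x3 \<in> carrier R" for x1 x2 x3
    by (rule sweedler3_kap[OF R.kspace_axioms _ _ d]) (auto intro!: bilinear_mapI lins that)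
  have Slin: "linear_map R R (\<lambda>x1. ?S x1 x2 x3)" "linear_map R R (\<lambda>x. ?S x2 x x3)" "linear_map R R (\<lambda>x. ?S x2 x3 x)"
    if "x2 \<in> carrier R" "x3 \<in> carrier R" for x2 x3
    unfolding split_def
    \<comment> \<open>The element \<open>\<kappa> 0\<close> only discharges the membership premise
      of \<open>lins\<close> for the variable that is bound in its conclusion.\<close>
    by (intro linear_map_lin_fun[OF R.kspace_axioms] lins(1)[OF kap_closed[of 0] that kap_closed kap_closed kap_closed]
        lins(2)[OF that(1) kap_closed[of 0] that(2) kap_closed kap_closed kap_closed]
        lins(3)[OF that kap_closed[of 0] kap_closed kap_closed kap_closed])+
  have sw: "linear_map R R (\<lambda>x1. sweedler3 R R (?f x1 x2 x3) (\<kappa> d))" "linear_map R R (\<lambda>x. sweedler3 R R (?f x2 x x3) (\<kappa> d))"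
    "linear_map R R (\<lambda>x. sweedler3 R R (?f x2 x3 x) (\<kappa> d))" if "x2 \<in> carrier R" "x3 \<in> carrier R" for x2 x3
    using Slin[OF that, THEN linear_map_cong[OF _ R.kspace_axioms]] S that by (simp_all only:)
  have "\<kappa> c \<otimes>\<^bsub>twist R \<gamma>\<^esub> \<kappa> d = sweedler3 R R (\<lambda>x1 x2 x3. sweedler3 R R (?f x1 x2 x3) (\<kappa> d)) (\<kappa> c)"
    by (simp add: twist_def Let_def \<delta>_def)
  also have "\<dots> = lin R (\<lambda>(k, k3). lin R (\<lambda>(k1, k2). sweedler3 R R (?f (\<kappa> (basis k1)) (\<kappa> (basis k2)) (\<kappa> (basis k3))) (\<kappa> d)) (copb k)) (cop c)"
    by (rule sweedler3_kap[OF R.kspace_axioms _ _ c]) (auto intro!: bilinear_mapI sw)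
  also have "\<dots> = lin R (\<lambda>(k, k3). lin R (\<lambda>(k1, k2). lin R (\<lambda>(l, l3). lin R (\<lambda>(l1, l2).
      ?f (\<kappa> (basis k1)) (\<kappa> (basis k2)) (\<kappa> (basis k3)) (\<kappa> (basis l1)) (\<kappa> (basis l2)) (\<kappa> (basis l3))) (copb l)) (cop d)) (copb k)) (cop c)"
    by (simp add: S)
  also have "\<dots> = lin R (\<lambda>(k, k3). lin R (\<lambda>(k1, k2). lin R (\<lambda>(l, l3). lin R (\<lambda>(l1, l2).
      \<kappa> (scale (gam p1 0 (basis k1) (basis l1) * gam 0 p1 (basis k3) (basis l3)) (prd 0 0 (basis k2) (basis l2)))) (copb l)) (cop d)) (copb k)) (cop c)"
  proof -
    have f: "?f (\<kappa> (basis k1)) (\<kappa> (basis k2)) (\<kappa> (basis k3)) (\<kappa> (basis l1)) (\<kappa> (basis l2)) (\<kappa> (basis l3)) =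
       \<kappa> (scale (gam p1 0 (basis k1) (basis l1) * gam 0 p1 (basis k3) (basis l3)) (prd 0 0 (basis k2) (basis l2)))"
      if "k1 \<in> idx" "k2 \<in> idx" "k3 \<in> idx" "l1 \<in> idx" "l2 \<in> idx" "l3 \<in> idx" for k1 k2 k3 l1 l2 l3
      using that by (simp add: formD[OF \<gamma>] formD[OF \<delta>] kap_mult kap_scale)
    have idx: "k \<in> idx \<and> l \<in> idx" if "(k, l) \<in> keys (copb x)" for k l x
      using that keys_copb[of x] by auto
    have cong: "lin R (\<lambda>(x, y). g x y) z = lin R (\<lambda>(x, y). g' x y) z"
      if "\<And>x y. (x, y) \<in> keys z \<Longrightarrow> g x y = g' x y" "\<And>x y. g' x y \<in> carrier R"
      for g g' and z :: "'g mono \<times> 'g mono \<Rightarrow>\<^sub>0 'k"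
      by (rule R.lin_cong) (auto intro: that)
    show ?thesis
    proof (rule cong, rule cong, rule cong, rule cong, rule f)
      fix k k3 k1 k2 l l3 l1 l2
      assume *: "(k, k3) \<in> keys (cop c)" "(k1, k2) \<in> keys (copb k)" "(l, l3) \<in> keys (cop d)" "(l1, l2) \<in> keys (copb l)"
      show "k1 \<in> idx" "k2 \<in> idx" "l1 \<in> idx" "l2 \<in> idx" using idx[OF *(2)] idx[OF *(4)] by blast+
      show "k3 \<in> idx" "l3 \<in> idx" using keys_copD[OF *(1)] keys_copD[OF *(3)] by blast+
    qed (simp_all add: split_def)
  qed
  also have "\<dots> = \<kappa> (ext (\<lambda>(k, k3). ext (\<lambda>(k1, k2). ext (\<lambda>(l, l3). ext (\<lambda>(l1, l2).
      scale (gam p1 0 (basis k1) (basis l1) * gam 0 p1 (basis k3) (basis l3)) (prd 0 0 (basis k2) (basis l2))) (copb l)) (cop d)) (copb k)) (cop c))"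
    by (simp add: kap_ext split_def)
  also have "ext (\<lambda>(k, k3). ext (\<lambda>(k1, k2). ext (\<lambda>(l, l3). ext (\<lambda>(l1, l2).
      scale (gam p1 0 (basis k1) (basis l1) * gam 0 p1 (basis k3) (basis l3)) (prd 0 0 (basis k2) (basis l2))) (copb l)) (cop d)) (copb k)) (cop c)
    = ext (\<lambda>(k, k3). ext (\<lambda>(l, l3). scale (gam 0 p1 (basis k3) (basis l3)) (ext (\<lambda>(k1, k2). ext (\<lambda>(l1, l2).
       scale (gam p1 0 (basis k1) (basis l1)) (prd 0 0 (basis k2) (basis l2))) (copb l)) (copb k))) (cop d)) (cop c)"
    unfolding split_def pm.lext_fun_scale[symmetric]
    by (subst pm.lext_swap) (simp add: mult.commute)
  also have "\<dots> = ext (\<lambda>(k, k3). ext (\<lambda>(l, l3). scale (gam 0 p1 (basis k3) (basis l3)) (prd p1 0 (basis k) (basis l))) (cop d)) (cop c)"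
  proof (rule fext_cop_cong)
    fix k k3 l l3 assume "k \<in> idx" "l \<in> idx"
    then show "scale (gam 0 p1 (basis k3) (basis l3)) (ext (\<lambda>(k1, k2). ext (\<lambda>(l1, l2).
       scale (gam p1 0 (basis k1) (basis l1)) (prd 0 0 (basis k2) (basis l2))) (copb l)) (copb k)) =
      scale (gam 0 p1 (basis k3) (basis l3)) (prd p1 0 (basis k) (basis l))"
      using prd_twist_left[of "basis k" p1 0 "basis l" 0] by simp
  qed
  also have "\<dots> = prd p1 p1 c d"
    by (rule prd_twist_right[OF c, symmetric])
  finally show ?thesis .
qed

lemma twist_model:
  assumes "form p1 0 \<gamma>"
  shows "quantum_plane_model G g1 g2 \<chi>1 \<chi>2 q r p1 (twist R \<gamma>) \<kappa>"
proof unfold_locales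
  show "comult (twist R \<gamma>) (\<kappa> c) = tcls (twist R \<gamma>) (twist R \<gamma>) (kap2 (cop c))" if "keys c \<subseteq> idx" for c
  proof -
    have "tcls (twist R \<gamma>) (twist R \<gamma>) (kap2 (cop c)) = tcls R R (kap2 (cop c))"
      by (rule tcls_cong) simp_all
    then show ?thesis using that by (simp add: comult_kap)
  qed
qed (simp_all add: kap_surj kap_outside kap_add kap_scale kap_zero kap_one counit_kap twist_mult[OF assms] kap_inj)

end

section \<open>The presented biproduct as a model, and the theorem\<close>

context quantum_plane
begin

lemma biproduct_eq_lifting: "quantum_plane_biproduct G g1 g2 \<chi>1 \<chi>2 q r = lifting G g1 g2 \<chi>1 \<chi>2 q r 0 0 0"
  by (simp add: quantum_plane_biproduct_def lifting_def)

lemma biproduct_model_A: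
  assumes "finite (carrier G)"
  shows "biproduct_model G g1 g2 \<chi>1 \<chi>2 q r (quantum_plane_biproduct G g1 g2 \<chi>1 \<chi>2 q r)
    (quantum_plane_lifting.kap G g1 g2 \<chi>1 \<chi>2 q r 0 0 0) (biproduct_gen G \<chi>1 \<chi>2 q r)"
proof -
  interpret Z: quantum_plane_lifting G g1 g2 \<chi>1 \<chi>2 q r 0 0 0 by unfold_locales
  have par: "(0, 0, 0) = (0 :: 'k params)" by (simp add: zero_prod_def)
  interpret M: quantum_plane_model G g1 g2 \<chi>1 \<chi>2 q r 0 "quantum_plane_biproduct G g1 g2 \<chi>1 \<chi>2 q r" Z.kap
    using Z.lifting_model by (simp only: biproduct_eq_lifting par)
  show ?thesis
  proof unfold_locales
    fix x assume x: "x \<in> gens G"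
    have "biproduct_gen G \<chi>1 \<chi>2 q r x = Z.Q.cls (gen x)"
      by (simp add: biproduct_gen_def presented_class_def Z.rels_def)
    also have "\<dots> = Z.kap (op 0 0 x (basis e0))"
      using Z.cls_eq_kap[of "gen x"] x by (simp add: Z.pi_gen par)
    finally show "biproduct_gen G \<chi>1 \<chi>2 q r x = Z.kap (op 0 0 x (basis e0))" .
  qed (rule assms)
qed

end

theorem proposition5p9:
  fixes G :: "('g, 'm) monoid_scheme" (structure)
    and g1 g2 :: 'g
    and \<chi>1 \<chi>2 :: "'g \<Rightarrow> 'k::field_char_0"
    and q a1 a2 a :: 'k
    and r :: nat
  assumes "comm_group G" and "finite (carrier G)"
    and "g1 \<in> carrier G" and "g2 \<in> carrier G"
    and "\<chi>1 \<in> hom G (mult_of scalars)" and "\<chi>2 \<in> hom G (mult_of scalars)"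
    and "\<forall>h\<in>carrier G. \<chi>1 h * \<chi>2 h = 1"
    and "\<chi>1 g2 * \<chi>2 g1 = 1"
    and "q = \<chi>1 g1"
    and "r > 1" and "q ^ r = 1" and "\<forall>k. 0 < k \<and> k < r \<longrightarrow> q ^ k \<noteq> 1"
    and "g1 \<otimes> g2 \<noteq> \<one>"
    and "g1 [^] r \<noteq> \<one>" and "g2 [^] r \<noteq> \<one>"
    and "\<forall>h\<in>carrier G. \<chi>1 h ^ r = 1" and "\<forall>h\<in>carrier G. \<chi>2 h ^ r = 1"
  shows "let A = quantum_plane_biproduct G g1 g2 \<chi>1 \<chi>2 q r;
             \<iota> = biproduct_gen G \<chi>1 \<chi>2 q r;
             H = group_subalgebra G A \<iota>;
             \<alpha> = convolution A (convolution A (gamma_a A H \<iota> r q a) (gamma_1 A H \<iota> r a1))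
                   (gamma_2 A H \<iota> r a2)
         in \<alpha> \<in> cocycles A H \<and>
            hopf_isomorphic (twist A \<alpha>) (lifting G g1 g2 \<chi>1 \<chi>2 q r a1 a2 a)"
proof -
  \<comment> \<open>\<open>\<chi>2 g1\<close> is the inverse of \<open>q\<close> because the
    characters are mutually inverse; the condition \<open>\<chi>1 g2 * \<chi>2 g1 = 1\<close> then
    forces \<open>\<chi>1 g2 = q\<close>.\<close>
  have chi2_g: "\<chi>2 g1 * q = 1" "\<chi>1 g2 = q"
  proof -
    show 1: "\<chi>2 g1 * q = 1" using assms(3,7,9) by (simp add: mult.commute)
    have "\<chi>1 g2 = \<chi>1 g2 * (\<chi>2 g1 * q)" by (simp add: 1)
    also have "\<dots> = q" using assms(8) by (simp flip: mult.assoc)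
    finally show "\<chi>1 g2 = q" .
  qed
  interpret G: comm_group G by fact
  interpret quantum_plane G g1 g2 \<chi>1 \<chi>2 q r
    by unfold_locales (use assms chi2_g in \<open>auto simp: hom_def\<close>)
  interpret quantum_plane_lifting G g1 g2 \<chi>1 \<chi>2 q r a1 a2 a by unfold_locales
  define A where "A = quantum_plane_biproduct G g1 g2 \<chi>1 \<chi>2 q r"
  define \<iota> where "\<iota> = biproduct_gen G \<chi>1 \<chi>2 q r"
  define \<kappa> where "\<kappa> = quantum_plane_lifting.kap G g1 g2 \<chi>1 \<chi>2 q r 0 0 0"
  interpret A: biproduct_model G g1 g2 \<chi>1 \<chi>2 q r A \<kappa> \<iota>
    unfolding A_def \<iota>_def \<kappa>_def by (rule biproduct_model_A) fact
  define \<alpha> where "\<alpha> = convolution A (convolution A (gamma_a A A.H \<iota> r q a) (gamma_1 A A.H \<iota> r a1)) (gamma_2 A A.H \<iota> r a2)"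
  have "A.form (a1, a2, a) (a1, a2, 0) (gamma_a A A.H \<iota> r q a)"
    unfolding gamma_a_def by (rule A.h_bilinear_extension_form) (rule gam_a_value)
  moreover have "A.form (a1, a2, 0) (0, a2, 0) (gamma_1 A A.H \<iota> r a1)"
    unfolding gamma_1_def by (rule A.h_bilinear_extension_form) (rule gam_1_value)
  moreover have "A.form (0, a2, 0) (0, 0, 0) (gamma_2 A A.H \<iota> r a2)"
    unfolding gamma_2_def by (rule A.h_bilinear_extension_form) (rule gam_2_value)
  ultimately have "A.form (a1, a2, a) (0, 0, 0) \<alpha>"
    unfolding \<alpha>_def by (intro A.form_convolution)
  then have \<alpha>: "A.form (a1, a2, a) 0 \<alpha>" by (simp add: zero_prod_def)
  interpret T: quantum_plane_model G g1 g2 \<chi>1 \<chi>2 q r "(a1, a2, a)" "twist A \<alpha>" \<kappa>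
    by (rule A.twist_model[OF \<alpha>])
  have "\<alpha> \<in> cocycles A A.H \<and> hopf_isomorphic (twist A \<alpha>) L"
    using A.form_cocycle[OF \<alpha>] T.hopf_isomorphic_models[OF lifting_model] by blast
  then show ?thesis
    unfolding Let_def \<alpha>_def A_def \<iota>_def .
qed

end
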